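(* Let $\lambda>0$ and fix $0<\lambda_1<\lambda_0<\lambda$ (the case $k=0$). Assume the following. (F) There are $q>2$, $\epsilon>0$ with $q-1-\epsilon>0$, and sequences $\alpha_1=(\alpha_{1i})_{i\in\mathbb Z},\alpha_2=(\alpha_{2i})_{i\in\mathbb Z}\in\ell^1$ such that $f:\ell^2\to\ell^2$, $(f(u))_i=f_i(u_i)$, is locally Lipschitz with $|f_i(a)-f_i(b)|\le\gamma(R)|a-b|$ whenever $|a|,|b|\le R$, where $\gamma:\mathbb R^+\to\mathbb R^+$ is bounded on bounded intervals, and $|f_i(a)|\le\alpha_{1i}|a|^{q-1-\epsilon}+\alpha_{2i}$. (G1) $g(t,u)=(g_i(t,u_i))_{i\in\mathbb Z}$, each $(t,a)\mapsto g_i(t,a)$ is continuous and differentiable in $a$, and there is $\beta>0$ with $g_i(t,a)a\le-\beta|a|^q+\psi_{1i}(t)$, $\frac{\partial g_i}{\partial a}(t,a)\le\psi_{2i}(t)$, $|g_i(t,a)|\le\psi_{3i}(t)|a|^{q-1}+\psi_{4i}(t)$, where $\psi_1\in L^1_{\rm loc}(\mathbb R;\ell^1)$, $\psi_2,\psi_3\in L^\infty_{\rm loc}(\mathbb R;\ell^\infty)$, $\psi_4\in L^2_{\rm loc}(\mathbb R;\ell^2)$. (G2) $\int_{-\infty}^0 e^{\lambda_1 s}(\|\psi_1(s)\|_1+\|\psi_4(s)\|^2)\,ds<\infty$ and $\psi_3\in L^\infty((-\infty,0];\ell^\infty)$. (H1) $h:\mathbb R\to\ell^2\cap\ell^q$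 is differentiable as an $\ell^2$-valued map, $h\in L^2_{\rm loc}(\mathbb R;\ell^2)\cap L^q_{\rm loc}(\mathbb R;\ell^q)$ and $h'\in L^2_{\rm loc}(\mathbb R;\ell^2)$. (H2) $\int_{-\infty}^0 e^{\lambda_1 s}(\|h(s)\|^2+\|h(s)\|_q^q+\|h'(s)\|^2)\,ds<\infty$. Then the nonautonomous random dynamical system $\varphi$ on $\ell^2$ defined in the context has a unique pullback random $\overline{\mathcal D}$-attractor $\overline{\mathcal A}$, and $\overline{\mathcal A}\in\overline{\mathcal D}$.
   Context: Spaces. For $p\in[1,\infty)$, $\ell^p$ is the Banach space of real bi-infinite sequences with $\|u\|_p^p=\sum_{i\in\mathbb Z}|u_i|^p<\infty$; $\ell^\infty$ is the space of bounded bi-infinite sequences with the sup norm $\|\cdot\|_\infty$; $\ell^2$ has inner product $(u,v)=\sum_i u_iv_i$ and norm $\|\cdot\|$. $(Au)_i=2u_i-u_{i-1}-u_{i+1}$. Probability space. On $\{\omega\in C(\mathbb R):\omega(0)=0\}$ with the compact-open topology take the Borel $\sigma$-algebra $\mathcal F$ and Wiener measure $\mathbb P$; $\theta_t\omega(\cdot)=\omega(\cdot+t)-\omega(t)$. Put $z(\theta_t\omega)=-\int_{-\infty}^0 e^{s}\,\theta_t\omega(s)\,ds$ (a pathwise solution of $dz+z\,dt=d\omega$). $\Omega$ is a $\theta_t$-invariant set of full measure such that for all $\omega\in\Omega$, $t\mapsto z(\theta_t\omega)$ is continuous and $\lim_{t\to\pm\infty}z(\theta_t\omega)/t=\lim_{t\to\pm\infty}\frac1t\int_0^t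 z(\theta_s\omega)ds=0$; we work on $\Omega$. $W(\omega)(t)=\omega(t)$. Equation ($k=0$). $du=-[A(Au+f(u))+\lambda u-g(t,u)]dt+h(t)dW(t)$, $t>\tau$, $u(\tau)=u_\tau\in\ell^2$. It is solved through the random equation $\frac{dv}{dt}=\overline F(t,\omega,v)$, $v(\tau)=v_\tau$, with $\overline F(t,\omega,v)=-A^2v-\lambda v-Af(v+z(\theta_t\omega)h(t))+g(t,v+z(\theta_t\omega)h(t))+z(\theta_t\omega)(-A^2h(t)+(1-\lambda)h(t)-h'(t))$, whose unique global solution is denoted $v(t,\tau,\omega,v_\tau)$. The solution of the stochastic equation is $u(t,\tau,\omega,u_\tau)=v(t,\tau,\omega,u_\tau-z(\theta_\tau\omega)h(\tau))+z(\theta_t\omega)h(t)$, and $\varphi(t,\tau,\omega,u_\tau)=u(t+\tau,\tau,\theta_{-\tau}\omega,u_\tau)$ for $t\ge0$, $\tau\in\mathbb R$, $\omega\in\Omega$, $u_\tau\in\ell^2$. Random sets and attractors. A nonautonomous random set in $X$ is a family of nonempty subsets $D(\tau,\omega)\subset X$, $(\tau,\omega)\in\mathbb R\times\Omega$, such that $\omega\mapsto d_X(x,D(\tau,\omega))$ is measurable for every $(x,\tau)$. $\overline{\mathcal D}$ is the collection of all nonautonomous random sets $D$ in $\ell^2$ with $\lim_{s\to-\infty}e^{\lambda_0 s}\|D(\tau+s,\theta_s\omega)\|^2=0$ for every $\tau\in\mathbb R,\omega\in\Omega$, where $\|D\|=\sup_{u\in D}\|u\|$. A pullback random $\overline{\mathcal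 D}$-attractor in $X=\ell^2$ for $\varphi$ is a nonautonomous random set $\mathcal A$ such that: (1) $\mathcal A(\tau,\omega)$ is compact for all $\tau$ and $\mathbb P$-a.s. $\omega$; (2) $\varphi(t,\tau,\omega,\mathcal A(\tau,\omega))=\mathcal A(\tau+t,\theta_t\omega)$ for all $t\ge0$ and $(\tau,\omega)$; (3) for every $D\in\overline{\mathcal D}$, $\lim_{t\to+\infty}\mathrm{dist}_X(\varphi(t,\tau-t,\theta_{-t}\omega,D(\tau-t,\theta_{-t}\omega)),\mathcal A(\tau,\omega))=0$, with $\mathrm{dist}_X(B,C)=\sup_{b\in B}\inf_{c\in C}\|b-c\|_X$; (4) there is a closed set $K\in\overline{\mathcal D}$ with $\mathcal A\subset K$.
   Formalization: Uniqueness is stated as: two attractors agree for every τ and P-a.e. ω, and at every (τ,ω) where both sets are compact; literal equality at all (τ,ω) fails when compactness is only required P-a.s. *)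

theory Defs
  imports "HOL-Probability.Probability"
begin

section \<open>Sequence spaces\<close>

definition ellp_norm :: "ennreal \<Rightarrow> (int \<Rightarrow> real) \<Rightarrow> real" where
  "ellp_norm p u =
     (if p = \<infinity> then (SUP i. \<bar>u i\<bar>)
      else (\<Sum>\<^sub>\<infinity>i. \<bar>u i\<bar> powr enn2real p) powr (1 / enn2real p))"

definition ellp :: "ennreal \<Rightarrow> (int \<Rightarrow> real) set" where
  "ellp p =
     {u. if p = \<infinity> then bounded (range u)
         else (\<lambda>i. \<bar>u i\<bar> powr enn2real p) summable_on UNIV}"

lemma ellp_2_iff: "u \<in> ellp 2 \<longleftrightarrow> (\<lambda>i. (u i)\<^sup>2) summable_on UNIV"
proof -
  have "\<bar>u i\<bar> powr 2 = (u i)\<^sup>2" for i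
    by (simp add: powr_numeral)
  then show ?thesis by (simp add: ellp_def)
qed

lemma ellp_norm_2: "ellp_norm 2 u = sqrt (\<Sum>\<^sub>\<infinity>i. (u i)\<^sup>2)"
proof -
  have "\<bar>u i\<bar> powr 2 = (u i)\<^sup>2" for i
    by (simp add: powr_numeral)
  then show ?thesis by (simp add: ellp_norm_def powr_half_sqrt infsum_nonneg)
qed

text \<open>The state space is a type of its own, so that the Bochner integral, derivatives and
  compactness of the library apply to it.\<close>

typedef ell2 = "ellp 2"
  morphisms coord Ell2
  by (rule exI[of _ "\<lambda>_. 0"]) (simp add: ellp_2_iff)

setup_lifting type_definition_ell2

lemma ell2_eqI: "(\<And>i. coord u i = coord v i) \<Longrightarrow> u = v"
  by (simp add: coord_inject[symmetric] fun_eq_iff)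

lemma coord_summable: "(\<lambda>i. (coord u i)\<^sup>2) summable_on UNIV"
  using coord[of u] by (simp add: ellp_2_iff)

lemma ellp_2_add:
  assumes "u \<in> ellp 2" "v \<in> ellp 2" shows "(\<lambda>i. u i + v i) \<in> ellp 2"
proof -
  have "(\<lambda>i. 2 * (u i)\<^sup>2 + 2 * (v i)\<^sup>2) summable_on UNIV"
    using assms by (intro summable_on_add summable_on_cmult_right) (auto simp: ellp_2_iff)
  moreover have "(u i + v i)\<^sup>2 \<le> 2 * (u i)\<^sup>2 + 2 * (v i)\<^sup>2" for i
    using sum_squares_bound[of "u i" "v i"] by (simp add: power2_sum)
  ultimately show ?thesis
    unfolding ellp_2_iff by (rule summable_on_comparison_test) auto
qed

lemma ellp_2_scale:
  assumes "u \<in> ellp 2" shows "(\<lambda>i. r * u i) \<in> ellp 2"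
  using assms by (simp add: ellp_2_iff power_mult_distrib summable_on_cmult_right)

lemma ellp_2_diff:
  assumes "u \<in> ellp 2" "v \<in> ellp 2" shows "(\<lambda>i. u i - v i) \<in> ellp 2"
  using ellp_2_add[OF assms(1) ellp_2_scale[OF assms(2), of "-1"]] by simp

lemma ellp_2_shift:
  assumes "u \<in> ellp 2" shows "(\<lambda>i. u (i + k)) \<in> ellp 2"
proof -
  have "bij_betw (\<lambda>i::int. i + k) UNIV UNIV"
    by (rule bij_betwI[where g = "\<lambda>i. i - k"]) auto
  from summable_on_reindex_bij_betw[OF this, of "\<lambda>i. (u i)\<^sup>2"] show ?thesis
    using assms by (simp add: ellp_2_iff)
qed

lemma coord_prod_summable: "(\<lambda>i. coord u i * coord v i) summable_on UNIV"
proof -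
  have "(\<lambda>i. ((coord u i)\<^sup>2 + (coord v i)\<^sup>2) * (1/2)) summable_on UNIV"
    by (intro summable_on_add summable_on_cmult_left coord_summable)
  moreover have "norm (coord u i * coord v i) \<le> ((coord u i)\<^sup>2 + (coord v i)\<^sup>2) * (1/2)" for i
    using sum_squares_bound[of "\<bar>coord u i\<bar>" "\<bar>coord v i\<bar>"] by (simp add: abs_mult)
  ultimately have "(\<lambda>i. norm (coord u i * coord v i)) summable_on UNIV"
    by (rule summable_on_comparison_test) auto
  then show ?thesis by (rule abs_summable_summable)
qed

instantiation ell2 :: real_inner
begin

lift_definition zero_ell2 :: ell2 is "\<lambda>_. 0" by (simp add: ellp_2_iff)
lift_definition plus_ell2 :: "ell2 \<Rightarrow> ell2 \<Rightarrow> ell2" is "\<lambda>u v i. u i + v i" by (rule ellp_2_add)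
lift_definition minus_ell2 :: "ell2 \<Rightarrow> ell2 \<Rightarrow> ell2" is "\<lambda>u v i. u i - v i" by (rule ellp_2_diff)
lift_definition uminus_ell2 :: "ell2 \<Rightarrow> ell2" is "\<lambda>u i. - u i" by (simp add: ellp_2_iff)
lift_definition scaleR_ell2 :: "real \<Rightarrow> ell2 \<Rightarrow> ell2" is "\<lambda>r u i. r * u i" by (rule ellp_2_scale)

definition inner_ell2 :: "ell2 \<Rightarrow> ell2 \<Rightarrow> real" where
  "inner_ell2 u v = (\<Sum>\<^sub>\<infinity>i. coord u i * coord v i)"
definition norm_ell2 :: "ell2 \<Rightarrow> real" where "norm_ell2 u = sqrt (inner u u)"
definition dist_ell2 :: "ell2 \<Rightarrow> ell2 \<Rightarrow> real" where "dist_ell2 u v = norm (u - v)"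
definition sgn_ell2 :: "ell2 \<Rightarrow> ell2" where "sgn_ell2 u = inverse (norm u) *\<^sub>R u"
definition uniformity_ell2 :: "(ell2 \<times> ell2) filter" where
  "uniformity_ell2 = (INF e\<in>{0<..}. principal {(u, v). dist u v < e})"
definition open_ell2 :: "ell2 set \<Rightarrow> bool" where
  "open_ell2 U \<longleftrightarrow> (\<forall>x\<in>U. eventually (\<lambda>(x', y). x' = x \<longrightarrow> y \<in> U) uniformity)"

lemmas coord_simps =
  zero_ell2.rep_eq plus_ell2.rep_eq minus_ell2.rep_eq uminus_ell2.rep_eq scaleR_ell2.rep_eq

instance
proof
  fix u v w :: ell2 and r s :: real
  show "u + v + w = u + (v + w)" "u + v = v + u" "0 + u = u" "- u + u = 0" "u - v = u + - v"
    by (rule ell2_eqI, simp add: coord_simps)+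
  show "r *\<^sub>R (u + v) = r *\<^sub>R u + r *\<^sub>R v" "(r + s) *\<^sub>R u = r *\<^sub>R u + s *\<^sub>R u"
    "r *\<^sub>R s *\<^sub>R u = (r * s) *\<^sub>R u" "1 *\<^sub>R u = u"
    by (rule ell2_eqI, simp add: coord_simps algebra_simps)+
  show "dist u v = norm (u - v)" by (fact dist_ell2_def)
  show "sgn u = inverse (norm u) *\<^sub>R u" by (fact sgn_ell2_def)
  show "uniformity = (INF e\<in>{0<..}. principal {(u, v :: ell2). dist u v < e})"
    by (fact uniformity_ell2_def)
  show "open U \<longleftrightarrow> (\<forall>x\<in>U. eventually (\<lambda>(x', y). x' = x \<longrightarrow> y \<in> U) uniformity)"
    for U :: "ell2 set" by (fact open_ell2_def)
  show "inner u v = inner v u" by (simp add: inner_ell2_def mult.commute)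
  show "inner (u + v) w = inner u w + inner v w"
    by (simp add: inner_ell2_def plus_ell2.rep_eq distrib_right infsum_add coord_prod_summable)
  show "inner (r *\<^sub>R u) v = r * inner u v"
    by (simp add: inner_ell2_def scaleR_ell2.rep_eq mult.assoc infsum_cmult_right coord_prod_summable)
  show "0 \<le> inner u u" by (simp add: inner_ell2_def infsum_nonneg)
  show "inner u u = 0 \<longleftrightarrow> u = 0"
  proof
    assume "inner u u = 0"
    then have "coord u i * coord u i = 0" for i
      by (intro nonneg_infsum_le_0D[of "\<lambda>i. coord u i * coord u i" UNIV])
        (auto simp: inner_ell2_def coord_prod_summable)
    then show "u = 0" by (intro ell2_eqI) (simp add: zero_ell2.rep_eq)
  qed (simp add: inner_ell2_def zero_ell2.rep_eq)
  show "norm u = sqrt (inner u u)" by (fact norm_ell2_def)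
qed

end

lemma norm_ell2_eq: "norm u = ellp_norm 2 (coord u)" for u :: ell2
  by (simp add: norm_ell2_def inner_ell2_def ellp_norm_2 power2_eq_square)

lemma norm_ell2_square: "(norm u)\<^sup>2 = (\<Sum>\<^sub>\<infinity>i. (coord u i)\<^sup>2)" for u :: ell2
  by (simp add: norm_ell2_eq ellp_norm_2 infsum_nonneg)

lemma sum_coord_le: "finite F \<Longrightarrow> (\<Sum>i\<in>F. (coord u i)\<^sup>2) \<le> (norm u)\<^sup>2"
  unfolding norm_ell2_square by (rule finite_sum_le_infsum[OF coord_summable]) auto

lemma abs_coord_le: "\<bar>coord u i\<bar> \<le> norm u"
  using sum_coord_le[of "{i}" u] by (simp add: abs_le_square_iff[symmetric])

lemma ell2_boundI:
  assumes "\<And>F. finite F \<Longrightarrow> (\<Sum>i\<in>F. (x i)\<^sup>2) \<le> C\<^sup>2" "0 \<le> C"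
  shows "x \<in> ellp 2" and "norm (Ell2 x) \<le> C"
proof -
  show x: "x \<in> ellp 2"
    unfolding ellp_2_iff using assms(1)
    by (intro nonneg_bdd_above_summable_on bdd_aboveI[of _ "C\<^sup>2"]) auto
  have "(norm (Ell2 x))\<^sup>2 = (\<Sum>\<^sub>\<infinity>i. (x i)\<^sup>2)"
    by (simp add: norm_ell2_square Ell2_inverse x)
  also have "\<dots> \<le> C\<^sup>2"
    using x assms(1) by (intro infsum_le_finite_sums) (auto simp: ellp_2_iff)
  finally show "norm (Ell2 x) \<le> C" using assms(2) by (rule power2_le_imp_le)
qed

instance ell2 :: complete_space
proof
  fix X :: "nat \<Rightarrow> ell2"
  assume X: "Cauchy X"
  have "Cauchy (\<lambda>n. coord (X n) i)" for i
  proof (rule metric_CauchyI)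
    fix e :: real assume "0 < e"
    from metric_CauchyD[OF X this] obtain M where M: "\<forall>m\<ge>M. \<forall>n\<ge>M. dist (X m) (X n) < e" by blast
    have "dist (coord (X m) i) (coord (X n) i) < e" if "m \<ge> M" "n \<ge> M" for m n
      using abs_coord_le[of "X m - X n" i] M that
      by (force simp: dist_norm minus_ell2.rep_eq)
    then show "\<exists>M. \<forall>m\<ge>M. \<forall>n\<ge>M. dist (coord (X m) i) (coord (X n) i) < e" by blast
  qed
  then have "\<exists>l. (\<lambda>n. coord (X n) i) \<longlonglongrightarrow> l" for i
    using Cauchy_convergent_iff convergent_def by blast
  then obtain l where l: "\<And>i. (\<lambda>n. coord (X n) i) \<longlonglongrightarrow> l i" by metis
  have bound: "(\<Sum>i\<in>F. (coord (X m) i - l i)\<^sup>2) \<le> e\<^sup>2"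
    if F: "finite F" and M: "\<forall>n\<ge>M. dist (X m) (X n) < e" for F m M e
  proof (rule LIMSEQ_le_const2)
    show "(\<lambda>n. \<Sum>i\<in>F. (coord (X m) i - coord (X n) i)\<^sup>2) \<longlonglongrightarrow> (\<Sum>i\<in>F. (coord (X m) i - l i)\<^sup>2)"
      by (intro tendsto_intros l)
    have "(\<Sum>i\<in>F. (coord (X m) i - coord (X n) i)\<^sup>2) \<le> e\<^sup>2" if "n \<ge> M" for n
    proof -
      have "(\<Sum>i\<in>F. (coord (X m) i - coord (X n) i)\<^sup>2) \<le> (norm (X m - X n))\<^sup>2"
        using sum_coord_le[OF F, of "X m - X n"] by (simp add: minus_ell2.rep_eq)
      also have "\<dots> \<le> e\<^sup>2" using M that by (intro power_mono) (auto simp: dist_norm less_imp_le)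
      finally show ?thesis .
    qed
    then show "\<exists>N. \<forall>n\<ge>N. (\<Sum>i\<in>F. (coord (X m) i - coord (X n) i)\<^sup>2) \<le> e\<^sup>2" by blast
  qed
  have lim: "\<exists>M. \<forall>m\<ge>M. (\<lambda>i. coord (X m) i - l i) \<in> ellp 2 \<and>
      norm (Ell2 (\<lambda>i. coord (X m) i - l i)) \<le> e" if e: "0 < e" for e
  proof -
    from metric_CauchyD[OF X e] obtain M where M: "\<forall>m\<ge>M. \<forall>n\<ge>M. dist (X m) (X n) < e" by blast
    show ?thesis
    proof (intro exI[of _ M] allI impI conjI)
      fix m assume "m \<ge> M"
      then have *: "\<And>F. finite F \<Longrightarrow> (\<Sum>i\<in>F. (coord (X m) i - l i)\<^sup>2) \<le> e\<^sup>2"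
        using bound[of _ M m e] M by blast
      show "(\<lambda>i. coord (X m) i - l i) \<in> ellp 2" "norm (Ell2 (\<lambda>i. coord (X m) i - l i)) \<le> e"
        using ell2_boundI[OF *] e by auto
    qed
  qed
  from lim[of 1] obtain m where "(\<lambda>i. coord (X m) i - l i) \<in> ellp 2" by auto
  from ellp_2_diff[OF coord[of "X m"] this] have l2: "l \<in> ellp 2" by simp
  have eq: "Ell2 (\<lambda>i. coord (X m) i - l i) = X m - Ell2 l"
    if "(\<lambda>i. coord (X m) i - l i) \<in> ellp 2" for m
    using that l2 by (intro ell2_eqI) (simp add: minus_ell2.rep_eq Ell2_inverse)
  have "X \<longlonglongrightarrow> Ell2 l"
  proof (rule metric_LIMSEQ_I)
    fix e :: real assume "0 < e"
    with lim[of "e/2"] obtain M where M: "\<forall>m\<ge>M. (\<lambda>i. coord (X m) i - l i) \<in> ellp 2 \<and>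
      norm (Ell2 (\<lambda>i. coord (X m) i - l i)) \<le> e/2" by auto
    then have "\<forall>m\<ge>M. dist (X m) (Ell2 l) < e"
      using \<open>0 < e\<close> by (force simp: dist_norm eq)
    then show "\<exists>M. \<forall>m\<ge>M. dist (X m) (Ell2 l) < e" by blast
  qed
  then show "convergent X" unfolding convergent_def by blast
qed

instance ell2 :: banach ..

text \<open>Second countability is what the library's Bochner integral asks for; the dense set
  consists of the finitely supported rational sequences.\<close>

instance ell2 :: second_countable_topology
proof
  define S :: "(int \<Rightarrow> real) set" where
    "S = (\<lambda>(F, r). \<lambda>i. if i \<in> F then real_of_rat (r i) else 0) `
       (SIGMA F:{F. finite F}. F \<rightarrow>\<^sub>E UNIV)"
  have "countable (SIGMA F:{F :: int set. finite F}. F \<rightarrow>\<^sub>E (UNIV :: rat set))"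
    by (intro countable_SIGMA countable_Collect_finite countable_PiE) auto
  then have cS: "countable S" unfolding S_def by (rule countable_image)
  have dense: "\<exists>d\<in>Ell2 ` S. dist d u < e" if e: "0 < e" for u :: ell2 and e
  proof -
    from coord_summable[of u] have "((\<lambda>i. (coord u i)\<^sup>2) has_sum (norm u)\<^sup>2) UNIV"
      unfolding norm_ell2_square by (rule has_sum_infsum)
    from has_sum_finite_approximation[OF this, of "e\<^sup>2 / 8"] e obtain F
      where F: "finite F" "dist (\<Sum>i\<in>F. (coord u i)\<^sup>2) ((norm u)\<^sup>2) \<le> e\<^sup>2 / 8" by auto
    define \<delta> where "\<delta> = e / (2 * sqrt (1 + real (card F)) * 2)"
    have \<delta>: "0 < \<delta>" using e by (simp add: \<delta>_def add_pos_nonneg)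
    have \<delta>2: "real (card F) * \<delta>\<^sup>2 \<le> e\<^sup>2 / 16"
      using e by (simp add: \<delta>_def power_divide power_mult_distrib field_simps add_pos_nonneg)
    have "\<exists>q. \<bar>real_of_rat q - coord u i\<bar> < \<delta>" for i
    proof -
      from of_rat_dense[of "coord u i - \<delta>" "coord u i + \<delta>"] \<delta>
      obtain q where "coord u i - \<delta> < real_of_rat q" "real_of_rat q < coord u i + \<delta>" by auto
      then show ?thesis by (intro exI[of _ q]) auto
    qed
    then obtain r where r: "\<And>i. \<bar>real_of_rat (r i) - coord u i\<bar> < \<delta>" by metis
    define x where "x i = (if i \<in> F then real_of_rat (r i) else 0)" for i
    have "x = (\<lambda>(F, r). \<lambda>i. if i \<in> F then real_of_rat (r i) else 0) (F, restrict r F)"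
      by (auto simp: x_def fun_eq_iff)
    then have xS: "x \<in> S" unfolding S_def using F(1)
      by (intro image_eqI[where x = "(F, restrict r F)"]) auto
    have x2: "x \<in> ellp 2" unfolding ellp_2_iff
    proof (rule finite_nonzero_values_imp_summable_on)
      have "{i \<in> UNIV. (x i)\<^sup>2 \<noteq> 0} \<subseteq> F" by (auto simp: x_def)
      then show "finite {i \<in> UNIV. (x i)\<^sup>2 \<noteq> 0}" using F(1) by (rule finite_subset)
    qed
    have "(\<Sum>i\<in>G. (x i - coord u i)\<^sup>2) \<le> (e/2)\<^sup>2" if G: "finite G" for G
    proof -
      have "(\<Sum>i\<in>G. (x i - coord u i)\<^sup>2) \<le> (\<Sum>i\<in>F \<union> G. (x i - coord u i)\<^sup>2)"
        using F(1) G by (intro sum_mono2) auto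
      also have "\<dots> = (\<Sum>i\<in>F. (x i - coord u i)\<^sup>2) + (\<Sum>i\<in>G - F. (x i - coord u i)\<^sup>2)"
        using F(1) G by (subst sum.union_disjoint[symmetric]) (auto intro: arg_cong2[where f = sum])
      also have "(\<Sum>i\<in>F. (x i - coord u i)\<^sup>2) \<le> (\<Sum>i\<in>F. \<delta>\<^sup>2)"
      proof (rule sum_mono)
        fix i assume "i \<in> F"
        then have "\<bar>x i - coord u i\<bar> \<le> \<delta>" using r[of i] by (simp add: x_def less_imp_le)
        then show "(x i - coord u i)\<^sup>2 \<le> \<delta>\<^sup>2" using \<delta> by (simp add: abs_le_square_iff[symmetric])
      qed
      also have "\<dots> \<le> e\<^sup>2 / 16" using \<delta>2 by simp
      also have "(\<Sum>i\<in>G - F. (x i - coord u i)\<^sup>2) = (\<Sum>i\<in>G - F. (coord u i)\<^sup>2)"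
        by (intro sum.cong) (auto simp: x_def)
      also have "\<dots> \<le> e\<^sup>2 / 8"
      proof -
        have "(\<Sum>i\<in>F. (coord u i)\<^sup>2) + (\<Sum>i\<in>G - F. (coord u i)\<^sup>2) = (\<Sum>i\<in>F \<union> (G - F). (coord u i)\<^sup>2)"
          using F(1) G by (subst sum.union_disjoint) auto
        also have "\<dots> \<le> (norm u)\<^sup>2" using F(1) G by (intro sum_coord_le) auto
        finally show ?thesis using F(2) unfolding dist_real_def by linarith
      qed
      finally have "(\<Sum>i\<in>G. (x i - coord u i)\<^sup>2) \<le> e\<^sup>2 / 16 + e\<^sup>2 / 8" by simp
      also have "\<dots> \<le> (e/2)\<^sup>2" by (simp add: power_divide)
      finally show ?thesis .
    qed
    from ell2_boundI[OF this] e
    have *: "(\<lambda>i. x i - coord u i) \<in> ellp 2" "norm (Ell2 (\<lambda>i. x i - coord u i)) \<le> e/2" by auto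
    have "Ell2 (\<lambda>i. x i - coord u i) = Ell2 x - u"
      using * x2 by (intro ell2_eqI) (simp add: minus_ell2.rep_eq Ell2_inverse)
    with * e have "dist (Ell2 x) u < e" by (simp add: dist_norm)
    with xS show ?thesis by blast
  qed
  define B where "B = (\<lambda>(d, n). ball d (1 / real (Suc n))) ` (Ell2 ` S \<times> (UNIV :: nat set))"
  have "countable B" unfolding B_def using cS by (intro countable_image countable_SIGMA) auto
  moreover have "topological_basis B"
  proof (rule topological_basisI)
    show "open U" if "U \<in> B" for U using that by (auto simp: B_def)
  next
    fix U and u :: ell2 assume U: "open U" "u \<in> U"
    then obtain e where e: "0 < e" "ball u e \<subseteq> U" using open_contains_ball by blast
    obtain n where n: "1 / real (Suc n) < e / 2"
      using reals_Archimedean[of "e/2"] e by (auto simp: inverse_eq_divide)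
    obtain d where d: "d \<in> Ell2 ` S" "dist d u < 1 / real (Suc n)"
      using dense[of "1 / real (Suc n)" u] by auto
    have "ball d (1 / real (Suc n)) \<subseteq> ball u e"
    proof
      fix w assume "w \<in> ball d (1 / real (Suc n))"
      then have "dist u w < e" using d(2) n dist_triangle[of u w d]
        by (simp add: dist_commute)
      then show "w \<in> ball u e" by simp
    qed
    moreover have "ball d (1 / real (Suc n)) \<in> B" using d(1) by (force simp: B_def)
    ultimately show "\<exists>B'\<in>B. u \<in> B' \<and> B' \<subseteq> U" using d(2) e(2)
      by (intro bexI[of _ "ball d (1 / real (Suc n))"]) auto
  qed
  ultimately show "\<exists>B :: ell2 set set. countable B \<and> open = generate_topology B"
    using topological_basis_imp_subbasis by blast
qed

lift_definition lap :: "ell2 \<Rightarrow> ell2" is "\<lambda>u i. 2 * u i - u (i - 1) - u (i + 1)"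
proof -
  fix u :: "int \<Rightarrow> real" assume u: "u \<in> ellp 2"
  show "(\<lambda>i. 2 * u i - u (i - 1) - u (i + 1)) \<in> ellp 2"
    using ellp_2_diff[OF ellp_2_diff[OF ellp_2_scale[OF u, of 2] ellp_2_shift[OF u, of "-1"]]
      ellp_2_shift[OF u, of 1]] by simp
qed

text \<open>The Bochner space \<open>L\<^sup>r(S; \<ell>\<^sup>p)\<close>. Measurability is strong: an almost everywhere
  limit, in the norm of \<open>\<ell>\<^sup>p\<close>, of simple functions (for \<open>p = \<infinity>\<close> the space is not separable).\<close>

definition bochner_L :: "ennreal \<Rightarrow> ennreal \<Rightarrow> real set \<Rightarrow> (real \<Rightarrow> int \<Rightarrow> real) set" where
  "bochner_L r p S =
     {\<psi>. (\<forall>t\<in>S. \<psi> t \<in> ellp p) \<and>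
         (\<exists>s. (\<forall>n. simple_function (lebesgue_on S) (s n) \<and> (\<forall>t\<in>S. s n t \<in> ellp p)) \<and>
              (AE t in lebesgue_on S. (\<lambda>n. ellp_norm p (\<lambda>i. s n t i - \<psi> t i)) \<longlonglongrightarrow> 0)) \<and>
         (if r = \<infinity> then (\<exists>C. AE t in lebesgue_on S. ellp_norm p (\<psi> t) \<le> C)
          else (\<integral>\<^sup>+t. ennreal (ellp_norm p (\<psi> t) powr enn2real r) \<partial>lebesgue_on S) < \<infinity>)}"

definition bochner_L_loc :: "ennreal \<Rightarrow> ennreal \<Rightarrow> (real \<Rightarrow> int \<Rightarrow> real) set" where
  "bochner_L_loc r p = (\<Inter>a. \<Inter>b. bochner_L r p {a..b})"

section \<open>The Wiener space\<close>

definition path_space :: "(real \<Rightarrow> real) set" where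
  "path_space = {\<omega>. continuous_on UNIV \<omega> \<and> \<omega> 0 = 0}"

definition compact_open_topology :: "(real \<Rightarrow> real) topology" where
  "compact_open_topology =
     topology_generated_by {{\<omega> \<in> path_space. \<omega> ` K \<subseteq> U} | K U. compact K \<and> open U}"

text \<open>Two-sided Wiener measure on the Borel sets of the compact-open topology: it is the unique
  probability measure under which the increments over adjacent time intervals are independent
  and centred Gaussian with variance the length of the interval.\<close>

definition wiener_measure :: "(real \<Rightarrow> real) measure \<Rightarrow> bool" where
  "wiener_measure P \<longleftrightarrow>
     prob_space P \<and> space P = path_space \<and>
     sets P = sigma_sets path_space {U. openin compact_open_topology U} \<and>
     (\<forall>s t. s < t \<longrightarrow>
        distributed P lborel (\<lambda>\<omega>. \<omega> t - \<omega> s) (\<lambda>x. ennreal (normal_density 0 (sqrt (t - s)) x))) \<and>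
     (\<forall>(n :: nat) \<tau>. mono \<tau> \<longrightarrow>
        prob_space.indep_vars P (\<lambda>_. borel) (\<lambda>j \<omega>. \<omega> (\<tau> (Suc j)) - \<omega> (\<tau> j)) {..<n})"

definition shift :: "real \<Rightarrow> (real \<Rightarrow> real) \<Rightarrow> real \<Rightarrow> real" where
  "shift t \<omega> = (\<lambda>s. \<omega> (s + t) - \<omega> t)"

definition ou :: "(real \<Rightarrow> real) \<Rightarrow> real" where
  "ou \<omega> = - (LBINT s:{..0}. exp s * \<omega> s)"

text \<open>The invariant set of full measure on which one works. Integrability is made explicit
  because the integral of a nonintegrable function is 0 by convention.\<close>

definition admissible_paths :: "(real \<Rightarrow> real) measure \<Rightarrow> (real \<Rightarrow> real) set \<Rightarrow> bool" where
  "admissible_paths P \<Omega> \<longleftrightarrow>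
     \<Omega> \<in> sets P \<and> emeasure P \<Omega> = 1 \<and> (\<forall>t. shift t ` \<Omega> = \<Omega>) \<and>
     (\<forall>\<omega>\<in>\<Omega>.
        set_integrable lborel {..0} (\<lambda>s. exp s * \<omega> s) \<and>
        continuous_on UNIV (\<lambda>t. ou (shift t \<omega>)) \<and>
        ((\<lambda>t. ou (shift t \<omega>) / t) \<longlongrightarrow> 0) at_top \<and>
        ((\<lambda>t. ou (shift t \<omega>) / t) \<longlongrightarrow> 0) at_bot \<and>
        ((\<lambda>t. 1 / t * (LBINT s=ereal 0..ereal t. ou (shift s \<omega>))) \<longlongrightarrow> 0) at_top \<and>
        ((\<lambda>t. 1 / t * (LBINT s=ereal 0..ereal t. ou (shift s \<omega>))) \<longlongrightarrow> 0) at_bot)"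

section \<open>The lattice equation\<close>

definition random_field ::
  "real \<Rightarrow> (ell2 \<Rightarrow> ell2) \<Rightarrow> (real \<Rightarrow> ell2 \<Rightarrow> ell2) \<Rightarrow> (real \<Rightarrow> ell2) \<Rightarrow> (real \<Rightarrow> ell2) \<Rightarrow>
    real \<Rightarrow> (real \<Rightarrow> real) \<Rightarrow> ell2 \<Rightarrow> ell2" where
  "random_field lam f g h h' t \<omega> v =
     (let z = ou (shift t \<omega>) in
        - lap (lap v) - lam *\<^sub>R v - lap (f (v + z *\<^sub>R h t)) + g t (v + z *\<^sub>R h t)
        + z *\<^sub>R (- lap (lap (h t)) + (1 - lam) *\<^sub>R h t - h' t))"

text \<open>Solutions are understood in the sense of Caratheodory, as \<open>h'\<close> and the bounds on \<open>g\<close> are only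
  locally integrable in time.\<close>

definition solves_from ::
  "real \<Rightarrow> ell2 \<Rightarrow> (real \<Rightarrow> ell2 \<Rightarrow> ell2) \<Rightarrow> (real \<Rightarrow> ell2) \<Rightarrow> bool" where
  "solves_from \<tau> v\<^sub>0 F v \<longleftrightarrow>
     continuous_on {\<tau>..} v \<and>
     (\<forall>t\<ge>\<tau>. set_integrable lebesgue {\<tau>..t} (\<lambda>s. F s (v s)) \<and>
             v t = v\<^sub>0 + (LINT s:{\<tau>..t}|lebesgue. F s (v s)))"

text \<open>The value at time \<open>t \<ge> \<tau>\<close> of the unique solution; taking values rather than functions avoids
  prescribing the solution before time \<open>\<tau>\<close>.\<close>

definition sol_v ::
  "real \<Rightarrow> (ell2 \<Rightarrow> ell2) \<Rightarrow> (real \<Rightarrow> ell2 \<Rightarrow> ell2) \<Rightarrow> (real \<Rightarrow> ell2) \<Rightarrow> (real \<Rightarrow> ell2) \<Rightarrow>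
    real \<Rightarrow> real \<Rightarrow> (real \<Rightarrow> real) \<Rightarrow> ell2 \<Rightarrow> ell2" where
  "sol_v lam f g h h' t \<tau> \<omega> v\<^sub>0 =
     (THE x. \<exists>v. solves_from \<tau> v\<^sub>0 (\<lambda>s. random_field lam f g h h' s \<omega>) v \<and> x = v t)"

definition sol_u ::
  "real \<Rightarrow> (ell2 \<Rightarrow> ell2) \<Rightarrow> (real \<Rightarrow> ell2 \<Rightarrow> ell2) \<Rightarrow> (real \<Rightarrow> ell2) \<Rightarrow> (real \<Rightarrow> ell2) \<Rightarrow>
    real \<Rightarrow> real \<Rightarrow> (real \<Rightarrow> real) \<Rightarrow> ell2 \<Rightarrow> ell2" where
  "sol_u lam f g h h' t \<tau> \<omega> u\<^sub>0 =
     sol_v lam f g h h' t \<tau> \<omega> (u\<^sub>0 - ou (shift \<tau> \<omega>) *\<^sub>R h \<tau>) + ou (shift t \<omega>) *\<^sub>R h t"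

definition nrds ::
  "real \<Rightarrow> (ell2 \<Rightarrow> ell2) \<Rightarrow> (real \<Rightarrow> ell2 \<Rightarrow> ell2) \<Rightarrow> (real \<Rightarrow> ell2) \<Rightarrow> (real \<Rightarrow> ell2) \<Rightarrow>
    real \<Rightarrow> real \<Rightarrow> (real \<Rightarrow> real) \<Rightarrow> ell2 \<Rightarrow> ell2" where
  "nrds lam f g h h' t \<tau> \<omega> u\<^sub>0 = sol_u lam f g h h' (t + \<tau>) \<tau> (shift (- \<tau>) \<omega>) u\<^sub>0"

section \<open>Random sets and attractors\<close>

text \<open>Below \<open>M\<close> is the probability space with \<open>space M = \<Omega>\<close>; values of a family outside \<open>\<Omega>\<close> are
  irrelevant. Suprema that may be infinite are taken in \<^typ>\<open>ennreal\<close>.\<close>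

type_synonym 'x family = "real \<Rightarrow> (real \<Rightarrow> real) \<Rightarrow> 'x set"

definition nonauto_random_set :: "(real \<Rightarrow> real) measure \<Rightarrow> 'x::metric_space family \<Rightarrow> bool" where
  "nonauto_random_set M D \<longleftrightarrow>
     (\<forall>\<tau>. \<forall>\<omega>\<in>space M. D \<tau> \<omega> \<noteq> {}) \<and>
     (\<forall>x \<tau>. (\<lambda>\<omega>. infdist x (D \<tau> \<omega>)) \<in> borel_measurable M)"

definition set_norm :: "'x::real_normed_vector set \<Rightarrow> ennreal" where
  "set_norm D = (SUP u\<in>D. ennreal (norm u))"

definition tempered_sets ::
  "(real \<Rightarrow> real) measure \<Rightarrow> real \<Rightarrow> 'x::real_normed_vector family set" where
  "tempered_sets M lam0 =
     {D. nonauto_random_set M D \<and>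
         (\<forall>\<tau>. \<forall>\<omega>\<in>space M.
            ((\<lambda>s. ennreal (exp (lam0 * s)) * (set_norm (D (\<tau> + s) (shift s \<omega>)))\<^sup>2) \<longlongrightarrow> 0) at_bot)}"

definition semidist :: "'x::metric_space set \<Rightarrow> 'x set \<Rightarrow> ennreal" where
  "semidist B C = (SUP b\<in>B. ennreal (infdist b C))"

definition pullback_attractor ::
  "(real \<Rightarrow> real) measure \<Rightarrow> 'x::metric_space family set \<Rightarrow>
    (real \<Rightarrow> real \<Rightarrow> (real \<Rightarrow> real) \<Rightarrow> 'x \<Rightarrow> 'x) \<Rightarrow> 'x family \<Rightarrow> bool" where
  "pullback_attractor M \<D> \<phi> \<A> \<longleftrightarrow>
     nonauto_random_set M \<A> \<and>
     (\<forall>\<tau>. AE \<omega> in M. compact (\<A> \<tau> \<omega>)) \<and>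
     (\<forall>t\<ge>0. \<forall>\<tau>. \<forall>\<omega>\<in>space M. \<phi> t \<tau> \<omega> ` \<A> \<tau> \<omega> = \<A> (\<tau> + t) (shift t \<omega>)) \<and>
     (\<forall>D\<in>\<D>. \<forall>\<tau>. \<forall>\<omega>\<in>space M.
        ((\<lambda>t. semidist (\<phi> t (\<tau> - t) (shift (- t) \<omega>) ` D (\<tau> - t) (shift (- t) \<omega>)) (\<A> \<tau> \<omega>))
           \<longlongrightarrow> 0) at_top) \<and>
     (\<exists>K\<in>\<D>. \<forall>\<tau>. \<forall>\<omega>\<in>space M. closed (K \<tau> \<omega>) \<and> \<A> \<tau> \<omega> \<subseteq> K \<tau> \<omega>)"

end

theory Submission
  imports Defs
begin

text \<open>For a fixed path the equation is a Caratheodory equation in \<open>\<ell>\<^sup>2\<close> whose right-hand side is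
  one-sided Lipschitz on bounded sets, because \<open>g\<close> is coordinatewise almost decreasing and the rest
  is locally Lipschitz; a delay approximation gives existence and Gronwall's inequality uniqueness
  and continuous dependence. Testing the equation with \<open>\<rho>\<^sub>i v\<^sub>i\<close> for a slowly varying bounded weight
  \<open>\<rho>\<close> gives an energy inequality in which the superlinear damping of \<open>g\<close> absorbs both
  \<open>A f\<close> and the noise. The weight 1 yields a tempered absorbing ball, and weights
  decaying geometrically towards the origin and equal to 1 far out yield uniformly small tails,
  hence pullback asymptotic compactness. The attractor is the omega-limit set of the absorbing ball.
  Its distance function is a limit of distances to images of balls, which are measurable since the
  flow is continuous in the initial value and depends measurably on the path.\<close>

section \<open>Absolutely continuous curves\<close>

text \<open>The term \<open>- lap (f u)\<close> has no sign and, once tested, pairs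
  \<open>fi i\<close> at one site with \<open>v\<close> at the neighbouring sites, whereas the
  damping of \<open>gi\<close> acts at its own site. The estimate is therefore made site by site,
  with errors charged to the neighbours, and summed only afterwards; weights whose ratio between
  neighbours is close to 1 keep these errors under the same weighted sum. The gap
  \<open>\<epsilon>\<close> in the growth exponent of \<open>fi\<close> lets an arbitrarily small
  multiple of the damping absorb it. The derivative of \<open>gi\<close> is bounded from above only,
  so no Lipschitz bound for \<open>g\<close> is at hand: solutions are compared through one-sided
  bounds, and continuity of \<open>g\<close> is proved separately by means of tails. The gaps
  between the rates have separate tasks: \<open>lam0 < lam\<close> leaves room for the local errors,
  \<open>lam1 < lam0\<close> pays for the growth of the noise. Up to the last sections the noise is
  an arbitrary continuous real path; of the random paths only measurability, continuity and
  sublinear growth of \<open>ou (shift t \<omega>)\<close> on a shift-invariant set are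
  used.\<close>

definition ac_on :: "real \<Rightarrow> real \<Rightarrow> (real \<Rightarrow> 'a::{banach,second_countable_topology}) \<Rightarrow> (real \<Rightarrow> 'a) \<Rightarrow> bool" where
  "ac_on a b x \<phi> \<longleftrightarrow> set_integrable lebesgue {a..b} \<phi> \<and>
     (\<forall>t\<in>{a..b}. x t = x a + (LINT s:{a..t}|lebesgue. \<phi> s))"

lemma set_integrable_Icc_subset:
  fixes \<phi> :: "real \<Rightarrow> 'a::{banach,second_countable_topology}"
  assumes "set_integrable lebesgue {a..b} \<phi>" "a \<le> c" "d \<le> b"
  shows "set_integrable lebesgue {c..d} \<phi>"
  using assms by (intro set_integrable_subset[OF assms(1)]) auto

lemma set_integral_Icc_combine:
  fixes \<phi> :: "real \<Rightarrow> 'a::{banach,second_countable_topology}"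
  assumes i: "set_integrable lebesgue {a..c} \<phi>" and "a \<le> b" "b \<le> c"
  shows "(LINT s:{a..c}|lebesgue. \<phi> s) = (LINT s:{a..b}|lebesgue. \<phi> s) + (LINT s:{b..c}|lebesgue. \<phi> s)"
proof -
  have "AE x in lebesgue. x \<noteq> b"
    using AE_lborel_singleton[of b] by (rule AE_completion)
  then have "AE x in lebesgue. \<not> (x \<in> {a..b} \<and> x \<in> {b..c})"
    by eventually_elim auto
  moreover have "{a..c} = {a..b} \<union> {b..c}" using assms by auto
  ultimately show ?thesis
    using set_integrable_Icc_subset[OF i, of a b] set_integrable_Icc_subset[OF i, of b c] assms
    by (simp add: set_integral_Un_AE)
qed

lemma set_integral_singleton [simp]:
  fixes \<phi> :: "real \<Rightarrow> 'a::{banach,second_countable_topology}"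
  shows "(LINT s:{a}|lebesgue. \<phi> s) = 0"
proof -
  have "AE x in lebesgue. x \<noteq> a"
    using AE_lborel_singleton[of a] by (rule AE_completion)
  then have "AE x in lebesgue. indicator {a} x *\<^sub>R \<phi> x = 0"
    by eventually_elim auto
  then show ?thesis
    unfolding set_lebesgue_integral_def by (rule integral_eq_zero_AE)
qed

lemma continuous_on_set_integral_Icc:
  fixes \<phi> :: "real \<Rightarrow> real"
  assumes "set_integrable lebesgue {a..b} \<phi>"
  shows "continuous_on {a..b} (\<lambda>t. LINT s:{a..t}|lebesgue. \<phi> s)"
proof -
  have "continuous_on {a..b} (\<lambda>t. integral {a..t} \<phi>)"
    using set_lebesgue_integral_eq_integral(1)[OF assms] by (rule indefinite_integral_continuous_1)
  moreover have "(LINT s:{a..t}|lebesgue. \<phi> s) = integral {a..t} \<phi>" if "t \<in> {a..b}" for t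
    using set_integrable_Icc_subset[OF assms, of a t] that
    by (intro set_lebesgue_integral_eq_integral(2)) auto
  ultimately show ?thesis by (metis (no_types, lifting) continuous_on_cong)
qed

lemma ac_onI:
  assumes "set_integrable lebesgue {a..b} \<phi>"
    and "\<And>t. a \<le> t \<Longrightarrow> t \<le> b \<Longrightarrow> x t = x a + (LINT s:{a..t}|lebesgue. \<phi> s)"
  shows "ac_on a b x \<phi>"
  using assms unfolding ac_on_def by (meson atLeastAtMost_iff)

lemma ac_on_integrable: "ac_on a b x \<phi> \<Longrightarrow> set_integrable lebesgue {a..b} \<phi>"
  by (simp add: ac_on_def)

lemma ac_on_eq:
  assumes "ac_on a b x \<phi>" "a \<le> t" "t \<le> b"
  shows "x t = x a + (LINT s:{a..t}|lebesgue. \<phi> s)"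
  using assms unfolding ac_on_def by (meson atLeastAtMost_iff)

lemma ac_on_diff:
  assumes "ac_on a b x \<phi>" "a \<le> s" "s \<le> t" "t \<le> b"
  shows "x t - x s = (LINT r:{s..t}|lebesgue. \<phi> r)"
proof -
  have "x t = x a + (LINT s:{a..t}|lebesgue. \<phi> s)" "x s = x a + (LINT s:{a..s}|lebesgue. \<phi> s)"
    using assms by (auto intro: ac_on_eq)
  moreover have "set_integrable lebesgue {a..t} \<phi>"
    using assms by (intro set_integrable_Icc_subset[OF ac_on_integrable]) auto
  ultimately show ?thesis using set_integral_Icc_combine[of a t \<phi> s] assms by simp
qed

lemma ac_on_subinterval:
  assumes "ac_on a b x \<phi>" "a \<le> c" "d \<le> b"
  shows "ac_on c d x \<phi>"
proof (rule ac_onI)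
  show "set_integrable lebesgue {c..d} \<phi>"
    using assms by (intro set_integrable_Icc_subset[OF ac_on_integrable]) auto
  show "x t = x c + (LINT s:{c..t}|lebesgue. \<phi> s)" if "c \<le> t" "t \<le> d" for t
    using ac_on_diff[OF assms(1), of c t] that assms by (simp add: algebra_simps)
qed

text \<open>The increments of \<open>x\<close> are dominated by those of the real indefinite
  integral of \<open>M\<close>. Curves with a common bound \<open>M\<close> thus share a modulus of
  continuity, on which the delayed approximations rely.\<close>

lemma ac_on_norm_diff_le:
  assumes "ac_on a b x \<phi>" "a \<le> s" "s \<le> t" "t \<le> b"
    and "set_integrable lebesgue {a..b} M" "\<And>r. r \<in> {a..b} \<Longrightarrow> norm (\<phi> r) \<le> M r"
  shows "norm (x t - x s) \<le> (LINT r:{a..t}|lebesgue. M r) - (LINT r:{a..s}|lebesgue. M r)"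
proof -
  have i: "set_integrable lebesgue {s..t} \<phi>"
    using assms by (intro set_integrable_Icc_subset[OF ac_on_integrable]) auto
  have iM: "set_integrable lebesgue {a..t} M" "set_integrable lebesgue {s..t} M"
    using assms by (auto intro!: set_integrable_Icc_subset[OF assms(5)])
  have "norm (x t - x s) \<le> (LINT r:{s..t}|lebesgue. norm (\<phi> r))"
    using ac_on_diff[OF assms(1-4)] set_integral_norm_bound[OF i] by simp
  also have "\<dots> \<le> (LINT r:{s..t}|lebesgue. M r)"
    using assms i iM by (intro set_integral_mono) (auto intro: set_integrable_norm)
  finally show ?thesis
    using set_integral_Icc_combine[OF iM(1), of s] assms by simp
qed

lemma ac_on_continuous:
  assumes "ac_on a b x \<phi>"
  shows "continuous_on {a..b} x"
proof -
  let ?\<mu> = "\<lambda>t. LINT r:{a..t}|lebesgue. norm (\<phi> r)"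
  have i: "set_integrable lebesgue {a..b} (\<lambda>r. norm (\<phi> r))"
    using ac_on_integrable[OF assms] by (rule set_integrable_norm)
  have c: "continuous_on {a..b} ?\<mu>" by (rule continuous_on_set_integral_Icc[OF i])
  have le: "dist (x t) (x s) \<le> dist (?\<mu> t) (?\<mu> s)" if "s \<in> {a..b}" "t \<in> {a..b}" for s t
  proof (cases "s \<le> t")
    case True
    then show ?thesis using ac_on_norm_diff_le[OF assms _ True _ i] that by (auto simp: dist_norm)
  next
    case False
    then show ?thesis using ac_on_norm_diff_le[OF assms, of t s, OF _ _ _ i] that
      by (auto simp: dist_norm norm_minus_commute)
  qed
  show ?thesis
    unfolding continuous_on_iff
  proof (intro ballI allI impI)
    fix t e assume t: "t \<in> {a..b}" and e: "(0::real) < e"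
    obtain d where "d > 0" "\<forall>s\<in>{a..b}. dist s t < d \<longrightarrow> dist (?\<mu> s) (?\<mu> t) < e"
      using c[unfolded continuous_on_iff, rule_format, OF t e] by blast
    then show "\<exists>d>0. \<forall>s\<in>{a..b}. dist s t < d \<longrightarrow> dist (x s) (x t) < e"
      using le[OF t] by (meson le_less_trans)
  qed
qed

text \<open>A mean value argument by bisection instead of differentiation: for fixed
  \<open>e\<close> the bound is additive over adjacent intervals because the increments of
  \<open>\<Phi>\<close> are, so the local bounds add up to the whole interval; then \<open>e\<close>
  tends to 0.\<close>

lemma constant_if_small_increments:
  fixes E :: "real \<Rightarrow> 'a::real_normed_vector" and \<Phi> :: "real \<Rightarrow> real"
  assumes "a \<le> b"
    and *: "\<And>x e. x \<in> {a..b} \<Longrightarrow> 0 < e \<Longrightarrow>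
      \<exists>d>0. \<forall>s t. a \<le> s \<and> s \<le> x \<and> x \<le> t \<and> t \<le> b \<and> t - s < d \<longrightarrow> norm (E t - E s) \<le> e * (\<Phi> t - \<Phi> s)"
  shows "E b = E a"
proof -
  have le: "norm (E b - E a) \<le> e * (\<Phi> b - \<Phi> a)" if "0 < e" for e
  proof -
    have "a \<le> a \<and> b \<le> b \<longrightarrow> norm (E b - E a) \<le> e * (\<Phi> b - \<Phi> a)" if "a \<le> b"
      using \<open>a \<le> b\<close>
    proof (induction rule: Bolzano[where P = "\<lambda>s t. a \<le> s \<and> t \<le> b \<longrightarrow> norm (E t - E s) \<le> e * (\<Phi> t - \<Phi> s)"])
      case (trans s t u)
      show ?case
      proof
        assume "a \<le> s \<and> u \<le> b"
        then have "norm (E t - E s) \<le> e * (\<Phi> t - \<Phi> s)" "norm (E u - E t) \<le> e * (\<Phi> u - \<Phi> t)"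
          using trans by auto
        then show "norm (E u - E s) \<le> e * (\<Phi> u - \<Phi> s)"
          using norm_triangle_ineq[of "E t - E s" "E u - E t"] by (simp add: algebra_simps)
      qed
    next
      case (local x)
      then obtain d where "d > 0" "\<forall>s t. a \<le> s \<and> s \<le> x \<and> x \<le> t \<and> t \<le> b \<and> t - s < d \<longrightarrow> norm (E t - E s) \<le> e * (\<Phi> t - \<Phi> s)"
        using *[of x e] \<open>0 < e\<close> by auto
      then show ?case by (intro exI[of _ d]) blast
    qed
    then show ?thesis using \<open>a \<le> b\<close> by simp
  qed
  show ?thesis
  proof (rule ccontr)
    assume "E b \<noteq> E a"
    then have n: "norm (E b - E a) > 0" by simp
    have c: "0 \<le> \<Phi> b - \<Phi> a" using order_trans[OF norm_ge_zero le[of 1]] by simp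
    \<comment> \<open>The summand 1 keeps the denominator positive when \<open>\<Phi>\<close> does
      not increase; the bound obtained is at most half of the norm that was supposed
      positive.\<close>
    define e where "e = norm (E b - E a) / (2 * (\<Phi> b - \<Phi> a + 1))"
    have "e > 0" using n c by (simp add: e_def)
    have "norm (E b - E a) \<le> e * (\<Phi> b - \<Phi> a)" using le[OF \<open>e > 0\<close>] .
    also have "\<dots> \<le> e * (\<Phi> b - \<Phi> a + 1)" using \<open>e > 0\<close> by simp
    also have "\<dots> = norm (E b - E a) / 2" using c by (simp add: e_def field_simps)
    finally show False using n by simp
  qed
qed

lemma set_borel_measurable_continuous_Icc:
  fixes x :: "real \<Rightarrow> 'a::{banach,second_countable_topology}"
  assumes "continuous_on {a..b} x"
  shows "(\<lambda>s. indicator {a..b} s *\<^sub>R x s) \<in> borel_measurable lebesgue"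
proof -
  have "(\<lambda>s. indicator {a..b} s *\<^sub>R x s) \<in> borel_measurable borel"
    using assms by (intro borel_measurable_continuous_on_indicator) auto
  then have "(\<lambda>s. indicator {a..b} s *\<^sub>R x s) \<in> borel_measurable lborel" by simp
  then show ?thesis by (rule measurable_completion)
qed

lemma continuous_Icc_norm_bound:
  fixes x :: "real \<Rightarrow> 'a::real_normed_vector"
  assumes "continuous_on {a..b} x"
  obtains B where "B > 0" "\<And>s. s \<in> {a..b} \<Longrightarrow> norm (x s) \<le> B"
proof -
  have "bounded (x ` {a..b})"
    using assms by (intro compact_imp_bounded compact_continuous_image) auto
  then obtain B where "B > 0" "\<forall>y\<in>x ` {a..b}. norm y \<le> B" using bounded_pos by blast
  then show ?thesis using that by blast
qed

lemma set_integrable_bilinear_left: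
  fixes \<phi> :: "real \<Rightarrow> 'a::{banach,second_countable_topology}"
    and w :: "real \<Rightarrow> 'b::{banach,second_countable_topology}"
    and prod :: "'a \<Rightarrow> 'b \<Rightarrow> 'c::{banach,second_countable_topology}"
  assumes "bounded_bilinear prod" "set_integrable lebesgue {a..b} \<phi>" "continuous_on {a..b} w"
  shows "set_integrable lebesgue {a..b} (\<lambda>s. prod (\<phi> s) (w s))"
proof -
  interpret bounded_bilinear prod by fact
  obtain K where K: "K > 0" "\<And>u v. norm (prod u v) \<le> norm u * norm v * K"
    using pos_bounded by blast
  obtain B where B: "B > 0" "\<And>s. s \<in> {a..b} \<Longrightarrow> norm (w s) \<le> B"
    using continuous_Icc_norm_bound[OF assms(3)] by blast
  show ?thesis
  proof (rule set_integrable_bound)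
    show "set_integrable lebesgue {a..b} (\<lambda>s. (B * K) *\<^sub>R \<phi> s)" using assms(2) by simp
    have "(\<lambda>s. prod (indicator {a..b} s *\<^sub>R \<phi> s) (indicator {a..b} s *\<^sub>R w s)) \<in> borel_measurable lebesgue"
    proof (rule borel_measurable_continuous_Pair[where H = prod])
      show "(\<lambda>s. indicator {a..b} s *\<^sub>R \<phi> s) \<in> borel_measurable lebesgue"
        using assms(2) unfolding set_integrable_def by (rule borel_measurable_integrable)
      show "(\<lambda>s. indicator {a..b} s *\<^sub>R w s) \<in> borel_measurable lebesgue"
        by (rule set_borel_measurable_continuous_Icc[OF assms(3)])
      show "continuous_on UNIV (\<lambda>x. prod (fst x) (snd x))"
        by (intro continuous_on continuous_intros)
    qed
    also have "(\<lambda>s. prod (indicator {a..b} s *\<^sub>R \<phi> s) (indicator {a..b} s *\<^sub>R w s)) =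
        (\<lambda>s. indicator {a..b} s *\<^sub>R prod (\<phi> s) (w s))"
      by (auto simp: fun_eq_iff indicator_def zero_left)
    finally show "set_borel_measurable lebesgue {a..b} (\<lambda>s. prod (\<phi> s) (w s))"
      unfolding set_borel_measurable_def .
    show "AE s in lebesgue. s \<in> {a..b} \<longrightarrow> norm (prod (\<phi> s) (w s)) \<le> norm ((B * K) *\<^sub>R \<phi> s)"
    proof (intro AE_I2 impI)
      fix s assume "s \<in> {a..b}"
      have "norm (prod (\<phi> s) (w s)) \<le> norm (\<phi> s) * norm (w s) * K" by (rule K)
      also have "\<dots> \<le> norm (\<phi> s) * B * K"
        using B K \<open>s \<in> {a..b}\<close> by (intro mult_right_mono mult_left_mono) auto
      finally show "norm (prod (\<phi> s) (w s)) \<le> norm ((B * K) *\<^sub>R \<phi> s)"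
        using B K by (simp add: mult_ac)
    qed
  qed
qed

lemma set_integrable_bilinear_right:
  fixes \<phi> :: "real \<Rightarrow> 'b::{banach,second_countable_topology}"
    and w :: "real \<Rightarrow> 'a::{banach,second_countable_topology}"
    and prod :: "'a \<Rightarrow> 'b \<Rightarrow> 'c::{banach,second_countable_topology}"
  assumes "bounded_bilinear prod" "set_integrable lebesgue {a..b} \<phi>" "continuous_on {a..b} w"
  shows "set_integrable lebesgue {a..b} (\<lambda>s. prod (w s) (\<phi> s))"
  using set_integrable_bilinear_left[OF bounded_bilinear.flip[OF assms(1)] assms(2,3)] .

lemma set_integral_bounded_linear:
  fixes \<phi> :: "real \<Rightarrow> 'a::{banach,second_countable_topology}"
    and T :: "'a \<Rightarrow> 'b::{banach,second_countable_topology}"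
  assumes "bounded_linear T" "set_integrable lebesgue S \<phi>"
  shows "set_integrable lebesgue S (\<lambda>s. T (\<phi> s))"
    and "(LINT s:S|lebesgue. T (\<phi> s)) = T (LINT s:S|lebesgue. \<phi> s)"
proof -
  interpret bounded_linear T by fact
  show "set_integrable lebesgue S (\<lambda>s. T (\<phi> s))"
    using integrable_bounded_linear[OF assms(1) assms(2)[unfolded set_integrable_def]]
    by (simp add: set_integrable_def scaleR)
  show "(LINT s:S|lebesgue. T (\<phi> s)) = T (LINT s:S|lebesgue. \<phi> s)"
    using integral_bounded_linear[OF assms(1) assms(2)[unfolded set_integrable_def]]
    by (simp add: set_lebesgue_integral_def scaleR)
qed

text \<open>The product rule without differentiability almost everywhere. Over a short interval from
  \<open>s\<close> to \<open>u\<close> the increment of the product is the integral of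
  \<open>prod (\<phi> r) (w u) + prod (x s) (\<theta> r)\<close>; replacing \<open>w u\<close> and
  \<open>x s\<close> by the values at \<open>r\<close> costs the oscillation of \<open>x\<close> and
  \<open>w\<close> times the integral of \<open>norm (\<phi> r) + norm (\<theta> r)\<close>. Hence
  the product minus its candidate integral is constant by
  \<open>constant_if_small_increments\<close>.\<close>

lemma ac_on_bilinear:
  fixes x \<phi> :: "real \<Rightarrow> 'a::{banach,second_countable_topology}"
    and w \<theta> :: "real \<Rightarrow> 'b::{banach,second_countable_topology}"
    and prod :: "'a \<Rightarrow> 'b \<Rightarrow> 'c::{banach,second_countable_topology}"
  assumes bb: "bounded_bilinear prod" and x: "ac_on a b x \<phi>" and w: "ac_on a b w \<theta>"
  shows "ac_on a b (\<lambda>t. prod (x t) (w t)) (\<lambda>t. prod (\<phi> t) (w t) + prod (x t) (\<theta> t))"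
proof -
  interpret bounded_bilinear prod by fact
  let ?d = "\<lambda>t. prod (\<phi> t) (w t) + prod (x t) (\<theta> t)"
  let ?n = "\<lambda>t. norm (\<phi> t) + norm (\<theta> t)"
  obtain K where K: "K > 0" "\<And>u v. norm (prod u v) \<le> norm u * norm v * K"
    using pos_bounded by blast
  note cx = ac_on_continuous[OF x] and cw = ac_on_continuous[OF w]
  note i\<phi> = ac_on_integrable[OF x] and i\<theta> = ac_on_integrable[OF w]
  have i1: "set_integrable lebesgue {a..b} (\<lambda>t. prod (\<phi> t) (w t))"
    by (rule set_integrable_bilinear_left[OF bb i\<phi> cw])
  have i2: "set_integrable lebesgue {a..b} (\<lambda>t. prod (x t) (\<theta> t))"
    by (rule set_integrable_bilinear_right[OF bb i\<theta> cx])
  have id: "set_integrable lebesgue {a..b} ?d" using i1 i2 by (rule set_integral_add)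
  have inn: "set_integrable lebesgue {a..b} ?n"
    using i\<phi> i\<theta> by (intro set_integral_add set_integrable_norm)
  have *: "prod (x t) (w t) - (LINT s:{a..t}|lebesgue. ?d s) =
      prod (x a) (w a) - (LINT s:{a..a}|lebesgue. ?d s)" if t: "a \<le> t" "t \<le> b" for t
  proof (rule constant_if_small_increments[where \<Phi> = "\<lambda>t. LINT s:{a..t}|lebesgue. ?n s", OF \<open>a \<le> t\<close>])
    fix y e :: real assume y: "y \<in> {a..t}" and e: "0 < e"
    then have yb: "y \<in> {a..b}" using t by auto
    \<comment> \<open>Values at two points of the window around \<open>y\<close> differ by at most
      \<open>2 * e'\<close>, and \<open>K\<close> bounds the product; together this is the factor
      \<open>e\<close>.\<close>
    define e' where "e' = e / (2 * K)"
    have e': "e' > 0" "2 * e' * K = e" using e K by (auto simp: e'_def)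
    obtain d1 where d1: "d1 > 0" "\<forall>s\<in>{a..b}. dist s y < d1 \<longrightarrow> dist (x s) (x y) < e'"
      using cx[unfolded continuous_on_iff, rule_format, OF yb e'(1)] by blast
    obtain d2 where d2: "d2 > 0" "\<forall>s\<in>{a..b}. dist s y < d2 \<longrightarrow> dist (w s) (w y) < e'"
      using cw[unfolded continuous_on_iff, rule_format, OF yb e'(1)] by blast
    show "\<exists>d>0. \<forall>s u. a \<le> s \<and> s \<le> y \<and> y \<le> u \<and> u \<le> t \<and> u - s < d \<longrightarrow>
      norm (prod (x u) (w u) - (LINT s:{a..u}|lebesgue. ?d s) -
        (prod (x s) (w s) - (LINT s:{a..s}|lebesgue. ?d s)))
      \<le> e * ((LINT s:{a..u}|lebesgue. ?n s) - (LINT s:{a..s}|lebesgue. ?n s))"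
    proof (intro exI[of _ "min d1 d2"] conjI allI impI)
      show "0 < min d1 d2" using d1 d2 by simp
      fix s u assume su: "a \<le> s \<and> s \<le> y \<and> y \<le> u \<and> u \<le> t \<and> u - s < min d1 d2"
      have sub: "set_integrable lebesgue {s..u} \<eta>" "set_integrable lebesgue {a..u} \<eta>"
        if "set_integrable lebesgue {a..b} \<eta>" for \<eta> :: "real \<Rightarrow> 'd::{banach,second_countable_topology}"
        using set_integrable_Icc_subset[OF that] su t by auto
      have near: "norm (x r - x r') \<le> 2 * e'" "norm (w r - w r') \<le> 2 * e'"
        if "r \<in> {s..u}" "r' \<in> {s..u}" for r r'
      proof -
        have *: "r \<in> {a..b}" "r' \<in> {a..b}" "dist r y < min d1 d2" "dist r' y < min d1 d2"
          using su t that by (auto simp: dist_real_def)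
        then have "dist (x r) (x y) < e'" "dist (x r') (x y) < e'"
          "dist (w r) (w y) < e'" "dist (w r') (w y) < e'" using d1 d2 by auto
        then show "norm (x r - x r') \<le> 2 * e'" "norm (w r - w r') \<le> 2 * e'"
          using dist_triangle2[of "x r" "x r'" "x y"] dist_triangle2[of "w r" "w r'" "w y"]
          by (auto simp: dist_norm)
      qed
      have j1: "set_integrable lebesgue {s..u} (\<lambda>r. prod (\<phi> r) (w u))"
        and j1': "(LINT r:{s..u}|lebesgue. prod (\<phi> r) (w u)) = prod (x u - x s) (w u)"
        using set_integral_bounded_linear[OF bounded_linear_left[of "w u"] sub(1)[OF i\<phi>]]
          ac_on_diff[OF x, of s u] su t by auto
      have j2: "set_integrable lebesgue {s..u} (\<lambda>r. prod (x s) (\<theta> r))"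
        and j2': "(LINT r:{s..u}|lebesgue. prod (x s) (\<theta> r)) = prod (x s) (w u - w s)"
        using set_integral_bounded_linear[OF bounded_linear_right[of "x s"] sub(1)[OF i\<theta>]]
          ac_on_diff[OF w, of s u] su t by auto
      have "prod (x u) (w u) - (LINT s:{a..u}|lebesgue. ?d s) - (prod (x s) (w s) - (LINT s:{a..s}|lebesgue. ?d s))
        = prod (x u - x s) (w u) + prod (x s) (w u - w s) - (LINT r:{s..u}|lebesgue. ?d r)"
        using set_integral_Icc_combine[OF sub(2)[OF id], of s] su
        by (simp add: diff_left diff_right)
      also have "\<dots> = (LINT r:{s..u}|lebesgue. (prod (\<phi> r) (w u) + prod (x s) (\<theta> r)) - ?d r)"
        using j1 j2 sub(1)[OF id] by (simp add: j1' j2' set_integral_add set_integral_diff)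
      also have "norm \<dots> \<le> (LINT r:{s..u}|lebesgue. norm ((prod (\<phi> r) (w u) + prod (x s) (\<theta> r)) - ?d r))"
        by (intro set_integral_norm_bound set_integral_diff set_integral_add j1 j2 sub(1)[OF i1] sub(1)[OF i2])
      also have "\<dots> \<le> (LINT r:{s..u}|lebesgue. e * ?n r)"
      proof (rule set_integral_mono)
        show "set_integrable lebesgue {s..u} (\<lambda>r. norm ((prod (\<phi> r) (w u) + prod (x s) (\<theta> r)) - ?d r))"
          by (intro set_integrable_norm set_integral_diff set_integral_add j1 j2 sub(1)[OF i1] sub(1)[OF i2])
        show "set_integrable lebesgue {s..u} (\<lambda>r. e * ?n r)" using sub(1)[OF inn] by simp
        fix r assume r: "r \<in> {s..u}"
        have "prod (\<phi> r) (w u) + prod (x s) (\<theta> r) - ?d r = prod (\<phi> r) (w u - w r) + prod (x s - x r) (\<theta> r)"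
          by (simp add: diff_left diff_right)
        also have "norm \<dots> \<le> norm (\<phi> r) * norm (w u - w r) * K + norm (x s - x r) * norm (\<theta> r) * K"
          by (intro norm_triangle_le add_mono K)
        also have "\<dots> \<le> norm (\<phi> r) * (2 * e') * K + (2 * e') * norm (\<theta> r) * K"
          using near r su K by (intro add_mono mult_right_mono mult_left_mono) auto
        also have "\<dots> = (2 * e' * K) * ?n r" by (simp add: algebra_simps)
        finally show "norm (prod (\<phi> r) (w u) + prod (x s) (\<theta> r) - ?d r) \<le> e * ?n r"
          using e' by simp
      qed
      also have "\<dots> = e * ((LINT s:{a..u}|lebesgue. ?n s) - (LINT s:{a..s}|lebesgue. ?n s))"
        using set_integral_Icc_combine[OF sub(2)[OF inn], of s] su by simp
      finally show "norm (prod (x u) (w u) - (LINT s:{a..u}|lebesgue. ?d s) -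
        (prod (x s) (w s) - (LINT s:{a..s}|lebesgue. ?d s)))
      \<le> e * ((LINT s:{a..u}|lebesgue. ?n s) - (LINT s:{a..s}|lebesgue. ?n s))" .
    qed
  qed
  show ?thesis
  proof (rule ac_onI[OF id])
    fix t assume "a \<le> t" "t \<le> b"
    from *[OF this] show "prod (x t) (w t) = prod (x a) (w a) + (LINT s:{a..t}|lebesgue. ?d s)"
      by (simp add: diff_eq_eq)
  qed
qed

text \<open>The fundamental theorem for the gauge integral asks for a derivative at every point but
  not for its continuity, which suits \<open>h'\<close>.\<close>

lemma ac_on_real_C1:
  fixes y :: "real \<Rightarrow> real"
  assumes "\<And>t. (y has_vector_derivative y' t) (at t)" "set_integrable lebesgue {a..b} y'"
  shows "ac_on a b y y'"
proof (rule ac_onI)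
  fix t assume t: "a \<le> t" "t \<le> b"
  have "(y' has_integral (y t - y a)) {a..t}"
    using assms(1) t by (intro fundamental_theorem_of_calculus) (auto intro: has_vector_derivative_at_within)
  moreover have "set_integrable lebesgue {a..t} y'"
    using t by (intro set_integrable_Icc_subset[OF assms(2)]) auto
  ultimately show "y t = y a + (LINT s:{a..t}|lebesgue. y' s)"
    by (simp add: set_lebesgue_integral_eq_integral(2) integral_unique)
qed (fact assms(2))

text \<open>The sign of \<open>c\<close> is arbitrary: \<open>c > 0\<close> gives continuous dependence, \<open>c < 0\<close> dissipation.\<close>

lemma gronwall_ac:
  fixes y \<psi> B :: "real \<Rightarrow> real"
  assumes y: "ac_on a b y \<psi>" and ab: "a \<le> b" and B: "set_integrable lebesgue {a..b} B"
    and le: "\<And>t. t \<in> {a..b} \<Longrightarrow> \<psi> t \<le> c * y t + B t"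
  shows "y b \<le> exp (c * (b - a)) * y a + (LINT s:{a..b}|lebesgue. exp (c * (b - s)) * B s)"
    and "set_integrable lebesgue {a..b} (\<lambda>s. exp (c * (b - s)) * B s)"
proof -
  let ?e = "\<lambda>t. exp (c * (b - t))" and ?e' = "\<lambda>t. - (c * exp (c * (b - t)))"
  have "ac_on a b ?e ?e'"
  proof (rule ac_on_real_C1)
    show "(?e has_vector_derivative ?e' t) (at t)" for t
      unfolding has_real_derivative_iff_has_vector_derivative[symmetric]
      by (auto intro!: derivative_eq_intros)
    show "set_integrable lebesgue {a..b} ?e'"
      by (intro absolutely_integrable_continuous_real continuous_intros)
  qed
  from ac_on_bilinear[OF bounded_bilinear_mult this y]
  have ac: "ac_on a b (\<lambda>t. ?e t * y t) (\<lambda>t. ?e' t * y t + ?e t * \<psi> t)" .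
  show i: "set_integrable lebesgue {a..b} (\<lambda>s. ?e s * B s)"
    by (intro set_integrable_bilinear_right[OF bounded_bilinear_mult B] continuous_intros)
  have "?e b * y b - ?e a * y a = (LINT t:{a..b}|lebesgue. ?e' t * y t + ?e t * \<psi> t)"
    using ab by (intro ac_on_diff[OF ac]) auto
  also have "\<dots> \<le> (LINT t:{a..b}|lebesgue. ?e t * B t)"
  proof (rule set_integral_mono[OF ac_on_integrable[OF ac] i])
    fix t assume "t \<in> {a..b}"
    then have "?e t * \<psi> t \<le> ?e t * (c * y t + B t)" using le by (intro mult_left_mono) auto
    then show "?e' t * y t + ?e t * \<psi> t \<le> ?e t * B t" by (simp add: algebra_simps)
  qed
  finally show "y b \<le> exp (c * (b - a)) * y a + (LINT s:{a..b}|lebesgue. exp (c * (b - s)) * B s)"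
    by simp
qed

lemma ac_on_norm_square:
  fixes x \<phi> :: "real \<Rightarrow> 'a::{real_inner,banach,second_countable_topology}"
  assumes "ac_on a b x \<phi>"
  shows "ac_on a b (\<lambda>t. (norm (x t))\<^sup>2) (\<lambda>t. 2 * inner (x t) (\<phi> t))"
  using ac_on_bilinear[OF bounded_bilinear_inner assms assms]
  by (simp add: power2_norm_eq_inner inner_commute)

lemma ac_on_minus:
  assumes "ac_on a b x \<phi>" "ac_on a b w \<theta>"
  shows "ac_on a b (\<lambda>t. x t - w t) (\<lambda>t. \<phi> t - \<theta> t)"
proof (rule ac_onI)
  show "set_integrable lebesgue {a..b} (\<lambda>t. \<phi> t - \<theta> t)"
    using assms by (intro set_integral_diff) (auto intro: ac_on_integrable)
  fix t assume t: "a \<le> t" "t \<le> b"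
  then have "set_integrable lebesgue {a..t} \<phi>" "set_integrable lebesgue {a..t} \<theta>"
    using assms by (auto intro!: set_integrable_Icc_subset[OF ac_on_integrable])
  moreover have "x t = x a + (LINT s:{a..t}|lebesgue. \<phi> s)" "w t = w a + (LINT s:{a..t}|lebesgue. \<theta> s)"
    using assms t by (auto intro: ac_on_eq)
  ultimately show "x t - w t = x a - w a + (LINT s:{a..t}|lebesgue. \<phi> s - \<theta> s)"
    by (simp only: set_integral_diff) simp
qed

section \<open>Caratheodory equations with one-sided Lipschitz right-hand side\<close>

lemma ac_on_cong:
  assumes "ac_on a b x \<phi>" "\<And>t. a \<le> t \<Longrightarrow> t \<le> b \<Longrightarrow> x t = y t" "\<And>t. a \<le> t \<Longrightarrow> t \<le> b \<Longrightarrow> \<phi> t = \<psi> t" "a \<le> b"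
  shows "ac_on a b y \<psi>"
proof (rule ac_onI)
  show "set_integrable lebesgue {a..b} \<psi>"
    using ac_on_integrable[OF assms(1)] assms(3)
    by (subst set_integrable_cong[where f' = \<phi> and A' = "{a..b}" and M' = lebesgue]) auto
  fix t assume t: "a \<le> t" "t \<le> b"
  have "(LINT s:{a..t}|lebesgue. \<psi> s) = (LINT s:{a..t}|lebesgue. \<phi> s)"
    using assms(3) t by (intro set_lebesgue_integral_cong) auto
  then show "y t = y a + (LINT s:{a..t}|lebesgue. \<psi> s)"
    using ac_on_eq[OF assms(1) t] assms(2)[OF t] assms(2)[of a] assms(4) by simp
qed

lemma ac_on_glue:
  assumes v: "ac_on a b v \<phi>" and w: "ac_on b c w \<psi>" and "a \<le> b" "b \<le> c" "v b = w b"
  shows "ac_on a c (\<lambda>t. if t \<le> b then v t else w t) (\<lambda>t. if t \<le> b then \<phi> t else \<psi> t)"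
    (is "ac_on a c ?u ?\<eta>")
proof -
  have u1: "ac_on a b ?u ?\<eta>"
    using assms by (intro ac_on_cong[OF v]) auto
  have ne: "AE s in lebesgue. s \<noteq> b"
    using AE_lborel_singleton[of b] by (rule AE_completion)
  have i\<psi>: "set_integrable lebesgue {b..c} \<psi>" by (rule ac_on_integrable[OF w])
  \<comment> \<open>At the junction the glued density has the value \<open>\<phi> b\<close> instead
    of \<open>\<psi> b\<close>; two singleton terms make this exchange without changing an
    integral.\<close>
  have "integrable lebesgue (\<lambda>s. indicator {b..c} s *\<^sub>R \<psi> s - indicator {b} s *\<^sub>R \<psi> b)"
    using i\<psi> unfolding set_integrable_def by (intro Bochner_Integration.integrable_diff) auto
  moreover have "integrable lebesgue (\<lambda>s. indicator {b} s *\<^sub>R \<phi> b)" by auto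
  ultimately have "integrable lebesgue (\<lambda>s. (indicator {b..c} s *\<^sub>R \<psi> s - indicator {b} s *\<^sub>R \<psi> b) + indicator {b} s *\<^sub>R \<phi> b)"
    by (rule Bochner_Integration.integrable_add)
  also have "(\<lambda>s. (indicator {b..c} s *\<^sub>R \<psi> s - indicator {b} s *\<^sub>R \<psi> b) + indicator {b} s *\<^sub>R \<phi> b) =
      (\<lambda>s. indicator {b..c} s *\<^sub>R ?\<eta> s)"
    using \<open>b \<le> c\<close> by (auto simp: fun_eq_iff indicator_def)
  finally have i\<eta>: "set_integrable lebesgue {b..c} ?\<eta>" unfolding set_integrable_def .
  have un: "{a..b} \<union> {b..c} = {a..c}" using assms by auto
  have "set_integrable lebesgue ({a..b} \<union> {b..c}) ?\<eta>"
    by (rule set_integrable_Un[OF ac_on_integrable[OF u1] i\<eta>]) auto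
  then have ia: "set_integrable lebesgue {a..c} ?\<eta>" unfolding un .
  show ?thesis
  proof (rule ac_onI[OF ia])
    fix t assume t: "a \<le> t" "t \<le> c"
    show "?u t = ?u a + (LINT s:{a..t}|lebesgue. ?\<eta> s)"
    proof (cases "t \<le> b")
      case True
      then show ?thesis using ac_on_eq[OF u1 t(1)] by simp
    next
      case False
      have sub: "set_integrable lebesgue {b..t} ?\<eta>" "set_integrable lebesgue {b..t} \<psi>"
        using t by (auto intro!: set_integrable_Icc_subset[OF i\<eta>] set_integrable_Icc_subset[OF i\<psi>])
      have "(LINT s:{b..t}|lebesgue. ?\<eta> s) = (LINT s:{b..t}|lebesgue. \<psi> s)"
        unfolding set_lebesgue_integral_def
      proof (rule integral_cong_AE)
        show "AE s in lebesgue. indicator {b..t} s *\<^sub>R ?\<eta> s = indicator {b..t} s *\<^sub>R \<psi> s"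
          using ne by eventually_elim (auto simp: indicator_def)
      qed (use sub in \<open>auto simp: set_integrable_def\<close>)
      moreover have "set_integrable lebesgue {a..t} ?\<eta>"
        using t by (intro set_integrable_Icc_subset[OF ia]) auto
      ultimately have eq: "(LINT s:{a..t}|lebesgue. ?\<eta> s) =
          (LINT s:{a..b}|lebesgue. ?\<eta> s) + (LINT s:{b..t}|lebesgue. \<psi> s)"
        using set_integral_Icc_combine[of a t ?\<eta> b] \<open>a \<le> b\<close> False by simp
      have "?u t = w t" using False by simp
      also have "w t = w b + (LINT s:{b..t}|lebesgue. \<psi> s)"
        using False t by (intro ac_on_eq[OF w]) auto
      also have "w b = ?u b" using assms(5) by simp
      also have "?u b = ?u a + (LINT s:{a..b}|lebesgue. ?\<eta> s)"
        using assms(3) by (intro ac_on_eq[OF u1]) auto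
      finally show ?thesis unfolding eq by (simp only: add.assoc)
    qed
  qed
qed

lemma set_integrable_singleton:
  fixes \<phi> :: "real \<Rightarrow> 'a::{banach,second_countable_topology}"
  shows "set_integrable lebesgue {a} \<phi>"
proof -
  have "integrable lebesgue (\<lambda>s. indicator {a} s *\<^sub>R \<phi> a)" by auto
  also have "(\<lambda>s. indicator {a} s *\<^sub>R \<phi> a) = (\<lambda>s. indicator {a} s *\<^sub>R \<phi> s)"
    by (auto simp: fun_eq_iff indicator_def)
  finally show ?thesis unfolding set_integrable_def .
qed

lemma ac_on_refl: "ac_on a a x \<phi>"
  by (rule ac_onI) (auto simp: set_integrable_singleton)

text \<open>The two curves may solve different equations. What the one-sided bound leaves over is
  collected in \<open>B\<close>: delay errors in the existence proof, the difference of two noise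
  paths in \<open>sol_compare\<close>.\<close>

lemma ode_compare:
  fixes v w :: "real \<Rightarrow> 'a::{real_inner,banach,second_countable_topology}"
  assumes v: "ac_on a b v \<phi>" and w: "ac_on a b w \<psi>" and "a \<le> b"
    and B: "set_integrable lebesgue {a..b} B" "\<And>s. s \<in> {a..b} \<Longrightarrow> 0 \<le> B s"
    and L: "0 \<le> L" "\<And>s. s \<in> {a..b} \<Longrightarrow> 2 * inner (v s - w s) (\<phi> s - \<psi> s) \<le> L * (norm (v s - w s))\<^sup>2 + B s"
  shows "(norm (v b - w b))\<^sup>2 \<le> exp (L * (b - a)) * ((norm (v a - w a))\<^sup>2 + (LINT s:{a..b}|lebesgue. B s))"
proof -
  note ac = ac_on_norm_square[OF ac_on_minus[OF v w]]
  have "(norm (v b - w b))\<^sup>2 \<le> exp (L * (b - a)) * (norm (v a - w a))\<^sup>2 + (LINT s:{a..b}|lebesgue. exp (L * (b - s)) * B s)"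
    using L by (intro gronwall_ac(1)[OF ac \<open>a \<le> b\<close> B(1)]) auto
  also have "(LINT s:{a..b}|lebesgue. exp (L * (b - s)) * B s) \<le> (LINT s:{a..b}|lebesgue. exp (L * (b - a)) * B s)"
  proof (rule set_integral_mono)
    show "set_integrable lebesgue {a..b} (\<lambda>s. exp (L * (b - s)) * B s)"
      using L by (intro gronwall_ac(2)[OF ac \<open>a \<le> b\<close> B(1)]) auto
    show "set_integrable lebesgue {a..b} (\<lambda>s. exp (L * (b - a)) * B s)" using B by simp
    fix s assume "s \<in> {a..b}"
    then show "exp (L * (b - s)) * B s \<le> exp (L * (b - a)) * B s"
      using L(1) B(2) by (intro mult_right_mono) (auto intro: mult_left_mono)
  qed
  finally show ?thesis by (simp add: algebra_simps)
qed

text \<open>Tonelli's delayed equation \<open>v'(t) = F(t, v(t - d))\<close> is solved by iteration, without a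
  fixed point argument; the one-sided Lipschitz bound makes its solutions Cauchy as \<open>d\<close> tends to 0.\<close>

lemma tonelli_delayed:
  fixes F :: "real \<Rightarrow> 'a::{real_inner,banach,second_countable_topology} \<Rightarrow> 'a"
  assumes ab: "a < b"
    and meas: "\<And>w. continuous_on {a..b} w \<Longrightarrow> set_borel_measurable lebesgue {a..b} (\<lambda>s. F s (w s))"
    and M: "set_integrable lebesgue {a..b} M" "(LINT s:{a..b}|lebesgue. M s) \<le> 1"
    and bd: "\<And>s u. s \<in> {a..b} \<Longrightarrow> norm (u - x) \<le> 1 \<Longrightarrow> norm (F s u) \<le> M s"
    and d: "d = (b - a) / real (Suc m)"
  obtains v :: "real \<Rightarrow> 'a" where "continuous_on UNIV v" "\<And>t. norm (v t - x) \<le> 1" "v a = x"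
    "ac_on a b v (\<lambda>s. F s (v (s - d)))"
    "\<And>s t. s \<le> t \<Longrightarrow> t \<le> b \<Longrightarrow> norm (v t - v s) \<le>
      (LINT r:{a..max a t}|lebesgue. M r) - (LINT r:{a..max a s}|lebesgue. M r)"
proof -
  have d0: "d > 0" using ab d by simp
  \<comment> \<open>Clamping the time makes every iterate a function on the whole line with the
    value \<open>x\<close> before \<open>a\<close>, so the delayed argument \<open>s - d\<close>
    always has a meaning.\<close>
  define cl where "cl t = max a (min t b)" for t
  have cl: "a \<le> cl t" "cl t \<le> b" for t using ab by (auto simp: cl_def)
  have cl_mono: "s \<le> t \<Longrightarrow> cl s \<le> cl t" for s t by (auto simp: cl_def)
  have cl_cont: "continuous_on UNIV cl" unfolding cl_def by (intro continuous_intros)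
  define T where "T v t = x + (LINT s:{a..cl t}|lebesgue. F s (v (s - d)))" for v t
  define ok where "ok v \<longleftrightarrow> continuous_on UNIV v \<and> (\<forall>t. norm (v t - x) \<le> 1)" for v :: "real \<Rightarrow> 'a"
  have int: "set_integrable lebesgue {a..b} (\<lambda>s. F s (v (s - d)))" if "ok v" for v
  proof (rule set_integrable_bound[OF M(1)])
    have "continuous_on {a..b} (\<lambda>s. v (s - d))"
      using that by (auto simp: ok_def intro!: continuous_intros continuous_on_compose2[of UNIV v])
    then show "set_borel_measurable lebesgue {a..b} (\<lambda>s. F s (v (s - d)))" by (rule meas)
    show "AE s in lebesgue. s \<in> {a..b} \<longrightarrow> norm (F s (v (s - d))) \<le> norm (M s)"
      using that by (auto intro!: AE_I2 order_trans[OF bd abs_ge_self] simp: ok_def)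
  qed
  have ac: "ac_on a b (\<lambda>t. x + (LINT s:{a..t}|lebesgue. F s (v (s - d)))) (\<lambda>s. F s (v (s - d)))"
    if "ok v" for v
    by (rule ac_onI[OF int[OF that]]) simp
  have inc: "norm (T v t - T v s) \<le> (LINT r:{a..cl t}|lebesgue. M r) - (LINT r:{a..cl s}|lebesgue. M r)"
    if "ok v" "s \<le> t" for v s t
    unfolding T_def
    by (rule ac_on_norm_diff_le[OF ac[OF that(1)] cl(1) cl_mono[OF that(2)] cl(2) M(1)])
      (use that bd in \<open>auto simp: ok_def\<close>)
  have Ta: "T v t = x" if "t \<le> a" for v t using that ab by (simp add: T_def cl_def)
  have ok_T: "ok (T v)" if "ok v" for v
    unfolding ok_def
  proof
    have "continuous_on UNIV ((\<lambda>t. x + (LINT s:{a..t}|lebesgue. F s (v (s - d)))) \<circ> cl)"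
      by (rule continuous_on_compose[OF cl_cont], rule continuous_on_subset[OF ac_on_continuous[OF ac[OF that]]])
        (use cl in auto)
    then show "continuous_on UNIV (T v)" by (simp add: T_def[abs_def] o_def)
    show "\<forall>t. norm (T v t - x) \<le> 1"
    proof
      fix t
      have "norm (T v t - x) \<le> 1" if "t \<ge> a"
      proof -
        have "norm (T v t - T v a) \<le> (LINT r:{a..cl t}|lebesgue. M r) - (LINT r:{a..cl a}|lebesgue. M r)"
          using inc \<open>ok v\<close> that by blast
        also have "\<dots> = (LINT r:{a..cl t}|lebesgue. M r)" using ab by (simp add: cl_def)
        also have "\<dots> \<le> (LINT r:{a..cl t}|lebesgue. M r) + (LINT r:{cl t..b}|lebesgue. M r)"
        proof -
          have "0 \<le> M r" if "r \<in> {a..b}" for r using bd[OF that, of x] by (auto intro: order_trans[OF norm_ge_zero])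
          then have "0 \<le> (LINT r:{cl t..b}|lebesgue. M r)"
            unfolding set_lebesgue_integral_def using cl
            by (intro integral_nonneg_AE AE_I2) (auto simp: indicator_def intro: order_trans)
          then show ?thesis by simp
        qed
        also have "\<dots> \<le> 1" using set_integral_Icc_combine[OF M(1) cl(1) cl(2)] M(2) by simp
        finally show ?thesis using Ta[of a v] by simp
      qed
      then show "norm (T v t - x) \<le> 1" using Ta[of t v] by (cases "t \<le> a") auto
    qed
  qed
  define V where "V k = (T ^^ k) (\<lambda>_. x)" for k
  have V_Suc: "V (Suc k) = T (V k)" for k by (simp add: V_def)
  have ok_V: "ok (V k)" for k
    by (induction k) (auto simp: V_Suc ok_T V_def ok_def[of "\<lambda>_. x"])
  \<comment> \<open>Each application of \<open>T\<close> settles the curve on one more interval of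
    length \<open>d\<close>, since \<open>T v\<close> at \<open>t\<close> reads \<open>v\<close>
    only up to \<open>t - d\<close>. As \<open>d\<close> is \<open>b - a\<close> divided by
    \<open>Suc m\<close>, the iterate \<open>V (Suc m)\<close> is a fixed point up to
    \<open>b\<close>.\<close>
  have stable: "V (Suc k) t = V k t" if "t \<le> a + real k * d" for k t
    using that
  proof (induction k arbitrary: t)
    case 0
    then show ?case using Ta[of t] by (simp add: V_def)
  next
    case (Suc k)
    have "(LINT s:{a..cl t}|lebesgue. F s (V (Suc k) (s - d))) = (LINT s:{a..cl t}|lebesgue. F s (V k (s - d)))"
    proof (rule set_lebesgue_integral_cong)
      show "\<forall>s. s \<in> {a..cl t} \<longrightarrow> F s (V (Suc k) (s - d)) = F s (V k (s - d))"
      proof (intro allI impI)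
        fix s assume "s \<in> {a..cl t}"
        then have "s \<le> a \<or> s \<le> t" by (auto simp: cl_def)
        moreover have "0 \<le> real (Suc k) * d" using d0 by simp
        ultimately have "s \<le> a + real (Suc k) * d" using Suc.prems by linarith
        then have "s - d \<le> a + real k * d" by (simp add: algebra_simps)
        then show "F s (V (Suc k) (s - d)) = F s (V k (s - d))" using Suc.IH by simp
      qed
    qed simp
    then show ?case unfolding V_Suc[of "Suc k"] V_Suc[of k] T_def by simp
  qed
  define v where "v = V (Suc m)"
  have fixp: "v t = T v t" if "t \<le> b" for t
  proof -
    have "t \<le> a + real (Suc m) * d" using that by (simp add: d)
    from stable[OF this] show ?thesis by (simp add: v_def V_Suc[of "Suc m"])
  qed
  have okv: "ok v" by (simp add: v_def ok_V)
  show ?thesis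
  proof (rule that)
    show "continuous_on UNIV v" "\<And>t. norm (v t - x) \<le> 1" using okv by (auto simp: ok_def)
    show "v a = x" using fixp[of a] Ta ab by simp
    show "ac_on a b v (\<lambda>s. F s (v (s - d)))"
    proof (rule ac_on_cong[OF ac[OF okv]])
      show "x + (LINT s:{a..t}|lebesgue. F s (v (s - d))) = v t" if "a \<le> t" "t \<le> b" for t
        using fixp[OF that(2)] that by (simp add: T_def cl_def)
    qed (use ab in auto)
    show "norm (v t - v s) \<le> (LINT r:{a..max a t}|lebesgue. M r) - (LINT r:{a..max a s}|lebesgue. M r)"
      if "s \<le> t" "t \<le> b" for s t
      using inc[OF okv that(1)] fixp[of s] fixp[of t] that by (simp add: cl_def)
  qed
qed

text \<open>Equicontinuous bounded curves in an infinite-dimensional space need not be precompact,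
  so the delayed solutions are compared with each other. Their difference and the difference of
  their delayed values are within \<open>2 * e\<close>; the one-sided bound applies to the latter,
  and the error is paired with a vector of norm at most \<open>2 * M s\<close>.\<close>

lemma ode_local_existence:
  fixes F :: "real \<Rightarrow> 'a::{real_inner,banach,second_countable_topology} \<Rightarrow> 'a"
  assumes ab: "a < b"
    and meas: "\<And>w. continuous_on {a..b} w \<Longrightarrow> set_borel_measurable lebesgue {a..b} (\<lambda>s. F s (w s))"
    and M: "set_integrable lebesgue {a..b} M" "(LINT s:{a..b}|lebesgue. M s) \<le> 1"
    and bd: "\<And>s u. s \<in> {a..b} \<Longrightarrow> norm (u - x) \<le> 1 \<Longrightarrow> norm (F s u) \<le> M s"
    and L: "0 \<le> L" "\<And>s u w. s \<in> {a..b} \<Longrightarrow> norm (u - x) \<le> 1 \<Longrightarrow> norm (w - x) \<le> 1 \<Longrightarrow>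
      inner (u - w) (F s u - F s w) \<le> L * (norm (u - w))\<^sup>2"
    and cont: "\<And>s. s \<in> {a..b} \<Longrightarrow> continuous_on (cball x 1) (F s)"
  obtains v where "v a = x" "ac_on a b v (\<lambda>s. F s (v s))"
proof -
  define d where "d m = (b - a) / real (Suc m)" for m
  define \<mu> where "\<mu> t = (LINT r:{a..max a t}|lebesgue. M r)" for t
  have "\<forall>m. \<exists>v. continuous_on UNIV v \<and> (\<forall>t. norm (v t - x) \<le> 1) \<and> v a = x \<and>
    ac_on a b v (\<lambda>s. F s (v (s - d m))) \<and> (\<forall>s t. s \<le> t \<longrightarrow> t \<le> b \<longrightarrow> norm (v t - v s) \<le> \<mu> t - \<mu> s)"
  proof
    fix m
    show "\<exists>v. continuous_on UNIV v \<and> (\<forall>t. norm (v t - x) \<le> 1) \<and> v a = x \<and>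
      ac_on a b v (\<lambda>s. F s (v (s - d m))) \<and> (\<forall>s t. s \<le> t \<longrightarrow> t \<le> b \<longrightarrow> norm (v t - v s) \<le> \<mu> t - \<mu> s)"
      unfolding \<mu>_def by (rule tonelli_delayed[OF ab meas M bd d_def[of m]]) auto
  qed
  then obtain V where V: "\<And>m. continuous_on UNIV (V m)" "\<And>m t. norm (V m t - x) \<le> 1" "\<And>m. V m a = x"
    "\<And>m. ac_on a b (V m) (\<lambda>s. F s (V m (s - d m)))"
    "\<And>m s t. s \<le> t \<Longrightarrow> t \<le> b \<Longrightarrow> norm (V m t - V m s) \<le> \<mu> t - \<mu> s" by metis
  have d0: "d m > 0" for m using ab by (simp add: d_def)
  have d_lim: "d \<longlonglongrightarrow> 0" unfolding d_def
    using LIMSEQ_Suc[OF lim_const_over_n[of "b - a"]] by simp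
  have delay: "\<exists>N. \<forall>m\<ge>N. \<forall>s\<in>{a..b}. norm (V m s - V m (s - d m)) \<le> e" if e: "0 < e" for e
  proof -
    \<comment> \<open>No delay exceeds \<open>b - a\<close>, so all delayed times lie in this
      interval.\<close>
    have "continuous_on {a - (b - a)..b} \<mu>"
    proof -
      have "continuous_on {a - (b - a)..b} ((\<lambda>t. LINT r:{a..t}|lebesgue. M r) \<circ> max a)"
        by (rule continuous_on_compose, intro continuous_intros,
            rule continuous_on_subset[OF continuous_on_set_integral_Icc[OF M(1)]]) (use ab in auto)
      then show ?thesis by (simp add: o_def \<mu>_def[abs_def])
    qed
    then have "uniformly_continuous_on {a - (b - a)..b} \<mu>"
      by (rule compact_uniformly_continuous) auto
    then obtain \<delta> where \<delta>: "\<delta> > 0"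
      "\<And>s t. s \<in> {a - (b - a)..b} \<Longrightarrow> t \<in> {a - (b - a)..b} \<Longrightarrow> dist t s < \<delta> \<Longrightarrow> dist (\<mu> t) (\<mu> s) < e"
      unfolding uniformly_continuous_on_def using e by metis
    obtain N where N: "\<forall>m\<ge>N. dist (d m) 0 < \<delta>"
      using metric_LIMSEQ_D[OF d_lim \<delta>(1)] by blast
    show ?thesis
    proof (intro exI[of _ N] allI impI ballI)
      fix m s assume m: "N \<le> m" and s: "s \<in> {a..b}"
      have "d m \<le> b - a" using ab frac_le[of "b - a" "b - a" 1 "real (Suc m)"] by (simp add: d_def)
      then have "dist (\<mu> s) (\<mu> (s - d m)) < e"
        using N m s d0[of m] by (intro \<delta>(2)) (auto simp: dist_real_def)
      moreover have "norm (V m s - V m (s - d m)) \<le> \<mu> s - \<mu> (s - d m)"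
        using V(5) s d0[of m] by simp
      ultimately show "norm (V m s - V m (s - d m)) \<le> e" by (simp add: dist_real_def)
    qed
  qed
  have M0: "0 \<le> M s" if "s \<in> {a..b}" for s
    using bd[OF that, of x] by (auto intro: order_trans[OF norm_ge_zero])
  \<comment> \<open>The one-sided bound contributes
    \<open>2 * L * (2 * (norm w)\<^sup>2 + 8 * e\<^sup>2)\<close> and the delay error
    \<open>2 * (2 * e) * (2 * M s)\<close>. This gives the rate \<open>4 * L\<close> and the
    remainder \<open>16 * L * e\<^sup>2 + 8 * e * M s\<close>, integrated with
    \<open>e \<le> 1\<close> and the integral of \<open>M\<close> at most 1.\<close>
  define C where "C = exp (4 * L * (b - a)) * (16 * L * (b - a) + 8)"
  have C: "C > 0" using ab L by (simp add: C_def add_nonneg_pos)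
  have close: "\<exists>N. \<forall>m\<ge>N. \<forall>n\<ge>N. \<forall>t\<in>{a..b}. (norm (V m t - V n t))\<^sup>2 \<le> C * e" if e: "0 < e" "e \<le> 1" for e
  proof -
    obtain N where N: "\<forall>m\<ge>N. \<forall>s\<in>{a..b}. norm (V m s - V m (s - d m)) \<le> e" using delay e by blast
    show ?thesis
    proof (intro exI[of _ N] allI impI ballI)
      fix m n t assume mn: "N \<le> m" "N \<le> n" and t: "t \<in> {a..b}"
      let ?B = "\<lambda>s. 16 * L * e\<^sup>2 + 8 * e * M s"
      have iM: "set_integrable lebesgue {a..t} M" using t by (intro set_integrable_Icc_subset[OF M(1)]) auto
      have ic: "set_integrable lebesgue {a..t} (\<lambda>s. 16 * L * e\<^sup>2)"
        by (intro absolutely_integrable_continuous_real continuous_intros)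
      have "(norm (V m t - V n t))\<^sup>2 \<le> exp (4 * L * (t - a)) * ((norm (V m a - V n a))\<^sup>2 + (LINT s:{a..t}|lebesgue. ?B s))"
      proof (rule ode_compare)
        show "ac_on a t (V m) (\<lambda>s. F s (V m (s - d m)))" "ac_on a t (V n) (\<lambda>s. F s (V n (s - d n)))"
          using t by (auto intro: ac_on_subinterval[OF V(4)])
        show "a \<le> t" using t by simp
        show "set_integrable lebesgue {a..t} ?B" using iM ic by (intro set_integral_add) auto
        show "0 \<le> ?B s" if "s \<in> {a..t}" for s using M0[of s] L e that t by simp
        show "0 \<le> 4 * L" using L by simp
        fix s assume "s \<in> {a..t}"
        then have s: "s \<in> {a..b}" using t by auto
        let ?p = "V m (s - d m)" and ?r = "V n (s - d n)" and ?w = "V m s - V n s"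
        have e1: "norm (V m s - ?p) \<le> e" "norm (V n s - ?r) \<le> e" using N mn s by auto
        have "norm (?w - (?p - ?r)) \<le> norm (V m s - ?p) + norm (V n s - ?r)"
          using norm_triangle_ineq4[of "V m s - ?p" "V n s - ?r"] by (simp add: algebra_simps)
        then have e2: "norm (?w - (?p - ?r)) \<le> 2 * e" using e1 by simp
        have "norm (?p - ?r) \<le> norm ?w + norm (?w - (?p - ?r))"
          using norm_triangle_ineq4[of ?w "?w - (?p - ?r)"] by simp
        then have pr: "norm (?p - ?r) \<le> norm ?w + 2 * e" using e2 by simp
        have "(norm (?p - ?r))\<^sup>2 \<le> (norm ?w + 2 * e)\<^sup>2" using pr by (intro power_mono) auto
        also have "\<dots> \<le> 2 * (norm ?w)\<^sup>2 + 8 * e\<^sup>2"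
          using sum_squares_bound[of "norm ?w" "2 * e"] by (simp add: power2_sum power_mult_distrib)
        finally have pr2: "(norm (?p - ?r))\<^sup>2 \<le> 2 * (norm ?w)\<^sup>2 + 8 * e\<^sup>2" .
        have "norm (F s ?p - F s ?r) \<le> 2 * M s"
          using norm_triangle_ineq4[of "F s ?p" "F s ?r"] bd[OF s V(2)[of m "s - d m"]] bd[OF s V(2)[of n "s - d n"]] by simp
        then have "inner (?w - (?p - ?r)) (F s ?p - F s ?r) \<le> (2 * e) * (2 * M s)"
          using e2 M0[OF s] e
          by (intro order_trans[OF norm_cauchy_schwarz] mult_mono) auto
        moreover have "inner (?p - ?r) (F s ?p - F s ?r) \<le> L * (2 * (norm ?w)\<^sup>2 + 8 * e\<^sup>2)"
          using L(2)[OF s V(2) V(2)] mult_left_mono[OF pr2 L(1)] by (rule order_trans)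
        moreover have "inner ?w (F s ?p - F s ?r) = inner (?p - ?r) (F s ?p - F s ?r) + inner (?w - (?p - ?r)) (F s ?p - F s ?r)"
          by (simp add: inner_diff_left)
        ultimately show "2 * inner ?w (F s ?p - F s ?r) \<le> 4 * L * (norm ?w)\<^sup>2 + ?B s"
          by (simp add: algebra_simps)
      qed
      also have "\<dots> = exp (4 * L * (t - a)) * (16 * L * e\<^sup>2 * (t - a) + 8 * e * (LINT s:{a..t}|lebesgue. M s))"
      proof -
        have "(LINT s:{a..t}|lebesgue. ?B s) = (LINT s:{a..t}|lebesgue. 16 * L * e\<^sup>2) + (LINT s:{a..t}|lebesgue. 8 * e * M s)"
          using iM ic by (intro set_integral_add) auto
        also have "(LINT s:{a..t}|lebesgue. 16 * L * e\<^sup>2) = 16 * L * e\<^sup>2 * (t - a)"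
          using t set_lebesgue_integral_eq_integral(2)[OF ic] by (simp add: mult_ac)
        finally show ?thesis by (simp add: V(3))
      qed
      also have "\<dots> \<le> exp (4 * L * (b - a)) * (16 * L * e * (b - a) + 8 * e * 1)"
      proof (intro mult_mono add_mono)
        show "exp (4 * L * (t - a)) \<le> exp (4 * L * (b - a))" using t L by (auto intro: mult_left_mono)
        show "e\<^sup>2 \<le> e" using e by (simp add: power2_eq_square mult_left_le)
        have "0 \<le> (LINT r:{t..b}|lebesgue. M r)"
          unfolding set_lebesgue_integral_def using t M0
          by (intro integral_nonneg_AE AE_I2) (auto simp: indicator_def)
        then show "(LINT s:{a..t}|lebesgue. M s) \<le> 1"
          using set_integral_Icc_combine[OF M(1), of t] t M(2) by simp
        have "0 \<le> (LINT r:{a..t}|lebesgue. M r)"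
          unfolding set_lebesgue_integral_def using t M0
          by (intro integral_nonneg_AE AE_I2) (auto simp: indicator_def)
        then show "0 \<le> 16 * L * e\<^sup>2 * (t - a) + 8 * e * (LINT s:{a..t}|lebesgue. M s)" "0 \<le> (LINT s:{a..t}|lebesgue. M s)"
          using t L e by auto
      qed (use t L e in auto)
      also have "\<dots> = C * e" by (simp add: C_def algebra_simps)
      finally show "(norm (V m t - V n t))\<^sup>2 \<le> C * e" .
    qed
  qed
  have "uniformly_Cauchy_on {a..b} V"
    unfolding uniformly_Cauchy_on_def
  proof (intro allI impI)
    fix \<epsilon> :: real assume \<epsilon>: "0 < \<epsilon>"
    define e where "e = min 1 (\<epsilon>\<^sup>2 / (2 * C))"
    have e: "0 < e" "e \<le> 1" using \<epsilon> C by (auto simp: e_def)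
    have Ce: "C * e < \<epsilon>\<^sup>2"
    proof -
      have "C * e \<le> C * (\<epsilon>\<^sup>2 / (2 * C))" using C by (intro mult_left_mono) (auto simp: e_def)
      also have "\<dots> < \<epsilon>\<^sup>2" using C \<epsilon> by simp
      finally show ?thesis .
    qed
    obtain N where "\<forall>m\<ge>N. \<forall>n\<ge>N. \<forall>t\<in>{a..b}. (norm (V m t - V n t))\<^sup>2 \<le> C * e" using close[OF e] by blast
    then have "\<forall>m\<ge>N. \<forall>n\<ge>N. \<forall>t\<in>{a..b}. (norm (V m t - V n t))\<^sup>2 < \<epsilon>\<^sup>2" using Ce by (meson le_less_trans)
    then show "\<exists>N. \<forall>t\<in>{a..b}. \<forall>m\<ge>N. \<forall>n\<ge>N. dist (V m t) (V n t) < \<epsilon>"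
      using \<epsilon> by (intro exI[of _ N]) (auto simp: dist_norm intro: power2_less_imp_less)
  qed
  then have "uniformly_convergent_on {a..b} V" by (rule Cauchy_uniformly_convergent)
  then obtain v where ul: "uniform_limit {a..b} V v sequentially"
    by (auto simp: uniformly_convergent_on_def)
  have lim: "(\<lambda>m. V m t) \<longlonglongrightarrow> v t" if "t \<in> {a..b}" for t
    using tendsto_uniform_limitI[OF ul that] .
  have cv: "continuous_on {a..b} v"
    by (rule uniform_limit_theorem[OF _ ul]) (auto intro: always_eventually continuous_on_subset[OF V(1)])
  have nv: "norm (v t - x) \<le> 1" if "t \<in> {a..b}" for t
    by (rule LIMSEQ_le_const2[OF tendsto_norm[OF tendsto_diff[OF lim[OF that] tendsto_const]]]) (use V(2) in auto)
  have limd: "(\<lambda>m. V m (s - d m)) \<longlonglongrightarrow> v s" if s: "s \<in> {a..b}" for s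
  proof -
    have "(\<lambda>m. V m s - V m (s - d m)) \<longlonglongrightarrow> 0"
    proof (rule metric_LIMSEQ_I)
      fix r :: real assume "0 < r"
      then obtain N where "\<forall>m\<ge>N. \<forall>s\<in>{a..b}. norm (V m s - V m (s - d m)) \<le> r / 2" using delay[of "r / 2"] by auto
      then show "\<exists>N. \<forall>m\<ge>N. dist (V m s - V m (s - d m)) 0 < r" using s \<open>0 < r\<close> by (intro exI[of _ N]) force
    qed
    from tendsto_diff[OF lim[OF s] this] show ?thesis by simp
  qed
  have limF: "(\<lambda>m. F s (V m (s - d m))) \<longlonglongrightarrow> F s (v s)" if s: "s \<in> {a..b}" for s
    using cont[OF s] limd[OF s] nv[OF s] V(2)
    by (intro continuous_on_tendsto_compose[of "cball x 1" "F s"]) (auto simp: dist_norm norm_minus_commute)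
  have ms: "set_borel_measurable lebesgue {a..b} (\<lambda>s. F s (v s))" by (rule meas[OF cv])
  have iF: "set_integrable lebesgue {a..b} (\<lambda>s. F s (v s))"
    using nv by (auto intro!: set_integrable_bound[OF M(1) ms] AE_I2 order_trans[OF bd abs_ge_self])
  show ?thesis
  proof (rule that)
    show "v a = x" using LIMSEQ_unique[OF lim[of a]] V(3) ab by simp
    show "ac_on a b v (\<lambda>s. F s (v s))"
    proof (rule ac_onI[OF iF])
      fix t assume t: "a \<le> t" "t \<le> b"
      have "(\<lambda>m. LINT s:{a..t}|lebesgue. F s (V m (s - d m))) \<longlonglongrightarrow> (LINT s:{a..t}|lebesgue. F s (v s))"
        unfolding set_lebesgue_integral_def
      proof (rule integral_dominated_convergence[where w = "\<lambda>s. indicator {a..t} s *\<^sub>R M s"])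
        show "(\<lambda>s. indicator {a..t} s *\<^sub>R F s (v s)) \<in> borel_measurable lebesgue"
          using set_integrable_Icc_subset[OF iF, of a t] t by (auto simp: set_integrable_def)
        show "(\<lambda>s. indicator {a..t} s *\<^sub>R F s (V m (s - d m))) \<in> borel_measurable lebesgue" for m
          using set_integrable_Icc_subset[OF ac_on_integrable[OF V(4)], of a t m] t by (auto simp: set_integrable_def)
        show "integrable lebesgue (\<lambda>s. indicator {a..t} s *\<^sub>R M s)"
          using set_integrable_Icc_subset[OF M(1), of a t] t by (auto simp: set_integrable_def)
        show "AE s in lebesgue. (\<lambda>m. indicator {a..t} s *\<^sub>R F s (V m (s - d m))) \<longlonglongrightarrow> indicator {a..t} s *\<^sub>R F s (v s)"
          using limF t by (intro AE_I2) (auto simp: indicator_def)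
        show "AE s in lebesgue. norm (indicator {a..t} s *\<^sub>R F s (V m (s - d m))) \<le> indicator {a..t} s *\<^sub>R M s" for m
          using bd V(2) t by (intro AE_I2) (auto simp: indicator_def)
      qed
      then have "(\<lambda>m. V m a + (LINT s:{a..t}|lebesgue. F s (V m (s - d m)))) \<longlonglongrightarrow> x + (LINT s:{a..t}|lebesgue. F s (v s))"
        using V(3) by (simp add: tendsto_add)
      then have "(\<lambda>m. V m t) \<longlonglongrightarrow> x + (LINT s:{a..t}|lebesgue. F s (v s))"
        using ac_on_eq[OF V(4) t] by simp
      from LIMSEQ_unique[OF lim this] \<open>v a = x\<close> t show "v t = v a + (LINT s:{a..t}|lebesgue. F s (v s))" by simp
    qed
  qed
qed

text \<open>Extendability of a solution from one time to a later one is transitive, so bisection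
  reduces it to short intervals. Their length depends only on the continuity of the integral of
  \<open>M\<close>: the a priori bound keeps every solution within \<open>R\<close>, and the unit
  ball around its current value within \<open>R + 1\<close>, where \<open>M\<close> and
  \<open>L\<close> are valid.\<close>

lemma ode_existence_from_bound:
  fixes F :: "real \<Rightarrow> 'a::{real_inner,banach,second_countable_topology} \<Rightarrow> 'a"
  assumes ab: "a \<le> b"
    and meas: "\<And>c d w. a \<le> c \<Longrightarrow> d \<le> b \<Longrightarrow> continuous_on {c..d} w \<Longrightarrow>
      set_borel_measurable lebesgue {c..d} (\<lambda>s. F s (w s))"
    and apriori: "\<And>t v. a \<le> t \<Longrightarrow> t \<le> b \<Longrightarrow> v a = x \<Longrightarrow> ac_on a t v (\<lambda>s. F s (v s)) \<Longrightarrow> norm (v t) \<le> R"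
    and M: "set_integrable lebesgue {a..b} M"
    and bd: "\<And>s u. s \<in> {a..b} \<Longrightarrow> norm u \<le> R + 1 \<Longrightarrow> norm (F s u) \<le> M s"
    and L: "0 \<le> L" "\<And>s u w. s \<in> {a..b} \<Longrightarrow> norm u \<le> R + 1 \<Longrightarrow> norm w \<le> R + 1 \<Longrightarrow>
      inner (u - w) (F s u - F s w) \<le> L * (norm (u - w))\<^sup>2"
    and cont: "\<And>s. s \<in> {a..b} \<Longrightarrow> continuous_on (cball 0 (R + 1)) (F s)"
  shows "\<exists>v. v a = x \<and> ac_on a b v (\<lambda>s. F s (v s))"
proof -
  let ?S = "\<lambda>t v. v a = x \<and> ac_on a t v (\<lambda>s. F s (v s))"
  let ?P = "\<lambda>s t. a \<le> s \<and> t \<le> b \<longrightarrow> (\<exists>v. ?S s v) \<longrightarrow> (\<exists>v. ?S t v)"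
  let ?\<mu> = "\<lambda>t. LINT r:{a..t}|lebesgue. M r"
  have "?P a b"
    using ab
  proof (induction rule: Bolzano[where P = ?P])
    case (trans s t u)
    then show ?case by fastforce
  next
    case (local y)
    have "continuous_on {a..b} ?\<mu>" by (rule continuous_on_set_integral_Icc[OF M])
    then obtain \<delta> where \<delta>: "\<delta> > 0" "\<And>t. t \<in> {a..b} \<Longrightarrow> dist t y < \<delta> \<Longrightarrow> dist (?\<mu> t) (?\<mu> y) < 1/2"
      unfolding continuous_on_iff using local by (metis atLeastAtMost_iff half_gt_zero_iff zero_less_one)
    show ?case
    proof (intro exI[of _ \<delta>] conjI allI impI)
      show "\<delta> > 0" by fact
      fix s t assume st: "s \<le> y \<and> y \<le> t \<and> t - s < \<delta>" "a \<le> s \<and> t \<le> b" and "\<exists>v. ?S s v"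
      then obtain v where v: "v a = x" "ac_on a s v (\<lambda>s. F s (v s))" by blast
      show "\<exists>v. ?S t v"
      proof (cases "s = t")
        case True then show ?thesis using v by blast
      next
        case False
        have "dist (?\<mu> s) (?\<mu> y) < 1/2" "dist (?\<mu> t) (?\<mu> y) < 1/2"
          using st \<delta>(2)[of s] \<delta>(2)[of t] by (auto simp: dist_real_def)
        then have "?\<mu> t - ?\<mu> s \<le> 1" unfolding dist_real_def by linarith
        moreover have "set_integrable lebesgue {a..t} M" using st by (intro set_integrable_Icc_subset[OF M]) auto
        ultimately have M1: "(LINT r:{s..t}|lebesgue. M r) \<le> 1"
          using set_integral_Icc_combine[of a t M s] st by simp
        have nv: "norm (v s) \<le> R" using apriori[of s v] v st by auto
        have near: "norm u \<le> R + 1" if "norm (u - v s) \<le> 1" for u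
          using norm_triangle_ineq[of "v s" "u - v s"] nv that by simp
        obtain w where w: "w s = v s" "ac_on s t w (\<lambda>r. F r (w r))"
        proof (rule ode_local_existence[of s t F M "v s" L])
          show "s < t" using st False by simp
          show "set_borel_measurable lebesgue {s..t} (\<lambda>r. F r (w r))" if "continuous_on {s..t} w" for w
            using meas st that by blast
          show "set_integrable lebesgue {s..t} M" using st by (intro set_integrable_Icc_subset[OF M]) auto
          show "norm (F r u) \<le> M r" if "r \<in> {s..t}" "norm (u - v s) \<le> 1" for r u
            using that st near by (intro bd) auto
          show "inner (u - w) (F r u - F r w) \<le> L * (norm (u - w))\<^sup>2"
            if "r \<in> {s..t}" "norm (u - v s) \<le> 1" "norm (w - v s) \<le> 1" for r u w
            using that st near by (intro L(2)) auto
          show "continuous_on (cball (v s) 1) (F r)" if "r \<in> {s..t}" for r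
            using that st near
            by (intro continuous_on_subset[OF cont]) (auto simp: dist_norm norm_minus_commute)
        qed (use M1 L in auto)
        have "ac_on a t (\<lambda>r. if r \<le> s then v r else w r) (\<lambda>r. if r \<le> s then F r (v r) else F r (w r))"
          using ac_on_glue[OF v(2) w(2)] st w(1) by auto
        also have "(\<lambda>r. if r \<le> s then F r (v r) else F r (w r)) = (\<lambda>r. F r (if r \<le> s then v r else w r))"
          by auto
        finally show ?thesis using v(1) st
          by (intro exI[of _ "\<lambda>r. if r \<le> s then v r else w r"]) auto
      qed
    qed
  qed
  moreover have "\<exists>v. ?S a v" by (intro exI[of _ "\<lambda>_. x"]) (simp add: ac_on_refl)
  ultimately show ?thesis by simp
qed

lemma solves_from_iff_ac_on:
  "solves_from \<tau> x F v \<longleftrightarrow> v \<tau> = x \<and> (\<forall>t\<ge>\<tau>. ac_on \<tau> t v (\<lambda>s. F s (v s)))"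
proof
  assume s: "solves_from \<tau> x F v"
  have eq: "v t = x + (LINT s:{\<tau>..t}|lebesgue. F s (v s))"
    and int: "set_integrable lebesgue {\<tau>..t} (\<lambda>s. F s (v s))" if "t \<ge> \<tau>" for t
    using s that unfolding solves_from_def by blast+
  have x: "v \<tau> = x" unfolding eq[OF order_refl] by simp
  have "ac_on \<tau> t v (\<lambda>s. F s (v s))" if "t \<ge> \<tau>" for t
    by (rule ac_onI[OF int[OF that]]) (unfold x, rule eq)
  with x show "v \<tau> = x \<and> (\<forall>t\<ge>\<tau>. ac_on \<tau> t v (\<lambda>s. F s (v s)))" by blast
next
  assume s: "v \<tau> = x \<and> (\<forall>t\<ge>\<tau>. ac_on \<tau> t v (\<lambda>s. F s (v s)))"
  have "continuous_on {\<tau>..} v"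
    unfolding continuous_on_eq_continuous_within
  proof
    fix t assume t: "t \<in> {\<tau>..}"
    have "continuous_on {\<tau>..t + 1} v" using s t by (intro ac_on_continuous[of _ _ _ "\<lambda>s. F s (v s)"]) auto
    then have "continuous (at t within {\<tau>..t + 1}) v" using t by (auto simp: continuous_on_eq_continuous_within)
    moreover have "at t within {\<tau>..t + 1} = at t within {\<tau>..}"
    proof (rule at_within_nhd[of _ "{..<t + 1}"])
    qed auto
    ultimately show "continuous (at t within {\<tau>..}) v" by (simp add: continuous_within)
  qed
  moreover have "v t = x + (LINT s:{\<tau>..t}|lebesgue. F s (v s))" if "t \<ge> \<tau>" for t
    using ac_on_eq[of \<tau> t v _ t] s that by blast
  ultimately show "solves_from \<tau> x F v"
    unfolding solves_from_def using s ac_on_integrable by blast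
qed

text \<open>Uniqueness makes the solutions on different intervals agree, so the diagonal
  \<open>W t t\<close> is a solution on the whole half-line.\<close>

lemma solves_from_ex:
  assumes ex: "\<And>t. \<tau> \<le> t \<Longrightarrow> \<exists>w. w \<tau> = x \<and> ac_on \<tau> t w (\<lambda>s. F s (w s))"
    and uniq: "\<And>t v w. \<tau> \<le> t \<Longrightarrow> v \<tau> = x \<Longrightarrow> w \<tau> = x \<Longrightarrow> ac_on \<tau> t v (\<lambda>s. F s (v s)) \<Longrightarrow>
      ac_on \<tau> t w (\<lambda>s. F s (w s)) \<Longrightarrow> v t = w t"
  shows "\<exists>v. solves_from \<tau> x F v"
proof -
  have "\<forall>t. \<exists>w. \<tau> \<le> t \<longrightarrow> w \<tau> = x \<and> ac_on \<tau> t w (\<lambda>s. F s (w s))" using ex by blast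
  from choice[OF this] obtain W where
    W0: "\<forall>t. \<tau> \<le> t \<longrightarrow> W t \<tau> = x \<and> ac_on \<tau> t (W t) (\<lambda>s. F s (W t s))" ..
  then have W: "W t \<tau> = x" "ac_on \<tau> t (W t) (\<lambda>s. F s (W t s))" if "\<tau> \<le> t" for t using that by simp_all
  have eq: "W T t = W t t" if "\<tau> \<le> t" "t \<le> T" for t T
  proof (rule uniq[OF that(1), of "W T" "W t"])
    show "ac_on \<tau> t (W T) (\<lambda>s. F s (W T s))"
      using that by (intro ac_on_subinterval[OF W(2)[of T]]) auto
  qed (use W(1)[of T] W[of t] that in simp_all)
  have "ac_on \<tau> T (\<lambda>t. W t t) (\<lambda>s. F s (W s s))" if "\<tau> \<le> T" for T
  proof (rule ac_on_cong[OF W(2)[OF that]])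
    show "W T t = W t t" "F t (W T t) = F t (W t t)" if "\<tau> \<le> t" "t \<le> T" for t
      using eq[OF that] by auto
  qed fact
  then show ?thesis using W(1)[of \<tau>] by (intro exI[of _ "\<lambda>t. W t t"]) (simp add: solves_from_iff_ac_on)
qed

section \<open>Attractors of asymptotically compact cocycles\<close>

text \<open>Initial time and path are merged into one parameter \<open>p\<close> moved by
  \<open>\<sigma>\<close>, which turns the nonautonomous random flow into a cocycle over this base.
  Absorption and asymptotic compactness are stated for \<open>K\<close> itself; other families enter
  through \<open>attractor_attracts\<close>.\<close>

locale absorbed_cocycle =
  fixes Q :: "'p set" and \<sigma> :: "real \<Rightarrow> 'p \<Rightarrow> 'p"
    and \<phi> :: "real \<Rightarrow> 'p \<Rightarrow> 'x::metric_space \<Rightarrow> 'x" and K :: "'p \<Rightarrow> 'x set"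
  assumes flow_in: "p \<in> Q \<Longrightarrow> \<sigma> t p \<in> Q"
    and flow_0: "p \<in> Q \<Longrightarrow> \<sigma> 0 p = p"
    and flow_add: "p \<in> Q \<Longrightarrow> \<sigma> s (\<sigma> t p) = \<sigma> (s + t) p"
    and cocycle: "p \<in> Q \<Longrightarrow> 0 \<le> s \<Longrightarrow> 0 \<le> t \<Longrightarrow> \<phi> (s + t) p x = \<phi> t (\<sigma> s p) (\<phi> s p x)"
    and cont: "p \<in> Q \<Longrightarrow> 0 \<le> t \<Longrightarrow> continuous_on UNIV (\<phi> t p)"
    and K_nonempty: "p \<in> Q \<Longrightarrow> K p \<noteq> {}"
    and K_closed: "p \<in> Q \<Longrightarrow> closed (K p)"
    and K_absorbs: "p \<in> Q \<Longrightarrow> \<exists>T\<ge>0. \<forall>t\<ge>T. \<forall>x\<in>K (\<sigma> (- t) p). \<phi> t (\<sigma> (- t) p) x \<in> K p"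
    and asymp_compact: "\<And>p t x. p \<in> Q \<Longrightarrow> filterlim t at_top sequentially \<Longrightarrow> (\<And>n. 0 \<le> t n) \<Longrightarrow>
      (\<And>n. x n \<in> K (\<sigma> (- t n) p)) \<Longrightarrow>
      \<exists>l r. strict_mono (r :: nat \<Rightarrow> nat) \<and> (\<lambda>n. \<phi> (t (r n)) (\<sigma> (- t (r n)) p) (x (r n))) \<longlonglongrightarrow> l"
begin

text \<open>The intersection over \<open>T\<close> of the closures of the union of all images at
  times \<open>t \<ge> T\<close>, with the closure written out.\<close>

definition attractor :: "'p \<Rightarrow> 'x set" where
  "attractor p = {y. \<forall>e>0. \<forall>T\<ge>0. \<exists>t\<ge>T. \<exists>x\<in>K (\<sigma> (- t) p). dist (\<phi> t (\<sigma> (- t) p) x) y < e}"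

lemma attractorI:
  assumes t: "filterlim t at_top sequentially" and x: "\<And>n. x n \<in> K (\<sigma> (- t n) p)"
    and y: "(\<lambda>n. \<phi> (t n) (\<sigma> (- t n) p) (x n)) \<longlonglongrightarrow> y"
  shows "y \<in> attractor p"
  unfolding attractor_def
proof (intro CollectI allI impI)
  fix e T :: real assume e: "0 < e"
  have "eventually (\<lambda>n. T \<le> t n) sequentially" using t by (simp add: filterlim_at_top)
  moreover have "eventually (\<lambda>n. dist (\<phi> (t n) (\<sigma> (- t n) p) (x n)) y < e) sequentially"
    using y e by (simp add: tendsto_iff)
  ultimately have "eventually (\<lambda>n. T \<le> t n \<and> dist (\<phi> (t n) (\<sigma> (- t n) p) (x n)) y < e) sequentially"
    by (rule eventually_conj)
  then obtain n where "T \<le> t n" "dist (\<phi> (t n) (\<sigma> (- t n) p) (x n)) y < e"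
    using eventually_happens'[OF sequentially_bot] by blast
  then show "\<exists>t\<ge>T. \<exists>x\<in>K (\<sigma> (- t) p). dist (\<phi> t (\<sigma> (- t) p) x) y < e" using x by blast
qed

lemma filterlim_ge_real: "(\<And>n. real n \<le> t n) \<Longrightarrow> filterlim t at_top sequentially"
  by (rule filterlim_at_top_mono[OF filterlim_real_sequentially]) auto

lemma LIMSEQ_inverse_Suc_dist:
  assumes "\<And>n. dist (u n) (v n) < 1 / real (Suc n)" "v \<longlonglongrightarrow> l"
  shows "u \<longlonglongrightarrow> (l :: 'b::metric_space)"
proof (rule metric_LIMSEQ_I)
  fix e :: real assume e: "0 < e"
  have "(\<lambda>n. 1 / real (Suc n)) \<longlonglongrightarrow> 0" using LIMSEQ_Suc[OF lim_const_over_n[of 1]] by simp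
  from metric_LIMSEQ_D[OF this, of "e / 2"] e obtain N1 where N1: "\<forall>n\<ge>N1. 1 / real (Suc n) < e / 2" by auto
  obtain N2 where N2: "\<forall>n\<ge>N2. dist (v n) l < e / 2" using metric_LIMSEQ_D[OF assms(2), of "e / 2"] e by auto
  show "\<exists>N. \<forall>n\<ge>N. dist (u n) l < e"
  proof (intro exI[of _ "max N1 N2"] allI impI)
    fix n assume n: "max N1 N2 \<le> n"
    have "dist (u n) l \<le> dist (u n) (v n) + dist (v n) l" by (rule dist_triangle)
    also have "\<dots> < 1 / real (Suc n) + e / 2" using assms(1)[of n] N2 n by (intro add_strict_mono) auto
    also have "\<dots> \<le> e / 2 + e / 2" using N1 n by (intro add_mono order_less_imp_le) auto
    finally show "dist (u n) l < e" by simp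
  qed
qed

text \<open>At each \<open>n\<close> a possibly different point is approximated, by an orbit of
  length at least \<open>n\<close>: a constant sequence serves invariance, an arbitrary one
  compactness.\<close>

lemma attractor_seq:
  assumes "\<And>n. y n \<in> attractor p"
  obtains t x where "\<And>n. real n \<le> t n" "\<And>n. x n \<in> K (\<sigma> (- t n) p)"
    "\<And>n. dist (\<phi> (t n) (\<sigma> (- t n) p) (x n)) (y n) < 1 / real (Suc n)"
proof -
  have "\<forall>n. \<exists>tx. real n \<le> fst tx \<and> snd tx \<in> K (\<sigma> (- fst tx) p) \<and>
    dist (\<phi> (fst tx) (\<sigma> (- fst tx) p) (snd tx)) (y n) < 1 / real (Suc n)"
  proof
    fix n
    have "0 < 1 / real (Suc n)" "0 \<le> real n" by auto
    then obtain t x where "t \<ge> real n" "x \<in> K (\<sigma> (- t) p)" "dist (\<phi> t (\<sigma> (- t) p) x) (y n) < 1 / real (Suc n)"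
      using assms[of n] unfolding attractor_def by blast
    then show "\<exists>tx. real n \<le> fst tx \<and> snd tx \<in> K (\<sigma> (- fst tx) p) \<and>
      dist (\<phi> (fst tx) (\<sigma> (- fst tx) p) (snd tx)) (y n) < 1 / real (Suc n)"
      by (intro exI[of _ "(t, x)"]) simp
  qed
  from choice[OF this] obtain tx where tx: "\<forall>n. real n \<le> fst (tx n) \<and> snd (tx n) \<in> K (\<sigma> (- fst (tx n)) p) \<and>
    dist (\<phi> (fst (tx n)) (\<sigma> (- fst (tx n)) p) (snd (tx n))) (y n) < 1 / real (Suc n)" ..
  show ?thesis by (rule that[of "\<lambda>n. fst (tx n)" "\<lambda>n. snd (tx n)"]) (use tx in auto)
qed

lemma pull_in: "p \<in> Q \<Longrightarrow> \<sigma> (- t) p \<in> Q" by (rule flow_in)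

lemma cocycle_split:
  assumes "p \<in> Q" "0 \<le> s" "s \<le> t"
  shows "\<phi> t (\<sigma> (- t) p) x = \<phi> s (\<sigma> (- s) p) (\<phi> (t - s) (\<sigma> (- (t - s)) (\<sigma> (- s) p)) x)"
proof -
  have "\<phi> ((t - s) + s) (\<sigma> (- t) p) x = \<phi> s (\<sigma> (t - s) (\<sigma> (- t) p)) (\<phi> (t - s) (\<sigma> (- t) p) x)"
    using assms by (intro cocycle flow_in) auto
  moreover have "\<sigma> (t - s) (\<sigma> (- t) p) = \<sigma> (- s) p" "\<sigma> (- (t - s)) (\<sigma> (- s) p) = \<sigma> (- t) p"
    using assms by (auto simp: flow_add)
  ultimately show ?thesis by simp
qed

lemma attractor_nonempty:
  assumes p: "p \<in> Q" shows "attractor p \<noteq> {}"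
proof -
  have "\<forall>n. \<exists>x. x \<in> K (\<sigma> (- real n) p)" using K_nonempty[OF pull_in[OF p]] by blast
  then obtain x where x: "\<And>n. x n \<in> K (\<sigma> (- real n) p)" by metis
  obtain l r where r: "strict_mono (r :: nat \<Rightarrow> nat)"
    "(\<lambda>n. \<phi> (real (r n)) (\<sigma> (- real (r n)) p) (x (r n))) \<longlonglongrightarrow> l"
    using asymp_compact[of p real x, OF p filterlim_real_sequentially _ x] by auto
  have "filterlim (\<lambda>n. real (r n)) at_top sequentially"
    using seq_suble[OF r(1)] by (intro filterlim_ge_real) simp
  then have "l \<in> attractor p" by (rule attractorI[OF _ x r(2)])
  then show ?thesis by blast
qed

lemma attractor_subset:
  assumes p: "p \<in> Q" shows "attractor p \<subseteq> K p"
proof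
  fix y assume y: "y \<in> attractor p"
  obtain T where T: "T \<ge> 0" "\<forall>t\<ge>T. \<forall>x\<in>K (\<sigma> (- t) p). \<phi> t (\<sigma> (- t) p) x \<in> K p"
    using K_absorbs[OF p] by blast
  have "\<forall>e>0. \<exists>z\<in>K p. dist z y < e"
    using y T unfolding attractor_def by fast
  then show "y \<in> K p" using closed_approachable[OF K_closed[OF p]] by blast
qed

text \<open>Points of the attractor are shadowed by orbits issued ever further in the past.
  Asymptotic compactness gives a convergent subsequence of these, and its limit is again an
  omega-limit point.\<close>

lemma attractor_compact:
  assumes p: "p \<in> Q" shows "compact (attractor p)"
  unfolding compact_def
proof (intro allI impI)
  fix y :: "nat \<Rightarrow> 'x" assume "\<forall>n. y n \<in> attractor p"
  then obtain t x where t: "\<And>n. real n \<le> t n" and x: "\<And>n. x n \<in> K (\<sigma> (- t n) p)"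
    and d: "\<And>n. dist (\<phi> (t n) (\<sigma> (- t n) p) (x n)) (y n) < 1 / real (Suc n)"
    using attractor_seq[of y p] by blast
  have t0: "0 \<le> t n" for n using t[of n] by (rule order_trans[rotated]) simp
  obtain l r where r: "strict_mono (r :: nat \<Rightarrow> nat)"
    and l: "(\<lambda>n. \<phi> (t (r n)) (\<sigma> (- t (r n)) p) (x (r n))) \<longlonglongrightarrow> l"
    using asymp_compact[OF p filterlim_ge_real[OF t] t0 x] by blast
  have "filterlim (\<lambda>n. t (r n)) at_top sequentially"
    using seq_suble[OF r] t by (intro filterlim_ge_real) (meson of_nat_mono order_trans)
  then have "l \<in> attractor p" by (rule attractorI[OF _ x l])
  moreover have "(y \<circ> r) \<longlonglongrightarrow> l"
  proof (rule LIMSEQ_inverse_Suc_dist[OF _ l])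
    fix n
    have "1 / real (Suc (r n)) \<le> 1 / real (Suc n)" using seq_suble[OF r, of n] by (intro divide_left_mono) auto
    then show "dist ((y \<circ> r) n) (\<phi> (t (r n)) (\<sigma> (- t (r n)) p) (x (r n))) < 1 / real (Suc n)"
      using d[of "r n"] by (simp add: dist_commute)
  qed
  ultimately show "\<exists>l\<in>attractor p. \<exists>r. strict_mono r \<and> (y \<circ> r) \<longlonglongrightarrow> l" using r by blast
qed

text \<open>Forwards, orbits that end near \<open>y\<close> are continued for the time
  \<open>s\<close>. Backwards, orbits that reach \<open>y\<close> are stopped \<open>s\<close>
  before their end; the stopped orbits subconverge by asymptotic compactness, and continuity of
  \<open>\<phi> s p\<close> carries their limit to \<open>y\<close>.\<close>

lemma attractor_invariant:
  assumes p: "p \<in> Q" and s: "0 \<le> s"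
  shows "\<phi> s p ` attractor p = attractor (\<sigma> s p)"
proof
  show "\<phi> s p ` attractor p \<subseteq> attractor (\<sigma> s p)"
  proof (rule image_subsetI)
    fix y assume "y \<in> attractor p"
    then obtain t x where t: "\<And>n. real n \<le> t n" and x: "\<And>n. x n \<in> K (\<sigma> (- t n) p)"
      and d: "\<And>n. dist (\<phi> (t n) (\<sigma> (- t n) p) (x n)) y < 1 / real (Suc n)"
      using attractor_seq[of "\<lambda>_. y" p] by blast
    have t0: "0 \<le> t n" for n using t[of n] by (rule order_trans[rotated]) simp
    have "(\<lambda>n. \<phi> (t n) (\<sigma> (- t n) p) (x n)) \<longlonglongrightarrow> y"
      by (rule LIMSEQ_inverse_Suc_dist[OF d tendsto_const])
    then have "(\<lambda>n. \<phi> s p (\<phi> (t n) (\<sigma> (- t n) p) (x n))) \<longlonglongrightarrow> \<phi> s p y"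
      by (intro continuous_on_tendsto_compose[OF cont[OF p s]]) auto
    moreover have "\<phi> (t n + s) (\<sigma> (- (t n + s)) (\<sigma> s p)) z = \<phi> s p (\<phi> (t n) (\<sigma> (- t n) p) z)" for n z
      using cocycle[of "\<sigma> (- t n) p" "t n" s z] p s t0[of n] by (simp add: flow_add flow_in flow_0)
    ultimately have "(\<lambda>n. \<phi> (t n + s) (\<sigma> (- (t n + s)) (\<sigma> s p)) (x n)) \<longlonglongrightarrow> \<phi> s p y" by simp
    then show "\<phi> s p y \<in> attractor (\<sigma> s p)"
    proof (rule attractorI[rotated 2])
      show "filterlim (\<lambda>n. t n + s) at_top sequentially"
        using t s by (intro filterlim_ge_real) (meson add_increasing2)
      show "x n \<in> K (\<sigma> (- (t n + s)) (\<sigma> s p))" for n using x[of n] p by (simp add: flow_add)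
    qed
  qed
  show "attractor (\<sigma> s p) \<subseteq> \<phi> s p ` attractor p"
  proof
    fix y assume "y \<in> attractor (\<sigma> s p)"
    then obtain t' x' where t': "\<And>n. real n \<le> t' n" and x': "\<And>n. x' n \<in> K (\<sigma> (- t' n) (\<sigma> s p))"
      and d': "\<And>n. dist (\<phi> (t' n) (\<sigma> (- t' n) (\<sigma> s p)) (x' n)) y < 1 / real (Suc n)"
      using attractor_seq[of "\<lambda>_. y" "\<sigma> s p"] by blast
    \<comment> \<open>Dropping at least \<open>s\<close> terms keeps the shortened times
      \<open>t n\<close> above \<open>n\<close>.\<close>
    define N where "N = nat \<lceil>s\<rceil>"
    define t where "t n = t' (n + N) - s" for n
    define x where "x n = x' (n + N)" for n
    have N: "s \<le> real N" by (simp add: N_def real_nat_ceiling_ge)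
    have t: "real n \<le> t n" for n using t'[of "n + N"] N by (simp add: t_def)
    have t0: "0 \<le> t n" for n using t[of n] by (rule order_trans[rotated]) simp
    have x: "x n \<in> K (\<sigma> (- t n) p)" for n using x'[of "n + N"] p by (simp add: x_def t_def flow_add)
    obtain l r where r: "strict_mono (r :: nat \<Rightarrow> nat)"
      and l: "(\<lambda>n. \<phi> (t (r n)) (\<sigma> (- t (r n)) p) (x (r n))) \<longlonglongrightarrow> l"
      using asymp_compact[OF p filterlim_ge_real[OF t] t0 x] by blast
    have "filterlim (\<lambda>n. t (r n)) at_top sequentially"
      using seq_suble[OF r] t by (intro filterlim_ge_real) (meson of_nat_mono order_trans)
    then have lA: "l \<in> attractor p" by (rule attractorI[OF _ x l])
    have "(\<lambda>n. \<phi> s p (\<phi> (t (r n)) (\<sigma> (- t (r n)) p) (x (r n)))) \<longlonglongrightarrow> \<phi> s p l"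
      by (intro continuous_on_tendsto_compose[OF cont[OF p s] l]) auto
    moreover have "\<phi> s p (\<phi> (t n) (\<sigma> (- t n) p) (x n)) = \<phi> (t' (n + N)) (\<sigma> (- t' (n + N)) (\<sigma> s p)) (x' (n + N))" for n
      using cocycle[of "\<sigma> (- t n) p" "t n" s "x n"] p s t0[of n]
      by (simp add: flow_add flow_in flow_0 t_def x_def)
    moreover have "(\<lambda>n. \<phi> (t' (r n + N)) (\<sigma> (- t' (r n + N)) (\<sigma> s p)) (x' (r n + N))) \<longlonglongrightarrow> y"
    proof (rule LIMSEQ_inverse_Suc_dist[OF _ tendsto_const])
      fix n
      have "1 / real (Suc (r n + N)) \<le> 1 / real (Suc n)" using seq_suble[OF r, of n] by (intro divide_left_mono) auto
      then show "dist (\<phi> (t' (r n + N)) (\<sigma> (- t' (r n + N)) (\<sigma> s p)) (x' (r n + N))) y < 1 / real (Suc n)"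
        using d'[of "r n + N"] by (rule order.strict_trans2[rotated])
    qed
    ultimately have "\<phi> s p l = y" using LIMSEQ_unique by force
    then show "y \<in> \<phi> s p ` attractor p" using lA by blast
  qed
qed

lemma attractor_attracts_K:
  assumes p: "p \<in> Q" and e: "0 < e"
  shows "\<exists>T\<ge>0. \<forall>t\<ge>T. \<forall>x\<in>K (\<sigma> (- t) p). infdist (\<phi> t (\<sigma> (- t) p) x) (attractor p) < e"
proof (rule ccontr)
  assume "\<not> ?thesis"
  then have *: "\<forall>T\<ge>0. \<exists>t\<ge>T. \<exists>x\<in>K (\<sigma> (- t) p). e \<le> infdist (\<phi> t (\<sigma> (- t) p) x) (attractor p)"
    by (auto simp: not_less)
  have "\<forall>n. \<exists>tx. real n \<le> fst tx \<and> snd tx \<in> K (\<sigma> (- fst tx) p) \<and>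
    e \<le> infdist (\<phi> (fst tx) (\<sigma> (- fst tx) p) (snd tx)) (attractor p)"
  proof
    fix n :: nat
    from *[rule_format, of "real n"] obtain t x where "t \<ge> real n" "x \<in> K (\<sigma> (- t) p)"
      "e \<le> infdist (\<phi> t (\<sigma> (- t) p) x) (attractor p)" by auto
    then show "\<exists>tx. real n \<le> fst tx \<and> snd tx \<in> K (\<sigma> (- fst tx) p) \<and>
      e \<le> infdist (\<phi> (fst tx) (\<sigma> (- fst tx) p) (snd tx)) (attractor p)"
      by (intro exI[of _ "(t, x)"]) simp
  qed
  from choice[OF this] obtain tx where tx: "\<forall>n. real n \<le> fst (tx n) \<and> snd (tx n) \<in> K (\<sigma> (- fst (tx n)) p) \<and>
    e \<le> infdist (\<phi> (fst (tx n)) (\<sigma> (- fst (tx n)) p) (snd (tx n))) (attractor p)" ..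
  define t x where "t n = fst (tx n)" and "x n = snd (tx n)" for n
  have t: "real n \<le> t n" and x: "x n \<in> K (\<sigma> (- t n) p)"
    and far: "e \<le> infdist (\<phi> (t n) (\<sigma> (- t n) p) (x n)) (attractor p)" for n
    using tx by (auto simp: t_def x_def)
  have t0: "0 \<le> t n" for n using t[of n] by (rule order_trans[rotated]) simp
  obtain l r where r: "strict_mono (r :: nat \<Rightarrow> nat)"
    and l: "(\<lambda>n. \<phi> (t (r n)) (\<sigma> (- t (r n)) p) (x (r n))) \<longlonglongrightarrow> l"
    using asymp_compact[OF p filterlim_ge_real[OF t] t0 x] by blast
  have "filterlim (\<lambda>n. t (r n)) at_top sequentially"
    using seq_suble[OF r] t by (intro filterlim_ge_real) (meson of_nat_mono order_trans)
  then have "l \<in> attractor p" by (rule attractorI[OF _ x l])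
  obtain n where "dist (\<phi> (t (r n)) (\<sigma> (- t (r n)) p) (x (r n))) l < e"
    using metric_LIMSEQ_D[OF l e] by blast
  moreover have "infdist (\<phi> (t (r n)) (\<sigma> (- t (r n)) p) (x (r n))) (attractor p) \<le> dist (\<phi> (t (r n)) (\<sigma> (- t (r n)) p) (x (r n))) l"
    using \<open>l \<in> attractor p\<close> by (rule infdist_le)
  ultimately show False using far[of "r n"] by simp
qed

text \<open>Two stages: a time \<open>s\<close> is fixed after which \<open>K\<close> is close to
  the attractor, and \<open>D\<close> is absorbed into \<open>K\<close> at the parameter
  \<open>\<sigma> (- s) p\<close>. This is why absorption is asked at every parameter and not at
  \<open>p\<close> alone.\<close>

lemma attractor_attracts:
  assumes p: "p \<in> Q" and e: "0 < e"
    and D: "\<And>p. p \<in> Q \<Longrightarrow> \<exists>T\<ge>0. \<forall>t\<ge>T. \<forall>x\<in>D (\<sigma> (- t) p). \<phi> t (\<sigma> (- t) p) x \<in> K p"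
  shows "\<exists>T\<ge>0. \<forall>t\<ge>T. \<forall>x\<in>D (\<sigma> (- t) p). infdist (\<phi> t (\<sigma> (- t) p) x) (attractor p) < e"
proof -
  obtain s where s: "s \<ge> 0" "\<forall>x\<in>K (\<sigma> (- s) p). infdist (\<phi> s (\<sigma> (- s) p) x) (attractor p) < e"
    using attractor_attracts_K[OF p e] by blast
  obtain T where T: "T \<ge> 0" "\<forall>t\<ge>T. \<forall>x\<in>D (\<sigma> (- t) (\<sigma> (- s) p)). \<phi> t (\<sigma> (- t) (\<sigma> (- s) p)) x \<in> K (\<sigma> (- s) p)"
    using D[OF pull_in[OF p]] by blast
  show ?thesis
  proof (intro exI[of _ "s + T"] conjI allI impI ballI)
    show "0 \<le> s + T" using s T by simp
    fix t x assume t: "s + T \<le> t" and x: "x \<in> D (\<sigma> (- t) p)"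
    have "\<sigma> (- (t - s)) (\<sigma> (- s) p) = \<sigma> (- t) p" using p by (simp add: flow_add)
    then have "\<phi> (t - s) (\<sigma> (- (t - s)) (\<sigma> (- s) p)) x \<in> K (\<sigma> (- s) p)"
      using T(2)[rule_format, of "t - s" x] t x by simp
    then show "infdist (\<phi> t (\<sigma> (- t) p) x) (attractor p) < e"
      using s(2) cocycle_split[OF p s(1), of t x] t T by simp
  qed
qed

text \<open>By invariance the attractor lies in every image of \<open>K\<close>, so the distance to
  the image is the smaller one; attraction bounds the gap by \<open>e / 2\<close>. Restricting to
  integer times yields a limit of a sequence, as measurability requires.\<close>

lemma infdist_attractor_lim:
  assumes p: "p \<in> Q"
  shows "(\<lambda>n. infdist y (\<phi> (real n) (\<sigma> (- real n) p) ` K (\<sigma> (- real n) p))) \<longlonglongrightarrow> infdist y (attractor p)"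
proof (rule metric_LIMSEQ_I)
  fix e :: real assume e: "0 < e"
  obtain T where T: "T \<ge> 0" "\<forall>t\<ge>T. \<forall>x\<in>K (\<sigma> (- t) p). infdist (\<phi> t (\<sigma> (- t) p) x) (attractor p) < e / 2"
    using attractor_attracts_K[OF p, of "e / 2"] e by auto
  show "\<exists>N. \<forall>n\<ge>N. dist (infdist y (\<phi> (real n) (\<sigma> (- real n) p) ` K (\<sigma> (- real n) p))) (infdist y (attractor p)) < e"
  proof (intro exI[of _ "nat \<lceil>T\<rceil>"] allI impI)
    fix n assume "nat \<lceil>T\<rceil> \<le> n"
    then have n: "T \<le> real n" by (simp add: nat_ceiling_le_eq)
    let ?B = "\<phi> (real n) (\<sigma> (- real n) p) ` K (\<sigma> (- real n) p)"
    have ne: "?B \<noteq> {}" using K_nonempty[OF pull_in[OF p]] by simp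
    have "attractor p = \<phi> (real n) (\<sigma> (- real n) p) ` attractor (\<sigma> (- real n) p)"
      using attractor_invariant[OF pull_in[OF p], of "real n" "real n"] p by (simp add: flow_add flow_0)
    then have sub: "attractor p \<subseteq> ?B" using attractor_subset[OF pull_in[OF p]] by blast
    have le1: "infdist y ?B \<le> infdist y (attractor p)"
      by (rule infdist_mono[OF sub attractor_nonempty[OF p]])
    have "infdist y (attractor p) - e / 2 \<le> infdist y ?B"
      unfolding infdist_notempty[OF ne]
    proof (rule cINF_greatest[OF ne])
      fix b assume "b \<in> ?B"
      then have "infdist b (attractor p) < e / 2" using T n by auto
      then show "infdist y (attractor p) - e / 2 \<le> dist y b" using infdist_triangle[of y "attractor p" b] by simp
    qed
    then show "dist (infdist y ?B) (infdist y (attractor p)) < e" using le1 e by (simp add: dist_real_def)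
  qed
qed

end

section \<open>Operators and compactness on the sequence space\<close>

lemma bounded_linear_coord: "bounded_linear (\<lambda>u. coord u i)"
  by (rule bounded_linear_intro[of _ 1]) (auto simp: coord_simps abs_coord_le)

lemma coord_sum: "coord (\<Sum>j\<in>F. x j) i = (\<Sum>j\<in>F. coord (x j) i)"
  using linear_sum[OF bounded_linear.linear[OF bounded_linear_coord[of i]], of x F] by simp

lemma norm_ell2_mono:
  assumes "\<And>i. \<bar>coord u i\<bar> \<le> B * \<bar>coord v i\<bar>" "0 \<le> B"
  shows "norm u \<le> B * norm v"
proof (rule power2_le_imp_le)
  have "(norm u)\<^sup>2 \<le> (\<Sum>\<^sub>\<infinity>i. B\<^sup>2 * (coord v i)\<^sup>2)"
    unfolding norm_ell2_square
  proof (rule infsum_mono)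
    show "(\<lambda>i. (coord u i)\<^sup>2) summable_on UNIV" by (rule coord_summable)
    show "(\<lambda>i. B\<^sup>2 * (coord v i)\<^sup>2) summable_on UNIV" by (intro summable_on_cmult_right coord_summable)
    show "(coord u i)\<^sup>2 \<le> B\<^sup>2 * (coord v i)\<^sup>2" for i
      using power_mono[OF assms(1)[of i], of 2] by (simp add: power_mult_distrib)
  qed
  also have "\<dots> = (B * norm v)\<^sup>2"
    by (simp add: infsum_cmult_right coord_summable norm_ell2_square power_mult_distrib)
  finally show "(norm u)\<^sup>2 \<le> (B * norm v)\<^sup>2" .
qed (use assms in simp)

text \<open>\<open>Ell2\<close> is specified only on square summable sequences, so the multiplier is
  meaningful for bounded \<open>\<rho>\<close>; the lemmas about it carry that bound.\<close>

definition diag :: "(int \<Rightarrow> real) \<Rightarrow> ell2 \<Rightarrow> ell2" where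
  "diag \<rho> u = Ell2 (\<lambda>i. \<rho> i * coord u i)"

lemma coord_diag:
  assumes "\<And>i. \<bar>\<rho> i\<bar> \<le> B"
  shows "coord (diag \<rho> u) i = \<rho> i * coord u i"
proof -
  have "(\<lambda>i. B\<^sup>2 * (coord u i)\<^sup>2) summable_on UNIV" by (intro summable_on_cmult_right coord_summable)
  moreover have "(\<rho> i * coord u i)\<^sup>2 \<le> B\<^sup>2 * (coord u i)\<^sup>2" for i
    using power_mono[OF assms[of i], of 2] by (simp add: power_mult_distrib mult_right_mono)
  ultimately have "(\<lambda>i. (\<rho> i * coord u i)\<^sup>2) summable_on UNIV"
    by (rule summable_on_comparison_test) auto
  then show ?thesis by (simp add: diag_def Ell2_inverse ellp_2_iff)
qed

lemma norm_diag_le: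
  assumes "\<And>i. \<bar>\<rho> i\<bar> \<le> B" shows "norm (diag \<rho> u) \<le> B * norm u"
proof (rule norm_ell2_mono)
  show "0 \<le> B" using assms[of 0] by simp
  show "\<bar>coord (diag \<rho> u) i\<bar> \<le> B * \<bar>coord u i\<bar>" for i
    using assms[of i] by (simp add: coord_diag[of \<rho> B, OF assms] abs_mult mult_right_mono)
qed

lemma bounded_linear_diag:
  assumes "\<And>i. \<bar>\<rho> i\<bar> \<le> B" shows "bounded_linear (diag \<rho>)"
proof (rule bounded_linear_intro)
  note c = coord_diag[of \<rho> B, OF assms]
  show "diag \<rho> (u + v) = diag \<rho> u + diag \<rho> v" for u v
    by (rule ell2_eqI) (simp add: c coord_simps algebra_simps)
  show "diag \<rho> (r *\<^sub>R u) = r *\<^sub>R diag \<rho> u" for r u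
    by (rule ell2_eqI) (simp add: c coord_simps algebra_simps)
  show "norm (diag \<rho> u) \<le> norm u * B" for u
    using norm_diag_le[of \<rho> B u, OF assms] by (simp add: mult.commute)
qed

lemma inner_diag:
  assumes "\<And>i. \<bar>\<rho> i\<bar> \<le> B"
  shows "inner (diag \<rho> u) v = (\<Sum>\<^sub>\<infinity>i. \<rho> i * coord u i * coord v i)"
    and "(\<lambda>i. \<rho> i * coord u i * coord v i) summable_on UNIV"
  using coord_prod_summable[of "diag \<rho> u" v] by (simp_all add: inner_ell2_def coord_diag[of \<rho> B, OF assms])

lemma coord_lap: "coord (lap u) i = 2 * coord u i - coord u (i - 1) - coord u (i + 1)"
  by (simp add: lap.rep_eq)

lemma summable_on_shift:
  fixes X :: "int \<Rightarrow> real"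
  shows "(\<lambda>i. X (i + k)) summable_on UNIV \<longleftrightarrow> X summable_on UNIV"
    and "(\<Sum>\<^sub>\<infinity>i. X (i + k)) = (\<Sum>\<^sub>\<infinity>i. X i)"
proof -
  have b: "bij_betw (\<lambda>i::int. i + k) UNIV UNIV"
    by (rule bij_betwI[where g = "\<lambda>i. i - k"]) auto
  show "(\<lambda>i. X (i + k)) summable_on UNIV \<longleftrightarrow> X summable_on UNIV"
    by (rule summable_on_reindex_bij_betw[OF b])
  show "(\<Sum>\<^sub>\<infinity>i. X (i + k)) = (\<Sum>\<^sub>\<infinity>i. X i)"
    by (rule infsum_reindex_bij_betw[OF b])
qed

lemma lap_linear: "lap (u + v) = lap u + lap v" "lap (u - v) = lap u - lap v" "lap (r *\<^sub>R u) = r *\<^sub>R lap u"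
  by (rule ell2_eqI, simp add: coord_lap coord_simps algebra_simps)+

lemma norm_lap_le: "norm (lap u) \<le> 4 * norm u"
proof (rule power2_le_imp_le)
  let ?X = "\<lambda>i. (coord u i)\<^sup>2"
  have s: "(\<lambda>i. ?X (i + k)) summable_on UNIV" for k using summable_on_shift(1)[of ?X] coord_summable by blast
  have "(norm (lap u))\<^sup>2 \<le> (\<Sum>\<^sub>\<infinity>i. 8 * ?X i + (4 * ?X (i + (- 1)) + 4 * ?X (i + 1)))"
    unfolding norm_ell2_square
  proof (rule infsum_mono)
    show "(\<lambda>i. (coord (lap u) i)\<^sup>2) summable_on UNIV" by (rule coord_summable)
    show "(\<lambda>i. 8 * ?X i + (4 * ?X (i + (- 1)) + 4 * ?X (i + 1))) summable_on UNIV"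
      by (intro summable_on_add summable_on_cmult_right s coord_summable)
    fix i
    \<comment> \<open>The coefficients 8, 4, 4 add up to 16, so the norm bound 4 is sharp: the
      symbol of the operator is \<open>2 - 2 cos\<close>.\<close>
    have *: "(2 * a - b - c)\<^sup>2 \<le> 8 * a\<^sup>2 + (4 * b\<^sup>2 + 4 * c\<^sup>2)" for a b c :: real
      using zero_le_power2[of "2 * a + (b + c)"] zero_le_power2[of "b - c"]
      by (simp add: power2_eq_square algebra_simps)
    show "(coord (lap u) i)\<^sup>2 \<le> 8 * ?X i + (4 * ?X (i + (- 1)) + 4 * ?X (i + 1))"
      using *[of "coord u i" "coord u (i - 1)" "coord u (i + 1)"] by (simp add: coord_lap)
  qed
  also have "\<dots> = 8 * (\<Sum>\<^sub>\<infinity>i. ?X i) + (4 * (\<Sum>\<^sub>\<infinity>i. ?X (i + (- 1))) + 4 * (\<Sum>\<^sub>\<infinity>i. ?X (i + 1)))"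
    by (simp only: infsum_add infsum_cmult_right summable_on_add summable_on_cmult_right s coord_summable)
  also have "\<dots> = (4 * norm u)\<^sup>2"
    by (simp only: summable_on_shift(2)[of ?X]) (simp add: norm_ell2_square power_mult_distrib)
  finally show "(norm (lap u))\<^sup>2 \<le> (4 * norm u)\<^sup>2" .
qed simp

lemma bounded_linear_lap: "bounded_linear lap"
  by (rule bounded_linear_intro[of _ 4]) (use norm_lap_le in \<open>auto simp: lap_linear mult.commute\<close>)

lemma inner_lap: "inner (lap u) v = inner u (lap v)"
proof -
  have s: "(\<lambda>i. coord u (i + k) * coord v (i + l)) summable_on UNIV" for k l
  proof -
    have "(\<lambda>i. coord u (i + k)) \<in> ellp 2" "(\<lambda>i. coord v (i + l)) \<in> ellp 2"
      by (rule ellp_2_shift[OF coord])+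
    then show ?thesis
      using coord_prod_summable[of "Ell2 (\<lambda>i. coord u (i + k))" "Ell2 (\<lambda>i. coord v (i + l))"] by (simp add: Ell2_inverse)
  qed
  have s': "(\<lambda>i. coord u i * coord v i) summable_on UNIV" by (rule coord_prod_summable)
  have s1: "(\<lambda>i. coord u (i + k) * coord v i) summable_on UNIV"
    and s2: "(\<lambda>i. coord u i * coord v (i + k)) summable_on UNIV" for k
    using s[of k 0] s[of 0 k] by simp_all
  have "inner (lap u) v = (\<Sum>\<^sub>\<infinity>i. 2 * (coord u i * coord v i) + ((- 1) * (coord u (i + (- 1)) * coord v i) + (- 1) * (coord u (i + 1) * coord v i)))"
    unfolding inner_ell2_def by (intro infsum_cong) (simp add: coord_lap algebra_simps)
  also have "\<dots> = 2 * (\<Sum>\<^sub>\<infinity>i. coord u i * coord v i) + ((- 1) * (\<Sum>\<^sub>\<infinity>i. coord u (i + (- 1)) * coord v i) + (- 1) * (\<Sum>\<^sub>\<infinity>i. coord u (i + 1) * coord v i))"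
    by (simp only: infsum_add infsum_cmult_right summable_on_add summable_on_cmult_right s' s1)
  also have "(\<Sum>\<^sub>\<infinity>i. coord u (i + (- 1)) * coord v i) = (\<Sum>\<^sub>\<infinity>i. coord u i * coord v (i + 1))"
    using summable_on_shift(2)[of "\<lambda>i. coord u i * coord v (i + 1)" "-1"] by simp
  also have "(\<Sum>\<^sub>\<infinity>i. coord u (i + 1) * coord v i) = (\<Sum>\<^sub>\<infinity>i. coord u i * coord v (i + (- 1)))"
    using summable_on_shift(2)[of "\<lambda>i. coord u i * coord v (i + (- 1))" "1"] by simp
  also have "2 * (\<Sum>\<^sub>\<infinity>i. coord u i * coord v i) + ((- 1) * (\<Sum>\<^sub>\<infinity>i. coord u i * coord v (i + 1)) + (- 1) * (\<Sum>\<^sub>\<infinity>i. coord u i * coord v (i + (- 1))))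
     = (\<Sum>\<^sub>\<infinity>i. 2 * (coord u i * coord v i) + ((- 1) * (coord u i * coord v (i + 1)) + (- 1) * (coord u i * coord v (i + (- 1)))))"
    by (simp only: infsum_add infsum_cmult_right summable_on_add summable_on_cmult_right s' s2)
  also have "\<dots> = inner u (lap v)"
    unfolding inner_ell2_def by (intro infsum_cong) (simp add: coord_lap algebra_simps)
  finally show ?thesis .
qed

text \<open>Symmetric windows are cofinal among the finite sets, so an unordered sum becomes the
  limit of a sequence. Measurability of sums and decay of tails rest on this.\<close>

lemma infsum_int_limit:
  fixes X :: "int \<Rightarrow> real"
  assumes "X summable_on UNIV"
  shows "(\<lambda>n. \<Sum>i\<in>{- int n..int n}. X i) \<longlonglongrightarrow> (\<Sum>\<^sub>\<infinity>i. X i)"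
proof -
  have "(X has_sum (\<Sum>\<^sub>\<infinity>i. X i)) UNIV" using assms by (rule has_sum_infsum)
  then have "(sum X \<longlongrightarrow> (\<Sum>\<^sub>\<infinity>i. X i)) (finite_subsets_at_top UNIV)" by (simp add: has_sum_def)
  moreover have "filterlim (\<lambda>n. {- int n..int n}) (finite_subsets_at_top UNIV) sequentially"
    unfolding filterlim_finite_subsets_at_top
  proof (intro allI impI)
    fix F :: "int set" assume F: "finite F \<and> F \<subseteq> UNIV"
    then obtain B where B: "\<forall>i\<in>F. \<bar>i\<bar> \<le> B" using finite_int_iff_bounded_le[of F] by auto
    have "eventually (\<lambda>n. nat B \<le> n) sequentially" by (rule eventually_ge_at_top)
    then show "eventually (\<lambda>n. finite {- int n..int n} \<and> F \<subseteq> {- int n..int n} \<and> {- int n..int n} \<subseteq> UNIV) sequentially"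
    proof eventually_elim
      case (elim n)
      have "i \<in> {- int n..int n}" if "i \<in> F" for i using B[rule_format, OF that] elim by auto
      then show ?case by auto
    qed
  qed
  ultimately show ?thesis by (rule filterlim_compose)
qed

lemma infsum_measurable:
  fixes X :: "'a \<Rightarrow> int \<Rightarrow> real"
  assumes "\<And>i. (\<lambda>t. X t i) \<in> borel_measurable M" "\<And>t. t \<in> space M \<Longrightarrow> X t summable_on UNIV"
  shows "(\<lambda>t. \<Sum>\<^sub>\<infinity>i. X t i) \<in> borel_measurable M"
proof (rule borel_measurable_LIMSEQ_real[where u = "\<lambda>n t. \<Sum>i\<in>{- int n..int n}. X t i"])
  show "(\<lambda>n. \<Sum>i\<in>{- int n..int n}. X t i) \<longlonglongrightarrow> (\<Sum>\<^sub>\<infinity>i. X t i)" if "t \<in> space M" for t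
    by (rule infsum_int_limit[OF assms(2)[OF that]])
  show "(\<lambda>t. \<Sum>i\<in>{- int n..int n}. X t i) \<in> borel_measurable M" for n
    using assms(1) by (intro borel_measurable_sum) auto
qed

section \<open>Finite sections, tails and compactness in the sequence space\<close>

definition unit_vec :: "int \<Rightarrow> ell2" where "unit_vec i = Ell2 (\<lambda>j. if j = i then 1 else 0)"

lemma coord_unit_vec: "coord (unit_vec i) j = (if j = i then 1 else 0)"
proof -
  have "(\<lambda>j. (if j = i then 1 else 0 :: real)\<^sup>2) summable_on UNIV"
    by (rule finite_nonzero_values_imp_summable_on) (rule finite_subset[of _ "{i}"], auto)
  then show ?thesis unfolding unit_vec_def by (subst Ell2_inverse) (auto simp: ellp_2_iff)
qed

definition tail :: "nat \<Rightarrow> ell2 \<Rightarrow> ell2" where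
  "tail k = diag (\<lambda>i. if \<bar>i\<bar> \<le> int k then 0 else 1)"

lemma coord_tail: "coord (tail k u) i = (if \<bar>i\<bar> \<le> int k then 0 else coord u i)"
  unfolding tail_def by (subst coord_diag[of _ 1]) auto

lemma head_tail: "u = (\<Sum>i\<in>{- int k..int k}. coord u i *\<^sub>R unit_vec i) + tail k u"
proof (rule ell2_eqI)
  fix j
  have "(\<Sum>i\<in>{- int k..int k}. coord u i * (if j = i then 1 else 0)) = (if j \<in> {- int k..int k} then coord u j else 0)"
    by (simp add: sum.delta' if_distrib cong: if_cong)
  then show "coord u j = coord ((\<Sum>i\<in>{- int k..int k}. coord u i *\<^sub>R unit_vec i) + tail k u) j"
    by (auto simp: coord_simps coord_sum coord_unit_vec coord_tail)
qed

lemma norm_tail_square: "(norm (tail k u))\<^sup>2 = (norm u)\<^sup>2 - (\<Sum>i\<in>{- int k..int k}. (coord u i)\<^sup>2)"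
proof -
  let ?I = "{- int k..int k}"
  have "(\<Sum>\<^sub>\<infinity>i. (coord u i)\<^sup>2) = (\<Sum>\<^sub>\<infinity>i. (if i \<in> ?I then (coord u i)\<^sup>2 else 0) + (coord (tail k u) i)\<^sup>2)"
    by (intro infsum_cong) (auto simp: coord_tail)
  also have "\<dots> = (\<Sum>\<^sub>\<infinity>i. (if i \<in> ?I then (coord u i)\<^sup>2 else 0)) + (\<Sum>\<^sub>\<infinity>i. (coord (tail k u) i)\<^sup>2)"
  proof (rule infsum_add[OF _ coord_summable])
    show "(\<lambda>i. if i \<in> ?I then (coord u i)\<^sup>2 else 0) summable_on UNIV"
      by (rule finite_nonzero_values_imp_summable_on) (rule finite_subset[of _ ?I], auto)
  qed
  also have "(\<Sum>\<^sub>\<infinity>i. (if i \<in> ?I then (coord u i)\<^sup>2 else 0)) = (\<Sum>\<^sub>\<infinity>i\<in>?I. (coord u i)\<^sup>2)"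
    by (rule infsum_cong_neutral) auto
  finally show ?thesis by (simp add: norm_ell2_square)
qed

lemma tail_tendsto_0: "(\<lambda>k. tail k u) \<longlonglongrightarrow> 0"
proof -
  have "(\<lambda>k. (norm u)\<^sup>2 - (\<Sum>i\<in>{- int k..int k}. (coord u i)\<^sup>2)) \<longlonglongrightarrow> (norm u)\<^sup>2 - (norm u)\<^sup>2"
    unfolding norm_ell2_square[of u] by (intro tendsto_intros infsum_int_limit coord_summable)
  then have "(\<lambda>k. sqrt ((norm (tail k u))\<^sup>2)) \<longlonglongrightarrow> sqrt 0"
    by (intro tendsto_real_sqrt) (simp add: norm_tail_square)
  then show ?thesis by (simp add: tendsto_norm_zero_iff)
qed

text \<open>\<open>F\<close> is the pointwise limit of its finite sections, which are finite sums of
  measurable multiples of fixed vectors.\<close>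

lemma ell2_measurableI:
  assumes "\<And>i. (\<lambda>x. coord (F x) i) \<in> borel_measurable M"
  shows "F \<in> borel_measurable M"
proof (rule borel_measurable_LIMSEQ_metric[where f = "\<lambda>k x. \<Sum>i\<in>{- int k..int k}. coord (F x) i *\<^sub>R unit_vec i"])
  show "(\<lambda>x. \<Sum>i\<in>{- int k..int k}. coord (F x) i *\<^sub>R unit_vec i) \<in> borel_measurable M" for k
    using assms by (intro borel_measurable_sum borel_measurable_scaleR) auto
  fix x assume "x \<in> space M"
  have "(\<lambda>k. F x - tail k (F x)) \<longlonglongrightarrow> F x - 0" by (intro tendsto_intros tail_tendsto_0)
  moreover have "F x - tail k (F x) = (\<Sum>i\<in>{- int k..int k}. coord (F x) i *\<^sub>R unit_vec i)" for k
    using head_tail[of "F x" k] by (simp add: algebra_simps)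
  ultimately show "(\<lambda>k. \<Sum>i\<in>{- int k..int k}. coord (F x) i *\<^sub>R unit_vec i) \<longlonglongrightarrow> F x" by simp
qed

lemma coord_measurable: "F \<in> borel_measurable M \<Longrightarrow> (\<lambda>x. coord (F x) i) \<in> borel_measurable M"
  by (rule measurable_compose[of F M borel _ borel])
    (auto intro!: borel_measurable_continuous_onI bounded_linear.continuous_on[OF bounded_linear_coord] continuous_intros)

lemma coordinatewise_convergent_subsequence:
  fixes v :: "nat \<Rightarrow> ell2"
  assumes "\<And>n. norm (v n) \<le> B"
  obtains r where "strict_mono (r :: nat \<Rightarrow> nat)" "\<And>i. convergent (\<lambda>n. coord (v (r n)) i)"
proof -
  define c :: "nat \<Rightarrow> (nat \<Rightarrow> nat) \<Rightarrow> bool"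
    where "c j s \<longleftrightarrow> convergent (\<lambda>n. coord (v (s n)) (from_nat j))" for j s
  interpret subseqs c
  proof
    fix n :: nat and s :: "nat \<Rightarrow> nat"
    have "bounded (range (\<lambda>m. coord (v (s m)) (from_nat n)))"
      using order_trans[OF abs_coord_le assms] by (intro boundedI[of _ B]) auto
    from bounded_imp_convergent_subsequence[OF this]
    show "\<exists>r'. strict_mono r' \<and> c n (s \<circ> r')" by (auto simp: c_def o_def convergent_def)
  qed
  show ?thesis
  proof (rule that[OF subseq_diagseq])
    fix i :: int
    \<comment> \<open>The diagonal sequence is a subsequence of the one chosen for coordinate
      \<open>i\<close> only after finitely many terms, hence the offset.\<close>
    have "c (to_nat i) (diagseq \<circ> ((+) (Suc (to_nat i))))"
    proof (rule diagseq_holds)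
      show "c n (s \<circ> r)" if "strict_mono r" "c n s" for r s n
        using convergent_subseq_convergent[OF that(2)[unfolded c_def] that(1)] by (simp add: c_def o_def)
    qed
    then have "convergent (\<lambda>n. coord (v (diagseq (n + Suc (to_nat i)))) i)"
      by (simp add: c_def o_def add.commute)
    then show "convergent (\<lambda>n. coord (v (diagseq n)) i)"
      using convergent_ignore_initial_segment[of "\<lambda>n. coord (v (diagseq n)) i" "Suc (to_nat i)"] by simp
  qed
qed

text \<open>Small tails reduce the Cauchy property to finitely many coordinates, and these converge
  along a diagonal subsequence. The tail bound may start at an index depending on
  \<open>\<eta>\<close>, because in the application the initial energy has to decay before it
  holds.\<close>

lemma uniform_tails_convergent_subsequence:
  fixes v :: "nat \<Rightarrow> ell2"
  assumes B: "\<And>n. norm (v n) \<le> B"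
    and tails: "\<And>\<eta>. 0 < \<eta> \<Longrightarrow> \<exists>k N. \<forall>n\<ge>N. norm (tail k (v n)) \<le> \<eta>"
  obtains l r where "strict_mono (r :: nat \<Rightarrow> nat)" "(\<lambda>n. v (r n)) \<longlonglongrightarrow> l"
proof -
  obtain r where r: "strict_mono r" "\<And>i. convergent (\<lambda>n. coord (v (r n)) i)"
    using coordinatewise_convergent_subsequence[of v B] B by blast
  have "Cauchy (\<lambda>n. v (r n))"
  proof (rule metric_CauchyI)
    fix e :: real assume e: "0 < e"
    obtain k N where N: "\<forall>n\<ge>N. norm (tail k (v n)) \<le> e / 4" using tails[of "e / 4"] e by auto
    let ?H = "\<lambda>n. \<Sum>i\<in>{- int k..int k}. coord (v (r n)) i *\<^sub>R unit_vec i"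
    have "convergent ?H"
    proof -
      obtain L where "\<And>i. (\<lambda>n. coord (v (r n)) i) \<longlonglongrightarrow> L i" using r(2) unfolding convergent_def by metis
      then have "?H \<longlonglongrightarrow> (\<Sum>i\<in>{- int k..int k}. L i *\<^sub>R unit_vec i)" by (intro tendsto_intros)
      then show ?thesis by (auto simp: convergent_def)
    qed
    then have "Cauchy ?H" by (rule convergent_Cauchy)
    then obtain N' where N': "\<forall>m\<ge>N'. \<forall>n\<ge>N'. dist (?H m) (?H n) < e / 4"
      using e unfolding Cauchy_def by (meson zero_less_divide_iff zero_less_numeral)
    have "dist (v (r m)) (v (r n)) < e" if "m \<ge> max N N'" "n \<ge> max N N'" for m n
    proof -
      have "r m \<ge> N" "r n \<ge> N" using that seq_suble[OF r(1), of m] seq_suble[OF r(1), of n] by auto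
      then have t: "norm (tail k (v (r m))) \<le> e / 4" "norm (tail k (v (r n))) \<le> e / 4" using N by auto
      have "v (r m) - v (r n) = (?H m - ?H n) + (tail k (v (r m)) - tail k (v (r n)))"
        using head_tail[of "v (r m)" k] head_tail[of "v (r n)" k] by (simp add: algebra_simps)
      then have "norm (v (r m) - v (r n)) \<le> norm (?H m - ?H n) + norm (tail k (v (r m)) - tail k (v (r n)))"
        by (metis norm_triangle_ineq)
      also have "\<dots> \<le> norm (?H m - ?H n) + (e / 4 + e / 4)"
        using norm_triangle_ineq4[of "tail k (v (r m))" "tail k (v (r n))"] t by simp
      also have "\<dots> < e"
      proof -
        have "norm (?H m - ?H n) < e / 4" using N' that by (simp add: dist_norm)
        then show ?thesis using e by linarith
      qed
      finally show ?thesis by (simp add: dist_norm)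
    qed
    then show "\<exists>M. \<forall>m\<ge>M. \<forall>n\<ge>M. dist (v (r m)) (v (r n)) < e" by blast
  qed
  then obtain l where "(\<lambda>n. v (r n)) \<longlonglongrightarrow> l" using Cauchy_convergent_iff convergent_def by blast
  with r(1) show ?thesis by (rule that)
qed

section \<open>Bochner spaces: coordinates and integrability\<close>

lemma ellp_finite_iff: "p \<noteq> \<infinity> \<Longrightarrow> u \<in> ellp p \<longleftrightarrow> (\<lambda>i. \<bar>u i\<bar> powr enn2real p) summable_on UNIV"
  by (simp add: ellp_def)

lemma ellp_infinity_bdd:
  assumes "u \<in> ellp \<infinity>" shows "bdd_above (range (\<lambda>i. \<bar>u i\<bar>))"
proof -
  have "bounded (range u)" using assms by (simp add: ellp_def)
  then obtain B where "\<And>i. \<bar>u i\<bar> \<le> B" by (auto simp: bounded_iff)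
  then show ?thesis by (intro bdd_aboveI2) auto
qed

lemma abs_le_ellp_norm:
  assumes u: "u \<in> ellp p" and p: "0 < p"
  shows "\<bar>u i\<bar> \<le> ellp_norm p u"
proof (cases "p = \<infinity>")
  case True
  then have "bdd_above (range (\<lambda>i. \<bar>u i\<bar>))"
    using u by (simp add: ellp_infinity_bdd)
  then have "\<bar>u i\<bar> \<le> (SUP i. \<bar>u i\<bar>)" by (rule cSUP_upper[OF UNIV_I])
  then show ?thesis using True by (simp add: ellp_norm_def)
next
  case False
  define r where "r = enn2real p"
  have r: "0 < r" using p False by (auto simp: r_def enn2real_positive_iff top.not_eq_extremum)
  have s: "(\<lambda>i. \<bar>u i\<bar> powr r) summable_on UNIV" using u False by (simp add: ellp_def r_def)
  have "\<bar>u i\<bar> powr r \<le> (\<Sum>\<^sub>\<infinity>i. \<bar>u i\<bar> powr r)"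
    using finite_sum_le_infsum[OF s, of "{i}"] by simp
  then have "(\<bar>u i\<bar> powr r) powr (1 / r) \<le> (\<Sum>\<^sub>\<infinity>i. \<bar>u i\<bar> powr r) powr (1 / r)"
    using r by (intro powr_mono2) auto
  then show ?thesis using r False by (simp add: powr_powr ellp_norm_def r_def[symmetric])
qed

lemma powr_diff_le:
  fixes a b r :: real
  assumes "0 \<le> r"
  shows "\<bar>a - b\<bar> powr r \<le> 2 powr r * (\<bar>a\<bar> powr r + \<bar>b\<bar> powr r)"
proof -
  have "\<bar>a - b\<bar> powr r \<le> (2 * max \<bar>a\<bar> \<bar>b\<bar>) powr r"
    using assms by (intro powr_mono2) auto
  also have "\<dots> = 2 powr r * (max \<bar>a\<bar> \<bar>b\<bar> powr r)" by (simp add: powr_mult)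
  also have "max \<bar>a\<bar> \<bar>b\<bar> powr r \<le> \<bar>a\<bar> powr r + \<bar>b\<bar> powr r" by (auto simp: max_def)
  finally show ?thesis by simp
qed

lemma ellp_diff:
  assumes u: "u \<in> ellp p" "v \<in> ellp p"
  shows "(\<lambda>i. u i - v i) \<in> ellp p"
proof (cases "p = \<infinity>")
  case True
  obtain B C where "\<And>i. \<bar>u i\<bar> \<le> B" "\<And>i. \<bar>v i\<bar> \<le> C"
    using u True by (auto simp: ellp_def bounded_iff)
  then have "\<bar>u i - v i\<bar> \<le> B + C" for i using abs_triangle_ineq4[of "u i" "v i"] by (meson add_mono order_trans)
  then show ?thesis using True by (auto simp: ellp_def bounded_iff intro!: exI[of _ "B + C"])
next
  case False
  have "(\<lambda>i. 2 powr enn2real p * (\<bar>u i\<bar> powr enn2real p + \<bar>v i\<bar> powr enn2real p)) summable_on UNIV"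
    using u False by (intro summable_on_cmult_right summable_on_add) (auto simp: ellp_def)
  then have "(\<lambda>i. \<bar>u i - v i\<bar> powr enn2real p) summable_on UNIV"
    by (rule summable_on_comparison_test) (use powr_diff_le[OF enn2real_nonneg] in auto)
  then show ?thesis using False by (simp add: ellp_def)
qed

lemma borel_measurable_lebesgue_AE:
  fixes f g :: "real \<Rightarrow> real"
  assumes f: "f \<in> borel_measurable lebesgue" and ae: "AE t in lebesgue. f t = g t"
  shows "g \<in> borel_measurable lebesgue"
proof (rule measurableI)
  fix U :: "real set" assume U: "U \<in> sets borel"
  have A: "f -` U \<inter> space lebesgue \<in> sets lebesgue" using f U by (rule measurable_sets)
  have ae': "AE t in lebesgue. t \<in> f -` U \<inter> space lebesgue \<longleftrightarrow> t \<in> g -` U \<inter> space lebesgue"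
    using ae by eventually_elim auto
  show "g -` U \<inter> space lebesgue \<in> sets lebesgue"
    by (rule completion.in_sets_AE[OF ae' A]) simp
qed simp

text \<open>A coordinate is bounded by the norm, so the simple functions converge in each coordinate
  almost everywhere, and completeness of Lebesgue measure removes the null set. Nonseparability of
  the bounded sequences does no harm, as only real functions are involved.\<close>

lemma bochner_L_coord_measurable:
  assumes \<psi>: "\<psi> \<in> bochner_L r p S" and S: "S \<in> sets lebesgue" and p: "0 < p"
  shows "(\<lambda>t. indicator S t * \<psi> t i) \<in> borel_measurable lebesgue"
proof -
  obtain s where s: "\<And>n. simple_function (lebesgue_on S) (s n)" "\<And>n t. t \<in> S \<Longrightarrow> s n t \<in> ellp p"
    and lim: "AE t in lebesgue_on S. (\<lambda>n. ellp_norm p (\<lambda>i. s n t i - \<psi> t i)) \<longlonglongrightarrow> 0"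
    and mem: "\<And>t. t \<in> S \<Longrightarrow> \<psi> t \<in> ellp p"
    using \<psi> unfolding bochner_L_def by blast
  have meas: "(\<lambda>t. indicator S t * s n t i) \<in> borel_measurable lebesgue" for n
  proof -
    have "simple_function (lebesgue_on S) ((\<lambda>x. x i) \<circ> s n)" by (rule simple_function_compose[OF s(1)])
    then have "(\<lambda>t. s n t i) \<in> borel_measurable (lebesgue_on S)"
      by (simp add: o_def borel_measurable_simple_function)
    then show ?thesis using S by (subst (asm) borel_measurable_restrict_space_iff) auto
  qed
  have "AE t in lebesgue. t \<in> S \<longrightarrow> (\<lambda>n. ellp_norm p (\<lambda>i. s n t i - \<psi> t i)) \<longlonglongrightarrow> 0"
    using lim S by (subst (asm) AE_restrict_space_iff) auto
  then have "AE t in lebesgue. lim (\<lambda>n. indicator S t * s n t i) = indicator S t * \<psi> t i"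
  proof eventually_elim
    case (elim t)
    have "(\<lambda>n. indicator S t * s n t i) \<longlonglongrightarrow> indicator S t * \<psi> t i"
    proof (cases "t \<in> S")
      case True
      have "(\<lambda>n. s n t i - \<psi> t i) \<longlonglongrightarrow> 0"
      proof (rule Lim_null_comparison)
        show "(\<lambda>n. ellp_norm p (\<lambda>i. s n t i - \<psi> t i)) \<longlonglongrightarrow> 0" using elim True by simp
        show "\<forall>\<^sub>F n in sequentially. norm (s n t i - \<psi> t i) \<le> ellp_norm p (\<lambda>i. s n t i - \<psi> t i)"
          using abs_le_ellp_norm[OF ellp_diff[OF s(2)[OF True] mem[OF True]] p] by (intro always_eventually) auto
      qed
      then show ?thesis using True by (simp add: LIM_zero_iff)
    qed simp
    then show ?case by (rule limI)
  qed
  with borel_measurable_lim_metric[OF meas] show ?thesis by (rule borel_measurable_lebesgue_AE)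
qed

lemma bochner_L_locD: "\<psi> \<in> bochner_L_loc r p \<Longrightarrow> \<psi> \<in> bochner_L r p {a..b}"
  unfolding bochner_L_loc_def INT_iff ball_UNIV by (elim allE)

lemma bochner_L_loc_coord_measurable:
  assumes \<psi>: "\<psi> \<in> bochner_L_loc r p" and p: "0 < p"
  shows "(\<lambda>t. \<psi> t i) \<in> borel_measurable lebesgue"
proof (rule borel_measurable_LIMSEQ_real)
  show "(\<lambda>t. indicator {- real n..real n} t * \<psi> t i) \<in> borel_measurable lebesgue" for n
  proof (rule bochner_L_coord_measurable[OF _ _ p])
    show "\<psi> \<in> bochner_L r p {- real n..real n}" using \<psi> by (rule bochner_L_locD)
  qed simp
  fix t :: real
  have "eventually (\<lambda>n. nat \<lceil>\<bar>t\<bar>\<rceil> \<le> n) sequentially" by (rule eventually_ge_at_top)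
  then have "eventually (\<lambda>n. indicator {- real n..real n} t * \<psi> t i = \<psi> t i) sequentially"
  proof eventually_elim
    case (elim n)
    then have "\<bar>t\<bar> \<le> real n" by (simp add: nat_ceiling_le_eq)
    then show ?case by (auto simp: indicator_def)
  qed
  then show "(\<lambda>n. indicator {- real n..real n} t * \<psi> t i) \<longlonglongrightarrow> \<psi> t i"
    by (rule tendsto_eventually)
qed

lemma bochner_L_loc_mem: "\<psi> \<in> bochner_L_loc r p \<Longrightarrow> \<psi> t \<in> ellp p"
proof -
  assume "\<psi> \<in> bochner_L_loc r p"
  then have "\<psi> \<in> bochner_L r p {t..t}" by (rule bochner_L_locD)
  then have "\<forall>s\<in>{t..t}. \<psi> s \<in> ellp p" unfolding bochner_L_def by (elim CollectE conjE)
  then show ?thesis by simp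
qed

lemma ellp_norm_powr:
  assumes "p \<noteq> \<infinity>" "0 < p"
  shows "ellp_norm p u powr enn2real p = (\<Sum>\<^sub>\<infinity>i. \<bar>u i\<bar> powr enn2real p)"
proof -
  define r where "r = enn2real p"
  have "0 < r" using assms by (auto simp: r_def enn2real_positive_iff top.not_eq_extremum)
  moreover have "0 \<le> (\<Sum>\<^sub>\<infinity>i. \<bar>u i\<bar> powr r)" by (intro infsum_nonneg) simp
  moreover have "ellp_norm p u = (\<Sum>\<^sub>\<infinity>i. \<bar>u i\<bar> powr r) powr (1 / r)"
    using assms(1) by (simp add: ellp_norm_def r_def)
  ultimately show ?thesis unfolding r_def[symmetric] by (simp add: powr_powr)
qed

lemma set_integrable_if_nn:
  fixes f :: "real \<Rightarrow> real"
  assumes f: "f \<in> borel_measurable lebesgue" "\<And>t. 0 \<le> f t" and S: "S \<in> sets lebesgue"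
    and fin: "(\<integral>\<^sup>+t\<in>S. ennreal (f t) \<partial>lebesgue) < \<infinity>"
  shows "set_integrable lebesgue S f"
  unfolding set_integrable_def
proof (rule integrableI_nonneg)
  show "(\<lambda>t. indicator S t *\<^sub>R f t) \<in> borel_measurable lebesgue" using f S by measurable
  show "AE t in lebesgue. 0 \<le> indicator S t *\<^sub>R f t" using f by simp
  have "(\<integral>\<^sup>+t. ennreal (indicator S t *\<^sub>R f t) \<partial>lebesgue) = (\<integral>\<^sup>+t\<in>S. ennreal (f t) \<partial>lebesgue)"
    by (intro nn_integral_cong) (auto simp: indicator_def)
  then show "(\<integral>\<^sup>+t. ennreal (indicator S t *\<^sub>R f t) \<partial>lebesgue) < \<infinity>" using fin by simp
qed

lemma bochner_L_loc_integrable: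
  assumes \<psi>: "\<psi> \<in> bochner_L_loc p p" and p: "p \<noteq> \<infinity>" "0 < p"
  shows "set_integrable lebesgue {a..b} (\<lambda>t. \<Sum>\<^sub>\<infinity>i. \<bar>\<psi> t i\<bar> powr enn2real p)"
proof (rule set_integrable_if_nn)
  have m: "(\<lambda>t. \<psi> t i) \<in> borel_measurable lebesgue" for i
    by (rule bochner_L_loc_coord_measurable[OF \<psi> p(2)])
  show "(\<lambda>t. \<Sum>\<^sub>\<infinity>i. \<bar>\<psi> t i\<bar> powr enn2real p) \<in> borel_measurable lebesgue"
  proof (rule infsum_measurable)
    show "(\<lambda>t. \<bar>\<psi> t i\<bar> powr enn2real p) \<in> borel_measurable lebesgue" for i using m by measurable
    show "(\<lambda>i. \<bar>\<psi> t i\<bar> powr enn2real p) summable_on UNIV" for t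
      using bochner_L_loc_mem[OF \<psi>] p(1) by (simp add: ellp_finite_iff)
  qed
  have "\<psi> \<in> bochner_L p p {a..b}" using \<psi> by (rule bochner_L_locD)
  then have "(\<integral>\<^sup>+t. ennreal (ellp_norm p (\<psi> t) powr enn2real p) \<partial>lebesgue_on {a..b}) < \<infinity>"
    using p by (auto simp: bochner_L_def)
  then show "(\<integral>\<^sup>+t\<in>{a..b}. ennreal (\<Sum>\<^sub>\<infinity>i. \<bar>\<psi> t i\<bar> powr enn2real p) \<partial>lebesgue) < \<infinity>"
    using p by (simp add: nn_integral_restrict_space ellp_norm_powr)
qed (auto intro: infsum_nonneg)

text \<open>One constant and one null set serve all coordinates. Taking \<open>max 0 C\<close> makes
  the constant nonnegative even when \<open>S\<close> is a null set.\<close>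

lemma bochner_L_infinity_AE_bound:
  assumes "\<psi> \<in> bochner_L \<infinity> \<infinity> S" "S \<in> sets lebesgue"
  obtains C where "0 \<le> C" "AE t in lebesgue. t \<in> S \<longrightarrow> (\<forall>i. \<bar>\<psi> t i\<bar> \<le> C)"
proof -
  have ex: "\<exists>C. AE t in lebesgue_on S. ellp_norm \<infinity> (\<psi> t) \<le> C" and "\<forall>t\<in>S. \<psi> t \<in> ellp \<infinity>"
    using assms(1) unfolding bochner_L_def mem_Collect_eq if_P[OF refl] by blast+
  then have mem: "\<psi> t \<in> ellp \<infinity>" if "t \<in> S" for t using that by blast
  from ex obtain C where C: "AE t in lebesgue_on S. ellp_norm \<infinity> (\<psi> t) \<le> C" ..
  have "AE t in lebesgue. t \<in> S \<longrightarrow> ellp_norm \<infinity> (\<psi> t) \<le> C"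
    using C assms(2) by (subst (asm) AE_restrict_space_iff) auto
  then have "AE t in lebesgue. t \<in> S \<longrightarrow> (\<forall>i. \<bar>\<psi> t i\<bar> \<le> max 0 C)"
  proof eventually_elim
    case (elim t)
    have "\<bar>\<psi> t i\<bar> \<le> max 0 C" if "t \<in> S" for i
      using abs_le_ellp_norm[OF mem[OF that], of i] elim that by simp
    then show ?case by blast
  qed
  then show ?thesis by (intro that[of "max 0 C"]) auto
qed

text \<open>A reflection of the integral over a right half-line; the change of variables is made for
  the Borel measure and carried over to its completion.\<close>

lemma exp_integrable_atMost:
  assumes "0 < (c :: real)" shows "set_integrable lebesgue {..b} (\<lambda>s. exp (c * s))"
proof -
  have "set_integrable lebesgue {-b..} (\<lambda>s. exp (- c * s))"
    by (intro nonnegative_absolutely_integrable_1 integrable_on_exp_minus_to_infinity assms) auto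
  then have "integrable lborel (\<lambda>s. indicator {-b..} s *\<^sub>R exp (- c * s))"
    unfolding set_integrable_def
    by (rule iffD1[OF integrable_completion, rotated]) (auto intro!: borel_measurable_continuous_on_indicator continuous_intros)
  from lborel_integrable_real_affine[OF this, of "-1" 0]
  have "integrable lborel (\<lambda>s. indicator {-b..} (- s) *\<^sub>R exp (c * s))" by simp
  also have "(\<lambda>s. indicator {-b..} (- s) *\<^sub>R exp (c * s)) = (\<lambda>s. indicator {..b} s *\<^sub>R exp (c * s))"
    by (auto simp: fun_eq_iff indicator_def)
  finally show ?thesis unfolding set_integrable_def
    by (rule iffD2[OF integrable_completion, rotated]) (auto intro!: borel_measurable_continuous_on_indicator continuous_intros)
qed

section \<open>Energy estimates for the lattice equation\<close>

text \<open>Two cases replace the usual convexity argument. Either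
  \<open>a \<le> \<delta> * X powr e\<close>, and the left side is at most
  \<open>\<delta> * X powr q\<close>; or \<open>X powr e < a / \<delta>\<close>, and the left side
  is bounded by a power of \<open>a\<close> alone, with the constant
  \<open>\<delta> powr (1 - q / e)\<close>.\<close>

lemma young_powr:
  fixes a X q e \<delta> :: real
  assumes "0 \<le> a" "0 \<le> X" "0 < e" "e \<le> q" "0 < \<delta>"
  shows "a * X powr (q - e) \<le> \<delta> * X powr q + \<delta> powr (1 - q / e) * a powr (q / e)"
proof (cases "X = 0")
  case True
  then show ?thesis by simp
next
  case False
  then have X: "0 < X" using assms by simp
  show ?thesis
  proof (cases "a \<le> \<delta> * X powr e")
    case True
    then have "a * X powr (q - e) \<le> \<delta> * X powr e * X powr (q - e)" by (intro mult_right_mono) auto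
    also have "\<dots> = \<delta> * X powr q" using X by (simp add: powr_add[symmetric])
    finally show ?thesis by (simp add: add_increasing2)
  next
    case False
    then have le: "X powr e < a / \<delta>" using assms by (simp add: field_simps)
    then have a: "0 < a / \<delta>" by (rule le_less_trans[rotated]) simp
    then have a0: "0 < a" using assms by (simp add: zero_less_divide_iff)
    have "X powr (q - e) = (X powr e) powr ((q - e) / e)" using assms by (simp add: powr_powr)
    also have "\<dots> \<le> (a / \<delta>) powr ((q - e) / e)"
      using le assms by (intro powr_mono2) auto
    finally have "a * X powr (q - e) \<le> a * (a / \<delta>) powr ((q - e) / e)" using a0 by simp
    also have "(q - e) / e = q / e - 1" using assms by (simp add: diff_divide_distrib)
    also have "(a / \<delta>) powr (q / e - 1) = a powr (q / e - 1) * \<delta> powr (1 - q / e)"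
    proof -
      have "(a / \<delta>) powr (q / e - 1) = a powr (q / e - 1) / \<delta> powr (q / e - 1)"
        by (rule powr_divide)
      then show ?thesis using powr_minus[of \<delta> "q / e - 1"] by (simp add: divide_inverse)
    qed
    also have "a * (a powr (q / e - 1) * \<delta> powr (1 - q / e)) = \<delta> powr (1 - q / e) * a powr (q / e)"
      using powr_mult_base[of a "q / e - 1"] a0 by (simp add: mult_ac)
    finally show ?thesis using assms by (simp add: add_increasing)
  qed
qed

lemma weighted_am_gm:
  fixes x y \<mu> :: real
  assumes "0 < \<mu>" shows "2 * x * y \<le> \<mu> * x\<^sup>2 + y\<^sup>2 / \<mu>"
proof -
  have "0 \<le> (\<mu> * x - y)\<^sup>2 / \<mu>" using assms by simp
  also have "\<dots> = \<mu> * x\<^sup>2 + y\<^sup>2 / \<mu> - 2 * x * y" using assms by (simp add: power2_eq_square field_simps)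
  finally show ?thesis by simp
qed

text \<open>\<open>v\<close> may belong to another site than \<open>u\<close>. With \<open>X\<close>
  the larger of the two moduli, the product of the powers is at most
  \<open>X powr (q - \<epsilon>)\<close>, and the missing exponent \<open>\<epsilon>\<close> is
  traded for the power \<open>q / \<epsilon>\<close> of \<open>a1\<close>.\<close>

lemma growth_bound:
  fixes u v \<phi> a1 a2 q \<epsilon> \<delta> \<mu> :: real
  assumes "0 < \<epsilon>" "0 < q - 1 - \<epsilon>" "0 < \<delta>" "0 < \<mu>" "\<bar>\<phi>\<bar> \<le> a1 * \<bar>u\<bar> powr (q - 1 - \<epsilon>) + a2"
  shows "\<bar>\<phi>\<bar> * \<bar>v\<bar> \<le> \<delta> * (\<bar>u\<bar> powr q + \<bar>v\<bar> powr q) + \<delta> powr (1 - q / \<epsilon>) * \<bar>a1\<bar> powr (q / \<epsilon>) + \<mu> * v\<^sup>2 + a2\<^sup>2 / \<mu>"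
proof -
  define X where "X = max \<bar>u\<bar> \<bar>v\<bar>"
  have X: "0 \<le> X" "\<bar>u\<bar> \<le> X" "\<bar>v\<bar> \<le> X" by (auto simp: X_def)
  have "\<bar>u\<bar> powr (q - 1 - \<epsilon>) * \<bar>v\<bar> \<le> X powr (q - 1 - \<epsilon>) * X"
    using X assms by (intro mult_mono powr_mono2) auto
  also have "\<dots> = X powr (q - \<epsilon>)" using X powr_mult_base[of X "q - 1 - \<epsilon>"] by (simp add: mult.commute)
  finally have uv: "\<bar>u\<bar> powr (q - 1 - \<epsilon>) * \<bar>v\<bar> \<le> X powr (q - \<epsilon>)" .
  have Xq: "X powr q \<le> \<bar>u\<bar> powr q + \<bar>v\<bar> powr q" by (auto simp: X_def max_def)
  have "a1 * \<bar>u\<bar> powr (q - 1 - \<epsilon>) \<le> \<bar>a1\<bar> * \<bar>u\<bar> powr (q - 1 - \<epsilon>)" by (intro mult_right_mono) auto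
  then have "\<bar>\<phi>\<bar> \<le> \<bar>a1\<bar> * \<bar>u\<bar> powr (q - 1 - \<epsilon>) + \<bar>a2\<bar>" using assms(5) abs_ge_self[of a2] by linarith
  then have "\<bar>\<phi>\<bar> * \<bar>v\<bar> \<le> (\<bar>a1\<bar> * \<bar>u\<bar> powr (q - 1 - \<epsilon>) + \<bar>a2\<bar>) * \<bar>v\<bar>" by (intro mult_right_mono) auto
  also have "\<dots> = \<bar>a1\<bar> * (\<bar>u\<bar> powr (q - 1 - \<epsilon>) * \<bar>v\<bar>) + \<bar>a2\<bar> * \<bar>v\<bar>" by (simp add: algebra_simps)
  also have "\<dots> \<le> \<bar>a1\<bar> * X powr (q - \<epsilon>) + \<bar>a2\<bar> * \<bar>v\<bar>" using uv by (intro add_mono mult_left_mono) auto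
  also have "\<dots> \<le> (\<delta> * X powr q + \<delta> powr (1 - q / \<epsilon>) * \<bar>a1\<bar> powr (q / \<epsilon>)) + (\<mu> * v\<^sup>2 + a2\<^sup>2 / \<mu>)"
  proof (intro add_mono)
    show "\<bar>a1\<bar> * X powr (q - \<epsilon>) \<le> \<delta> * X powr q + \<delta> powr (1 - q / \<epsilon>) * \<bar>a1\<bar> powr (q / \<epsilon>)"
      using assms X by (intro young_powr) auto
    have "2 * \<bar>v\<bar> * \<bar>a2\<bar> \<le> \<mu> * \<bar>v\<bar>\<^sup>2 + \<bar>a2\<bar>\<^sup>2 / \<mu>" using assms by (intro weighted_am_gm) auto
    then have "2 * (\<bar>a2\<bar> * \<bar>v\<bar>) \<le> \<mu> * v\<^sup>2 + a2\<^sup>2 / \<mu>" by (simp add: mult_ac)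
    moreover have "0 \<le> \<bar>a2\<bar> * \<bar>v\<bar>" by simp
    ultimately show "\<bar>a2\<bar> * \<bar>v\<bar> \<le> \<mu> * v\<^sup>2 + a2\<^sup>2 / \<mu>" by linarith
  qed
  also have "\<dots> \<le> (\<delta> * (\<bar>u\<bar> powr q + \<bar>v\<bar> powr q) + \<delta> powr (1 - q / \<epsilon>) * \<bar>a1\<bar> powr (q / \<epsilon>)) + (\<mu> * v\<^sup>2 + a2\<^sup>2 / \<mu>)"
    using Xq assms by (intro add_mono mult_left_mono) auto
  finally show ?thesis by simp
qed

text \<open>The left side is the tested term of the squared Laplacian at one site. The Laplacian of
  the weighted sequence is \<open>r * w + e\<close>, where \<open>w\<close> is the Laplacian of
  \<open>v\<close> and \<open>e\<close> a commutator of relative size \<open>\<kappa>\<close>; the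
  term \<open>- 2 * r * w\<^sup>2\<close> absorbs the part of the mixed product that contains
  \<open>w\<close>.\<close>

lemma weighted_lap_bound:
  fixes r rm rp v vm vp \<kappa> :: real
  assumes "0 \<le> r" "\<bar>r - rm\<bar> \<le> \<kappa> * r" "\<bar>r - rp\<bar> \<le> \<kappa> * r"
  shows "- 2 * (2 * (r * v) - rm * vm - rp * vp) * (2 * v - vm - vp) \<le> r * (\<kappa>\<^sup>2 * (vm\<^sup>2 + vp\<^sup>2))"
proof -
  define w where "w = 2 * v - vm - vp"
  define e where "e = (r - rm) * vm + (r - rp) * vp"
  have "\<bar>e\<bar> \<le> \<bar>r - rm\<bar> * \<bar>vm\<bar> + \<bar>r - rp\<bar> * \<bar>vp\<bar>" unfolding e_def abs_mult[symmetric] by (rule abs_triangle_ineq)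
  also have "\<dots> \<le> \<kappa> * r * \<bar>vm\<bar> + \<kappa> * r * \<bar>vp\<bar>" using assms by (intro add_mono mult_right_mono) auto
  finally have e: "\<bar>e\<bar> \<le> r * (\<kappa> * (\<bar>vm\<bar> + \<bar>vp\<bar>))" by (simp add: algebra_simps)
  have "- 2 * e * w \<le> 2 * (\<bar>e\<bar> * \<bar>w\<bar>)" using abs_ge_minus_self[of "e * w"] by (simp add: abs_mult)
  also have "\<dots> \<le> 2 * (r * (\<kappa> * (\<bar>vm\<bar> + \<bar>vp\<bar>)) * \<bar>w\<bar>)" using e by (intro mult_left_mono mult_right_mono) auto
  also have "\<dots> = r * (2 * \<bar>w\<bar> * (\<kappa> * (\<bar>vm\<bar> + \<bar>vp\<bar>)))" by (simp add: algebra_simps)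
  also have "\<dots> \<le> r * (2 * w\<^sup>2 + (\<kappa> * (\<bar>vm\<bar> + \<bar>vp\<bar>))\<^sup>2 / 2)"
    using weighted_am_gm[of 2 "\<bar>w\<bar>" "\<kappa> * (\<bar>vm\<bar> + \<bar>vp\<bar>)"] assms(1) by (intro mult_left_mono) auto
  also have "\<dots> \<le> r * (2 * w\<^sup>2 + \<kappa>\<^sup>2 * (vm\<^sup>2 + vp\<^sup>2))"
  proof -
    have "(\<bar>vm\<bar> + \<bar>vp\<bar>)\<^sup>2 \<le> 2 * (vm\<^sup>2 + vp\<^sup>2)"
      using sum_squares_bound[of "\<bar>vm\<bar>" "\<bar>vp\<bar>"] by (simp add: power2_sum)
    from mult_left_mono[OF this, of "\<kappa>\<^sup>2"]
    have "\<kappa>\<^sup>2 * (\<bar>vm\<bar> + \<bar>vp\<bar>)\<^sup>2 \<le> 2 * (\<kappa>\<^sup>2 * (vm\<^sup>2 + vp\<^sup>2))" by (simp only: mult.left_commute[of "\<kappa>\<^sup>2" 2] zero_le_power2 simp_thms)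
    then have "(\<kappa> * (\<bar>vm\<bar> + \<bar>vp\<bar>))\<^sup>2 / 2 \<le> \<kappa>\<^sup>2 * (vm\<^sup>2 + vp\<^sup>2)" unfolding power_mult_distrib by linarith
    then show ?thesis using assms(1) by (intro mult_left_mono add_left_mono)
  qed
  finally have "- 2 * e * w \<le> 2 * r * w\<^sup>2 + r * (\<kappa>\<^sup>2 * (vm\<^sup>2 + vp\<^sup>2))" by (simp add: algebra_simps)
  moreover have "2 * (r * v) - rm * vm - rp * vp = r * w + e" by (simp add: w_def e_def algebra_simps)
  ultimately show ?thesis unfolding w_def[symmetric] by (simp add: algebra_simps power2_eq_square)
qed

section \<open>The lattice equation along a deterministic noise path\<close>

locale lattice_equation =
  fixes lam lam0 lam1 q \<epsilon> \<beta> :: real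
    and f :: "ell2 \<Rightarrow> ell2" and fi :: "int \<Rightarrow> real \<Rightarrow> real"
    and \<gamma> :: "real \<Rightarrow> real" and \<alpha>1 \<alpha>2 :: "int \<Rightarrow> real"
    and g :: "real \<Rightarrow> ell2 \<Rightarrow> ell2" and gi :: "int \<Rightarrow> real \<Rightarrow> real \<Rightarrow> real"
    and \<psi>1 \<psi>2 \<psi>3 \<psi>4 :: "real \<Rightarrow> int \<Rightarrow> real"
    and h h' :: "real \<Rightarrow> ell2"
  assumes lam: "0 < lam1" "lam1 < lam0" "lam0 < lam"
    and q: "q > 2" and eps: "\<epsilon> > 0" "q - 1 - \<epsilon> > 0"
    and \<alpha>1: "\<alpha>1 \<in> ellp 1" and \<alpha>2: "\<alpha>2 \<in> ellp 1"
    and coord_f: "\<forall>u i. coord (f u) i = fi i (coord u i)"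
    and \<gamma>_nonneg: "\<forall>R\<ge>0. \<gamma> R \<ge> 0"
    and fi_lipschitz: "\<forall>R\<ge>0. \<forall>i a b. \<bar>a\<bar> \<le> R \<and> \<bar>b\<bar> \<le> R \<longrightarrow> \<bar>fi i a - fi i b\<bar> \<le> \<gamma> R * \<bar>a - b\<bar>"
    and fi_growth: "\<forall>i a. \<bar>fi i a\<bar> \<le> \<alpha>1 i * \<bar>a\<bar> powr (q - 1 - \<epsilon>) + \<alpha>2 i"
    and coord_g: "\<forall>t u i. coord (g t u) i = gi i t (coord u i)"
    and gi_cont: "\<forall>i. continuous_on UNIV (\<lambda>(t, a). gi i t a)"
    and gi_diff: "\<forall>i t a. gi i t differentiable at a"
    and beta: "\<beta> > 0"
    and gi_diss: "\<forall>i t a. gi i t a * a \<le> - \<beta> * \<bar>a\<bar> powr q + \<psi>1 t i"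
    and gi_deriv: "\<forall>i t a. deriv (gi i t) a \<le> \<psi>2 t i"
    and gi_growth: "\<forall>i t a. \<bar>gi i t a\<bar> \<le> \<psi>3 t i * \<bar>a\<bar> powr (q - 1) + \<psi>4 t i"
    and \<psi>1: "\<psi>1 \<in> bochner_L_loc 1 1" and \<psi>2: "\<psi>2 \<in> bochner_L_loc \<infinity> \<infinity>"
    and \<psi>3: "\<psi>3 \<in> bochner_L_loc \<infinity> \<infinity>" and \<psi>4: "\<psi>4 \<in> bochner_L_loc 2 2"
    and \<psi>_tail: "(\<integral>\<^sup>+s\<in>{..0}. ennreal (exp (lam1 * s) *
          (ellp_norm 1 (\<psi>1 s) + (ellp_norm 2 (\<psi>4 s))\<^sup>2)) \<partial>lebesgue) < \<infinity>"
    and \<psi>3_tail: "\<psi>3 \<in> bochner_L \<infinity> \<infinity> {..0}"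
    and h_ellp: "\<forall>t. coord (h t) \<in> ellp (ennreal q)"
    and h_deriv: "\<forall>t. (h has_vector_derivative h' t) (at t)"
    and h_loc: "(\<lambda>t. coord (h t)) \<in> bochner_L_loc 2 2"
    and h_locq: "(\<lambda>t. coord (h t)) \<in> bochner_L_loc (ennreal q) (ennreal q)"
    and h'_loc: "(\<lambda>t. coord (h' t)) \<in> bochner_L_loc 2 2"
    and h_tail: "(\<integral>\<^sup>+s\<in>{..0}. ennreal (exp (lam1 * s) *
          ((norm (h s))\<^sup>2 + ellp_norm (ennreal q) (coord (h s)) powr q + (norm (h' s))\<^sup>2))
          \<partial>lebesgue) < \<infinity>"
begin

definition forcing :: "real \<Rightarrow> ell2" where
  "forcing t = - lap (lap (h t)) + (1 - lam) *\<^sub>R h t - h' t"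

text \<open>The value of the noise is a free real argument, so that solutions along different paths
  can be compared and a path can be replaced by polynomials.\<close>

definition field :: "real \<Rightarrow> real \<Rightarrow> ell2 \<Rightarrow> ell2" where
  "field t z v = - lap (lap v) - lam *\<^sub>R v - lap (f (v + z *\<^sub>R h t)) + g t (v + z *\<^sub>R h t) + z *\<^sub>R forcing t"

lemma random_field_eq: "random_field lam f g h h' t \<omega> v = field t (ou (shift t \<omega>)) v"
  by (simp add: random_field_def field_def forcing_def Let_def)

text \<open>What the energy estimate leaves at site \<open>i\<close> when all terms with the unknown
  are absorbed. The exponents \<open>q / \<epsilon>\<close> for \<open>\<alpha>1\<close> and
  \<open>q\<close> for the product of \<open>\<psi>3\<close> and \<open>h\<close> are those produced
  by \<open>young_powr\<close>.\<close>

definition source :: "real \<Rightarrow> int \<Rightarrow> real" where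
  "source t i = \<bar>\<alpha>1 i\<bar> powr (q / \<epsilon>) + (\<alpha>2 i)\<^sup>2 + \<psi>1 t i + (\<psi>4 t i)\<^sup>2 + \<bar>coord (h t) i\<bar> powr q
     + (\<bar>\<psi>3 t i\<bar> * \<bar>coord (h t) i\<bar>) powr q + (coord (h t) i)\<^sup>2 + (coord (forcing t) i)\<^sup>2"

text \<open>\<open>\<delta>\<close> and \<open>\<mu>\<close> are the parameters in Young's inequality for the \<open>q\<close>-th powers and the squares, and
  \<open>1 + \<kappa>\<close> bounds the ratio of neighbouring weights; they are small enough for all the errors to be
  absorbed by \<open>\<beta> \<bar>u\<^sub>i\<bar>\<^sup>q\<close> and \<open>(2 \<lambda> - \<lambda>\<^sub>0) v\<^sub>i\<^sup>2\<close>.\<close>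

definition \<delta> :: real where "\<delta> = \<beta> / (7 + 10 * 2 powr q)"
definition \<mu> :: real where "\<mu> = lam / 50"
definition \<kappa> :: real where "\<kappa> = min 1 (lam / 50)"
text \<open>A sum of nonnegative numbers, one for each of the eight summands of
  \<open>source\<close>; it dominates every coefficient with which such a summand arises in
  \<open>local_energy\<close>.\<close>

definition C0 :: real where
  "C0 = 12 * \<delta> powr (1 - q / \<epsilon>) + 12 / \<mu> + 20 * \<delta> * 2 powr q + 2 + 2 * \<delta> powr (1 - q) + 2 + 2 + 1 / \<mu>"

text \<open>Neighbouring weights are compared relative to the weight itself, so that commutator
  errors again carry the factor \<open>\<rho> i\<close>. An absolute bound on the differences would
  not be absorbed where the weight is small.\<close>

definition slowly_varying :: "(int \<Rightarrow> real) \<Rightarrow> bool" where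
  "slowly_varying \<rho> \<longleftrightarrow> (\<forall>i. 0 < \<rho> i \<and> \<rho> i \<le> 1 \<and> \<rho> (i + 1) \<le> (1 + \<kappa>) * \<rho> i \<and> \<rho> i \<le> (1 + \<kappa>) * \<rho> (i + 1))"

lemma const_pos: "0 < \<delta>" "0 < \<mu>" "0 < \<kappa>" "\<kappa> \<le> 1" "\<kappa>\<^sup>2 \<le> lam / 50" "0 < C0" "0 < lam"
proof -
  show l: "0 < lam" using lam by simp
  show d: "0 < \<delta>" unfolding \<delta>_def using beta by (intro divide_pos_pos add_pos_pos) auto
  show m: "0 < \<mu>" using l by (simp add: \<mu>_def)
  show k: "0 < \<kappa>" "\<kappa> \<le> 1" using l by (auto simp: \<kappa>_def)
  have "\<kappa>\<^sup>2 \<le> \<kappa> * 1" unfolding power2_eq_square using k by (intro mult_left_mono) auto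
  also have "\<dots> \<le> lam / 50" by (simp add: \<kappa>_def)
  finally show "\<kappa>\<^sup>2 \<le> lam / 50" .
  show "0 < C0" unfolding C0_def using d m by (intro add_pos_pos add_pos_nonneg add_nonneg_pos) auto
qed

text \<open>\<open>site\<close> collects the errors that the discrete Laplacian moves to neighbouring sites. Neighbouring
  weights differ by a factor of at most 2, so four times the term at a site pays for both neighbours.\<close>

definition site :: "real \<Rightarrow> real \<Rightarrow> real \<Rightarrow> real" where
  "site z hh v = 4 * (\<delta> * (2 powr q * (\<bar>v + z * hh\<bar> powr q + \<bar>z\<bar> powr q * \<bar>hh\<bar> powr q)) + \<mu> * v\<^sup>2) + \<kappa>\<^sup>2 * v\<^sup>2"

lemma site_nonneg: "0 \<le> site z hh v"
  unfolding site_def using const_pos by (intro add_nonneg_nonneg mult_nonneg_nonneg) auto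

lemma powr_v_le: "\<bar>v\<bar> powr q \<le> 2 powr q * (\<bar>v + z * hh\<bar> powr q + \<bar>z\<bar> powr q * \<bar>hh\<bar> powr q)"
  using powr_diff_le[of q "v + z * hh" "z * hh"] q by (simp add: abs_mult powr_mult)

text \<open>As \<open>q > 2\<close>, squares of the noise fit under the single factor
  \<open>1 + \<bar>z\<bar> powr q\<close> that is kept in all estimates.\<close>

lemma z_square_le: "z\<^sup>2 \<le> 1 + \<bar>z\<bar> powr q"
proof (cases "\<bar>z\<bar> \<le> 1")
  case True
  then have "z\<^sup>2 \<le> 1" by (simp add: abs_square_le_1)
  then show ?thesis by (simp add: add_increasing2)
next
  case False
  then have "\<bar>z\<bar> powr 2 \<le> \<bar>z\<bar> powr q" using q by (intro powr_mono) auto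
  then show ?thesis using False by (simp add: powr_numeral)
qed

text \<open>The damping is available for \<open>u = v + z h\<close>, but the test function is
  \<open>v = u - z h\<close>. The extra product of \<open>z h\<close> with \<open>gi\<close> is
  bounded by its growth: \<open>young_powr\<close> treats the part with \<open>\<psi>3\<close> at
  the cost of a small multiple of the damping, a sum of squares the part with
  \<open>\<psi>4\<close>.\<close>

lemma local_g_bound:
  "2 * v * gi i t (v + z * coord (h t) i) \<le> (2 * \<delta> - 2 * \<beta>) * \<bar>v + z * coord (h t) i\<bar> powr q + 2 * \<psi>1 t i
     + 2 * \<delta> powr (1 - q) * (\<bar>z\<bar> powr q * (\<bar>\<psi>3 t i\<bar> * \<bar>coord (h t) i\<bar>) powr q) + (\<psi>4 t i)\<^sup>2 + z\<^sup>2 * (coord (h t) i)\<^sup>2"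
proof -
  define hh u G where "hh = coord (h t) i" and "u = v + z * hh" and "G = gi i t u"
  have 1: "G * u \<le> - \<beta> * \<bar>u\<bar> powr q + \<psi>1 t i" using gi_diss by (simp add: G_def)
  have "\<bar>G\<bar> \<le> \<psi>3 t i * \<bar>u\<bar> powr (q - 1) + \<psi>4 t i" using gi_growth by (simp add: G_def)
  also have "\<dots> \<le> \<bar>\<psi>3 t i\<bar> * \<bar>u\<bar> powr (q - 1) + \<bar>\<psi>4 t i\<bar>" by (intro add_mono mult_right_mono) auto
  finally have "\<bar>z * hh\<bar> * \<bar>G\<bar> \<le> \<bar>z * hh\<bar> * (\<bar>\<psi>3 t i\<bar> * \<bar>u\<bar> powr (q - 1) + \<bar>\<psi>4 t i\<bar>)" by (intro mult_left_mono) auto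
  also have "\<dots> = (\<bar>\<psi>3 t i\<bar> * \<bar>z * hh\<bar>) * \<bar>u\<bar> powr (q - 1) + \<bar>z * hh\<bar> * \<bar>\<psi>4 t i\<bar>" by (simp add: algebra_simps)
  also have "(\<bar>\<psi>3 t i\<bar> * \<bar>z * hh\<bar>) * \<bar>u\<bar> powr (q - 1) \<le> \<delta> * \<bar>u\<bar> powr q + \<delta> powr (1 - q / 1) * (\<bar>\<psi>3 t i\<bar> * \<bar>z * hh\<bar>) powr (q / 1)"
    using const_pos q by (intro young_powr) auto
  also have "(\<bar>\<psi>3 t i\<bar> * \<bar>z * hh\<bar>) powr (q / 1) = \<bar>z\<bar> powr q * (\<bar>\<psi>3 t i\<bar> * \<bar>hh\<bar>) powr q"
    by (simp add: abs_mult powr_mult mult_ac)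
  finally have 2: "\<bar>z * hh\<bar> * \<bar>G\<bar> \<le> \<delta> * \<bar>u\<bar> powr q + \<delta> powr (1 - q) * (\<bar>z\<bar> powr q * (\<bar>\<psi>3 t i\<bar> * \<bar>hh\<bar>) powr q) + \<bar>z * hh\<bar> * \<bar>\<psi>4 t i\<bar>"
    by simp
  have 3: "2 * (\<bar>z * hh\<bar> * \<bar>\<psi>4 t i\<bar>) \<le> z\<^sup>2 * hh\<^sup>2 + (\<psi>4 t i)\<^sup>2"
    using sum_squares_bound[of "\<bar>z * hh\<bar>" "\<bar>\<psi>4 t i\<bar>"] by (simp add: power_mult_distrib mult_ac)
  have "2 * v * G = 2 * (G * u) + 2 * (- ((z * hh) * G))" by (simp add: u_def algebra_simps)
  also have "\<dots> \<le> 2 * (- \<beta> * \<bar>u\<bar> powr q + \<psi>1 t i) + 2 * (\<bar>z * hh\<bar> * \<bar>G\<bar>)"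
    using 1 abs_ge_minus_self[of "(z * hh) * G"] by (intro add_mono mult_left_mono) (auto simp: abs_mult)
  also have "\<dots> \<le> 2 * (- \<beta> * \<bar>u\<bar> powr q + \<psi>1 t i) + 2 * (\<delta> * \<bar>u\<bar> powr q + \<delta> powr (1 - q) * (\<bar>z\<bar> powr q * (\<bar>\<psi>3 t i\<bar> * \<bar>hh\<bar>) powr q) + \<bar>z * hh\<bar> * \<bar>\<psi>4 t i\<bar>)"
    using 2 by (intro add_left_mono mult_left_mono) auto
  also have "\<dots> \<le> 2 * (- \<beta> * \<bar>u\<bar> powr q + \<psi>1 t i) + (2 * (\<delta> * \<bar>u\<bar> powr q + \<delta> powr (1 - q) * (\<bar>z\<bar> powr q * (\<bar>\<psi>3 t i\<bar> * \<bar>hh\<bar>) powr q)) + (z\<^sup>2 * hh\<^sup>2 + (\<psi>4 t i)\<^sup>2))"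
    using 3 by (simp add: distrib_left)
  finally have "2 * v * G \<le> 2 * (- \<beta> * \<bar>u\<bar> powr q + \<psi>1 t i) + (2 * (\<delta> * \<bar>u\<bar> powr q + \<delta> powr (1 - q) * (\<bar>z\<bar> powr q * (\<bar>\<psi>3 t i\<bar> * \<bar>hh\<bar>) powr q)) + (z\<^sup>2 * hh\<^sup>2 + (\<psi>4 t i)\<^sup>2))" .
  then show ?thesis unfolding G_def u_def hh_def by (simp add: algebra_simps)
qed

text \<open>Here \<open>r\<close>, \<open>rm\<close>, \<open>rp\<close> are the weights at a site
  and its neighbours, and \<open>d\<close> is the Laplacian of the weighted solution there. The
  product \<open>d * \<phi>\<close> contains \<open>vm\<close> and \<open>vp\<close>;
  \<open>powr_v_le\<close> converts their powers into those of the damped quantities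
  \<open>vm + z * hm\<close> and \<open>vp + z * hp\<close>, which make up the \<open>site\<close>
  terms of the neighbours.\<close>

lemma local_energy:
  assumes r: "0 \<le> r" "\<bar>r - rm\<bar> \<le> \<kappa> * r" "\<bar>r - rp\<bar> \<le> \<kappa> * r"
    and \<phi>: "\<phi> = fi i (v + z * coord (h t) i)" and G: "G = gi i t (v + z * coord (h t) i)"
    and m: "m = coord (forcing t) i" and d: "d = 2 * (r * v) - rm * vm - rp * vp"
  shows "- 2 * d * (2 * v - vm - vp) - (2 * lam - lam0) * (r * v * v) - 2 * d * \<phi> + 2 * (r * v * G) + 2 * z * (r * v * m)
    \<le> r * (C0 * (1 + \<bar>z\<bar> powr q) * source t i - 4 * site z (coord (h t) i) v + site z hm vm + site z hp vp)"
proof -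
  define hh u where "hh = coord (h t) i" and "u = v + z * hh"
  let ?A = "\<delta> powr (1 - q / \<epsilon>) * \<bar>\<alpha>1 i\<bar> powr (q / \<epsilon>)"
  have A: "- 2 * d * (2 * v - vm - vp) \<le> r * (\<kappa>\<^sup>2 * (vm\<^sup>2 + vp\<^sup>2))"
    unfolding d by (rule weighted_lap_bound[OF r])
  have rr: "0 \<le> rm" "rm \<le> 2 * r" "0 \<le> rp" "rp \<le> 2 * r"
    using r mult_right_mono[OF const_pos(4) r(1)] by linarith+
  have "\<bar>d\<bar> \<le> 2 * (r * \<bar>v\<bar>) + rm * \<bar>vm\<bar> + rp * \<bar>vp\<bar>"
    unfolding d using abs_triangle_ineq4[of "2 * (r * v) - rm * vm" "rp * vp"] abs_triangle_ineq4[of "2 * (r * v)" "rm * vm"] r rr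
    by (simp add: abs_mult)
  also have "\<dots> \<le> 2 * r * \<bar>v\<bar> + 2 * r * \<bar>vm\<bar> + 2 * r * \<bar>vp\<bar>"
    using rr by (intro add_mono mult_right_mono) auto
  finally have "\<bar>d\<bar> * \<bar>\<phi>\<bar> \<le> (2 * r * \<bar>v\<bar> + 2 * r * \<bar>vm\<bar> + 2 * r * \<bar>vp\<bar>) * \<bar>\<phi>\<bar>" by (intro mult_right_mono) auto
  then have "- 2 * d * \<phi> \<le> 2 * ((2 * r * \<bar>v\<bar> + 2 * r * \<bar>vm\<bar> + 2 * r * \<bar>vp\<bar>) * \<bar>\<phi>\<bar>)"
    using abs_ge_minus_self[of "d * \<phi>"] unfolding abs_mult mult.assoc[of "- 2" d \<phi>] by linarith
  also have "\<dots> = r * (4 * (\<bar>\<phi>\<bar> * \<bar>v\<bar> + \<bar>\<phi>\<bar> * \<bar>vm\<bar> + \<bar>\<phi>\<bar> * \<bar>vp\<bar>))" by (simp add: algebra_simps)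
  also have "\<dots> \<le> r * (4 * ((\<delta> * (\<bar>u\<bar> powr q + (2 powr q * (\<bar>v + z * hh\<bar> powr q + \<bar>z\<bar> powr q * \<bar>hh\<bar> powr q))) + ?A + \<mu> * v\<^sup>2 + (\<alpha>2 i)\<^sup>2 / \<mu>)
      + (\<delta> * (\<bar>u\<bar> powr q + (2 powr q * (\<bar>vm + z * hm\<bar> powr q + \<bar>z\<bar> powr q * \<bar>hm\<bar> powr q))) + ?A + \<mu> * vm\<^sup>2 + (\<alpha>2 i)\<^sup>2 / \<mu>)
      + (\<delta> * (\<bar>u\<bar> powr q + (2 powr q * (\<bar>vp + z * hp\<bar> powr q + \<bar>z\<bar> powr q * \<bar>hp\<bar> powr q))) + ?A + \<mu> * vp\<^sup>2 + (\<alpha>2 i)\<^sup>2 / \<mu>)))"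
  proof (intro mult_left_mono[OF _ r(1)] mult_left_mono[where c = 4] add_mono)
    have \<phi>': "\<bar>\<phi>\<bar> \<le> \<alpha>1 i * \<bar>u\<bar> powr (q - 1 - \<epsilon>) + \<alpha>2 i"
      using fi_growth by (simp add: \<phi> u_def hh_def)
    have *: "\<bar>\<phi>\<bar> * \<bar>x\<bar> \<le> \<delta> * (\<bar>u\<bar> powr q + (2 powr q * (\<bar>x + z * k\<bar> powr q + \<bar>z\<bar> powr q * \<bar>k\<bar> powr q))) + ?A + \<mu> * x\<^sup>2 + (\<alpha>2 i)\<^sup>2 / \<mu>" for x k
    proof -
      have "\<bar>\<phi>\<bar> * \<bar>x\<bar> \<le> \<delta> * (\<bar>u\<bar> powr q + \<bar>x\<bar> powr q) + ?A + \<mu> * x\<^sup>2 + (\<alpha>2 i)\<^sup>2 / \<mu>"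
        by (rule growth_bound[OF eps const_pos(1,2) \<phi>'])
      also have "\<dots> \<le> \<delta> * (\<bar>u\<bar> powr q + (2 powr q * (\<bar>x + z * k\<bar> powr q + \<bar>z\<bar> powr q * \<bar>k\<bar> powr q))) + ?A + \<mu> * x\<^sup>2 + (\<alpha>2 i)\<^sup>2 / \<mu>"
        using const_pos(1) powr_v_le[of x z k] by (intro add_right_mono mult_left_mono add_left_mono) auto
      finally show ?thesis .
    qed
    show "\<bar>\<phi>\<bar> * \<bar>v\<bar> \<le> \<delta> * (\<bar>u\<bar> powr q + (2 powr q * (\<bar>v + z * hh\<bar> powr q + \<bar>z\<bar> powr q * \<bar>hh\<bar> powr q))) + ?A + \<mu> * v\<^sup>2 + (\<alpha>2 i)\<^sup>2 / \<mu>" by (rule *)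
    show "\<bar>\<phi>\<bar> * \<bar>vm\<bar> \<le> \<delta> * (\<bar>u\<bar> powr q + (2 powr q * (\<bar>vm + z * hm\<bar> powr q + \<bar>z\<bar> powr q * \<bar>hm\<bar> powr q))) + ?A + \<mu> * vm\<^sup>2 + (\<alpha>2 i)\<^sup>2 / \<mu>" by (rule *)
    show "\<bar>\<phi>\<bar> * \<bar>vp\<bar> \<le> \<delta> * (\<bar>u\<bar> powr q + (2 powr q * (\<bar>vp + z * hp\<bar> powr q + \<bar>z\<bar> powr q * \<bar>hp\<bar> powr q))) + ?A + \<mu> * vp\<^sup>2 + (\<alpha>2 i)\<^sup>2 / \<mu>" by (rule *)
  qed simp
  finally have B: "- 2 * d * \<phi> \<le> r * (12 * \<delta> * \<bar>u\<bar> powr q + 12 * ?A + 12 * ((\<alpha>2 i)\<^sup>2 / \<mu>)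
      + (site z hh v - \<kappa>\<^sup>2 * v\<^sup>2) + (site z hm vm - \<kappa>\<^sup>2 * vm\<^sup>2) + (site z hp vp - \<kappa>\<^sup>2 * vp\<^sup>2))"
    unfolding site_def by (simp add: algebra_simps)
  let ?p3 = "(\<bar>\<psi>3 t i\<bar> * \<bar>hh\<bar>) powr q"
  have C: "2 * (r * v * G) \<le> r * ((2 * \<delta> - 2 * \<beta>) * \<bar>u\<bar> powr q + 2 * \<psi>1 t i + 2 * \<delta> powr (1 - q) * (\<bar>z\<bar> powr q * ?p3) + (\<psi>4 t i)\<^sup>2 + z\<^sup>2 * hh\<^sup>2)"
    using mult_left_mono[OF local_g_bound[of v i t z] r(1)] by (simp add: G u_def hh_def mult_ac)
  have D: "2 * z * (r * v * m) \<le> r * (\<mu> * v\<^sup>2 + z\<^sup>2 * m\<^sup>2 / \<mu>)"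
    using mult_left_mono[OF weighted_am_gm[OF const_pos(2), of v "z * m"] r(1)] by (simp add: power_mult_distrib mult_ac)
  let ?Z = "1 + \<bar>z\<bar> powr q"
  have \<psi>1_nonneg: "0 \<le> \<psi>1 t i" using gi_diss[rule_format, of i t 0] by simp
  \<comment> \<open>Of the five copies of \<open>site\<close> one is the error arising at this site;
    the other four are the reserve that appears with negative sign in the claim.\<close>
  have key: "12 * \<delta> * \<bar>u\<bar> powr q + 12 * ?A + 12 * ((\<alpha>2 i)\<^sup>2 / \<mu>) + 5 * site z hh v
     + ((2 * \<delta> - 2 * \<beta>) * \<bar>u\<bar> powr q + 2 * \<psi>1 t i + 2 * \<delta> powr (1 - q) * (\<bar>z\<bar> powr q * ?p3) + (\<psi>4 t i)\<^sup>2 + z\<^sup>2 * hh\<^sup>2)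
     + (\<mu> * v\<^sup>2 + z\<^sup>2 * m\<^sup>2 / \<mu>) - (2 * lam - lam0) * v\<^sup>2 \<le> C0 * ?Z * source t i"
  proof -
    \<comment> \<open>The power of \<open>u\<close> is multiplied by \<open>12 * \<delta>\<close>
      from \<open>fi\<close>, by \<open>2 * \<delta>\<close> from \<open>gi\<close> and by
      \<open>4 * \<delta> * 2 powr q\<close> from each of the five \<open>site\<close> terms; the
      definition of \<open>\<delta>\<close> makes the total equal to
      \<open>2 * \<beta>\<close>.\<close>
    have u0: "14 * \<delta> + 20 * \<delta> * 2 powr q - 2 * \<beta> = 0"
    proof -
      have p: "7 + 10 * 2 powr q > (0::real)" by (intro add_pos_nonneg) auto
      have "\<delta> * (7 + 10 * 2 powr q) = \<beta>" using p by (simp add: \<delta>_def)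
      then show ?thesis by (simp add: algebra_simps)
    qed
    \<comment> \<open>Each \<open>site\<close> contributes \<open>4 * \<mu>\<close> and the forcing
      one more. With \<open>\<mu>\<close> and \<open>\<kappa>\<^sup>2\<close> at most
      \<open>lam / 50\<close> the sum is at most \<open>26 / 50 * lam\<close>, which is below
      \<open>2 * lam - lam0\<close>.\<close>
    have v0: "(21 * \<mu> + 5 * \<kappa>\<^sup>2 - (2 * lam - lam0)) * v\<^sup>2 \<le> 0"
      using const_pos(5,7) lam by (intro mult_nonpos_nonneg) (auto simp: \<mu>_def)
    let ?R = "12 * ?A + 12 * ((\<alpha>2 i)\<^sup>2 / \<mu>) + 20 * \<delta> * 2 powr q * (\<bar>z\<bar> powr q * \<bar>hh\<bar> powr q) + 2 * \<psi>1 t i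
      + 2 * \<delta> powr (1 - q) * (\<bar>z\<bar> powr q * ?p3) + (\<psi>4 t i)\<^sup>2 + z\<^sup>2 * hh\<^sup>2 + z\<^sup>2 * m\<^sup>2 / \<mu>"
    have "12 * \<delta> * \<bar>u\<bar> powr q + 12 * ?A + 12 * ((\<alpha>2 i)\<^sup>2 / \<mu>) + 5 * site z hh v
     + ((2 * \<delta> - 2 * \<beta>) * \<bar>u\<bar> powr q + 2 * \<psi>1 t i + 2 * \<delta> powr (1 - q) * (\<bar>z\<bar> powr q * ?p3) + (\<psi>4 t i)\<^sup>2 + z\<^sup>2 * hh\<^sup>2)
     + (\<mu> * v\<^sup>2 + z\<^sup>2 * m\<^sup>2 / \<mu>) - (2 * lam - lam0) * v\<^sup>2
     = (14 * \<delta> + 20 * \<delta> * 2 powr q - 2 * \<beta>) * \<bar>u\<bar> powr q + (21 * \<mu> + 5 * \<kappa>\<^sup>2 - (2 * lam - lam0)) * v\<^sup>2 + ?R"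
      unfolding site_def u_def[symmetric] by (simp add: algebra_simps)
    also have "\<dots> \<le> ?R" using v0 by (simp add: u0)
    also have "\<dots> \<le> C0 * ?Z * \<bar>\<alpha>1 i\<bar> powr (q / \<epsilon>) + C0 * ?Z * (\<alpha>2 i)\<^sup>2 + C0 * ?Z * \<bar>hh\<bar> powr q + C0 * ?Z * \<psi>1 t i
      + C0 * ?Z * ?p3 + C0 * ?Z * (\<psi>4 t i)\<^sup>2 + C0 * ?Z * hh\<^sup>2 + C0 * ?Z * m\<^sup>2"
    proof (intro add_mono)
      have Z: "1 \<le> ?Z" "\<bar>z\<bar> powr q \<le> ?Z" "z\<^sup>2 \<le> ?Z" using z_square_le by auto
      have CZ: "c * y * x \<le> C0 * ?Z * x" if "0 \<le> c" "c \<le> C0" "0 \<le> y" "y \<le> ?Z" "0 \<le> x" for c x y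
        using that const_pos by (intro mult_right_mono mult_mono) auto
      have nn: "0 \<le> 12 * \<delta> powr (1 - q / \<epsilon>)" "0 \<le> 12 / \<mu>" "0 \<le> 20 * \<delta> * 2 powr q" "0 \<le> 2 * \<delta> powr (1 - q)" "0 \<le> 1 / \<mu>"
        using const_pos by auto
      have c: "12 * \<delta> powr (1 - q / \<epsilon>) \<le> C0" "12 / \<mu> \<le> C0" "20 * \<delta> * 2 powr q \<le> C0" "2 \<le> C0" "2 * \<delta> powr (1 - q) \<le> C0" "1 / \<mu> \<le> C0" "1 \<le> C0"
        using nn unfolding C0_def by linarith+
      show "12 * ?A \<le> C0 * ?Z * \<bar>\<alpha>1 i\<bar> powr (q / \<epsilon>)" using CZ[OF nn(1) c(1), of 1] Z by (simp add: mult.assoc)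
      show "12 * ((\<alpha>2 i)\<^sup>2 / \<mu>) \<le> C0 * ?Z * (\<alpha>2 i)\<^sup>2" using CZ[OF nn(2) c(2), of 1] Z by simp
      show "20 * \<delta> * 2 powr q * (\<bar>z\<bar> powr q * \<bar>hh\<bar> powr q) \<le> C0 * ?Z * \<bar>hh\<bar> powr q"
        using CZ[OF nn(3) c(3), of "\<bar>z\<bar> powr q" "\<bar>hh\<bar> powr q"] Z by (simp add: mult.assoc)
      show "2 * \<psi>1 t i \<le> C0 * ?Z * \<psi>1 t i" using CZ[of 2 1 "\<psi>1 t i"] c Z \<psi>1_nonneg by simp
      show "2 * \<delta> powr (1 - q) * (\<bar>z\<bar> powr q * ?p3) \<le> C0 * ?Z * ?p3"
        using CZ[OF nn(4) c(5), of "\<bar>z\<bar> powr q" ?p3] Z by (simp add: mult.assoc)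
      show "(\<psi>4 t i)\<^sup>2 \<le> C0 * ?Z * (\<psi>4 t i)\<^sup>2" using CZ[of 1 1 "(\<psi>4 t i)\<^sup>2"] c Z by simp
      show "z\<^sup>2 * hh\<^sup>2 \<le> C0 * ?Z * hh\<^sup>2" using CZ[of 1 "z\<^sup>2" "hh\<^sup>2"] c Z by simp
      show "z\<^sup>2 * m\<^sup>2 / \<mu> \<le> C0 * ?Z * m\<^sup>2" using CZ[OF nn(5) c(6), of "z\<^sup>2" "m\<^sup>2"] Z by simp
    qed
    also have "\<dots> = C0 * ?Z * source t i" unfolding source_def m hh_def[symmetric] by (simp only: algebra_simps)
    finally show ?thesis .
  qed
  have "- 2 * d * (2 * v - vm - vp) - (2 * lam - lam0) * (r * v * v) - 2 * d * \<phi> + 2 * (r * v * G) + 2 * z * (r * v * m)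
    \<le> r * (\<kappa>\<^sup>2 * (vm\<^sup>2 + vp\<^sup>2)) - (2 * lam - lam0) * (r * v * v)
      + r * (12 * \<delta> * \<bar>u\<bar> powr q + 12 * ?A + 12 * ((\<alpha>2 i)\<^sup>2 / \<mu>)
        + (site z hh v - \<kappa>\<^sup>2 * v\<^sup>2) + (site z hm vm - \<kappa>\<^sup>2 * vm\<^sup>2) + (site z hp vp - \<kappa>\<^sup>2 * vp\<^sup>2))
      + r * ((2 * \<delta> - 2 * \<beta>) * \<bar>u\<bar> powr q + 2 * \<psi>1 t i + 2 * \<delta> powr (1 - q) * (\<bar>z\<bar> powr q * ?p3) + (\<psi>4 t i)\<^sup>2 + z\<^sup>2 * hh\<^sup>2)
      + r * (\<mu> * v\<^sup>2 + z\<^sup>2 * m\<^sup>2 / \<mu>)"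
    using A B C D by linarith
  also have "\<dots> = r * ((12 * \<delta> * \<bar>u\<bar> powr q + 12 * ?A + 12 * ((\<alpha>2 i)\<^sup>2 / \<mu>) + 5 * site z hh v
     + ((2 * \<delta> - 2 * \<beta>) * \<bar>u\<bar> powr q + 2 * \<psi>1 t i + 2 * \<delta> powr (1 - q) * (\<bar>z\<bar> powr q * ?p3) + (\<psi>4 t i)\<^sup>2 + z\<^sup>2 * hh\<^sup>2)
     + (\<mu> * v\<^sup>2 + z\<^sup>2 * m\<^sup>2 / \<mu>) - (2 * lam - lam0) * v\<^sup>2) - 4 * site z hh v + site z hm vm + site z hp vp) - r * (\<kappa>\<^sup>2 * v\<^sup>2)"
    by (simp add: algebra_simps power2_eq_square)
  also have "\<dots> \<le> r * (C0 * ?Z * source t i - 4 * site z hh v + site z hm vm + site z hp vp) - 0"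
    using key r(1) by (intro diff_mono mult_left_mono add_mono) auto
  finally show ?thesis by (simp add: hh_def)
qed

end

section \<open>Summability and integrability of the source terms\<close>

lemma powr_summable_mono:
  fixes x :: "int \<Rightarrow> real"
  assumes s: "(\<lambda>i. \<bar>x i\<bar> powr r) summable_on UNIV" and r: "0 < r" "r \<le> p"
  shows "(\<lambda>i. \<bar>x i\<bar> powr p) summable_on UNIV"
proof -
  have "x \<in> ellp (ennreal r)" using s r by (simp add: ellp_finite_iff)
  from abs_le_ellp_norm[OF this] obtain B where B: "\<And>i. \<bar>x i\<bar> \<le> B" using r by auto
  have "(\<lambda>i. B powr (p - r) * \<bar>x i\<bar> powr r) summable_on UNIV" by (intro summable_on_cmult_right s)
  moreover have "\<bar>x i\<bar> powr p \<le> B powr (p - r) * \<bar>x i\<bar> powr r" for i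
  proof -
    have "\<bar>x i\<bar> powr p = \<bar>x i\<bar> powr (p - r) * \<bar>x i\<bar> powr r" by (simp add: powr_add[symmetric])
    also have "\<dots> \<le> B powr (p - r) * \<bar>x i\<bar> powr r"
      using B[of i] r by (intro mult_right_mono powr_mono2) auto
    finally show ?thesis .
  qed
  ultimately show ?thesis by (rule summable_on_comparison_test) auto
qed

lemma coord_powr_summable: "2 \<le> p \<Longrightarrow> (\<lambda>i. \<bar>coord u i\<bar> powr p) summable_on UNIV"
  using powr_summable_mono[of "coord u" 2 p] coord_summable[of u] by (simp add: powr_numeral)

lemma weighted_summable:
  fixes \<rho> X :: "int \<Rightarrow> real"
  assumes "X summable_on UNIV" "\<And>i. 0 \<le> X i" "\<And>i. 0 \<le> \<rho> i \<and> \<rho> i \<le> 1"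
  shows "(\<lambda>i. \<rho> i * X i) summable_on UNIV"
proof (rule summable_on_comparison_test[OF assms(1)])
  show "\<rho> i * X i \<le> X i" "0 \<le> \<rho> i * X i" for i
    using assms(2)[of i] assms(3)[of i] by (auto intro: mult_left_le_one_le)
qed

context lattice_equation
begin

lemma \<psi>1_nonneg: "0 \<le> \<psi>1 t i"
  using gi_diss[rule_format, of i t 0] by simp

lemma source_nonneg: "0 \<le> source t i"
  unfolding source_def using \<psi>1_nonneg[of t i] by (intro add_nonneg_nonneg) auto

definition \<psi>3_sup :: "real \<Rightarrow> real" where "\<psi>3_sup t = ellp_norm \<infinity> (\<psi>3 t)"

lemma \<psi>3_le_sup: "\<bar>\<psi>3 t i\<bar> \<le> \<psi>3_sup t"
  unfolding \<psi>3_sup_def by (rule abs_le_ellp_norm[OF bochner_L_loc_mem[OF \<psi>3]]) simp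

lemma \<psi>3_sup_nonneg: "0 \<le> \<psi>3_sup t"
  using \<psi>3_le_sup[of t 0] by (rule order_trans[OF abs_ge_zero])

lemma \<psi>_measurable: "(\<lambda>t. \<psi>1 t i) \<in> borel_measurable lebesgue" "(\<lambda>t. \<psi>3 t i) \<in> borel_measurable lebesgue"
  "(\<lambda>t. \<psi>4 t i) \<in> borel_measurable lebesgue"
  by (rule bochner_L_loc_coord_measurable[OF \<psi>1] bochner_L_loc_coord_measurable[OF \<psi>3]
      bochner_L_loc_coord_measurable[OF \<psi>4], simp)+

lemma \<psi>3_sup_measurable: "\<psi>3_sup \<in> borel_measurable lebesgue"
proof -
  have "(\<lambda>t. SUP i. \<bar>\<psi>3 t i\<bar>) \<in> borel_measurable lebesgue"
  proof (rule borel_measurable_cSUP)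
    show "(\<lambda>t. \<bar>\<psi>3 t i\<bar>) \<in> borel_measurable lebesgue" for i using \<psi>_measurable(2) by measurable
    show "bdd_above ((\<lambda>i. \<bar>\<psi>3 t i\<bar>) ` UNIV)" for t using \<psi>3_le_sup by (intro bdd_aboveI2) auto
  qed auto
  then show ?thesis by (simp add: \<psi>3_sup_def[abs_def] ellp_norm_def)
qed

lemma h_continuous: "continuous_on S h"
  using h_deriv has_vector_derivative_continuous continuous_at_imp_continuous_on by blast

lemma h_measurable: "h \<in> borel_measurable lebesgue"
  by (rule measurable_completion) (use borel_measurable_continuous_onI[OF h_continuous] in simp)

lemma h'_measurable: "h' \<in> borel_measurable lebesgue"
  by (rule ell2_measurableI, rule bochner_L_loc_coord_measurable[OF h'_loc]) simp

lemma lap_measurable: "u \<in> borel_measurable M \<Longrightarrow> (\<lambda>t. lap (u t)) \<in> borel_measurable M"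
  by (rule measurable_compose[of u M borel])
    (auto intro!: borel_measurable_continuous_onI bounded_linear.continuous_on[OF bounded_linear_lap] continuous_intros)

lemma forcing_measurable: "forcing \<in> borel_measurable lebesgue"
  unfolding forcing_def[abs_def]
  by (intro borel_measurable_diff borel_measurable_add borel_measurable_uminus borel_measurable_scaleR
      lap_measurable h_measurable h'_measurable borel_measurable_const)

lemma norm_forcing_le: "norm (forcing t) \<le> (16 + \<bar>1 - lam\<bar>) * norm (h t) + norm (h' t)"
proof -
  have "norm (forcing t) \<le> norm (- lap (lap (h t)) + (1 - lam) *\<^sub>R h t) + norm (h' t)"
    unfolding forcing_def by (rule norm_triangle_ineq4)
  also have "norm (- lap (lap (h t)) + (1 - lam) *\<^sub>R h t) \<le> norm (- lap (lap (h t))) + norm ((1 - lam) *\<^sub>R h t)"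
    by (rule norm_triangle_ineq)
  also have "norm ((1 - lam) *\<^sub>R h t) = \<bar>1 - lam\<bar> * norm (h t)" by simp
  also have "norm (- lap (lap (h t))) \<le> 4 * (4 * norm (h t))"
    using norm_lap_le[of "lap (h t)"] norm_lap_le[of "h t"] by simp
  finally show ?thesis by (simp add: algebra_simps)
qed

lemma source_parts_summable:
  "(\<lambda>i. \<bar>\<alpha>1 i\<bar> powr (q / \<epsilon>)) summable_on UNIV" "(\<lambda>i. (\<alpha>2 i)\<^sup>2) summable_on UNIV"
  "\<psi>1 t summable_on UNIV" "(\<lambda>i. (\<psi>4 t i)\<^sup>2) summable_on UNIV"
  "(\<lambda>i. \<bar>coord (h t) i\<bar> powr q) summable_on UNIV"
  "(\<lambda>i. (\<bar>\<psi>3 t i\<bar> * \<bar>coord (h t) i\<bar>) powr q) summable_on UNIV"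
proof -
  have "(\<lambda>i. \<bar>\<alpha>1 i\<bar> powr 1) summable_on UNIV" "(\<lambda>i. \<bar>\<alpha>2 i\<bar> powr 1) summable_on UNIV"
    using \<alpha>1 \<alpha>2 ellp_finite_iff[of 1 \<alpha>1] ellp_finite_iff[of 1 \<alpha>2] by simp_all
  note \<alpha> = this[THEN powr_summable_mono]
  \<comment> \<open>The exponent \<open>q / \<epsilon>\<close> exceeds 1 because
    \<open>\<epsilon> < q - 1\<close>, so summability passes up from the exponent 1.\<close>
  show "(\<lambda>i. \<bar>\<alpha>1 i\<bar> powr (q / \<epsilon>)) summable_on UNIV" by (rule \<alpha>(1)) (use eps in simp_all)
  have "(\<lambda>i. \<bar>\<alpha>2 i\<bar> powr 2) summable_on UNIV" by (rule \<alpha>(2)) simp_all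
  then show "(\<lambda>i. (\<alpha>2 i)\<^sup>2) summable_on UNIV" by (simp add: powr_numeral)
  show "\<psi>1 t summable_on UNIV"
    using bochner_L_loc_mem[OF \<psi>1, of t] ellp_finite_iff[of 1 "\<psi>1 t"] \<psi>1_nonneg by simp
  show "(\<lambda>i. (\<psi>4 t i)\<^sup>2) summable_on UNIV"
    using bochner_L_loc_mem[OF \<psi>4, of t] by (simp add: ellp_2_iff)
  show hq: "(\<lambda>i. \<bar>coord (h t) i\<bar> powr q) summable_on UNIV" using q by (intro coord_powr_summable) simp
  show "(\<lambda>i. (\<bar>\<psi>3 t i\<bar> * \<bar>coord (h t) i\<bar>) powr q) summable_on UNIV"
  proof (rule summable_on_comparison_test[OF summable_on_cmult_right[OF hq]])
    show "(\<bar>\<psi>3 t i\<bar> * \<bar>coord (h t) i\<bar>) powr q \<le> \<psi>3_sup t powr q * \<bar>coord (h t) i\<bar> powr q" for i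
      unfolding powr_mult using \<psi>3_le_sup[of t i] q by (intro mult_right_mono powr_mono2) auto
  qed simp
qed

lemma source_summable: "source t summable_on UNIV"
  unfolding source_def[abs_def] by (intro summable_on_add source_parts_summable coord_summable)

lemma source_measurable: "(\<lambda>t. source t i) \<in> borel_measurable lebesgue"
proof -
  note [measurable] = \<psi>_measurable coord_measurable[OF h_measurable] coord_measurable[OF forcing_measurable]
  show ?thesis unfolding source_def by measurable
qed

definition total_source :: "(int \<Rightarrow> real) \<Rightarrow> real \<Rightarrow> real" where
  "total_source \<rho> t = (\<Sum>\<^sub>\<infinity>i. \<rho> i * source t i)"

lemma weighted_source_summable:
  "(\<And>i. 0 \<le> \<rho> i \<and> \<rho> i \<le> 1) \<Longrightarrow> (\<lambda>i. \<rho> i * source t i) summable_on UNIV"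
  by (rule weighted_summable[OF source_summable source_nonneg])

lemma total_nonneg: "(\<And>i. 0 \<le> \<rho> i \<and> \<rho> i \<le> 1) \<Longrightarrow> 0 \<le> total_source \<rho> t"
  unfolding total_source_def using source_nonneg by (intro infsum_nonneg) (meson mult_nonneg_nonneg)

lemma total_measurable: "(\<And>i. 0 \<le> \<rho> i \<and> \<rho> i \<le> 1) \<Longrightarrow> total_source \<rho> \<in> borel_measurable lebesgue"
  unfolding total_source_def[abs_def]
  by (rule infsum_measurable[OF borel_measurable_times[OF borel_measurable_const source_measurable] weighted_source_summable])

lemma total_mono: "(\<And>i. 0 \<le> \<rho> i \<and> \<rho> i \<le> 1) \<Longrightarrow> total_source \<rho> t \<le> total_source (\<lambda>_. 1) t"
  unfolding total_source_def
  by (rule infsum_mono[OF weighted_source_summable weighted_source_summable])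
    (use source_nonneg in \<open>auto intro: mult_left_le_one_le\<close>)

lemma total_split:
  "total_source (\<lambda>_. 1) t = (\<Sum>\<^sub>\<infinity>i. \<bar>\<alpha>1 i\<bar> powr (q / \<epsilon>)) + (\<Sum>\<^sub>\<infinity>i. (\<alpha>2 i)\<^sup>2) + (\<Sum>\<^sub>\<infinity>i. \<psi>1 t i) + (\<Sum>\<^sub>\<infinity>i. (\<psi>4 t i)\<^sup>2)
    + (\<Sum>\<^sub>\<infinity>i. \<bar>coord (h t) i\<bar> powr q) + (\<Sum>\<^sub>\<infinity>i. (\<bar>\<psi>3 t i\<bar> * \<bar>coord (h t) i\<bar>) powr q) + (norm (h t))\<^sup>2 + (norm (forcing t))\<^sup>2"
  unfolding total_source_def mult_1 source_def norm_ell2_square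
  by (simp only: infsum_add summable_on_add source_parts_summable coord_summable)

text \<open>Shared by two ranges of time: on the past half-line the integrals are finite by the
  weighted hypotheses, on \<open>{0..b}\<close> by the local ones. The forcing is controlled by
  \<open>h\<close> and \<open>h'\<close> since the Laplacian is bounded.\<close>

lemma total_integrable_on:
  assumes S: "S \<in> sets lebesgue" and C: "AE t in lebesgue. t \<in> S \<longrightarrow> (\<forall>i. \<bar>\<psi>3 t i\<bar> \<le> C)" "0 \<le> C"
    and i: "set_integrable lebesgue S (\<lambda>s. exp (lam1 * s))"
      "set_integrable lebesgue S (\<lambda>s. exp (lam1 * s) * (\<Sum>\<^sub>\<infinity>i. \<psi>1 s i))"
      "set_integrable lebesgue S (\<lambda>s. exp (lam1 * s) * (\<Sum>\<^sub>\<infinity>i. (\<psi>4 s i)\<^sup>2))"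
      "set_integrable lebesgue S (\<lambda>s. exp (lam1 * s) * (\<Sum>\<^sub>\<infinity>i. \<bar>coord (h s) i\<bar> powr q))"
      "set_integrable lebesgue S (\<lambda>s. exp (lam1 * s) * (norm (h s))\<^sup>2)"
      "set_integrable lebesgue S (\<lambda>s. exp (lam1 * s) * (norm (h' s))\<^sup>2)"
  shows "set_integrable lebesgue S (\<lambda>s. exp (lam1 * s) * total_source (\<lambda>_. 1) s)"
proof -
  define B where "B = 1 + 2 * (16 + \<bar>1 - lam\<bar>)\<^sup>2"
  define A where "A = (\<Sum>\<^sub>\<infinity>i. \<bar>\<alpha>1 i\<bar> powr (q / \<epsilon>)) + (\<Sum>\<^sub>\<infinity>i. (\<alpha>2 i)\<^sup>2)"
  let ?G = "\<lambda>s. A * exp (lam1 * s) + exp (lam1 * s) * (\<Sum>\<^sub>\<infinity>i. \<psi>1 s i) + exp (lam1 * s) * (\<Sum>\<^sub>\<infinity>i. (\<psi>4 s i)\<^sup>2)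
    + (1 + C powr q) * (exp (lam1 * s) * (\<Sum>\<^sub>\<infinity>i. \<bar>coord (h s) i\<bar> powr q)) + B * (exp (lam1 * s) * (norm (h s))\<^sup>2)
    + 2 * (exp (lam1 * s) * (norm (h' s))\<^sup>2)"
  show ?thesis
  proof (rule set_integrable_bound)
    show "set_integrable lebesgue S ?G"
      by (intro set_integral_add set_integrable_mult_right i)
    show "set_borel_measurable lebesgue S (\<lambda>s. exp (lam1 * s) * total_source (\<lambda>_. 1) s)"
    proof -
      have [measurable]: "total_source (\<lambda>_. 1) \<in> borel_measurable lebesgue" by (rule total_measurable) simp
      have [measurable]: "(\<lambda>s. exp (lam1 * s)) \<in> borel_measurable lebesgue"
        by (rule measurable_completion) (auto intro!: borel_measurable_continuous_onI continuous_intros)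
      note [measurable] = S
      show ?thesis unfolding set_borel_measurable_def by measurable
    qed
    show "AE s in lebesgue. s \<in> S \<longrightarrow> norm (exp (lam1 * s) * total_source (\<lambda>_. 1) s) \<le> norm (?G s)"
      using C(1)
    proof eventually_elim
      case (elim s)
      show ?case
      proof
        assume s: "s \<in> S"
        have "(\<Sum>\<^sub>\<infinity>i. (\<bar>\<psi>3 s i\<bar> * \<bar>coord (h s) i\<bar>) powr q) \<le> (\<Sum>\<^sub>\<infinity>i. C powr q * \<bar>coord (h s) i\<bar> powr q)"
        proof (rule infsum_mono)
          show "(\<bar>\<psi>3 s i\<bar> * \<bar>coord (h s) i\<bar>) powr q \<le> C powr q * \<bar>coord (h s) i\<bar> powr q" for i
            unfolding powr_mult using elim s q by (intro mult_right_mono powr_mono2) auto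
        qed (intro source_parts_summable summable_on_cmult_right)+
        also have "\<dots> = C powr q * (\<Sum>\<^sub>\<infinity>i. \<bar>coord (h s) i\<bar> powr q)"
          by (intro infsum_cmult_right source_parts_summable)
        finally have 1: "(\<Sum>\<^sub>\<infinity>i. (\<bar>\<psi>3 s i\<bar> * \<bar>coord (h s) i\<bar>) powr q) \<le> C powr q * (\<Sum>\<^sub>\<infinity>i. \<bar>coord (h s) i\<bar> powr q)" .
        have "(norm (forcing s))\<^sup>2 \<le> ((16 + \<bar>1 - lam\<bar>) * norm (h s) + norm (h' s))\<^sup>2"
          using norm_forcing_le by (intro power_mono) auto
        also have "\<dots> \<le> 2 * ((16 + \<bar>1 - lam\<bar>) * norm (h s))\<^sup>2 + 2 * (norm (h' s))\<^sup>2"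
          using sum_squares_bound[of "(16 + \<bar>1 - lam\<bar>) * norm (h s)" "norm (h' s)"] by (simp add: power2_sum)
        finally have 2: "(norm (forcing s))\<^sup>2 \<le> 2 * (16 + \<bar>1 - lam\<bar>)\<^sup>2 * (norm (h s))\<^sup>2 + 2 * (norm (h' s))\<^sup>2"
          by (simp add: power_mult_distrib)
        have "total_source (\<lambda>_. 1) s \<le> A + (\<Sum>\<^sub>\<infinity>i. \<psi>1 s i) + (\<Sum>\<^sub>\<infinity>i. (\<psi>4 s i)\<^sup>2) + (1 + C powr q) * (\<Sum>\<^sub>\<infinity>i. \<bar>coord (h s) i\<bar> powr q)
          + B * (norm (h s))\<^sup>2 + 2 * (norm (h' s))\<^sup>2"
          using 1 2 unfolding total_split A_def B_def distrib_right by linarith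
        from mult_left_mono[OF this, of "exp (lam1 * s)"] have "exp (lam1 * s) * total_source (\<lambda>_. 1) s \<le> ?G s"
          by (simp add: algebra_simps)
        moreover have "0 \<le> exp (lam1 * s) * total_source (\<lambda>_. 1) s" using total_nonneg[of "\<lambda>_. 1" s] by simp
        ultimately show "norm (exp (lam1 * s) * total_source (\<lambda>_. 1) s) \<le> norm (?G s)" by simp
      qed
    qed
  qed
qed

lemma exp_lam1_measurable: "(\<lambda>s. exp (lam1 * s)) \<in> borel_measurable lebesgue"
  by (rule measurable_completion) (auto intro!: borel_measurable_continuous_onI continuous_intros)

lemma source_norms:
  "ellp_norm 1 (\<psi>1 s) = (\<Sum>\<^sub>\<infinity>i. \<psi>1 s i)" "(ellp_norm 2 (\<psi>4 s))\<^sup>2 = (\<Sum>\<^sub>\<infinity>i. (\<psi>4 s i)\<^sup>2)"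
  "ellp_norm (ennreal q) (coord (h s)) powr q = (\<Sum>\<^sub>\<infinity>i. \<bar>coord (h s) i\<bar> powr q)"
proof -
  show "ellp_norm 1 (\<psi>1 s) = (\<Sum>\<^sub>\<infinity>i. \<psi>1 s i)"
    using \<psi>1_nonneg by (simp add: ellp_norm_def infsum_nonneg)
  show "(ellp_norm 2 (\<psi>4 s))\<^sup>2 = (\<Sum>\<^sub>\<infinity>i. (\<psi>4 s i)\<^sup>2)"
    by (simp add: ellp_norm_2 infsum_nonneg)
  show "ellp_norm (ennreal q) (coord (h s)) powr q = (\<Sum>\<^sub>\<infinity>i. \<bar>coord (h s) i\<bar> powr q)"
    using ellp_norm_powr[of "ennreal q" "coord (h s)"] q by simp
qed

lemma source_norms_measurable:
  "(\<lambda>s. \<Sum>\<^sub>\<infinity>i. \<psi>1 s i) \<in> borel_measurable lebesgue" "(\<lambda>s. \<Sum>\<^sub>\<infinity>i. (\<psi>4 s i)\<^sup>2) \<in> borel_measurable lebesgue"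
  "(\<lambda>s. \<Sum>\<^sub>\<infinity>i. \<bar>coord (h s) i\<bar> powr q) \<in> borel_measurable lebesgue"
proof -
  note [measurable] = \<psi>_measurable coord_measurable[OF h_measurable]
  show "(\<lambda>s. \<Sum>\<^sub>\<infinity>i. \<psi>1 s i) \<in> borel_measurable lebesgue"
    by (rule infsum_measurable) (measurable, rule source_parts_summable)
  show "(\<lambda>s. \<Sum>\<^sub>\<infinity>i. (\<psi>4 s i)\<^sup>2) \<in> borel_measurable lebesgue"
    by (rule infsum_measurable) (measurable, rule source_parts_summable)
  show "(\<lambda>s. \<Sum>\<^sub>\<infinity>i. \<bar>coord (h s) i\<bar> powr q) \<in> borel_measurable lebesgue"
    by (rule infsum_measurable) (measurable, rule source_parts_summable)
qed

lemma source_norms_nonneg: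
  "0 \<le> (\<Sum>\<^sub>\<infinity>i. \<psi>1 s i)" "0 \<le> (\<Sum>\<^sub>\<infinity>i. (\<psi>4 s i)\<^sup>2)" "0 \<le> (\<Sum>\<^sub>\<infinity>i. \<bar>coord (h s) i\<bar> powr q)"
  using \<psi>1_nonneg by (auto intro: infsum_nonneg)

lemma local_parts_integrable:
  "set_integrable lebesgue {a..b} (\<lambda>s. \<Sum>\<^sub>\<infinity>i. \<psi>1 s i)"
  "set_integrable lebesgue {a..b} (\<lambda>s. \<Sum>\<^sub>\<infinity>i. (\<psi>4 s i)\<^sup>2)"
  "set_integrable lebesgue {a..b} (\<lambda>s. \<Sum>\<^sub>\<infinity>i. \<bar>coord (h s) i\<bar> powr q)"
  "set_integrable lebesgue {a..b} (\<lambda>s. (norm (h s))\<^sup>2)"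
  "set_integrable lebesgue {a..b} (\<lambda>s. (norm (h' s))\<^sup>2)"
proof -
  show "set_integrable lebesgue {a..b} (\<lambda>s. \<Sum>\<^sub>\<infinity>i. \<psi>1 s i)"
    using bochner_L_loc_integrable[OF \<psi>1, of a b] \<psi>1_nonneg by simp
  show "set_integrable lebesgue {a..b} (\<lambda>s. \<Sum>\<^sub>\<infinity>i. (\<psi>4 s i)\<^sup>2)"
    using bochner_L_loc_integrable[OF \<psi>4, of a b] by (simp add: powr_numeral)
  show "set_integrable lebesgue {a..b} (\<lambda>s. \<Sum>\<^sub>\<infinity>i. \<bar>coord (h s) i\<bar> powr q)"
    using bochner_L_loc_integrable[OF h_locq, of a b] q by simp
  show "set_integrable lebesgue {a..b} (\<lambda>s. (norm (h s))\<^sup>2)"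
    using bochner_L_loc_integrable[OF h_loc, of a b] by (simp add: powr_numeral norm_ell2_square)
  show "set_integrable lebesgue {a..b} (\<lambda>s. (norm (h' s))\<^sup>2)"
    using bochner_L_loc_integrable[OF h'_loc, of a b] by (simp add: powr_numeral norm_ell2_square)
qed

lemma total_integrable: "set_integrable lebesgue {..b} (\<lambda>s. exp (lam1 * s) * total_source (\<lambda>_. 1) s)"
proof -
  note [measurable] = exp_lam1_measurable source_norms_measurable h_measurable h'_measurable
  let ?e = "\<lambda>s. exp (lam1 * s)"
  have 0: "set_integrable lebesgue {..0} (\<lambda>s. ?e s * total_source (\<lambda>_. 1) s)"
  proof -
    obtain C where C: "0 \<le> C" "AE t in lebesgue. t \<in> {..0} \<longrightarrow> (\<forall>i. \<bar>\<psi>3 t i\<bar> \<le> C)"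
      by (rule bochner_L_infinity_AE_bound[OF \<psi>3_tail]) auto
    have a: "set_integrable lebesgue {..0} (\<lambda>s. ?e s * ((\<Sum>\<^sub>\<infinity>i. \<psi>1 s i) + (\<Sum>\<^sub>\<infinity>i. (\<psi>4 s i)\<^sup>2)))"
    proof (rule set_integrable_if_nn)
      show "(\<integral>\<^sup>+s\<in>{..0}. ennreal (?e s * ((\<Sum>\<^sub>\<infinity>i. \<psi>1 s i) + (\<Sum>\<^sub>\<infinity>i. (\<psi>4 s i)\<^sup>2))) \<partial>lebesgue) < \<infinity>"
        using \<psi>_tail unfolding source_norms .
    qed (use source_norms_nonneg in \<open>auto intro!: mult_nonneg_nonneg add_nonneg_nonneg\<close>)
    have b: "set_integrable lebesgue {..0} (\<lambda>s. ?e s * ((norm (h s))\<^sup>2 + (\<Sum>\<^sub>\<infinity>i. \<bar>coord (h s) i\<bar> powr q) + (norm (h' s))\<^sup>2))"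
    proof (rule set_integrable_if_nn)
      show "(\<integral>\<^sup>+s\<in>{..0}. ennreal (?e s * ((norm (h s))\<^sup>2 + (\<Sum>\<^sub>\<infinity>i. \<bar>coord (h s) i\<bar> powr q) + (norm (h' s))\<^sup>2)) \<partial>lebesgue) < \<infinity>"
        using h_tail unfolding source_norms .
    qed (use source_norms_nonneg in \<open>auto intro!: mult_nonneg_nonneg add_nonneg_nonneg\<close>)
    \<comment> \<open>The hypotheses bound sums of nonnegative terms; every single summand is split
      off by domination.\<close>
    have dom: "set_integrable lebesgue {..0} (\<lambda>s. ?e s * X s)"
      if "set_integrable lebesgue {..0} (\<lambda>s. ?e s * Y s)" "X \<in> borel_measurable lebesgue" "\<And>s. 0 \<le> X s" "\<And>s. X s \<le> Y s"
      for X Y :: "real \<Rightarrow> real"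
    proof (rule set_integrable_bound[OF that(1)])
      show "set_borel_measurable lebesgue {..0} (\<lambda>s. ?e s * X s)"
        unfolding set_borel_measurable_def
        by (intro borel_measurable_scaleR borel_measurable_indicator borel_measurable_times exp_lam1_measurable that(2)) simp
      show "AE s in lebesgue. s \<in> {..0} \<longrightarrow> norm (?e s * X s) \<le> norm (?e s * Y s)"
        using that(3,4) order_trans[OF that(3) that(4)] by (intro AE_I2) (auto simp: abs_mult)
    qed
    show ?thesis
    proof (rule total_integrable_on[OF _ C(2) C(1)])
      show "set_integrable lebesgue {..0} ?e" using lam by (intro exp_integrable_atMost)
      show "set_integrable lebesgue {..0} (\<lambda>s. ?e s * (\<Sum>\<^sub>\<infinity>i. \<psi>1 s i))"
        by (rule dom[OF a]) (use source_norms_nonneg in auto)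
      show "set_integrable lebesgue {..0} (\<lambda>s. ?e s * (\<Sum>\<^sub>\<infinity>i. (\<psi>4 s i)\<^sup>2))"
        by (rule dom[OF a]) (use source_norms_nonneg in auto)
      show "set_integrable lebesgue {..0} (\<lambda>s. ?e s * (\<Sum>\<^sub>\<infinity>i. \<bar>coord (h s) i\<bar> powr q))"
        by (rule dom[OF b]) (use source_norms_nonneg in \<open>auto simp: add_increasing add_increasing2\<close>)
      show "set_integrable lebesgue {..0} (\<lambda>s. ?e s * (norm (h s))\<^sup>2)"
        by (rule dom[OF b]) (use source_norms_nonneg in \<open>auto simp: add_increasing2\<close>)
      show "set_integrable lebesgue {..0} (\<lambda>s. ?e s * (norm (h' s))\<^sup>2)"
        by (rule dom[OF b]) (use source_norms_nonneg in \<open>auto simp: add_increasing\<close>)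
    qed auto
  qed
  have 1: "set_integrable lebesgue {0..b} (\<lambda>s. ?e s * total_source (\<lambda>_. 1) s)"
  proof -
    obtain C where C: "0 \<le> C" "AE t in lebesgue. t \<in> {0..b} \<longrightarrow> (\<forall>i. \<bar>\<psi>3 t i\<bar> \<le> C)"
      by (rule bochner_L_infinity_AE_bound[OF bochner_L_locD[OF \<psi>3]]) auto
    have c: "continuous_on {0..b} ?e" by (intro continuous_intros)
    have "set_integrable lebesgue {0..b} (\<lambda>s. ?e s * X s)" if "set_integrable lebesgue {0..b} X" for X
      by (rule set_integrable_bilinear_right[OF bounded_bilinear_mult that c])
    note e = this[OF local_parts_integrable(1)] this[OF local_parts_integrable(2)] this[OF local_parts_integrable(3)]
      this[OF local_parts_integrable(4)] this[OF local_parts_integrable(5)]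
    show ?thesis
      by (rule total_integrable_on[OF _ C(2) C(1) absolutely_integrable_continuous_real[OF c] e]) simp
  qed
  have "set_integrable lebesgue ({..0} \<union> {0..b}) (\<lambda>s. ?e s * total_source (\<lambda>_. 1) s)"
    by (rule set_integrable_Un[OF 0 1]) auto
  then show ?thesis by (rule set_integrable_subset) auto
qed

section \<open>Summing the local estimate against a slowly varying weight\<close>

lemma slowly_varyingD:
  assumes "slowly_varying \<rho>"
  shows "0 < \<rho> i" "\<rho> i \<le> 1" "\<bar>\<rho> i - \<rho> (i - 1)\<bar> \<le> \<kappa> * \<rho> i" "\<bar>\<rho> i - \<rho> (i + 1)\<bar> \<le> \<kappa> * \<rho> i"
    "\<rho> (i - 1) \<le> 2 * \<rho> i" "\<rho> (i + 1) \<le> 2 * \<rho> i"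
proof -
  have *: "0 < \<rho> j" "\<rho> j \<le> 1" "\<rho> (j + 1) \<le> (1 + \<kappa>) * \<rho> j" "\<rho> j \<le> (1 + \<kappa>) * \<rho> (j + 1)" for j
    using assms by (auto simp: slowly_varying_def)
  show "0 < \<rho> i" "\<rho> i \<le> 1" using * by auto
  have near: "\<bar>x - y\<bar> \<le> \<kappa> * x \<and> y \<le> 2 * x" if "0 < x" "0 < y" "y \<le> (1 + \<kappa>) * x" "x \<le> (1 + \<kappa>) * y" for x y
  proof -
    have k: "\<kappa> * x \<le> 1 * x" using that const_pos by (intro mult_right_mono) auto
    have "x - y \<le> \<kappa> * x"
    proof (cases "y \<le> x")
      case True
      then have "\<kappa> * y \<le> \<kappa> * x" using const_pos by (intro mult_left_mono) auto
      then show ?thesis using that by (simp add: algebra_simps)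
    next
      case False
      moreover have "0 \<le> \<kappa> * x" using that const_pos by simp
      ultimately show ?thesis by linarith
    qed
    moreover have "y - x \<le> \<kappa> * x" using that by (simp add: algebra_simps)
    ultimately show ?thesis using k by (simp add: abs_le_iff)
  qed
  show "\<bar>\<rho> i - \<rho> (i + 1)\<bar> \<le> \<kappa> * \<rho> i" "\<rho> (i + 1) \<le> 2 * \<rho> i"
    using near[of "\<rho> i" "\<rho> (i + 1)"] * by auto
  show "\<bar>\<rho> i - \<rho> (i - 1)\<bar> \<le> \<kappa> * \<rho> i" "\<rho> (i - 1) \<le> 2 * \<rho> i"
    using near[of "\<rho> i" "\<rho> (i - 1)"] *[of i] *[of "i - 1"] by auto
qed

text \<open>Reindexing moves the shift onto the weight, which changes by a factor of at most
  2.\<close>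

lemma weighted_shift_le:
  assumes \<rho>: "slowly_varying \<rho>" and X: "X summable_on UNIV" "\<And>i. 0 \<le> X i"
  shows "(\<Sum>\<^sub>\<infinity>i. \<rho> i * X (i + 1)) \<le> 2 * (\<Sum>\<^sub>\<infinity>i. \<rho> i * X i)" "(\<Sum>\<^sub>\<infinity>i. \<rho> i * X (i + (- 1))) \<le> 2 * (\<Sum>\<^sub>\<infinity>i. \<rho> i * X i)"
proof -
  have r: "0 \<le> \<rho> i \<and> \<rho> i \<le> 1" for i using slowly_varyingD[OF \<rho>, of i] by simp
  have s: "(\<lambda>i. \<rho> i * X i) summable_on UNIV" by (rule weighted_summable[OF X r])
  have sk: "(\<lambda>i. X (i + k)) summable_on UNIV" for k using X(1) summable_on_shift(1) by blast
  have le: "(\<Sum>\<^sub>\<infinity>i. \<rho> i * X (i + k)) \<le> 2 * (\<Sum>\<^sub>\<infinity>i. \<rho> i * X i)" if "\<And>i. \<rho> i \<le> 2 * \<rho> (i + k)" for k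
  proof -
    have "(\<Sum>\<^sub>\<infinity>i. \<rho> i * X (i + k)) \<le> (\<Sum>\<^sub>\<infinity>i. 2 * (\<rho> (i + k) * X (i + k)))"
    proof (rule infsum_mono)
      show "(\<lambda>i. \<rho> i * X (i + k)) summable_on UNIV" by (rule weighted_summable[OF sk X(2) r])
      show "(\<lambda>i. 2 * (\<rho> (i + k) * X (i + k))) summable_on UNIV"
        by (intro summable_on_cmult_right weighted_summable[OF sk X(2) r])
      show "\<rho> i * X (i + k) \<le> 2 * (\<rho> (i + k) * X (i + k))" for i
        using mult_right_mono[OF that[of i] X(2)[of "i + k"]] by (simp add: mult.assoc)
    qed
    also have "\<dots> = 2 * (\<Sum>\<^sub>\<infinity>i. \<rho> (i + k) * X (i + k))"
      by (intro infsum_cmult_right weighted_summable[OF sk X(2) r])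
    also have "(\<Sum>\<^sub>\<infinity>i. \<rho> (i + k) * X (i + k)) = (\<Sum>\<^sub>\<infinity>i. \<rho> i * X i)"
      by (rule summable_on_shift(2)[of "\<lambda>i. \<rho> i * X i"])
    finally show ?thesis .
  qed
  have "\<rho> i \<le> 2 * \<rho> (i + 1)" "\<rho> i \<le> 2 * \<rho> (i + - 1)" for i
    using slowly_varyingD(5)[OF \<rho>, of "i + 1"] slowly_varyingD(6)[OF \<rho>, of "i - 1"] by auto
  then show "(\<Sum>\<^sub>\<infinity>i. \<rho> i * X (i + 1)) \<le> 2 * (\<Sum>\<^sub>\<infinity>i. \<rho> i * X i)" "(\<Sum>\<^sub>\<infinity>i. \<rho> i * X (i + (- 1))) \<le> 2 * (\<Sum>\<^sub>\<infinity>i. \<rho> i * X i)"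
    using le by blast+
qed

lemma energy_inequality:
  assumes \<rho>: "slowly_varying \<rho>"
  shows "2 * inner (diag \<rho> v) (field t z v) \<le> - lam0 * inner (diag \<rho> v) v + C0 * (1 + \<bar>z\<bar> powr q) * total_source \<rho> t"
proof -
  have r: "0 \<le> \<rho> i \<and> \<rho> i \<le> 1" for i using slowly_varyingD[OF \<rho>, of i] by simp
  then have rb: "\<bar>\<rho> i\<bar> \<le> 1" for i by simp
  define u D where "u = v + z *\<^sub>R h t" and "D = diag \<rho> v"
  let ?X = "\<lambda>i. site z (coord (h t) i) (coord v i)"
  have cD: "coord D i = \<rho> i * coord v i" for i unfolding D_def by (rule coord_diag[OF rb])
  have cu: "coord u i = coord v i + z * coord (h t) i" for i by (simp add: u_def coord_simps)
  have Xs: "?X summable_on UNIV"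
  proof -
    have "(\<lambda>i. \<bar>coord v i + z * coord (h t) i\<bar> powr q) summable_on UNIV"
      using coord_powr_summable[of q u] q by (simp add: cu)
    then show ?thesis
      unfolding site_def by (intro summable_on_add summable_on_cmult_right coord_summable source_parts_summable)
  qed
  have X0: "0 \<le> ?X i" for i by (rule site_nonneg)
  note Xk = summable_on_shift(1)[of ?X, THEN iffD2, OF Xs]
  \<comment> \<open>Symmetry moves one Laplacian onto the weighted solution \<open>D\<close>, so
    that \<open>f\<close> itself and not its Laplacian remains to be estimated.\<close>
  have F: "inner D (field t z v) = - inner (lap D) (lap v) - lam * inner D v - inner (lap D) (f u) + inner D (g t u) + z * inner D (forcing t)"
    unfolding field_def u_def[symmetric] by (simp add: inner_simps inner_lap)
  let ?p = "\<lambda>a b i. coord a i * coord b i"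
  let ?L = "\<lambda>i. (- 2) * ?p (lap D) (lap v) i + ((lam0 - 2 * lam) * ?p D v i + ((- 2) * ?p (lap D) (f u) i + (2 * ?p D (g t u) i + (2 * z) * ?p D (forcing t) i)))"
  have Ls: "?L summable_on UNIV" by (intro summable_on_add summable_on_cmult_right coord_prod_summable)
  have "2 * inner D (field t z v) + lam0 * inner D v = (\<Sum>\<^sub>\<infinity>i. ?L i)"
    unfolding F unfolding inner_ell2_def
    by (simp only: infsum_add infsum_cmult_right summable_on_add summable_on_cmult_right coord_prod_summable)
      (simp add: algebra_simps)
  also have "\<dots> \<le> (\<Sum>\<^sub>\<infinity>i. (C0 * (1 + \<bar>z\<bar> powr q)) * (\<rho> i * source t i) + ((- 4) * (\<rho> i * ?X i) + (\<rho> i * ?X (i + (- 1)) + \<rho> i * ?X (i + 1))))"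
  proof (rule infsum_mono[OF Ls])
    show "(\<lambda>i. (C0 * (1 + \<bar>z\<bar> powr q)) * (\<rho> i * source t i) + ((- 4) * (\<rho> i * ?X i) + (\<rho> i * ?X (i + (- 1)) + \<rho> i * ?X (i + 1)))) summable_on UNIV"
      by (intro summable_on_add summable_on_cmult_right weighted_source_summable weighted_summable[OF Xs X0] weighted_summable[OF Xk X0] r)
    fix i
    have "- 2 * coord (lap D) i * (2 * coord v i - coord v (i - 1) - coord v (i + 1)) - (2 * lam - lam0) * (\<rho> i * coord v i * coord v i)
        - 2 * coord (lap D) i * coord (f u) i + 2 * (\<rho> i * coord v i * coord (g t u) i) + 2 * z * (\<rho> i * coord v i * coord (forcing t) i)
      \<le> \<rho> i * (C0 * (1 + \<bar>z\<bar> powr q) * source t i - 4 * ?X i + ?X (i - 1) + ?X (i + 1))"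
    proof (rule local_energy)
      show "coord (lap D) i = 2 * (\<rho> i * coord v i) - \<rho> (i - 1) * coord v (i - 1) - \<rho> (i + 1) * coord v (i + 1)"
        by (simp add: coord_lap cD)
    qed (use slowly_varyingD[OF \<rho>, of i] r coord_f coord_g in \<open>auto simp: cu\<close>)
    then show "?L i \<le> (C0 * (1 + \<bar>z\<bar> powr q)) * (\<rho> i * source t i) + ((- 4) * (\<rho> i * ?X i) + (\<rho> i * ?X (i + (- 1)) + \<rho> i * ?X (i + 1)))"
      by (simp add: coord_lap[of v] cD algebra_simps)
  qed
  also have "\<dots> = (C0 * (1 + \<bar>z\<bar> powr q)) * total_source \<rho> t + ((- 4) * (\<Sum>\<^sub>\<infinity>i. \<rho> i * ?X i) + ((\<Sum>\<^sub>\<infinity>i. \<rho> i * ?X (i + (- 1))) + (\<Sum>\<^sub>\<infinity>i. \<rho> i * ?X (i + 1))))"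
    unfolding total_source_def
    by (simp only: infsum_add infsum_cmult_right summable_on_add summable_on_cmult_right weighted_source_summable[OF r]
        weighted_summable[OF Xs X0 r] weighted_summable[OF Xk X0 r])
  \<comment> \<open>The coefficient \<open>- 4\<close> meets two shifted sums, each at most twice
    the unshifted one.\<close>
  also have "\<dots> \<le> (C0 * (1 + \<bar>z\<bar> powr q)) * total_source \<rho> t"
    using weighted_shift_le[OF \<rho> Xs X0] by simp
  finally show ?thesis unfolding D_def by simp
qed

end

section \<open>The solution operator\<close>

lemma norm_ell2_two_bound:
  assumes "\<And>i. \<bar>coord a i\<bar> \<le> A * \<bar>coord b i\<bar> + \<bar>coord c i\<bar>" "0 \<le> A"
  shows "norm a \<le> 2 * A * norm b + 2 * norm c"
proof (rule power2_le_imp_le)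
  have "(norm a)\<^sup>2 \<le> (\<Sum>\<^sub>\<infinity>i. (2 * A\<^sup>2) * (coord b i)\<^sup>2 + 2 * (coord c i)\<^sup>2)"
    unfolding norm_ell2_square
  proof (rule infsum_mono)
    show "(\<lambda>i. (coord a i)\<^sup>2) summable_on UNIV" by (rule coord_summable)
    show "(\<lambda>i. (2 * A\<^sup>2) * (coord b i)\<^sup>2 + 2 * (coord c i)\<^sup>2) summable_on UNIV"
      by (intro summable_on_add summable_on_cmult_right coord_summable)
    fix i
    have "(coord a i)\<^sup>2 \<le> (A * \<bar>coord b i\<bar> + \<bar>coord c i\<bar>)\<^sup>2"
      using power_mono[OF assms(1)[of i], of 2] by simp
    also have "\<dots> \<le> 2 * (A * \<bar>coord b i\<bar>)\<^sup>2 + 2 * \<bar>coord c i\<bar>\<^sup>2"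
      using sum_squares_bound[of "A * \<bar>coord b i\<bar>" "\<bar>coord c i\<bar>"] by (simp add: power2_sum)
    finally show "(coord a i)\<^sup>2 \<le> (2 * A\<^sup>2) * (coord b i)\<^sup>2 + 2 * (coord c i)\<^sup>2"
      by (simp add: power_mult_distrib)
  qed
  also have "\<dots> = (2 * A\<^sup>2) * (norm b)\<^sup>2 + 2 * (norm c)\<^sup>2"
    unfolding norm_ell2_square
    by (simp only: infsum_add infsum_cmult_right summable_on_add summable_on_cmult_right coord_summable)
  also have "\<dots> \<le> (2 * A * norm b + 2 * norm c)\<^sup>2"
  proof -
    have "0 \<le> 2 * A\<^sup>2 * (norm b)\<^sup>2 + 2 * (norm c)\<^sup>2 + 8 * (A * norm b * norm c)" using assms(2) by simp
    then show ?thesis by (simp add: power2_eq_square algebra_simps)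
  qed
  finally show "(norm a)\<^sup>2 \<le> (2 * A * norm b + 2 * norm c)\<^sup>2" .
qed (use assms in simp)

text \<open>A set of full measure is dense; together with continuity this carries a bound from
  almost every time to every time.\<close>

lemma AE_lebesgue_open_ex:
  assumes "AE t in lebesgue. P t" "c < (d :: real)"
  obtains t where "c < t" "t < d" "P t"
proof (rule ccontr)
  assume "\<not> thesis"
  then have sub: "{c<..<d} \<subseteq> {t. \<not> P t}" using that by auto
  have "AE t in lebesgue. t \<notin> {c<..<d}" using assms(1) by eventually_elim (use sub in auto)
  then have "{c<..<d} \<in> null_sets lebesgue" by (subst completion.null_sets_iff_AE) simp
  then have "emeasure lebesgue {c<..<d} = 0" by auto
  then show False using assms(2) by simp
qed

context lattice_equation
begin

section \<open>Growth, continuity and one-sided bounds of the nonlinear terms\<close>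

definition psi4_vec :: "real \<Rightarrow> ell2" where "psi4_vec t = Ell2 (\<psi>4 t)"

lemma coord_psi4_vec: "coord (psi4_vec t) i = \<psi>4 t i"
  using bochner_L_loc_mem[OF \<psi>4, of t] by (simp add: psi4_vec_def Ell2_inverse)

text \<open>One locally integrable majorant for the data of the field that are merely integrable in
  time; the summand 1 lets constants be absorbed into its multiples.\<close>

definition envelope :: "real \<Rightarrow> real" where
  "envelope t = 1 + \<psi>3_sup t + norm (psi4_vec t) + norm (forcing t)"

lemma envelope_ge: "1 \<le> envelope t" "\<psi>3_sup t \<le> envelope t" "norm (psi4_vec t) \<le> envelope t" "norm (forcing t) \<le> envelope t"
  using \<psi>3_sup_nonneg[of t] norm_ge_zero[of "psi4_vec t"] norm_ge_zero[of "forcing t"]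
  unfolding envelope_def by linarith+

lemma le_one_plus_square: "(x::real) \<le> 1 + x\<^sup>2"
proof -
  have "0 \<le> x\<^sup>2 - 2 * x + 1" using zero_le_power2[of "x - 1"] by (simp add: power2_diff)
  then show ?thesis using zero_le_power2[of x] by linarith
qed

lemma envelope_integrable: "set_integrable lebesgue {a..b} envelope"
proof -
  obtain C where C: "0 \<le> C" "AE t in lebesgue. t \<in> {a..b} \<longrightarrow> (\<forall>i. \<bar>\<psi>3 t i\<bar> \<le> C)"
    by (rule bochner_L_infinity_AE_bound[OF bochner_L_locD[OF \<psi>3]]) auto
  define A where "A = 16 + \<bar>1 - lam\<bar>"
  have A: "0 \<le> A" by (simp add: A_def)
  have c: "set_integrable lebesgue {a..b} (\<lambda>s. c)" for c :: real
    by (intro absolutely_integrable_continuous_real continuous_intros)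
  let ?G = "\<lambda>s. (3 + C + A) + (\<Sum>\<^sub>\<infinity>i. (\<psi>4 s i)\<^sup>2) + A * (norm (h s))\<^sup>2 + (norm (h' s))\<^sup>2"
  show ?thesis
  proof (rule set_integrable_bound)
    show "set_integrable lebesgue {a..b} ?G"
      by (intro set_integral_add set_integrable_mult_right c local_parts_integrable)
    have "psi4_vec \<in> borel_measurable lebesgue"
      by (rule ell2_measurableI) (simp add: coord_psi4_vec \<psi>_measurable)
    then have "envelope \<in> borel_measurable lebesgue"
      unfolding envelope_def[abs_def]
      by (intro borel_measurable_add borel_measurable_const \<psi>3_sup_measurable
          measurable_compose[OF _ borel_measurable_norm] forcing_measurable)
    then show "set_borel_measurable lebesgue {a..b} envelope"
      unfolding set_borel_measurable_def by (intro borel_measurable_scaleR borel_measurable_indicator) auto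
    show "AE s in lebesgue. s \<in> {a..b} \<longrightarrow> norm (envelope s) \<le> norm (?G s)"
      using C(2)
    proof eventually_elim
      case (elim s)
      show ?case
      proof
        assume s: "s \<in> {a..b}"
        have "\<psi>3_sup s = (SUP i. \<bar>\<psi>3 s i\<bar>)" by (simp add: \<psi>3_sup_def ellp_norm_def)
        also have "\<dots> \<le> C" using elim s by (intro cSUP_least) auto
        finally have 1: "\<psi>3_sup s \<le> C" .
        have 2: "norm (psi4_vec s) \<le> 1 + (\<Sum>\<^sub>\<infinity>i. (\<psi>4 s i)\<^sup>2)"
          using le_one_plus_square[of "norm (psi4_vec s)"] by (simp add: norm_ell2_square coord_psi4_vec)
        have "norm (forcing s) \<le> A * norm (h s) + norm (h' s)" using norm_forcing_le by (simp add: A_def)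
        also have "\<dots> \<le> A * (1 + (norm (h s))\<^sup>2) + (1 + (norm (h' s))\<^sup>2)"
          using A by (intro add_mono mult_left_mono le_one_plus_square) auto
        finally have 3: "norm (forcing s) \<le> A + A * (norm (h s))\<^sup>2 + 1 + (norm (h' s))\<^sup>2" by (simp add: algebra_simps)
        have "envelope s \<le> ?G s" using 1 2 3 unfolding envelope_def by linarith
        moreover have "0 \<le> envelope s" using envelope_ge(1)[of s] by simp
        ultimately show "norm (envelope s) \<le> norm (?G s)" by simp
      qed
    qed
  qed
qed

lemma norm_f_diff_le:
  assumes "norm u \<le> R" "norm w \<le> R"
  shows "norm (f u - f w) \<le> \<gamma> R * norm (u - w)"
proof (rule norm_ell2_mono)
  have R: "0 \<le> R" using assms(1) norm_ge_zero order_trans by blast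
  then show "0 \<le> \<gamma> R" using \<gamma>_nonneg by simp
  fix i
  have "\<bar>coord u i\<bar> \<le> R" "\<bar>coord w i\<bar> \<le> R" using abs_coord_le assms order_trans by blast+
  then show "\<bar>coord (f u - f w) i\<bar> \<le> \<gamma> R * \<bar>coord (u - w) i\<bar>"
    using fi_lipschitz R by (simp add: coord_simps coord_f)
qed

text \<open>The surplus power \<open>q - 2\<close> is bounded by the radius, which leaves a bound
  linear in the coordinate. Such a bound passes to norms and also to tails.\<close>

lemma coord_g_le:
  assumes "\<bar>coord u i\<bar> \<le> R"
  shows "\<bar>coord (g t u) i\<bar> \<le> (\<psi>3_sup t * R powr (q - 2)) * \<bar>coord u i\<bar> + \<bar>coord (psi4_vec t) i\<bar>"
proof -
  have "\<bar>coord (g t u) i\<bar> \<le> \<psi>3 t i * \<bar>coord u i\<bar> powr (q - 1) + \<psi>4 t i" using gi_growth by (simp add: coord_g)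
  also have "\<dots> \<le> \<psi>3_sup t * (R powr (q - 2) * \<bar>coord u i\<bar>) + \<bar>\<psi>4 t i\<bar>"
  proof (intro add_mono mult_mono)
    show "\<psi>3 t i \<le> \<psi>3_sup t" using \<psi>3_le_sup[of t i] by simp
    have "\<bar>coord u i\<bar> powr (q - 1) = \<bar>coord u i\<bar> powr (q - 2) * \<bar>coord u i\<bar>"
      using powr_mult_base[of "\<bar>coord u i\<bar>" "q - 2"] by (simp add: mult.commute)
    also have "\<dots> \<le> R powr (q - 2) * \<bar>coord u i\<bar>"
      using assms q by (intro mult_right_mono powr_mono2) auto
    finally show "\<bar>coord u i\<bar> powr (q - 1) \<le> R powr (q - 2) * \<bar>coord u i\<bar>" .
  qed (use \<psi>3_sup_nonneg in auto)
  finally show ?thesis by (simp add: coord_psi4_vec mult.assoc)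
qed

lemma norm_g_le:
  assumes "norm u \<le> R"
  shows "norm (g t u) \<le> (2 * R powr (q - 2) * R + 2) * envelope t"
proof -
  have R: "0 \<le> R" using assms norm_ge_zero order_trans by blast
  have "norm (g t u) \<le> 2 * (\<psi>3_sup t * R powr (q - 2)) * norm u + 2 * norm (psi4_vec t)"
    using \<psi>3_sup_nonneg[of t] order_trans[OF abs_coord_le assms]
    by (intro norm_ell2_two_bound coord_g_le) auto
  also have "\<dots> \<le> 2 * (envelope t * R powr (q - 2)) * R + 2 * envelope t"
    using envelope_ge[of t] assms R \<psi>3_sup_nonneg[of t] by (intro add_mono mult_mono) auto
  finally show ?thesis by (simp add: algebra_simps)
qed

lemma gi_section_continuous: "continuous_on UNIV (gi i t)" "continuous_on UNIV (\<lambda>t. gi i t x)"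
proof -
  have c: "continuous_on UNIV (\<lambda>p. gi i (fst p) (snd p))" using gi_cont by (simp add: case_prod_beta')
  show "continuous_on UNIV (gi i t)"
    using continuous_on_compose2[OF c, of UNIV "\<lambda>a. (t, a)"] by (simp add: continuous_intros)
  show "continuous_on UNIV (\<lambda>t. gi i t x)"
    using continuous_on_compose2[OF c, of UNIV "\<lambda>t. (t, x)"] by (simp add: continuous_intros)
qed

text \<open>Coordinatewise continuity is lifted to the norm by tails: the linear bound of
  \<open>coord_g_le\<close> controls the tail of \<open>g t (u n)\<close> by those of
  \<open>w\<close> and \<open>psi4_vec t\<close> and by \<open>norm (u n - w)\<close>. The cut
  \<open>k\<close> is fixed by the tails of the limit, and only finitely many coordinates
  remain.\<close>

lemma g_continuous: "continuous_on UNIV (g t)"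
  unfolding continuous_on_sequentially
proof (intro ballI allI impI)
  fix u :: "nat \<Rightarrow> ell2" and w assume "(\<forall>n. u n \<in> UNIV) \<and> u \<longlonglongrightarrow> w"
  then have lim: "u \<longlonglongrightarrow> w" by simp
  then have "Bseq u" by (rule convergent_imp_Bseq[OF convergentI])
  then obtain R0 where R0: "\<And>n. norm (u n) \<le> R0" unfolding Bseq_def by blast
  define R where "R = max R0 (norm w)"
  have R: "norm (u n) \<le> R" "norm w \<le> R" for n using R0[of n] by (auto simp: R_def)
  define A where "A = \<psi>3_sup t * R powr (q - 2)"
  have A: "0 \<le> A" using \<psi>3_sup_nonneg[of t] by (simp add: A_def)
  have tail_le: "norm (tail k (g t x)) \<le> 2 * A * norm (tail k x) + 2 * norm (tail k (psi4_vec t))"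
    if "norm x \<le> R" for k x
    using coord_g_le[OF order_trans[OF abs_coord_le that]]
    by (intro norm_ell2_two_bound A) (auto simp: coord_tail A_def)
  let ?H = "\<lambda>k x. \<Sum>i\<in>{- int k..int k}. coord x i *\<^sub>R unit_vec i"
  show "(g t \<circ> u) \<longlonglongrightarrow> g t w"
    unfolding o_def
  proof (rule metric_LIMSEQ_I)
    fix e :: real assume e: "0 < e"
    have "(\<lambda>k. 4 * A * norm (tail k w) + 4 * norm (tail k (psi4_vec t))) \<longlonglongrightarrow> 4 * A * norm (0::ell2) + 4 * norm (0::ell2)"
      by (intro tendsto_intros tail_tendsto_0)
    then have "(\<lambda>k. 4 * A * norm (tail k w) + 4 * norm (tail k (psi4_vec t))) \<longlonglongrightarrow> 0" by simp
    from metric_LIMSEQ_D[OF this, of "e / 2"] e obtain k where "dist (4 * A * norm (tail k w) + 4 * norm (tail k (psi4_vec t))) 0 < e / 2"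
      by auto
    then have k: "4 * A * norm (tail k w) + 4 * norm (tail k (psi4_vec t)) < e / 2"
      unfolding dist_real_def by linarith
    have "(\<lambda>n. norm (?H k (g t (u n)) - ?H k (g t w)) + 2 * A * norm (u n - w)) \<longlonglongrightarrow> norm (?H k (g t w) - ?H k (g t w)) + 2 * A * norm (w - w)"
    proof (intro tendsto_intros lim)
      fix i
      have "(\<lambda>n. coord (u n) i) \<longlonglongrightarrow> coord w i" using lim by (rule bounded_linear.tendsto[OF bounded_linear_coord])
      then have "(\<lambda>n. gi i t (coord (u n) i)) \<longlonglongrightarrow> gi i t (coord w i)"
        by (rule continuous_on_tendsto_compose[OF gi_section_continuous(1)]) auto
      then show "(\<lambda>n. coord (g t (u n)) i) \<longlonglongrightarrow> coord (g t w) i" by (simp add: coord_g)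
    qed
    then have "(\<lambda>n. norm (?H k (g t (u n)) - ?H k (g t w)) + 2 * A * norm (u n - w)) \<longlonglongrightarrow> 0" by simp
    from metric_LIMSEQ_D[OF this, of "e / 2"] e
    obtain N where "\<forall>n\<ge>N. dist (norm (?H k (g t (u n)) - ?H k (g t w)) + 2 * A * norm (u n - w)) 0 < e / 2"
      by auto
    then have N: "\<forall>n\<ge>N. norm (?H k (g t (u n)) - ?H k (g t w)) + 2 * A * norm (u n - w) < e / 2"
      unfolding dist_real_def diff_0_right by (meson abs_less_iff)
    have "dist (g t (u n)) (g t w) < e" if n: "n \<ge> N" for n
    proof -
      have "g t (u n) - g t w = (?H k (g t (u n)) - ?H k (g t w)) + (tail k (g t (u n)) - tail k (g t w))"
        using head_tail[of "g t (u n)" k] head_tail[of "g t w" k] by (simp add: algebra_simps)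
      then have "norm (g t (u n) - g t w) \<le> norm (?H k (g t (u n)) - ?H k (g t w)) + norm (tail k (g t (u n)) - tail k (g t w))"
        by (metis norm_triangle_ineq)
      also have "norm (tail k (g t (u n)) - tail k (g t w)) \<le> norm (tail k (g t (u n))) + norm (tail k (g t w))"
        by (rule norm_triangle_ineq4)
      also have "norm (tail k (g t (u n))) \<le> 2 * A * norm (tail k (u n)) + 2 * norm (tail k (psi4_vec t))" by (rule tail_le[OF R(1)])
      also have "norm (tail k (g t w)) \<le> 2 * A * norm (tail k w) + 2 * norm (tail k (psi4_vec t))" by (rule tail_le[OF R(2)])
      also have "norm (tail k (u n)) \<le> norm (tail k w) + norm (u n - w)"
      proof -
        have "bounded_linear (tail k)" unfolding tail_def by (rule bounded_linear_diag[of _ 1]) auto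
        then have "tail k (u n) = tail k w + tail k (u n - w)" by (simp add: linear_diff bounded_linear.linear)
        then have "norm (tail k (u n)) \<le> norm (tail k w) + norm (tail k (u n - w))" by (metis norm_triangle_ineq)
        also have "norm (tail k (u n - w)) \<le> 1 * norm (u n - w)" unfolding tail_def by (rule norm_diag_le) auto
        finally show ?thesis by simp
      qed
      finally have "norm (g t (u n) - g t w) \<le> norm (?H k (g t (u n)) - ?H k (g t w)) +
          (2 * A * (norm (tail k w) + norm (u n - w)) + 2 * norm (tail k (psi4_vec t)) + (2 * A * norm (tail k w) + 2 * norm (tail k (psi4_vec t))))"
        using A by (simp add: mult_left_mono)
      also have "\<dots> = (norm (?H k (g t (u n)) - ?H k (g t w)) + 2 * A * norm (u n - w)) + (4 * A * norm (tail k w) + 4 * norm (tail k (psi4_vec t)))"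
        by (simp add: algebra_simps)
      also have "\<dots> < e / 2 + e / 2" using N n k by (intro add_strict_mono) auto
      finally show ?thesis by (simp add: dist_norm)
    qed
    then show "\<exists>N. \<forall>n\<ge>N. dist (g t (u n)) (g t w) < e" by blast
  qed
qed

lemma f_continuous: "continuous_on UNIV f"
  unfolding continuous_on_sequentially
proof (intro ballI allI impI)
  fix u :: "nat \<Rightarrow> ell2" and w assume "(\<forall>n. u n \<in> UNIV) \<and> u \<longlonglongrightarrow> w"
  then have lim: "u \<longlonglongrightarrow> w" by simp
  then have "Bseq u" by (rule convergent_imp_Bseq[OF convergentI])
  then obtain R0 where R0: "\<And>n. norm (u n) \<le> R0" unfolding Bseq_def by blast
  define R where "R = max R0 (norm w)"
  have R: "norm (u n) \<le> R" "norm w \<le> R" for n using R0[of n] by (auto simp: R_def)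
  have "(\<lambda>n. f (u n) - f w) \<longlonglongrightarrow> 0"
  proof (rule Lim_null_comparison)
    show "\<forall>\<^sub>F n in sequentially. norm (f (u n) - f w) \<le> \<gamma> R * norm (u n - w)"
      using norm_f_diff_le[OF R] by (intro always_eventually) auto
    have "(\<lambda>n. \<gamma> R * norm (u n - w)) \<longlonglongrightarrow> \<gamma> R * norm (w - w)" by (intro tendsto_intros lim)
    then show "(\<lambda>n. \<gamma> R * norm (u n - w)) \<longlonglongrightarrow> 0" by simp
  qed
  then show "(f \<circ> u) \<longlonglongrightarrow> f w" by (simp add: LIM_zero_iff o_def)
qed

text \<open>The bound on the derivative holds for almost every time with a constant, hence for every
  time by continuity of \<open>g\<^sub>i\<close> in \<open>t\<close>.\<close>

lemma gi_one_sided: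
  obtains C where "0 \<le> C" "\<And>t i x y. t \<in> {a..b} \<Longrightarrow> (gi i t x - gi i t y) * (x - y) \<le> C * (x - y)\<^sup>2"
proof -
  \<comment> \<open>The interval is enlarged by 1, so that good times found slightly to the right of
    \<open>t\<close> remain inside.\<close>
  obtain C where C: "0 \<le> C" "AE t in lebesgue. t \<in> {a - 1..b + 1} \<longrightarrow> (\<forall>i. \<bar>\<psi>2 t i\<bar> \<le> C)"
    by (rule bochner_L_infinity_AE_bound[OF bochner_L_locD[OF \<psi>2]]) auto
  have good: "(gi i t x - gi i t y) * (x - y) \<le> C * (x - y)\<^sup>2" if t: "\<forall>i. \<bar>\<psi>2 t i\<bar> \<le> C" for t i x y
  proof -
    have *: "gi i t x - gi i t y \<le> C * (x - y)" if "y < x" for x y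
    proof -
      have "\<exists>z. y < z \<and> z < x \<and> gi i t x - gi i t y = (x - y) * deriv (gi i t) z"
        using gi_diff that by (intro MVT2) (auto simp: DERIV_deriv_iff_real_differentiable)
      then obtain z where "gi i t x - gi i t y = (x - y) * deriv (gi i t) z" by blast
      moreover have "deriv (gi i t) z \<le> C" using gi_deriv[rule_format, of i t z] t[rule_format, of i] by linarith
      ultimately show ?thesis using that by (simp add: mult.commute mult_right_mono)
    qed
    consider "y < x" | "x < y" | "x = y" by linarith
    then show ?thesis
    proof cases
      case 1
      then show ?thesis using mult_right_mono[OF *[OF 1], of "x - y"] by (simp add: power2_eq_square mult.assoc)
    next
      case 2
      then show ?thesis using mult_right_mono[OF *[OF 2], of "y - x"] by (simp add: power2_eq_square algebra_simps)
    qed simp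
  qed
  show ?thesis
  proof (rule that[OF C(1)], rule ccontr)
    fix t i x y assume t: "t \<in> {a..b}" and bad: "\<not> (gi i t x - gi i t y) * (x - y) \<le> C * (x - y)\<^sup>2"
    let ?k = "\<lambda>t. (gi i t x - gi i t y) * (x - y) - C * (x - y)\<^sup>2"
    have "continuous_on UNIV ?k" by (intro continuous_intros gi_section_continuous)
    then have "open {s. 0 < ?k s}" by (rule open_Collect_less[OF continuous_on_const])
    moreover have "t \<in> {s. 0 < ?k s}" using bad by simp
    ultimately obtain d where d: "0 < d" "ball t d \<subseteq> {s. 0 < ?k s}" using open_contains_ball by blast
    obtain s where s: "t < s" "s < t + min d 1" "s \<in> {a - 1..b + 1} \<longrightarrow> (\<forall>i. \<bar>\<psi>2 s i\<bar> \<le> C)"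
      using AE_lebesgue_open_ex[OF C(2), of t "t + min d 1"] d(1) by (metis less_add_same_cancel1 min_less_iff_conj zero_less_one)
    then have "\<forall>i. \<bar>\<psi>2 s i\<bar> \<le> C" using t by auto
    from good[OF this, of i x y] have "?k s \<le> 0" by simp
    moreover have "s \<in> ball t d" using s by (auto simp: dist_real_def)
    ultimately show False using d(2) by auto
  qed
qed

lemma g_one_sided:
  assumes "\<And>i x y. (gi i t x - gi i t y) * (x - y) \<le> C * (x - y)\<^sup>2"
  shows "inner (u - w) (g t u - g t w) \<le> C * (norm (u - w))\<^sup>2"
proof -
  have "inner (u - w) (g t u - g t w) \<le> (\<Sum>\<^sub>\<infinity>i. C * (coord (u - w) i)\<^sup>2)"
    unfolding inner_ell2_def
  proof (rule infsum_mono)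
    show "(\<lambda>i. coord (u - w) i * coord (g t u - g t w) i) summable_on UNIV" by (rule coord_prod_summable)
    show "(\<lambda>i. C * (coord (u - w) i)\<^sup>2) summable_on UNIV" by (intro summable_on_cmult_right coord_summable)
    show "coord (u - w) i * coord (g t u - g t w) i \<le> C * (coord (u - w) i)\<^sup>2" for i
      using assms[of i "coord u i" "coord w i"] by (simp add: coord_simps coord_g mult.commute)
  qed
  also have "\<dots> = C * (norm (u - w))\<^sup>2"
    unfolding norm_ell2_square by (intro infsum_cmult_right coord_summable)
  finally show ?thesis .
qed

text \<open>The constants are uniform over the time interval and over bounded noise values and
  states. The one-sided bound for \<open>g\<close> pairs with \<open>u1 - u2\<close>, which is
  \<open>w\<close> plus \<open>d\<close> times \<open>h t\<close>; the correction is
  \<open>d\<close> times the inner product of \<open>h t\<close> with a difference of values of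
  \<open>g\<close>, for which only boundedness is used. The difference of the noise therefore enters
  to the first power.\<close>

lemma field_compare:
  assumes "0 \<le> Z" "0 \<le> R"
  obtains L N where "0 \<le> L" "0 \<le> N"
    "\<And>t z1 z2 v1 v2. t \<in> {a..b} \<Longrightarrow> \<bar>z1\<bar> \<le> Z \<Longrightarrow> \<bar>z2\<bar> \<le> Z \<Longrightarrow> norm v1 \<le> R \<Longrightarrow> norm v2 \<le> R \<Longrightarrow>
      2 * inner (v1 - v2) (field t z1 v1 - field t z2 v2) \<le> L * (norm (v1 - v2))\<^sup>2 + \<bar>z1 - z2\<bar> * (N * envelope t)"
    "\<And>t z v. t \<in> {a..b} \<Longrightarrow> \<bar>z\<bar> \<le> Z \<Longrightarrow> norm v \<le> R \<Longrightarrow> norm (field t z v) \<le> N * envelope t"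
proof -
  obtain H where H: "H > 0" "\<And>s. s \<in> {a..b} \<Longrightarrow> norm (h s) \<le> H"
    using continuous_Icc_norm_bound[OF h_continuous] by blast
  obtain C where C: "0 \<le> C" "\<And>t i x y. t \<in> {a..b} \<Longrightarrow> (gi i t x - gi i t y) * (x - y) \<le> C * (x - y)\<^sup>2"
    using gi_one_sided[of a b] by blast
  define R' where "R' = R + Z * H"
  \<comment> \<open>The Lipschitz constant of \<open>f\<close> on the ball times the norm 4 of the
    Laplacian.\<close>
  define k where "k = 4 * \<gamma> R'"
  define G where "G = 2 * R' powr (q - 2) * R' + 2"
  define L where "L = 2 * (k + 2 * C)"
  \<comment> \<open>The first group of terms serves the comparison, the second the bound of the
    field; both are nonnegative, so the sum covers either use.\<close>
  define N where "N = (2 * (k * (2 * R) * H + 4 * C * Z * H\<^sup>2 + 2 * H * G + 2 * R)) + ((16 * R + lam * R + 4 * norm (f 0) + k * R') + G + Z)"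
  have R': "0 \<le> R'" using assms H by (simp add: R'_def)
  have pos: "0 \<le> k" "0 \<le> G" using \<gamma>_nonneg R' by (auto simp: k_def G_def)
  have ub: "norm (v + z *\<^sub>R h t) \<le> R'" if "t \<in> {a..b}" "\<bar>z\<bar> \<le> Z" "norm v \<le> R" for t z v
  proof -
    have "norm (v + z *\<^sub>R h t) \<le> norm v + \<bar>z\<bar> * norm (h t)" using norm_triangle_ineq[of v "z *\<^sub>R h t"] by simp
    also have "\<dots> \<le> R + Z * H" using that assms H by (intro add_mono mult_mono) auto
    finally show ?thesis by (simp add: R'_def)
  qed
  show ?thesis
  proof (rule that)
    show "0 \<le> L" using pos C by (simp add: L_def)
    have N1: "0 \<le> 2 * (k * (2 * R) * H + 4 * C * Z * H\<^sup>2 + 2 * H * G + 2 * R)" using pos C assms H by simp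
    have N2: "0 \<le> (16 * R + lam * R + 4 * norm (f 0) + k * R') + G + Z" using pos assms R' const_pos by simp
    show N: "0 \<le> N" using N1 N2 by (simp add: N_def)
    fix t assume t: "t \<in> {a..b}"
    let ?e = "envelope t"
    have e: "1 \<le> ?e" "0 \<le> ?e" using envelope_ge(1)[of t] by auto
    show "norm (field t z v) \<le> N * ?e" if z: "\<bar>z\<bar> \<le> Z" "norm v \<le> R" for z v
    proof -
      let ?u = "v + z *\<^sub>R h t"
      have fb: "norm (f ?u) \<le> norm (f 0) + \<gamma> R' * R'"
      proof -
        have "norm (f ?u - f 0) \<le> \<gamma> R' * norm (?u - 0)" using ub[OF t z] R' by (intro norm_f_diff_le) auto
        also have "\<dots> \<le> \<gamma> R' * R'" using ub[OF t z] \<gamma>_nonneg R' by (intro mult_left_mono) auto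
        finally show ?thesis using norm_triangle_ineq[of "f ?u - f 0" "f 0"] by simp
      qed
      have "norm (field t z v) \<le> norm (lap (lap v)) + norm (lam *\<^sub>R v) + norm (lap (f ?u)) + norm (g t ?u) + norm (z *\<^sub>R forcing t)"
        unfolding field_def
        by (intro order_trans[OF norm_triangle_ineq] order_trans[OF norm_triangle_ineq4] add_mono order_refl) simp
      also have "\<dots> \<le> 16 * R + lam * R + 4 * (norm (f 0) + \<gamma> R' * R') + G * ?e + Z * ?e"
      proof (intro add_mono)
        show "norm (lap (lap v)) \<le> 16 * R" using norm_lap_le[of "lap v"] norm_lap_le[of v] z by simp
        show "norm (lam *\<^sub>R v) \<le> lam * R" using z const_pos by (simp add: mult_left_mono)
        show "norm (lap (f ?u)) \<le> 4 * (norm (f 0) + \<gamma> R' * R')" using norm_lap_le[of "f ?u"] fb by simp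
        show "norm (g t ?u) \<le> G * ?e" unfolding G_def by (rule norm_g_le[OF ub[OF t z]])
        show "norm (z *\<^sub>R forcing t) \<le> Z * ?e" using z envelope_ge(4)[of t] assms by (simp add: mult_mono)
      qed
      also have "\<dots> \<le> (16 * R + lam * R + 4 * norm (f 0) + k * R') * ?e + G * ?e + Z * ?e"
        using mult_left_mono[OF e(1), of "16 * R + lam * R + 4 * norm (f 0) + k * R'"] pos assms R' const_pos
        by (simp add: k_def algebra_simps)
      also have "\<dots> = ((16 * R + lam * R + 4 * norm (f 0) + k * R') + G + Z) * ?e" by (simp add: algebra_simps)
      also have "\<dots> \<le> N * ?e" using N1 e by (intro mult_right_mono) (auto simp: N_def)
      finally show ?thesis .
    qed
    show "2 * inner (v1 - v2) (field t z1 v1 - field t z2 v2) \<le> L * (norm (v1 - v2))\<^sup>2 + \<bar>z1 - z2\<bar> * (N * ?e)"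
      if z: "\<bar>z1\<bar> \<le> Z" "\<bar>z2\<bar> \<le> Z" and v: "norm v1 \<le> R" "norm v2 \<le> R" for z1 z2 v1 v2
    proof -
      define w d u1 u2 where "w = v1 - v2" and "d = z1 - z2" and "u1 = v1 + z1 *\<^sub>R h t" and "u2 = v2 + z2 *\<^sub>R h t"
      have u: "norm u1 \<le> R'" "norm u2 \<le> R'" using ub[OF t z(1) v(1)] ub[OF t z(2) v(2)] by (auto simp: u1_def u2_def)
      have du: "u1 - u2 = w + d *\<^sub>R h t" by (simp add: u1_def u2_def w_def d_def algebra_simps)
      have hH: "norm (h t) \<le> H" using H(2)[OF t] .
      have w2R: "norm w \<le> 2 * R" using norm_triangle_ineq4[of v1 v2] v by (simp add: w_def)
      have dZ: "\<bar>d\<bar> \<le> 2 * Z" using z by (simp add: d_def)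
      have ndu: "norm (u1 - u2) \<le> norm w + \<bar>d\<bar> * H"
      proof -
        have "norm (u1 - u2) \<le> norm w + \<bar>d\<bar> * norm (h t)" unfolding du using norm_triangle_ineq[of w "d *\<^sub>R h t"] by simp
        also have "\<dots> \<le> norm w + \<bar>d\<bar> * H" using hH by (intro add_left_mono mult_left_mono) auto
        finally show ?thesis .
      qed
      have "field t z1 v1 - field t z2 v2 = - lap (lap w) - lam *\<^sub>R w - lap (f u1 - f u2) + (g t u1 - g t u2) + d *\<^sub>R forcing t"
        unfolding field_def u1_def[symmetric] u2_def[symmetric] w_def d_def by (simp add: lap_linear algebra_simps)
      then have split: "inner w (field t z1 v1 - field t z2 v2) =
          - (norm (lap w))\<^sup>2 - lam * (norm w)\<^sup>2 - inner w (lap (f u1 - f u2)) + inner w (g t u1 - g t u2) + d * inner w (forcing t)"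
        by (simp add: inner_simps power2_norm_eq_inner inner_lap)
      have 1: "- inner w (lap (f u1 - f u2)) \<le> k * (norm w)\<^sup>2 + \<bar>d\<bar> * (k * (2 * R) * H)"
      proof -
        have "- inner w (lap (f u1 - f u2)) \<le> norm w * norm (lap (f u1 - f u2))"
          using Cauchy_Schwarz_ineq2[of w "lap (f u1 - f u2)"] by (simp add: abs_le_iff)
        also have "\<dots> \<le> norm w * (4 * (\<gamma> R' * (norm w + \<bar>d\<bar> * H)))"
        proof (intro mult_left_mono order_trans[OF norm_lap_le] order_trans[OF norm_f_diff_le[OF u]] ndu)
        qed (use \<gamma>_nonneg R' in auto)
        also have "\<dots> = k * (norm w)\<^sup>2 + \<bar>d\<bar> * (k * norm w * H)" by (simp add: k_def power2_eq_square algebra_simps)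
        also have "\<dots> \<le> k * (norm w)\<^sup>2 + \<bar>d\<bar> * (k * (2 * R) * H)"
          using w2R pos H by (intro add_left_mono mult_left_mono mult_right_mono) auto
        finally show ?thesis .
      qed
      have 2: "inner w (g t u1 - g t u2) \<le> 2 * C * (norm w)\<^sup>2 + \<bar>d\<bar> * (4 * C * Z * H\<^sup>2 + 2 * H * G * ?e)"
      proof -
        have "inner w (g t u1 - g t u2) = inner (u1 - u2) (g t u1 - g t u2) + - (d * inner (h t) (g t u1 - g t u2))"
          by (simp add: du inner_simps algebra_simps)
        also have "inner (u1 - u2) (g t u1 - g t u2) \<le> C * (norm (u1 - u2))\<^sup>2" by (rule g_one_sided[OF C(2)[OF t]])
        also have "\<dots> \<le> C * (2 * (norm w)\<^sup>2 + \<bar>d\<bar> * (4 * Z * H\<^sup>2))"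
        proof (intro mult_left_mono C)
          have "(norm (u1 - u2))\<^sup>2 \<le> (norm w + \<bar>d\<bar> * H)\<^sup>2" using ndu by (intro power_mono) auto
          also have "\<dots> \<le> 2 * (norm w)\<^sup>2 + 2 * (\<bar>d\<bar> * H)\<^sup>2"
            using sum_squares_bound[of "norm w" "\<bar>d\<bar> * H"] by (simp add: power2_sum)
          also have "2 * (\<bar>d\<bar> * H)\<^sup>2 = \<bar>d\<bar> * (\<bar>d\<bar> * (2 * H\<^sup>2))" by (simp add: power2_eq_square algebra_simps)
          also have "\<dots> \<le> \<bar>d\<bar> * (2 * Z * (2 * H\<^sup>2))" using dZ by (intro mult_left_mono mult_right_mono) auto
          finally show "(norm (u1 - u2))\<^sup>2 \<le> 2 * (norm w)\<^sup>2 + \<bar>d\<bar> * (4 * Z * H\<^sup>2)" by (simp add: algebra_simps)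
        qed
        also have "- (d * inner (h t) (g t u1 - g t u2)) \<le> \<bar>d\<bar> * (2 * H * G * ?e)"
        proof -
          have gn: "norm (g t u1 - g t u2) \<le> 2 * (G * ?e)"
            using norm_triangle_ineq4[of "g t u1" "g t u2"] norm_g_le[OF u(1), of t] norm_g_le[OF u(2), of t] by (simp add: G_def)
          have "- (d * inner (h t) (g t u1 - g t u2)) \<le> \<bar>d\<bar> * \<bar>inner (h t) (g t u1 - g t u2)\<bar>"
            using abs_ge_minus_self[of "d * inner (h t) (g t u1 - g t u2)"] by (simp add: abs_mult)
          also have "\<dots> \<le> \<bar>d\<bar> * (H * (2 * (G * ?e)))"
            using hH gn H by (intro mult_left_mono order_trans[OF Cauchy_Schwarz_ineq2] mult_mono) auto
          finally show ?thesis by (simp add: mult_ac)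
        qed
        finally show ?thesis by (simp add: algebra_simps)
      qed
      have 3: "d * inner w (forcing t) \<le> \<bar>d\<bar> * (2 * R * ?e)"
      proof -
        have "d * inner w (forcing t) \<le> \<bar>d\<bar> * \<bar>inner w (forcing t)\<bar>"
          using abs_ge_self[of "d * inner w (forcing t)"] by (simp add: abs_mult)
        also have "\<dots> \<le> \<bar>d\<bar> * (2 * R * ?e)"
          using w2R envelope_ge(4)[of t] assms by (intro mult_left_mono order_trans[OF Cauchy_Schwarz_ineq2] mult_mono) auto
        finally show ?thesis .
      qed
      have aux: "2 * (- p - l - x + y + y') \<le> 2 * (X + Y + Y')"
        if "- x \<le> X" "y \<le> Y" "y' \<le> Y'" "0 \<le> p" "0 \<le> l" for p l x y y' X Y Y' :: real
        using that by (intro mult_left_mono) linarith+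
      have "2 * inner w (field t z1 v1 - field t z2 v2) \<le> 2 * ((k * (norm w)\<^sup>2 + \<bar>d\<bar> * (k * (2 * R) * H))
          + (2 * C * (norm w)\<^sup>2 + \<bar>d\<bar> * (4 * C * Z * H\<^sup>2 + 2 * H * G * ?e)) + \<bar>d\<bar> * (2 * R * ?e))"
        unfolding split by (rule aux[OF 1 2 3]) (use const_pos in auto)
      also have "\<dots> = L * (norm w)\<^sup>2 + \<bar>d\<bar> * (2 * (k * (2 * R) * H + 4 * C * Z * H\<^sup>2 + 2 * H * G * ?e + 2 * R * ?e))"
        by (simp add: L_def algebra_simps)
      also have "\<dots> \<le> L * (norm w)\<^sup>2 + \<bar>d\<bar> * (N * ?e)"
      proof (intro add_left_mono mult_left_mono)
        have "k * (2 * R) * H + 4 * C * Z * H\<^sup>2 \<le> (k * (2 * R) * H + 4 * C * Z * H\<^sup>2) * ?e"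
          using mult_left_mono[OF e(1), of "k * (2 * R) * H + 4 * C * Z * H\<^sup>2"] pos assms C H by simp
        then have "2 * (k * (2 * R) * H + 4 * C * Z * H\<^sup>2 + 2 * H * G * ?e + 2 * R * ?e) \<le>
           2 * (k * (2 * R) * H + 4 * C * Z * H\<^sup>2 + 2 * H * G + 2 * R) * ?e"
          by (simp add: algebra_simps)
        also have "\<dots> \<le> N * ?e" using N2 e by (intro mult_right_mono) (auto simp: N_def)
        finally show "2 * (k * (2 * R) * H + 4 * C * Z * H\<^sup>2 + 2 * H * G * ?e + 2 * R * ?e) \<le> N * ?e" .
      qed simp
      finally show ?thesis by (simp add: w_def d_def)
    qed
  qed
qed

end

section \<open>Existence, uniqueness and stability of solutions along a path\<close>

context lattice_equation
begin

lemma field_continuous: "continuous_on S (field t z)"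
proof -
  have c: "continuous_on S (\<lambda>v. v + z *\<^sub>R h t)" by (intro continuous_intros)
  show ?thesis
    unfolding field_def[abs_def]
    by (intro continuous_intros bounded_linear.continuous_on[OF bounded_linear_lap]
        continuous_on_compose2[OF f_continuous c] continuous_on_compose2[OF g_continuous c]) auto
qed

text \<open>Along a continuous curve the linear terms and \<open>f\<close> are continuous and
  \<open>g\<close> is so in each coordinate, by joint continuity of \<open>gi\<close>; only the
  forcing is merely measurable in time.\<close>

lemma field_measurable:
  assumes z: "continuous_on UNIV z" and w: "continuous_on {c..d} w"
  shows "set_borel_measurable lebesgue {c..d} (\<lambda>s. field s (z s) (w s))"
proof -
  let ?u = "\<lambda>s. w s + z s *\<^sub>R h s"
  have cz: "continuous_on {c..d} z" using z continuous_on_subset by blast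
  have cu: "continuous_on {c..d} ?u" by (intro continuous_intros w cz h_continuous)
  let ?A = "\<lambda>s. - lap (lap (w s)) - lam *\<^sub>R w s - lap (f (?u s))"
  have "continuous_on {c..d} ?A"
    by (intro continuous_intros bounded_linear.continuous_on[OF bounded_linear_lap] w
        continuous_on_compose2[OF f_continuous cu]) auto
  then have mA: "(\<lambda>s. indicator {c..d} s *\<^sub>R ?A s) \<in> borel_measurable lebesgue"
    by (rule set_borel_measurable_continuous_Icc)
  have mg: "(\<lambda>s. indicator {c..d} s *\<^sub>R g s (?u s)) \<in> borel_measurable lebesgue"
  proof (rule ell2_measurableI)
    fix i
    have cc: "continuous_on {c..d} (\<lambda>s. (s, coord (?u s) i))"
      by (intro continuous_intros bounded_linear.continuous_on[OF bounded_linear_coord] cu)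
    have "continuous_on {c..d} (\<lambda>s. (\<lambda>(t, a). gi i t a) (s, coord (?u s) i))"
      by (rule continuous_on_compose2[OF gi_cont[rule_format, of i] cc]) simp
    then have "continuous_on {c..d} (\<lambda>s. gi i s (coord (?u s) i))" by simp
    from set_borel_measurable_continuous_Icc[OF this]
    show "(\<lambda>s. coord (indicator {c..d} s *\<^sub>R g s (?u s)) i) \<in> borel_measurable lebesgue"
      by (simp add: coord_simps coord_g)
  qed
  have mz: "z \<in> borel_measurable lebesgue"
    by (rule measurable_completion) (use borel_measurable_continuous_onI[OF z] in simp)
  have mf: "(\<lambda>s. indicator {c..d} s *\<^sub>R (z s *\<^sub>R forcing s)) \<in> borel_measurable lebesgue"
    by (intro borel_measurable_scaleR borel_measurable_indicator mz forcing_measurable) auto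
  have "(\<lambda>s. indicator {c..d} s *\<^sub>R field s (z s) (w s)) =
    (\<lambda>s. indicator {c..d} s *\<^sub>R ?A s + indicator {c..d} s *\<^sub>R g s (?u s) + indicator {c..d} s *\<^sub>R (z s *\<^sub>R forcing s))"
    by (simp add: field_def fun_eq_iff split: split_indicator)
  then show ?thesis unfolding set_borel_measurable_def using mA mg mf by simp
qed

lemma total_local_integrable:
  assumes "\<And>i. 0 \<le> \<rho> i \<and> \<rho> i \<le> 1"
  shows "set_integrable lebesgue {a..b} (total_source \<rho>)"
proof (rule set_integrable_bound)
  have "set_integrable lebesgue {a..b} (\<lambda>s. exp (lam1 * s) * total_source (\<lambda>_. 1) s)"
    by (rule set_integrable_subset[OF total_integrable[of b]]) auto
  then have "set_integrable lebesgue {a..b} (\<lambda>s. exp (- lam1 * s) * (exp (lam1 * s) * total_source (\<lambda>_. 1) s))"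
    by (rule set_integrable_bilinear_right[OF bounded_bilinear_mult]) (intro continuous_intros)
  also have "(\<lambda>s. exp (- lam1 * s) * (exp (lam1 * s) * total_source (\<lambda>_. 1) s)) = total_source (\<lambda>_. 1)"
    by (simp add: fun_eq_iff mult.assoc[symmetric] exp_add[symmetric])
  finally show "set_integrable lebesgue {a..b} (total_source (\<lambda>_. 1))" .
  show "set_borel_measurable lebesgue {a..b} (total_source \<rho>)"
    unfolding set_borel_measurable_def
    by (intro borel_measurable_scaleR borel_measurable_indicator total_measurable assms) simp
  show "AE s in lebesgue. s \<in> {a..b} \<longrightarrow> norm (total_source \<rho> s) \<le> norm (total_source (\<lambda>_. 1) s)"
    using total_mono[OF assms] total_nonneg[OF assms] total_nonneg[of "\<lambda>_. 1"] by (intro AE_I2) simp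
qed

lemma slowly_varying_const: "slowly_varying (\<lambda>_. 1)"
  using const_pos by (simp add: slowly_varying_def)

lemma diag_one: "diag (\<lambda>_. 1) v = v"
  by (rule ell2_eqI) (subst coord_diag[of _ 1], auto)

definition is_sol :: "(real \<Rightarrow> real) \<Rightarrow> real \<Rightarrow> real \<Rightarrow> (real \<Rightarrow> ell2) \<Rightarrow> bool" where
  "is_sol z a b v \<longleftrightarrow> ac_on a b v (\<lambda>s. field s (z s) (v s))"

lemma sol_energy:
  assumes \<rho>: "slowly_varying \<rho>" and z: "continuous_on UNIV z" and ab: "a \<le> b" and v: "is_sol z a b v"
  shows "inner (diag \<rho> (v b)) (v b) \<le> exp (- lam0 * (b - a)) * inner (diag \<rho> (v a)) (v a)
      + (LINT s:{a..b}|lebesgue. exp (- lam0 * (b - s)) * (C0 * (1 + \<bar>z s\<bar> powr q) * total_source \<rho> s))"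
    and "set_integrable lebesgue {a..b} (\<lambda>s. exp (- lam0 * (b - s)) * (C0 * (1 + \<bar>z s\<bar> powr q) * total_source \<rho> s))"
proof -
  have r: "0 \<le> \<rho> i \<and> \<rho> i \<le> 1" for i using slowly_varyingD[OF \<rho>, of i] by simp
  have bl: "bounded_linear (diag \<rho>)" using r by (intro bounded_linear_diag[of _ 1]) auto
  have sym: "inner (diag \<rho> x) y = inner (diag \<rho> y) x" for x y
    using r inner_diag(1)[of \<rho> 1 x y] inner_diag(1)[of \<rho> 1 y x] by (simp add: mult_ac)
  have bb: "bounded_bilinear (\<lambda>x y. inner (diag \<rho> x) y)"
    by (rule bounded_bilinear.comp1[OF bounded_bilinear_inner bl])
  note v' = v[unfolded is_sol_def]
  have ac: "ac_on a b (\<lambda>t. inner (diag \<rho> (v t)) (v t)) (\<lambda>t. 2 * inner (diag \<rho> (v t)) (field t (z t) (v t)))"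
    using ac_on_bilinear[OF bb v' v'] by (simp add: sym[of "field _ _ _"])
  have iB: "set_integrable lebesgue {a..b} (\<lambda>s. C0 * (1 + \<bar>z s\<bar> powr q) * total_source \<rho> s)"
  proof (rule set_integrable_bilinear_right[OF bounded_bilinear_mult total_local_integrable[OF r]])
    have "continuous_on {a..b} z" using z continuous_on_subset by blast
    then show "continuous_on {a..b} (\<lambda>s. C0 * (1 + \<bar>z s\<bar> powr q))"
      using q by (intro continuous_on_mult continuous_on_add continuous_on_const continuous_on_powr' continuous_on_rabs) auto
  qed
  have le: "2 * inner (diag \<rho> (v t)) (field t (z t) (v t)) \<le> - lam0 * inner (diag \<rho> (v t)) (v t) + C0 * (1 + \<bar>z t\<bar> powr q) * total_source \<rho> t" for t
    by (rule energy_inequality[OF \<rho>])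
  show "inner (diag \<rho> (v b)) (v b) \<le> exp (- lam0 * (b - a)) * inner (diag \<rho> (v a)) (v a)
      + (LINT s:{a..b}|lebesgue. exp (- lam0 * (b - s)) * (C0 * (1 + \<bar>z s\<bar> powr q) * total_source \<rho> s))"
    by (rule gronwall_ac(1)[OF ac ab iB le])
  show "set_integrable lebesgue {a..b} (\<lambda>s. exp (- lam0 * (b - s)) * (C0 * (1 + \<bar>z s\<bar> powr q) * total_source \<rho> s))"
    by (rule gronwall_ac(2)[OF ac ab iB le])
qed

lemma is_sol_subinterval: "is_sol z a b v \<Longrightarrow> a \<le> c \<Longrightarrow> d \<le> b \<Longrightarrow> is_sol z c d v"
  unfolding is_sol_def by (rule ac_on_subinterval)

text \<open>The dissipation is given up (rate 0) for a bound that holds at all times of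
  \<open>{a..b}\<close> and depends on the path only through its size. This is the a priori estimate
  behind existence and continuous dependence.\<close>

lemma sol_bound:
  assumes v: "is_sol z a t v" and t: "a \<le> t" "t \<le> b" and Z: "\<And>s. s \<in> {a..b} \<Longrightarrow> \<bar>z s\<bar> \<le> Z"
  shows "(norm (v t))\<^sup>2 \<le> (norm (v a))\<^sup>2 + C0 * (1 + Z powr q) * (LINT s:{a..b}|lebesgue. total_source (\<lambda>_. 1) s)"
proof -
  let ?T = "total_source (\<lambda>_. 1)"
  have i: "set_integrable lebesgue {a..c} ?T" for c by (rule total_local_integrable) simp
  have "(norm (v t))\<^sup>2 \<le> exp (0 * (t - a)) * (norm (v a))\<^sup>2 + (LINT s:{a..t}|lebesgue. exp (0 * (t - s)) * (C0 * (1 + Z powr q) * ?T s))"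
  proof (rule gronwall_ac(1)[OF ac_on_norm_square[OF v[unfolded is_sol_def]] t(1)])
    show "set_integrable lebesgue {a..t} (\<lambda>s. C0 * (1 + Z powr q) * ?T s)" using i by simp
    fix s assume s: "s \<in> {a..t}"
    have "2 * inner (v s) (field s (z s) (v s)) \<le> - lam0 * inner (v s) (v s) + C0 * (1 + \<bar>z s\<bar> powr q) * ?T s"
      using energy_inequality[OF slowly_varying_const, of "v s" s "z s"] by (simp only: diag_one)
    also have "\<dots> \<le> 0 + C0 * (1 + Z powr q) * ?T s"
    proof (rule add_mono)
      show "- lam0 * inner (v s) (v s) \<le> 0" using lam by simp
      show "C0 * (1 + \<bar>z s\<bar> powr q) * ?T s \<le> C0 * (1 + Z powr q) * ?T s"
        using Z[of s] s t q const_pos total_nonneg[of "\<lambda>_. 1" s]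
        by (intro mult_right_mono mult_left_mono add_left_mono powr_mono2) auto
    qed
    finally show "2 * inner (v s) (field s (z s) (v s)) \<le> 0 * (norm (v s))\<^sup>2 + C0 * (1 + Z powr q) * ?T s" by simp
  qed
  also have "\<dots> = (norm (v a))\<^sup>2 + C0 * (1 + Z powr q) * (LINT s:{a..t}|lebesgue. ?T s)" by simp
  also have "\<dots> \<le> (norm (v a))\<^sup>2 + C0 * (1 + Z powr q) * (LINT s:{a..b}|lebesgue. ?T s)"
  proof -
    have "0 \<le> (LINT s:{t..b}|lebesgue. ?T s)"
      unfolding set_lebesgue_integral_def using total_nonneg[of "\<lambda>_. 1"] by (intro integral_nonneg_AE AE_I2) simp
    then have "(LINT s:{a..t}|lebesgue. ?T s) \<le> (LINT s:{a..b}|lebesgue. ?T s)"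
      using set_integral_Icc_combine[OF i[of b] t] by simp
    then show ?thesis using const_pos by (intro add_left_mono mult_left_mono) auto
  qed
  finally show ?thesis .
qed

lemma sol_exists:
  assumes z: "continuous_on UNIV z" and ab: "a \<le> b"
  shows "\<exists>v. v a = x \<and> is_sol z a b v"
proof -
  have "continuous_on {a..b} z" using z continuous_on_subset by blast
  then obtain Z where Z: "Z > 0" "\<And>s. s \<in> {a..b} \<Longrightarrow> \<bar>z s\<bar> \<le> Z"
    using continuous_Icc_norm_bound[of a b z] by auto
  define B where "B = (norm x)\<^sup>2 + C0 * (1 + Z powr q) * (LINT s:{a..b}|lebesgue. total_source (\<lambda>_. 1) s)"
  define R where "R = sqrt B"
  have B: "0 \<le> B"
  proof -
    have "0 \<le> (LINT s:{a..b}|lebesgue. total_source (\<lambda>_. 1) s)"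
      unfolding set_lebesgue_integral_def using total_nonneg[of "\<lambda>_. 1"] by (intro integral_nonneg_AE AE_I2) simp
    then show ?thesis using const_pos by (simp add: B_def)
  qed
  have R: "0 \<le> R" using B by (simp add: R_def)
  obtain L N where LN: "0 \<le> L" "0 \<le> N"
    "\<And>t z1 z2 v1 v2. t \<in> {a..b} \<Longrightarrow> \<bar>z1\<bar> \<le> Z \<Longrightarrow> \<bar>z2\<bar> \<le> Z \<Longrightarrow> norm v1 \<le> R + 1 \<Longrightarrow> norm v2 \<le> R + 1 \<Longrightarrow>
      2 * inner (v1 - v2) (field t z1 v1 - field t z2 v2) \<le> L * (norm (v1 - v2))\<^sup>2 + \<bar>z1 - z2\<bar> * (N * envelope t)"
    "\<And>t z v. t \<in> {a..b} \<Longrightarrow> \<bar>z\<bar> \<le> Z \<Longrightarrow> norm v \<le> R + 1 \<Longrightarrow> norm (field t z v) \<le> N * envelope t"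
    using field_compare[of Z "R + 1" a b] Z R by (metis add_nonneg_nonneg less_imp_le zero_le_one)
  show ?thesis
    unfolding is_sol_def
  proof (rule ode_existence_from_bound[where R = R and M = "\<lambda>t. N * envelope t" and L = "L / 2"])
    show "a \<le> b" by fact
    show "set_borel_measurable lebesgue {c..d} (\<lambda>s. field s (z s) (w s))" if "continuous_on {c..d} w" for c d w
      by (rule field_measurable[OF z that])
    show "norm (v t) \<le> R" if "a \<le> t" "t \<le> b" "v a = x" "ac_on a t v (\<lambda>s. field s (z s) (v s))" for t v
    proof -
      have "(norm (v t))\<^sup>2 \<le> B"
        using sol_bound[of z a t v b Z] that Z unfolding is_sol_def B_def by auto
      then show ?thesis unfolding R_def by (rule real_le_rsqrt)
    qed
    show "set_integrable lebesgue {a..b} (\<lambda>t. N * envelope t)" using envelope_integrable by simp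
    show "norm (field s (z s) u) \<le> N * envelope s" if "s \<in> {a..b}" "norm u \<le> R + 1" for s u
      using LN(4) Z that by blast
    show "inner (u - w) (field s (z s) u - field s (z s) w) \<le> L / 2 * (norm (u - w))\<^sup>2"
      if "s \<in> {a..b}" "norm u \<le> R + 1" "norm w \<le> R + 1" for s u w
      using LN(3)[OF that(1) Z(2)[OF that(1)] Z(2)[OF that(1)] that(2,3)] by simp
  qed (use LN in \<open>auto intro: field_continuous\<close>)
qed

text \<open>A single \<open>K\<close> serves all pairs of paths and solutions within the given
  bounds, so it can be used along a whole sequence of paths.\<close>

lemma sol_compare:
  assumes ab: "a \<le> b" and R: "0 \<le> R" and Z: "0 \<le> Z"
  obtains K where "0 \<le> K"
    "\<And>z1 z2 v1 v2 \<eta>. is_sol z1 a b v1 \<Longrightarrow> is_sol z2 a b v2 \<Longrightarrow> 0 \<le> \<eta> \<Longrightarrow>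
      (\<And>s. s \<in> {a..b} \<Longrightarrow> \<bar>z1 s\<bar> \<le> Z \<and> \<bar>z2 s\<bar> \<le> Z \<and> \<bar>z1 s - z2 s\<bar> \<le> \<eta> \<and> norm (v1 s) \<le> R \<and> norm (v2 s) \<le> R) \<Longrightarrow>
      (norm (v1 b - v2 b))\<^sup>2 \<le> K * ((norm (v1 a - v2 a))\<^sup>2 + \<eta>)"
proof -
  obtain L N where LN: "0 \<le> L" "0 \<le> N"
    "\<And>t z1 z2 v1 v2. t \<in> {a..b} \<Longrightarrow> \<bar>z1\<bar> \<le> Z \<Longrightarrow> \<bar>z2\<bar> \<le> Z \<Longrightarrow> norm v1 \<le> R \<Longrightarrow> norm v2 \<le> R \<Longrightarrow>
      2 * inner (v1 - v2) (field t z1 v1 - field t z2 v2) \<le> L * (norm (v1 - v2))\<^sup>2 + \<bar>z1 - z2\<bar> * (N * envelope t)"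
    using field_compare[OF Z R, of a b] by metis
  define I where "I = N * (LINT s:{a..b}|lebesgue. envelope s)"
  have env0: "0 \<le> envelope t" for t using envelope_ge(1)[of t] by simp
  have I: "0 \<le> I"
    unfolding I_def set_lebesgue_integral_def using LN env0
    by (intro mult_nonneg_nonneg integral_nonneg_AE AE_I2) auto
  show ?thesis
  proof (rule that[of "exp (L * (b - a)) * (1 + I)"])
    show "0 \<le> exp (L * (b - a)) * (1 + I)" using I by simp
    fix z1 z2 v1 v2 \<eta>
    assume v: "is_sol z1 a b v1" "is_sol z2 a b v2" and \<eta>: "0 \<le> \<eta>"
      and *: "\<And>s. s \<in> {a..b} \<Longrightarrow> \<bar>z1 s\<bar> \<le> Z \<and> \<bar>z2 s\<bar> \<le> Z \<and> \<bar>z1 s - z2 s\<bar> \<le> \<eta> \<and> norm (v1 s) \<le> R \<and> norm (v2 s) \<le> R"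
    have "(norm (v1 b - v2 b))\<^sup>2 \<le> exp (L * (b - a)) * ((norm (v1 a - v2 a))\<^sup>2 + (LINT s:{a..b}|lebesgue. \<eta> * (N * envelope s)))"
    proof (rule ode_compare[OF v[unfolded is_sol_def] ab _ _ LN(1)])
      show "set_integrable lebesgue {a..b} (\<lambda>s. \<eta> * (N * envelope s))" using envelope_integrable by simp
      show "0 \<le> \<eta> * (N * envelope s)" for s using \<eta> LN env0 by simp
      fix s assume s: "s \<in> {a..b}"
      have "2 * inner (v1 s - v2 s) (field s (z1 s) (v1 s) - field s (z2 s) (v2 s))
          \<le> L * (norm (v1 s - v2 s))\<^sup>2 + \<bar>z1 s - z2 s\<bar> * (N * envelope s)"
        using LN(3)[OF s] *[OF s] by blast
      also have "\<dots> \<le> L * (norm (v1 s - v2 s))\<^sup>2 + \<eta> * (N * envelope s)"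
        using *[OF s] LN env0 by (intro add_left_mono mult_right_mono) auto
      finally show "2 * inner (v1 s - v2 s) (field s (z1 s) (v1 s) - field s (z2 s) (v2 s))
          \<le> L * (norm (v1 s - v2 s))\<^sup>2 + \<eta> * (N * envelope s)" .
    qed
    also have "(LINT s:{a..b}|lebesgue. \<eta> * (N * envelope s)) = \<eta> * I" by (simp add: I_def)
    also have "exp (L * (b - a)) * ((norm (v1 a - v2 a))\<^sup>2 + \<eta> * I) \<le> exp (L * (b - a)) * ((1 + I) * ((norm (v1 a - v2 a))\<^sup>2 + \<eta>))"
      using I \<eta> by (intro mult_left_mono) (simp_all add: algebra_simps)
    finally show "(norm (v1 b - v2 b))\<^sup>2 \<le> exp (L * (b - a)) * (1 + I) * ((norm (v1 a - v2 a))\<^sup>2 + \<eta>)"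
      by (simp add: mult.assoc)
  qed
qed

lemma sol_unique:
  assumes z: "continuous_on UNIV z" and ab: "a \<le> b" and v: "is_sol z a b v" "is_sol z a b w" "v a = w a"
  shows "v b = w b"
proof -
  have "continuous_on {a..b} z" using z continuous_on_subset by blast
  then obtain Z where Z: "Z > 0" "\<And>s. s \<in> {a..b} \<Longrightarrow> \<bar>z s\<bar> \<le> Z"
    using continuous_Icc_norm_bound[of a b z] by auto
  obtain R1 where R1: "R1 > 0" "\<And>s. s \<in> {a..b} \<Longrightarrow> norm (v s) \<le> R1"
    using continuous_Icc_norm_bound[OF ac_on_continuous[OF v(1)[unfolded is_sol_def]]] by auto
  obtain R2 where R2: "R2 > 0" "\<And>s. s \<in> {a..b} \<Longrightarrow> norm (w s) \<le> R2"
    using continuous_Icc_norm_bound[OF ac_on_continuous[OF v(2)[unfolded is_sol_def]]] by auto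
  obtain K where K: "0 \<le> K"
    "\<And>z1 z2 v1 v2 \<eta>. is_sol z1 a b v1 \<Longrightarrow> is_sol z2 a b v2 \<Longrightarrow> 0 \<le> \<eta> \<Longrightarrow>
      (\<And>s. s \<in> {a..b} \<Longrightarrow> \<bar>z1 s\<bar> \<le> Z \<and> \<bar>z2 s\<bar> \<le> Z \<and> \<bar>z1 s - z2 s\<bar> \<le> \<eta> \<and> norm (v1 s) \<le> max R1 R2 \<and> norm (v2 s) \<le> max R1 R2) \<Longrightarrow>
      (norm (v1 b - v2 b))\<^sup>2 \<le> K * ((norm (v1 a - v2 a))\<^sup>2 + \<eta>)"
  proof (rule sol_compare[OF ab])
    show "0 \<le> max R1 R2" "0 \<le> Z" using Z R1 by auto
  qed blast
  have "(norm (v b - w b))\<^sup>2 \<le> K * ((norm (v a - w a))\<^sup>2 + 0)"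
    using Z R1 R2 by (intro K(2)[OF v(1,2)]) (auto simp: le_max_iff_disj)
  then show ?thesis using v(3) by simp
qed

text \<open>The description used in \<open>sol_v\<close>, for an arbitrary path in place of the
  noise.\<close>

definition flow :: "(real \<Rightarrow> real) \<Rightarrow> real \<Rightarrow> real \<Rightarrow> ell2 \<Rightarrow> ell2" where
  "flow z \<tau> t x = (THE y. \<exists>v. solves_from \<tau> x (\<lambda>s. field s (z s)) v \<and> y = v t)"

lemma sol_v_eq_flow: "sol_v lam f g h h' t \<tau> \<omega> x = flow (\<lambda>s. ou (shift s \<omega>)) \<tau> t x"
proof -
  have "(\<lambda>s. random_field lam f g h h' s \<omega>) = (\<lambda>s. field s (ou (shift s \<omega>)))"
    by (intro ext) (rule random_field_eq)
  then show ?thesis unfolding sol_v_def flow_def by simp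
qed

text \<open>The description in \<open>flow\<close> speaks of solutions on a whole half-line, whereas
  \<open>v\<close> is a solution on \<open>{a..b}\<close>. A global solution has to be produced
  first; uniqueness then gives every such solution the value \<open>v b\<close>.\<close>

lemma flow_eq:
  assumes z: "continuous_on UNIV z" and v: "v a = x" "is_sol z a b v" and ab: "a \<le> b"
  shows "flow z a b x = v b"
proof -
  have "\<exists>v. solves_from a x (\<lambda>s. field s (z s)) v"
  proof (rule solves_from_ex)
    show "\<exists>w. w a = x \<and> ac_on a t w (\<lambda>s. field s (z s) (w s))" if "a \<le> t" for t
      using sol_exists[OF z that, of x] unfolding is_sol_def .
    show "v t = w t" if "a \<le> t" "v a = x" "w a = x" "ac_on a t v (\<lambda>s. field s (z s) (v s))"
      "ac_on a t w (\<lambda>s. field s (z s) (w s))" for t v w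
      using sol_unique[OF z that(1), of v w] that by (simp add: is_sol_def)
  qed
  then obtain V where V: "solves_from a x (\<lambda>s. field s (z s)) V" ..
  have uniq: "w b = v b" if "solves_from a x (\<lambda>s. field s (z s)) w" for w
  proof -
    have "w a = x" "is_sol z a b w" using that ab by (auto simp: solves_from_iff_ac_on is_sol_def)
    then show ?thesis using sol_unique[OF z ab, of w v] v by simp
  qed
  show ?thesis
    unfolding flow_def
  proof (rule the_equality)
    show "\<exists>w. solves_from a x (\<lambda>s. field s (z s)) w \<and> v b = w b" using V uniq[OF V] by force
    show "y = v b" if "\<exists>w. solves_from a x (\<lambda>s. field s (z s)) w \<and> y = w b" for y
      using that uniq by blast
  qed
qed

lemma flow_sol:
  assumes z: "continuous_on UNIV z" and ab: "a \<le> b"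
  obtains v where "v a = x" "is_sol z a b v" "\<And>t. a \<le> t \<Longrightarrow> t \<le> b \<Longrightarrow> v t = flow z a t x"
proof -
  obtain v where v: "v a = x" "is_sol z a b v" using sol_exists[OF z ab] by blast
  have "v t = flow z a t x" if "a \<le> t" "t \<le> b" for t
    using flow_eq[OF z v(1) is_sol_subinterval[OF v(2) order_refl that(2)] that(1)] by simp
  then show ?thesis using v that by blast
qed

lemma flow_refl: "continuous_on UNIV z \<Longrightarrow> flow z a a x = x"
  by (rule flow_eq[where v = "\<lambda>_. x"]) (auto simp: is_sol_def ac_on_refl)

lemma flow_compose:
  assumes z: "continuous_on UNIV z" and "a \<le> b" "b \<le> c"
  shows "flow z b c (flow z a b x) = flow z a c x"
proof -
  obtain v where v: "v a = x" "is_sol z a c v" "\<And>t. a \<le> t \<Longrightarrow> t \<le> c \<Longrightarrow> v t = flow z a t x"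
    using flow_sol[OF z, of a c x] assms by auto
  have "flow z b c (flow z a b x) = v c"
    using assms v(3)[of b] by (intro flow_eq[OF z]) (auto intro: is_sol_subinterval[OF v(2)])
  then show ?thesis using v(3)[of c] assms by simp
qed

text \<open>Joint continuity in the path and the initial value serves two ends: a constant sequence
  of paths gives continuity of the flow, Bernstein polynomials give its measurability.\<close>

lemma flow_tendsto:
  assumes z: "\<And>n. continuous_on UNIV (zn n)" "continuous_on UNIV z"
    and ul: "uniform_limit {a..b} zn z sequentially" and x: "xn \<longlonglongrightarrow> x" and ab: "a \<le> b"
  shows "(\<lambda>n. flow (zn n) a b (xn n)) \<longlonglongrightarrow> flow z a b x"
proof -
  have "continuous_on {a..b} z" using z(2) continuous_on_subset by blast
  then obtain Z0 where Z0: "Z0 > 0" "\<And>s. s \<in> {a..b} \<Longrightarrow> \<bar>z s\<bar> \<le> Z0"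
    using continuous_Icc_norm_bound[of a b z] by auto
  \<comment> \<open>Room for paths within distance 1 of the limit path.\<close>
  define Z where "Z = Z0 + 1"
  have "Bseq xn" by (rule convergent_imp_Bseq[OF convergentI[OF x]])
  then obtain X where X: "\<And>n. norm (xn n) \<le> X" unfolding Bseq_def by blast
  have Xx: "norm x \<le> X" by (rule LIMSEQ_le_const2[OF tendsto_norm[OF x]]) (use X in blast)
  define B where "B = X\<^sup>2 + C0 * (1 + Z powr q) * (LINT s:{a..b}|lebesgue. total_source (\<lambda>_. 1) s)"
  define R where "R = sqrt B"
  have I0: "0 \<le> (LINT s:{a..b}|lebesgue. total_source (\<lambda>_. 1) s)"
    unfolding set_lebesgue_integral_def using total_nonneg[of "\<lambda>_. 1"] by (intro integral_nonneg_AE AE_I2) simp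
  have R: "0 \<le> R" using I0 const_pos by (simp add: R_def B_def)
  have bnd: "norm (v s) \<le> R" if "is_sol y a b v" "norm (v a) \<le> X" "\<And>s. s \<in> {a..b} \<Longrightarrow> \<bar>y s\<bar> \<le> Z" "s \<in> {a..b}" for y v s
  proof -
    have "is_sol y a s v" using that by (intro is_sol_subinterval[OF that(1)]) auto
    then have "(norm (v s))\<^sup>2 \<le> (norm (v a))\<^sup>2 + C0 * (1 + Z powr q) * (LINT s:{a..b}|lebesgue. total_source (\<lambda>_. 1) s)"
      using that by (intro sol_bound) auto
    also have "\<dots> \<le> B" using that(2) by (simp add: B_def power_mono)
    finally show ?thesis unfolding R_def by (rule real_le_rsqrt)
  qed
  obtain K where K: "0 \<le> K"
    "\<And>z1 z2 v1 v2 \<eta>. is_sol z1 a b v1 \<Longrightarrow> is_sol z2 a b v2 \<Longrightarrow> 0 \<le> \<eta> \<Longrightarrow>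
      (\<And>s. s \<in> {a..b} \<Longrightarrow> \<bar>z1 s\<bar> \<le> Z \<and> \<bar>z2 s\<bar> \<le> Z \<and> \<bar>z1 s - z2 s\<bar> \<le> \<eta> \<and> norm (v1 s) \<le> R \<and> norm (v2 s) \<le> R) \<Longrightarrow>
      (norm (v1 b - v2 b))\<^sup>2 \<le> K * ((norm (v1 a - v2 a))\<^sup>2 + \<eta>)"
  proof (rule sol_compare[OF ab R])
    show "0 \<le> Z" using Z0 by (simp add: Z_def)
  qed blast
  obtain v where v: "v a = x" "is_sol z a b v" "v b = flow z a b x"
    using flow_sol[OF z(2) ab, of x] ab by (metis order_refl)
  show ?thesis
  proof (rule metric_LIMSEQ_I)
    fix e :: real assume e: "0 < e"
    define \<eta> where "\<eta> = min 1 (e\<^sup>2 / (2 * (K + 1)))"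
    have \<eta>: "0 < \<eta>" "\<eta> \<le> 1" "2 * (K + 1) * \<eta> \<le> e\<^sup>2"
    proof -
      show "0 < \<eta>" "\<eta> \<le> 1" using e K by (auto simp: \<eta>_def)
      have "2 * (K + 1) * \<eta> \<le> 2 * (K + 1) * (e\<^sup>2 / (2 * (K + 1)))"
        using K by (intro mult_left_mono) (auto simp: \<eta>_def)
      then show "2 * (K + 1) * \<eta> \<le> e\<^sup>2" using K by simp
    qed
    have "eventually (\<lambda>n. \<forall>s\<in>{a..b}. dist (zn n s) (z s) < \<eta>) sequentially"
      using ul \<eta>(1) by (rule uniform_limitD)
    moreover have "eventually (\<lambda>n. dist (xn n) x < sqrt \<eta>) sequentially"
      using x \<eta>(1) by (simp add: tendsto_iff)
    ultimately have "eventually (\<lambda>n. dist (flow (zn n) a b (xn n)) (flow z a b x) < e) sequentially"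
    proof eventually_elim
      case (elim n)
      obtain w where w: "w a = xn n" "is_sol (zn n) a b w" "w b = flow (zn n) a b (xn n)"
        using flow_sol[OF z(1)[of n] ab, of "xn n"] ab by (metis order_refl)
      have zb: "\<bar>zn n s\<bar> \<le> Z" "\<bar>z s\<bar> \<le> Z" "\<bar>zn n s - z s\<bar> \<le> \<eta>" if "s \<in> {a..b}" for s
        using elim(1)[rule_format, OF that] Z0(2)[OF that] \<eta>(2) by (auto simp: dist_real_def Z_def)
      have "(norm (w b - v b))\<^sup>2 \<le> K * ((norm (w a - v a))\<^sup>2 + \<eta>)"
      proof (rule K(2)[OF w(2) v(2)])
        show "0 \<le> \<eta>" using \<eta> by simp
        fix s assume s: "s \<in> {a..b}"
        have "norm (w s) \<le> R" by (rule bnd[OF w(2) _ zb(1) s]) (simp_all add: w(1) X)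
        moreover have "norm (v s) \<le> R" by (rule bnd[OF v(2) _ zb(2) s]) (simp_all add: v(1) Xx)
        ultimately show "\<bar>zn n s\<bar> \<le> Z \<and> \<bar>z s\<bar> \<le> Z \<and> \<bar>zn n s - z s\<bar> \<le> \<eta> \<and> norm (w s) \<le> R \<and> norm (v s) \<le> R"
          using zb[OF s] by blast
      qed
      also have "\<dots> \<le> K * (\<eta> + \<eta>)"
      proof -
        have "(norm (w a - v a))\<^sup>2 \<le> (sqrt \<eta>)\<^sup>2"
          using elim(2) by (intro power_mono) (auto simp: dist_norm w(1) v(1))
        then show ?thesis using \<eta> K by (intro mult_left_mono add_right_mono) auto
      qed
      also have "\<dots> < 2 * (K + 1) * \<eta>" using \<eta> by (simp add: algebra_simps)
      also have "\<dots> \<le> e\<^sup>2" by (rule \<eta>(3))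
      finally have "norm (w b - v b) < e" using e by (auto intro: power2_less_imp_less)
      then show ?case by (simp add: dist_norm w(3) v(3))
    qed
    then show "\<exists>N. \<forall>n\<ge>N. dist (flow (zn n) a b (xn n)) (flow z a b x) < e" by (simp add: eventually_sequentially)
  qed
qed

lemma flow_continuous:
  assumes "continuous_on UNIV z" "a \<le> b" shows "continuous_on UNIV (flow z a b)"
  unfolding continuous_on_sequentially
proof (intro ballI allI impI)
  fix u :: "nat \<Rightarrow> ell2" and w assume "(\<forall>n. u n \<in> UNIV) \<and> u \<longlonglongrightarrow> w"
  then have "(\<lambda>n. flow z a b (u n)) \<longlonglongrightarrow> flow z a b w"
    using assms by (intro flow_tendsto uniform_limit_const) auto
  then show "(flow z a b \<circ> u) \<longlonglongrightarrow> flow z a b w" by (simp add: o_def)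
qed

end

section \<open>Pullback estimates\<close>

context lattice_equation
begin

text \<open>The exponential growth granted to the noise. Multiplied by \<open>q\<close> it is half
  of the gap \<open>lam0 - lam1\<close>, and the other half is left for the decay of the radius;
  since \<open>q > 2\<close>, twice the rate is below the gap as well.\<close>

definition rate :: real where "rate = (lam0 - lam1) / (2 * q)"

lemma rate_pos: "0 < rate" "q * rate = (lam0 - lam1) / 2" "2 * rate < lam0 - lam1"
proof -
  show "0 < rate" "q * rate = (lam0 - lam1) / 2" using lam q by (auto simp: rate_def)
  have "2 * rate = (lam0 - lam1) / q" using q by (simp add: rate_def field_simps)
  also have "\<dots> < (lam0 - lam1) / 1" using lam q by (intro divide_strict_left_mono) auto
  finally show "2 * rate < lam0 - lam1" by simp
qed

text \<open>An exponential bound in place of sublinear growth: it attaches to the path a single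
  number \<open>m\<close>, which changes at most by an exponential factor when the base time is
  moved back.\<close>

definition tempered_path :: "real \<Rightarrow> real \<Rightarrow> (real \<Rightarrow> real) \<Rightarrow> bool" where
  "tempered_path m \<tau> z \<longleftrightarrow> continuous_on UNIV z \<and> 0 \<le> m \<and> (\<forall>s\<le>\<tau>. \<bar>z s\<bar> \<le> m * exp (rate * (\<tau> - s)))"

lemma tempered_path_powr:
  assumes "tempered_path m \<tau> z" "s \<le> \<tau>"
  shows "1 + \<bar>z s\<bar> powr q \<le> (1 + m powr q) * exp ((lam0 - lam1) * (\<tau> - s))"
proof -
  have "\<bar>z s\<bar> powr q \<le> (m * exp (rate * (\<tau> - s))) powr q"
    using assms q unfolding tempered_path_def by (intro powr_mono2) auto
  also have "\<dots> = m powr q * exp (q * rate * (\<tau> - s))"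
    by (simp add: powr_mult exp_powr_real mult_ac)
  also have "\<dots> \<le> m powr q * exp ((lam0 - lam1) * (\<tau> - s))"
    unfolding rate_pos(2) using assms(2) lam by (intro mult_left_mono) (auto intro!: mult_right_mono)
  finally have "\<bar>z s\<bar> powr q \<le> m powr q * exp ((lam0 - lam1) * (\<tau> - s))" .
  moreover have "1 \<le> exp ((lam0 - lam1) * (\<tau> - s))" using assms(2) lam by simp
  ultimately show ?thesis unfolding distrib_right mult_1 by linarith
qed

definition past_source :: "(int \<Rightarrow> real) \<Rightarrow> real \<Rightarrow> real" where
  "past_source \<rho> \<tau> = (LINT s:{..\<tau>}|lebesgue. exp (lam1 * s) * total_source \<rho> s)"

lemma weighted_total_integrable:
  assumes "\<And>i. 0 \<le> \<rho> i \<and> \<rho> i \<le> 1"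
  shows "set_integrable lebesgue {..b} (\<lambda>s. exp (lam1 * s) * total_source \<rho> s)"
proof (rule set_integrable_bound[OF total_integrable])
  show "set_borel_measurable lebesgue {..b} (\<lambda>s. exp (lam1 * s) * total_source \<rho> s)"
    unfolding set_borel_measurable_def
    by (intro borel_measurable_scaleR borel_measurable_indicator borel_measurable_times exp_lam1_measurable total_measurable assms) simp
  show "AE s in lebesgue. s \<in> {..b} \<longrightarrow> norm (exp (lam1 * s) * total_source \<rho> s) \<le> norm (exp (lam1 * s) * total_source (\<lambda>_. 1) s)"
    using total_mono[OF assms] total_nonneg[OF assms] total_nonneg[of "\<lambda>_. 1"] by (intro AE_I2) (simp add: abs_mult)
qed

lemma past_source_mono:
  assumes r: "\<And>i. 0 \<le> \<rho> i \<and> \<rho> i \<le> 1" and that: "S \<in> sets lebesgue" "S \<subseteq> {..b}"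
  shows "(LINT s:S|lebesgue. exp (lam1 * s) * total_source \<rho> s) \<le> past_source \<rho> b"
proof -
  note i = weighted_total_integrable[of \<rho> b, OF r]
  show ?thesis
    unfolding past_source_def set_lebesgue_integral_def
  proof (rule integral_mono)
    show "integrable lebesgue (\<lambda>s. indicator S s *\<^sub>R (exp (lam1 * s) * total_source \<rho> s))"
      using set_integrable_subset[OF i that] by (simp add: set_integrable_def)
    show "integrable lebesgue (\<lambda>s. indicator {..b} s *\<^sub>R (exp (lam1 * s) * total_source \<rho> s))"
      using i by (simp add: set_integrable_def)
    show "indicator S s *\<^sub>R (exp (lam1 * s) * total_source \<rho> s) \<le> indicator {..b} s *\<^sub>R (exp (lam1 * s) * total_source \<rho> s)" for s
      using that(2) total_nonneg[of \<rho> s, OF r] by (auto simp: indicator_def)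
  qed
qed

lemma past_source_nonneg: "(\<And>i. 0 \<le> \<rho> i \<and> \<rho> i \<le> 1) \<Longrightarrow> 0 \<le> past_source \<rho> b"
  unfolding past_source_def set_lebesgue_integral_def using total_nonneg[of \<rho>]
  by (intro integral_nonneg_AE AE_I2) simp

text \<open>The decay \<open>exp (- lam0 * (\<tau> - s))\<close> against the noise growth
  \<open>exp ((lam0 - lam1) * (\<tau> - s))\<close> leaves
  \<open>exp (- lam1 * (\<tau> - s))\<close>, the weight of the integrability hypotheses. The source
  term is thus bounded independently of the starting time \<open>a\<close>.\<close>

lemma pullback_energy:
  assumes \<rho>: "slowly_varying \<rho>" and z: "tempered_path m \<tau> z" and a: "a \<le> \<tau>"
  shows "inner (diag \<rho> (flow z a \<tau> x)) (flow z a \<tau> x) \<le> exp (- lam0 * (\<tau> - a)) * (norm x)\<^sup>2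
    + C0 * (1 + m powr q) * (exp (- lam1 * \<tau>) * past_source \<rho> \<tau>)"
proof -
  have r: "0 \<le> \<rho> i \<and> \<rho> i \<le> 1" for i using slowly_varyingD[OF \<rho>, of i] by simp
  have cz: "continuous_on UNIV z" using z by (simp add: tempered_path_def)
  obtain v where v: "v a = x" "is_sol z a \<tau> v" "v \<tau> = flow z a \<tau> x"
    using flow_sol[OF cz a, of x] a by (metis order_refl)
  have "inner (diag \<rho> (v \<tau>)) (v \<tau>) \<le> exp (- lam0 * (\<tau> - a)) * inner (diag \<rho> (v a)) (v a)
      + (LINT s:{a..\<tau>}|lebesgue. exp (- lam0 * (\<tau> - s)) * (C0 * (1 + \<bar>z s\<bar> powr q) * total_source \<rho> s))"
    by (rule sol_energy(1)[OF \<rho> cz a v(2)])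
  also have "\<dots> \<le> exp (- lam0 * (\<tau> - a)) * (norm x)\<^sup>2
    + C0 * (1 + m powr q) * (exp (- lam1 * \<tau>) * past_source \<rho> \<tau>)"
  proof (rule add_mono)
    have "norm (diag \<rho> x) \<le> 1 * norm x" using r by (intro norm_diag_le) auto
    then have "inner (diag \<rho> x) x \<le> norm x * norm x"
      by (intro order_trans[OF norm_cauchy_schwarz] mult_right_mono) auto
    then show "exp (- lam0 * (\<tau> - a)) * inner (diag \<rho> (v a)) (v a) \<le> exp (- lam0 * (\<tau> - a)) * (norm x)\<^sup>2"
      by (simp add: v(1) power2_eq_square)
    have ii: "set_integrable lebesgue {a..\<tau>} (\<lambda>s. exp (lam1 * s) * total_source \<rho> s)"
      by (rule set_integrable_subset[OF weighted_total_integrable[of \<rho> \<tau>, OF r]]) auto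
    let ?c = "C0 * (1 + m powr q) * exp (- lam1 * \<tau>)"
    have "(LINT s:{a..\<tau>}|lebesgue. exp (- lam0 * (\<tau> - s)) * (C0 * (1 + \<bar>z s\<bar> powr q) * total_source \<rho> s))
       \<le> (LINT s:{a..\<tau>}|lebesgue. ?c * (exp (lam1 * s) * total_source \<rho> s))"
    proof (rule set_integral_mono[OF sol_energy(2)[OF \<rho> cz a v(2)]])
      show "set_integrable lebesgue {a..\<tau>} (\<lambda>s. ?c * (exp (lam1 * s) * total_source \<rho> s))" using ii by simp
      fix s assume s: "s \<in> {a..\<tau>}"
      have "exp (- lam0 * (\<tau> - s)) * (C0 * (1 + \<bar>z s\<bar> powr q) * total_source \<rho> s)
         \<le> exp (- lam0 * (\<tau> - s)) * (C0 * ((1 + m powr q) * exp ((lam0 - lam1) * (\<tau> - s))) * total_source \<rho> s)"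
        using tempered_path_powr[OF z, of s] s const_pos total_nonneg[of \<rho> s, OF r]
        by (intro mult_left_mono mult_right_mono) auto
      also have "\<dots> = C0 * (1 + m powr q) * (exp (- lam0 * (\<tau> - s)) * exp ((lam0 - lam1) * (\<tau> - s))) * total_source \<rho> s"
        by (simp add: mult_ac)
      also have "exp (- lam0 * (\<tau> - s)) * exp ((lam0 - lam1) * (\<tau> - s)) = exp (- lam1 * \<tau>) * exp (lam1 * s)"
        unfolding exp_add[symmetric] by (simp add: algebra_simps)
      finally show "exp (- lam0 * (\<tau> - s)) * (C0 * (1 + \<bar>z s\<bar> powr q) * total_source \<rho> s) \<le> ?c * (exp (lam1 * s) * total_source \<rho> s)"
        by (simp add: mult_ac)
    qed
    also have "\<dots> = ?c * (LINT s:{a..\<tau>}|lebesgue. exp (lam1 * s) * total_source \<rho> s)" by simp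
    also have "\<dots> \<le> ?c * past_source \<rho> \<tau>"
      using past_source_mono[of \<rho> "{a..\<tau>}" \<tau>, OF r] const_pos by (intro mult_left_mono) auto
    finally show "(LINT s:{a..\<tau>}|lebesgue. exp (- lam0 * (\<tau> - s)) * (C0 * (1 + \<bar>z s\<bar> powr q) * total_source \<rho> s))
       \<le> C0 * (1 + m powr q) * (exp (- lam1 * \<tau>) * past_source \<rho> \<tau>)" by (simp add: mult.assoc)
  qed
  finally show ?thesis by (simp only: v(3))
qed

section \<open>Weights concentrated far from the origin\<close>

definition far_weight :: "nat \<Rightarrow> int \<Rightarrow> real" where
  "far_weight k i = (1 + \<kappa>) powr (- real_of_int (max 0 (int k - \<bar>i\<bar>)))"

lemma far_weight_bounds: "0 < far_weight k i" "far_weight k i \<le> 1"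
proof -
  show "0 < far_weight k i" using const_pos by (simp add: far_weight_def)
  have "far_weight k i \<le> (1 + \<kappa>) powr 0" unfolding far_weight_def using const_pos by (intro powr_mono) auto
  then show "far_weight k i \<le> 1" using const_pos by simp
qed

text \<open>The exponent is Lipschitz in the site with constant 1, so one step changes the weight by
  a factor of at most \<open>1 + \<kappa>\<close>.\<close>

lemma slowly_varying_far_weight: "slowly_varying (far_weight k)"
proof -
  have step: "far_weight k i \<le> (1 + \<kappa>) * far_weight k j" if "\<bar>i - j\<bar> \<le> 1" for i j
  proof -
    have "far_weight k i \<le> (1 + \<kappa>) powr (1 + - real_of_int (max 0 (int k - \<bar>j\<bar>)))"
      unfolding far_weight_def using const_pos that by (intro powr_mono) (auto simp: max_def)
    also have "\<dots> = (1 + \<kappa>) * far_weight k j"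
      unfolding far_weight_def powr_add using const_pos by simp
    finally show ?thesis .
  qed
  show ?thesis unfolding slowly_varying_def using far_weight_bounds step by simp
qed

lemma tail_le_far_weight: "(norm (tail k v))\<^sup>2 \<le> inner (diag (far_weight k) v) v"
proof -
  have b: "\<bar>far_weight k i\<bar> \<le> 1" for i using far_weight_bounds[of k i] by simp
  show ?thesis
    unfolding inner_diag(1)[of "far_weight k" 1, OF b] norm_ell2_square
  proof (rule infsum_mono[OF coord_summable inner_diag(2)[of "far_weight k" 1, OF b]])
    show "(coord (tail k v) i)\<^sup>2 \<le> far_weight k i * coord v i * coord v i" for i
    proof (cases "\<bar>i\<bar> \<le> int k")
      case True
      then show ?thesis using far_weight_bounds(1)[of k i] by (simp add: coord_tail mult.assoc)
    next
      case False
      then show ?thesis using const_pos by (simp add: coord_tail far_weight_def power2_eq_square)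
    qed
  qed
qed

text \<open>A finite window carries the source up to \<open>e / 2\<close>; on it the weights tend to
  0, and outside they are at most 1.\<close>

lemma total_far_weight_tendsto: "(\<lambda>k. total_source (far_weight k) s) \<longlonglongrightarrow> 0"
proof (rule metric_LIMSEQ_I)
  fix e :: real assume e: "0 < e"
  let ?I = "\<lambda>n. {- int n..int n}"
  have "(\<lambda>n. \<Sum>i\<in>?I n. source s i) \<longlonglongrightarrow> total_source (\<lambda>_. 1) s"
    unfolding total_source_def using infsum_int_limit[OF source_summable] by simp
  from metric_LIMSEQ_D[OF this, of "e / 2"] e obtain n where n: "dist (\<Sum>i\<in>?I n. source s i) (total_source (\<lambda>_. 1) s) < e / 2"
    by auto
  have w: "(\<lambda>k. \<Sum>i\<in>?I n. far_weight k i * source s i) \<longlonglongrightarrow> (\<Sum>i\<in>?I n. 0 * source s i)"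
  proof (intro tendsto_intros)
    fix i
    have "filterlim (\<lambda>k. real_of_int (max 0 (int k - \<bar>i\<bar>))) at_top sequentially"
    proof (rule filterlim_at_top_mono[OF filterlim_tendsto_add_at_top[OF tendsto_const filterlim_real_sequentially]])
      show "\<forall>\<^sub>F k in sequentially. - real_of_int \<bar>i\<bar> + real k \<le> real_of_int (max 0 (int k - \<bar>i\<bar>))"
        by (intro always_eventually) auto
    qed
    then have "filterlim (\<lambda>k. real_of_int (max 0 (int k - \<bar>i\<bar>)) * ln (1 + \<kappa>)) at_top sequentially"
      using const_pos by (intro filterlim_at_top_mult_tendsto_pos[OF tendsto_const]) auto
    then have "filterlim (\<lambda>k. - (real_of_int (max 0 (int k - \<bar>i\<bar>)) * ln (1 + \<kappa>))) at_bot sequentially"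
      by (simp only: filterlim_uminus_at_top)
    from filterlim_compose[OF exp_at_bot this]
    have "(\<lambda>k. (1 + \<kappa>) powr (- real_of_int (max 0 (int k - \<bar>i\<bar>)))) \<longlonglongrightarrow> 0"
      using const_pos by (simp add: powr_def)
    then show "(\<lambda>k. far_weight k i) \<longlonglongrightarrow> 0" by (simp add: far_weight_def)
  qed
  then have "(\<lambda>k. \<Sum>i\<in>?I n. far_weight k i * source s i) \<longlonglongrightarrow> 0" by simp
  from metric_LIMSEQ_D[OF this, of "e / 2"] e obtain N where
    N: "\<forall>k\<ge>N. dist (\<Sum>i\<in>?I n. far_weight k i * source s i) 0 < e / 2" by auto
  have "dist (total_source (far_weight k) s) 0 < e" if "k \<ge> N" for k
  proof -
    have r: "0 \<le> far_weight k i \<and> far_weight k i \<le> 1" for i using far_weight_bounds[of k i] by simp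
    have sm: "(\<lambda>i. (1 - far_weight k i) * source s i) summable_on UNIV"
      using r by (intro weighted_source_summable) auto
    have "(\<Sum>i\<in>?I n. (1 - far_weight k i) * source s i) \<le> (\<Sum>\<^sub>\<infinity>i. (1 - far_weight k i) * source s i)"
      using r source_nonneg by (intro finite_sum_le_infsum[OF sm]) auto
    moreover have "(\<Sum>\<^sub>\<infinity>i. (1 - far_weight k i) * source s i) + total_source (far_weight k) s = total_source (\<lambda>_. 1) s"
      unfolding total_source_def infsum_add[OF sm weighted_source_summable[OF r], symmetric]
      by (simp add: algebra_simps)
    moreover have "(\<Sum>i\<in>?I n. (1 - far_weight k i) * source s i) = (\<Sum>i\<in>?I n. source s i) - (\<Sum>i\<in>?I n. far_weight k i * source s i)"
      by (simp add: sum_subtractf algebra_simps)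
    moreover have "(\<Sum>i\<in>?I n. far_weight k i * source s i) < e / 2"
      using N that by (simp only: dist_real_def) force
    moreover have "total_source (\<lambda>_. 1) s - (\<Sum>i\<in>?I n. source s i) < e / 2"
      using n unfolding dist_real_def by linarith
    ultimately have "total_source (far_weight k) s < e" by linarith
    then show ?thesis using total_nonneg[of "far_weight k" s, OF r] by simp
  qed
  then show "\<exists>N. \<forall>k\<ge>N. dist (total_source (far_weight k) s) 0 < e" by blast
qed

text \<open>Dominated convergence in time, with the unweighted source as majorant.\<close>

lemma past_source_far_weight_tendsto: "(\<lambda>k. past_source (far_weight k) \<tau>) \<longlonglongrightarrow> 0"
proof -
  have r: "0 \<le> far_weight k i \<and> far_weight k i \<le> 1" for k i using far_weight_bounds[of k i] by simp
  have "(\<lambda>k. past_source (far_weight k) \<tau>) \<longlonglongrightarrow> (LINT (s::real)|lebesgue. 0)"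
    unfolding past_source_def set_lebesgue_integral_def
  proof (rule integral_dominated_convergence[where f = "\<lambda>_. 0" and
        w = "\<lambda>s. indicator {..\<tau>} s *\<^sub>R (exp (lam1 * s) * total_source (\<lambda>_. 1) s)"])
    show "integrable lebesgue (\<lambda>s. indicator {..\<tau>} s *\<^sub>R (exp (lam1 * s) * total_source (\<lambda>_. 1) s))"
      using total_integrable by (simp add: set_integrable_def)
    show "(\<lambda>s. indicator {..\<tau>} s *\<^sub>R (exp (lam1 * s) * total_source (far_weight k) s)) \<in> borel_measurable lebesgue" for k
      using weighted_total_integrable[of "far_weight k" \<tau>, OF r] by (auto simp: set_integrable_def)
    show "AE s in lebesgue. (\<lambda>k. indicator {..\<tau>} s *\<^sub>R (exp (lam1 * s) * total_source (far_weight k) s)) \<longlonglongrightarrow> 0"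
    proof (rule AE_I2)
      fix s
      have "(\<lambda>k. indicator {..\<tau>} s *\<^sub>R (exp (lam1 * s) * total_source (far_weight k) s)) \<longlonglongrightarrow> indicator {..\<tau>} s *\<^sub>R (exp (lam1 * s) * 0)"
        by (intro tendsto_intros total_far_weight_tendsto)
      then show "(\<lambda>k. indicator {..\<tau>} s *\<^sub>R (exp (lam1 * s) * total_source (far_weight k) s)) \<longlonglongrightarrow> 0" by simp
    qed
    show "AE s in lebesgue. norm (indicator {..\<tau>} s *\<^sub>R (exp (lam1 * s) * total_source (far_weight k) s))
        \<le> indicator {..\<tau>} s *\<^sub>R (exp (lam1 * s) * total_source (\<lambda>_. 1) s)" for k
      using total_mono[of "far_weight k", OF r] total_nonneg[of "far_weight k", OF r] by (intro AE_I2) (auto simp: indicator_def abs_mult)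
  qed simp
  then show ?thesis by simp
qed

section \<open>Pointwise growth of the noise coefficient\<close>

lemma h_ac: "ac_on a b h h'"
proof -
  have i: "set_integrable lebesgue {a..b} h'"
  proof (rule set_integrable_bound)
    show "set_integrable lebesgue {a..b} (\<lambda>s. 1 + (norm (h' s))\<^sup>2)"
      by (intro set_integral_add local_parts_integrable absolutely_integrable_continuous_real continuous_intros)
    show "set_borel_measurable lebesgue {a..b} h'"
      unfolding set_borel_measurable_def by (intro borel_measurable_scaleR borel_measurable_indicator h'_measurable) simp
    show "AE s in lebesgue. s \<in> {a..b} \<longrightarrow> norm (h' s) \<le> norm (1 + (norm (h' s))\<^sup>2)"
      using le_one_plus_square by (intro AE_I2) (simp add: add_nonneg_nonneg)
  qed
  show ?thesis
  proof (rule ac_onI[OF i])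
    fix t assume t: "a \<le> t" "t \<le> b"
    have it: "set_integrable lebesgue {a..t} h'" using t by (intro set_integrable_Icc_subset[OF i]) auto
    show "h t = h a + (LINT s:{a..t}|lebesgue. h' s)"
    \<comment> \<open>The real fundamental theorem applies in each coordinate, and taking a
      coordinate commutes with the integral.\<close>
    proof (rule ell2_eqI)
      fix j
      note lin = set_integral_bounded_linear[OF bounded_linear_coord[of j] it]
      have "ac_on a t (\<lambda>s. coord (h s) j) (\<lambda>s. coord (h' s) j)"
        using bounded_linear.has_vector_derivative[OF bounded_linear_coord] h_deriv
        by (intro ac_on_real_C1 lin(1)) blast
      from ac_on_eq[OF this, of t] t show "coord (h t) j = coord (h a + (LINT s:{a..t}|lebesgue. h' s)) j"
        by (simp add: lin(2) coord_simps)
    qed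
  qed
qed

lemma norm_le_total: "(norm (h s))\<^sup>2 \<le> total_source (\<lambda>_. 1) s" "(norm (forcing s))\<^sup>2 \<le> total_source (\<lambda>_. 1) s"
proof -
  have nn: "0 \<le> (\<Sum>\<^sub>\<infinity>i. \<bar>\<alpha>1 i\<bar> powr (q / \<epsilon>))" "0 \<le> (\<Sum>\<^sub>\<infinity>i. (\<alpha>2 i)\<^sup>2)"
    "0 \<le> (\<Sum>\<^sub>\<infinity>i. (\<bar>\<psi>3 s i\<bar> * \<bar>coord (h s) i\<bar>) powr q)" "0 \<le> (norm (h s))\<^sup>2" "0 \<le> (norm (forcing s))\<^sup>2"
    by (auto intro: infsum_nonneg)
  show "(norm (h s))\<^sup>2 \<le> total_source (\<lambda>_. 1) s" "(norm (forcing s))\<^sup>2 \<le> total_source (\<lambda>_. 1) s"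
    unfolding total_split using nn source_norms_nonneg[of s] by linarith+
qed

text \<open>The hypotheses control \<open>h\<close> in the mean, but the substitution
  \<open>v = u - z h\<close> at the initial time calls for a pointwise bound. Integrating the
  derivative of \<open>exp (lam1 * s) * (norm (h s))\<^sup>2\<close> from \<open>s\<close> to
  \<open>\<tau>\<close> yields one, because this derivative is bounded below by a multiple of the
  integrable weighted source.\<close>

lemma h_growth: "\<exists>C\<ge>0. \<forall>s\<le>\<tau>. (norm (h s))\<^sup>2 \<le> C * exp (- lam1 * s)"
proof -
  let ?T = "total_source (\<lambda>_. 1)"
  define A where "A = 16 + \<bar>1 - lam\<bar>"
  \<comment> \<open>One from \<open>(norm (h s))\<^sup>2\<close> and
    \<open>2 + 2 * A\<^sup>2\<close> from \<open>(norm (h' s))\<^sup>2\<close>, with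
    \<open>h'\<close> recovered from \<open>forcing\<close> and \<open>h\<close>.\<close>
  define c where "c = 3 + 2 * A\<^sup>2"
  define C where "C = exp (lam1 * \<tau>) * (norm (h \<tau>))\<^sup>2 + c * past_source (\<lambda>_. 1) \<tau>"
  have p0: "0 \<le> past_source (\<lambda>_. 1) \<tau>" by (rule past_source_nonneg) simp
  have c0: "0 \<le> c" by (simp add: c_def)
  have lower: "- c * ?T s \<le> 2 * inner (h s) (h' s)" for s
  proof -
    have "h' s = (- lap (lap (h s)) + (1 - lam) *\<^sub>R h s) - forcing s" by (simp add: forcing_def)
    also have "norm \<dots> \<le> norm (- lap (lap (h s)) + (1 - lam) *\<^sub>R h s) + norm (forcing s)" by (rule norm_triangle_ineq4)
    also have "norm (- lap (lap (h s)) + (1 - lam) *\<^sub>R h s) \<le> norm (- lap (lap (h s))) + norm ((1 - lam) *\<^sub>R h s)" by (rule norm_triangle_ineq)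
    also have "norm ((1 - lam) *\<^sub>R h s) = \<bar>1 - lam\<bar> * norm (h s)" by simp
    also have "norm (- lap (lap (h s))) \<le> 16 * norm (h s)" using norm_lap_le[of "lap (h s)"] norm_lap_le[of "h s"] by simp
    finally have "norm (h' s) \<le> A * norm (h s) + norm (forcing s)" by (simp add: A_def algebra_simps)
    then have "(norm (h' s))\<^sup>2 \<le> (A * norm (h s) + norm (forcing s))\<^sup>2" by (intro power_mono) auto
    also have "\<dots> \<le> 2 * A\<^sup>2 * (norm (h s))\<^sup>2 + 2 * (norm (forcing s))\<^sup>2"
      using sum_squares_bound[of "A * norm (h s)" "norm (forcing s)"] by (simp add: power2_sum power_mult_distrib)
    also have "\<dots> \<le> 2 * A\<^sup>2 * ?T s + 2 * ?T s" using norm_le_total[of s] by (intro add_mono mult_left_mono) auto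
    finally have h'T: "(norm (h' s))\<^sup>2 \<le> (2 + 2 * A\<^sup>2) * ?T s" by (simp add: algebra_simps)
    have "- (2 * inner (h s) (h' s)) \<le> 2 * (norm (h s) * norm (h' s))"
      using Cauchy_Schwarz_ineq2[of "h s" "h' s"] by (simp add: abs_le_iff)
    also have "\<dots> \<le> (norm (h s))\<^sup>2 + (norm (h' s))\<^sup>2" using sum_squares_bound[of "norm (h s)" "norm (h' s)"] by simp
    also have "\<dots> \<le> ?T s + (2 + 2 * A\<^sup>2) * ?T s" using norm_le_total(1)[of s] h'T by (intro add_mono)
    also have "\<dots> = c * ?T s" by (simp add: c_def algebra_simps)
    finally show ?thesis by simp
  qed
  show ?thesis
  proof (intro exI[of _ C] conjI allI impI)
    show "0 \<le> C" using p0 c0 by (simp add: C_def)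
    fix s assume s: "s \<le> \<tau>"
    have ace: "ac_on s \<tau> (\<lambda>t. exp (lam1 * t)) (\<lambda>t. lam1 * exp (lam1 * t))"
    proof (rule ac_on_real_C1)
      show "((\<lambda>t. exp (lam1 * t)) has_vector_derivative lam1 * exp (lam1 * t)) (at t)" for t
        unfolding has_real_derivative_iff_has_vector_derivative[symmetric] by (auto intro!: derivative_eq_intros)
      show "set_integrable lebesgue {s..\<tau>} (\<lambda>t. lam1 * exp (lam1 * t))"
        by (intro absolutely_integrable_continuous_real continuous_intros)
    qed
    note ac = ac_on_bilinear[OF bounded_bilinear_mult ace ac_on_norm_square[OF h_ac[of s \<tau>]]]
    have ii: "set_integrable lebesgue {s..\<tau>} (\<lambda>r. exp (lam1 * r) * ?T r)"
      by (rule set_integrable_subset[OF total_integrable[of \<tau>]]) auto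
    have "- c * past_source (\<lambda>_. 1) \<tau> \<le> - c * (LINT r:{s..\<tau>}|lebesgue. exp (lam1 * r) * ?T r)"
      using past_source_mono[of "\<lambda>_. 1" "{s..\<tau>}" \<tau>] s c0 by (intro mult_left_mono_neg) auto
    also have "\<dots> = (LINT r:{s..\<tau>}|lebesgue. - c * (exp (lam1 * r) * ?T r))" by (simp only: set_integral_mult_right)
    also have "\<dots> \<le> (LINT r:{s..\<tau>}|lebesgue. lam1 * exp (lam1 * r) * (norm (h r))\<^sup>2 + exp (lam1 * r) * (2 * inner (h r) (h' r)))"
    proof (rule set_integral_mono)
      show "set_integrable lebesgue {s..\<tau>} (\<lambda>r. - c * (exp (lam1 * r) * ?T r))"
        by (rule set_integrable_mult_right) (rule ii)
      show "set_integrable lebesgue {s..\<tau>} (\<lambda>r. lam1 * exp (lam1 * r) * (norm (h r))\<^sup>2 + exp (lam1 * r) * (2 * inner (h r) (h' r)))"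
        by (rule ac_on_integrable[OF ac])
      fix r
      have "exp (lam1 * r) * (- c * ?T r) \<le> exp (lam1 * r) * (2 * inner (h r) (h' r))" using lower by (intro mult_left_mono) auto
      moreover have "0 \<le> lam1 * exp (lam1 * r) * (norm (h r))\<^sup>2" using lam by simp
      ultimately show "- c * (exp (lam1 * r) * ?T r) \<le> lam1 * exp (lam1 * r) * (norm (h r))\<^sup>2 + exp (lam1 * r) * (2 * inner (h r) (h' r))"
        by (simp add: mult_ac)
    qed
    also have "\<dots> = exp (lam1 * \<tau>) * (norm (h \<tau>))\<^sup>2 - exp (lam1 * s) * (norm (h s))\<^sup>2"
      using s by (intro ac_on_diff[OF ac, symmetric]) auto
    finally have "exp (lam1 * s) * (norm (h s))\<^sup>2 \<le> C" by (simp add: C_def)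
    then have "exp (- lam1 * s) * (exp (lam1 * s) * (norm (h s))\<^sup>2) \<le> exp (- lam1 * s) * C" by (intro mult_left_mono) auto
    then show "(norm (h s))\<^sup>2 \<le> C * exp (- lam1 * s)"
      by (simp add: mult.assoc[symmetric] exp_add[symmetric] mult.commute)
  qed
qed

text \<open>Into the past the square of the noise grows at most at the rate \<open>2 * rate\<close>
  and that of \<open>h\<close> at the rate \<open>lam1\<close>; together they stay below
  \<open>lam0\<close>.\<close>

lemma initial_shift_small:
  assumes z: "tempered_path m \<tau> z"
  shows "((\<lambda>t. exp (- lam0 * t) * ((z (\<tau> - t))\<^sup>2 * (norm (h (\<tau> - t)))\<^sup>2)) \<longlongrightarrow> 0) at_top"
proof -
  obtain C where C: "C \<ge> 0" "\<And>s. s \<le> \<tau> \<Longrightarrow> (norm (h s))\<^sup>2 \<le> C * exp (- lam1 * s)" using h_growth[of \<tau>] by blast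
  define c where "c = lam0 - lam1 - 2 * rate"
  have c: "0 < c" using rate_pos by (simp add: c_def)
  have m: "0 \<le> m" using z by (simp add: tempered_path_def)
  show ?thesis
  proof (rule Lim_null_comparison)
    show "\<forall>\<^sub>F t in at_top. norm (exp (- lam0 * t) * ((z (\<tau> - t))\<^sup>2 * (norm (h (\<tau> - t)))\<^sup>2)) \<le> (m\<^sup>2 * C * exp (- lam1 * \<tau>)) * exp (- (c * t))"
      using eventually_ge_at_top[of 0]
    proof eventually_elim
      case (elim t)
      have "\<bar>z (\<tau> - t)\<bar> \<le> m * exp (rate * t)" using z elim unfolding tempered_path_def by (metis diff_diff_eq2 add_diff_cancel_left' diff_le_eq le_add_same_cancel1)
      then have "\<bar>z (\<tau> - t)\<bar>\<^sup>2 \<le> (m * exp (rate * t))\<^sup>2" by (intro power_mono) auto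
      also have "\<dots> = m\<^sup>2 * exp (2 * rate * t)" by (simp add: power_mult_distrib exp_double[symmetric] mult_ac)
      finally have z2: "(z (\<tau> - t))\<^sup>2 \<le> m\<^sup>2 * exp (2 * rate * t)" by simp
      have "exp (- lam0 * t) * ((z (\<tau> - t))\<^sup>2 * (norm (h (\<tau> - t)))\<^sup>2)
        \<le> exp (- lam0 * t) * ((m\<^sup>2 * exp (2 * rate * t)) * (C * exp (- lam1 * (\<tau> - t))))"
        using z2 C(2)[of "\<tau> - t"] elim by (intro mult_left_mono mult_mono) auto
      also have "\<dots> = (m\<^sup>2 * C) * (exp (- lam0 * t) * exp (2 * rate * t) * exp (- lam1 * (\<tau> - t)))" by (simp add: mult_ac)
      also have "exp (- lam0 * t) * exp (2 * rate * t) * exp (- lam1 * (\<tau> - t)) = exp (- lam1 * \<tau>) * exp (- (c * t))"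
        unfolding exp_add[symmetric] by (simp add: c_def algebra_simps)
      finally show ?case by (simp add: abs_mult mult_ac)
    qed
    have "((\<lambda>t. exp (- (c * t))) \<longlongrightarrow> 0) at_top"
    proof (rule filterlim_compose[OF exp_at_bot])
      show "filterlim (\<lambda>t. - (c * t)) at_bot at_top"
        unfolding filterlim_uminus_at_top[symmetric] using c
        by (intro filterlim_tendsto_pos_mult_at_top[OF tendsto_const _ filterlim_ident])
    qed
    from tendsto_mult_left[OF this, of "m\<^sup>2 * C * exp (- lam1 * \<tau>)"]
    show "((\<lambda>t. (m\<^sup>2 * C * exp (- lam1 * \<tau>)) * exp (- (c * t))) \<longlongrightarrow> 0) at_top" by simp
  qed
qed

end

section \<open>The flow in the original variable: absorption, compactness, measurability\<close>

context lattice_equation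
begin

definition uflow :: "(real \<Rightarrow> real) \<Rightarrow> real \<Rightarrow> real \<Rightarrow> ell2 \<Rightarrow> ell2" where
  "uflow z a b x = flow z a b (x - z a *\<^sub>R h a) + z b *\<^sub>R h b"

text \<open>The square of the absorbing radius. The 1 bounds what is left of the initial energy, the
  factors 2 come from squaring the sum \<open>v + z h\<close>, and the last term is the contribution
  of \<open>z h\<close> at the final time.\<close>

definition rad :: "real \<Rightarrow> real \<Rightarrow> real" where
  "rad m \<tau> = 2 * (1 + C0 * (1 + m powr q) * (exp (- lam1 * \<tau>) * past_source (\<lambda>_. 1) \<tau>)) + 2 * (m\<^sup>2 * (norm (h \<tau>))\<^sup>2)"

lemma past_source_one_nonneg: "0 \<le> past_source (\<lambda>_. 1) \<tau>"
  by (rule past_source_nonneg) simp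

lemma rad_nonneg: "0 \<le> rad m \<tau>"
  unfolding rad_def using past_source_one_nonneg[of \<tau>] const_pos
  by (intro add_nonneg_nonneg mult_nonneg_nonneg) auto

lemma rad_mono: "0 \<le> m \<Longrightarrow> m \<le> m' \<Longrightarrow> rad m \<tau> \<le> rad m' \<tau>"
  unfolding rad_def using past_source_one_nonneg[of \<tau>] const_pos q
  by (intro add_mono mult_left_mono mult_right_mono powr_mono2 power_mono) auto

lemma uflow_compose:
  assumes "continuous_on UNIV z" "a \<le> b" "b \<le> c"
  shows "uflow z b c (uflow z a b x) = uflow z a c x"
  using flow_compose[OF assms] by (simp add: uflow_def)

lemma uflow_continuous:
  assumes "continuous_on UNIV z" "a \<le> b" shows "continuous_on UNIV (uflow z a b)"
  unfolding uflow_def[abs_def]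
  by (intro continuous_intros continuous_on_compose2[OF flow_continuous[OF assms]]) auto

lemma uflow_absorbed:
  assumes z: "tempered_path m \<tau> z" and a: "a \<le> \<tau>"
    and x: "exp (- lam0 * (\<tau> - a)) * (norm (x - z a *\<^sub>R h a))\<^sup>2 \<le> 1"
  shows "(norm (uflow z a \<tau> x))\<^sup>2 \<le> rad m \<tau>"
proof -
  define v where "v = flow z a \<tau> (x - z a *\<^sub>R h a)"
  have "(norm v)\<^sup>2 \<le> exp (- lam0 * (\<tau> - a)) * (norm (x - z a *\<^sub>R h a))\<^sup>2
    + C0 * (1 + m powr q) * (exp (- lam1 * \<tau>) * past_source (\<lambda>_. 1) \<tau>)"
    using pullback_energy[OF slowly_varying_const z a, of "x - z a *\<^sub>R h a"]
    by (simp only: diag_one v_def power2_norm_eq_inner)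
  then have v: "(norm v)\<^sup>2 \<le> 1 + C0 * (1 + m powr q) * (exp (- lam1 * \<tau>) * past_source (\<lambda>_. 1) \<tau>)"
    using x by linarith
  have "\<bar>z \<tau>\<bar> \<le> m * exp (rate * (\<tau> - \<tau>))" using z unfolding tempered_path_def by blast
  then have "(z \<tau>)\<^sup>2 \<le> m\<^sup>2" by (simp add: abs_le_square_iff[symmetric])
  then have zh: "(norm (z \<tau> *\<^sub>R h \<tau>))\<^sup>2 \<le> m\<^sup>2 * (norm (h \<tau>))\<^sup>2"
    by (simp add: power_mult_distrib mult_right_mono)
  have "(norm (v + z \<tau> *\<^sub>R h \<tau>))\<^sup>2 \<le> (norm v + norm (z \<tau> *\<^sub>R h \<tau>))\<^sup>2"
    by (intro power_mono norm_triangle_ineq) auto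
  also have "\<dots> \<le> 2 * (norm v)\<^sup>2 + 2 * (norm (z \<tau> *\<^sub>R h \<tau>))\<^sup>2"
    using sum_squares_bound[of "norm v" "norm (z \<tau> *\<^sub>R h \<tau>)"] by (simp add: power2_sum)
  also have "\<dots> \<le> rad m \<tau>" unfolding rad_def using v zh by (intro add_mono mult_left_mono) auto
  finally show ?thesis by (simp add: uflow_def v_def)
qed

text \<open>The sets are indexed by the time elapsed along one fixed path; this is the real-valued
  form of the limit in \<open>tempered_sets\<close>.\<close>

definition tempered_family :: "(real \<Rightarrow> ell2 set) \<Rightarrow> bool" where
  "tempered_family D \<longleftrightarrow> (\<forall>e>0. \<exists>T. \<forall>t\<ge>T. \<forall>x\<in>D t. exp (- lam0 * t) * (norm x)\<^sup>2 \<le> e)"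

text \<open>Passing from \<open>u\<close> to \<open>v\<close> at the initial time preserves
  temperedness, since the shift by \<open>z h\<close> is itself negligible by
  \<open>initial_shift_small\<close>.\<close>

lemma tempered_initial:
  assumes z: "tempered_path m \<tau> z" and D: "tempered_family D" and e: "0 < e"
  shows "\<exists>T\<ge>0. \<forall>t\<ge>T. \<forall>x\<in>D t. exp (- lam0 * t) * (norm (x - z (\<tau> - t) *\<^sub>R h (\<tau> - t)))\<^sup>2 \<le> e"
proof -
  have "0 < e / 4" using e by simp
  then obtain T1 where T1: "\<forall>t\<ge>T1. \<forall>x\<in>D t. exp (- lam0 * t) * (norm x)\<^sup>2 \<le> e / 4"
    using D unfolding tempered_family_def by blast
  have "eventually (\<lambda>t. exp (- lam0 * t) * ((z (\<tau> - t))\<^sup>2 * (norm (h (\<tau> - t)))\<^sup>2) < e / 4) at_top"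
    by (rule order_tendstoD(2)[OF initial_shift_small[OF z] \<open>0 < e / 4\<close>])
  then obtain T2 where T2: "\<forall>t\<ge>T2. exp (- lam0 * t) * ((z (\<tau> - t))\<^sup>2 * (norm (h (\<tau> - t)))\<^sup>2) < e / 4"
    unfolding eventually_at_top_linorder by blast
  show ?thesis
  proof (intro exI[of _ "max 0 (max T1 T2)"] conjI allI impI ballI)
    fix t x assume t: "max 0 (max T1 T2) \<le> t" and x: "x \<in> D t"
    let ?y = "z (\<tau> - t) *\<^sub>R h (\<tau> - t)"
    have "(norm (x - ?y))\<^sup>2 \<le> (norm x + norm ?y)\<^sup>2" by (intro power_mono norm_triangle_ineq4) auto
    also have "\<dots> \<le> 2 * (norm x)\<^sup>2 + 2 * (norm ?y)\<^sup>2"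
      using sum_squares_bound[of "norm x" "norm ?y"] by (simp add: power2_sum)
    finally have "exp (- lam0 * t) * (norm (x - ?y))\<^sup>2 \<le> exp (- lam0 * t) * (2 * (norm x)\<^sup>2 + 2 * (norm ?y)\<^sup>2)"
      by (intro mult_left_mono) auto
    also have "\<dots> = 2 * (exp (- lam0 * t) * (norm x)\<^sup>2) + 2 * (exp (- lam0 * t) * ((z (\<tau> - t))\<^sup>2 * (norm (h (\<tau> - t)))\<^sup>2))"
      by (simp add: algebra_simps power_mult_distrib)
    also have "\<dots> \<le> 2 * (e / 4) + 2 * (e / 4)"
      using T1 T2 t x by (intro add_mono mult_left_mono) (auto intro: less_imp_le)
    finally show "exp (- lam0 * t) * (norm (x - ?y))\<^sup>2 \<le> e" by simp
  qed simp
qed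

lemma uflow_absorbing:
  assumes z: "tempered_path m \<tau> z" and D: "tempered_family D"
  shows "\<exists>T\<ge>0. \<forall>t\<ge>T. \<forall>x\<in>D t. (norm (uflow z (\<tau> - t) \<tau> x))\<^sup>2 \<le> rad m \<tau>"
proof -
  obtain T where T: "T \<ge> 0" "\<forall>t\<ge>T. \<forall>x\<in>D t. exp (- lam0 * t) * (norm (x - z (\<tau> - t) *\<^sub>R h (\<tau> - t)))\<^sup>2 \<le> 1"
    using tempered_initial[OF z D zero_less_one] by blast
  have "(norm (uflow z (\<tau> - t) \<tau> x))\<^sup>2 \<le> rad m \<tau>" if "t \<ge> T" "x \<in> D t" for t x
    using T that by (intro uflow_absorbed[OF z]) auto
  then show ?thesis using T(1) by blast
qed

lemma uflow_asymptotically_compact: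
  assumes z: "tempered_path m \<tau> z" and D: "tempered_family D"
    and t: "filterlim t at_top sequentially" and x: "\<And>n. x n \<in> D (t n)"
  shows "\<exists>l r. strict_mono (r :: nat \<Rightarrow> nat) \<and> (\<lambda>n. uflow z (\<tau> - t (r n)) \<tau> (x (r n))) \<longlonglongrightarrow> l"
proof -
  define y where "y n = x n - z (\<tau> - t n) *\<^sub>R h (\<tau> - t n)" for n
  define v where "v n = flow z (\<tau> - t n) \<tau> (y n)" for n
  define c where "c = C0 * (1 + m powr q) * exp (- lam1 * \<tau>)"
  have c: "0 < c" unfolding c_def using const_pos by (intro mult_pos_pos add_pos_nonneg) auto
  have small: "\<exists>N. \<forall>n\<ge>N. 0 \<le> t n \<and> exp (- lam0 * t n) * (norm (y n))\<^sup>2 \<le> e" if e: "0 < e" for e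
  proof -
    obtain T where T: "T \<ge> 0" "\<forall>t\<ge>T. \<forall>x\<in>D t. exp (- lam0 * t) * (norm (x - z (\<tau> - t) *\<^sub>R h (\<tau> - t)))\<^sup>2 \<le> e"
      using tempered_initial[OF z D e] by blast
    have "eventually (\<lambda>n. T \<le> t n) sequentially" using t by (simp add: filterlim_at_top)
    then obtain N where "\<forall>n\<ge>N. T \<le> t n" unfolding eventually_sequentially by blast
    then show ?thesis using T x by (intro exI[of _ N]) (auto simp: y_def intro: order_trans)
  qed
  have energy: "inner (diag \<rho> (v n)) (v n) \<le> exp (- lam0 * t n) * (norm (y n))\<^sup>2 + c * past_source \<rho> \<tau>"
    if "slowly_varying \<rho>" "0 \<le> t n" for \<rho> n
    using pullback_energy[OF that(1) z, of "\<tau> - t n" "y n"] that(2) by (simp add: v_def c_def mult.assoc)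
  \<comment> \<open>The first terms are discarded: their times may be negative and their initial
    energy large.\<close>
  obtain N0 where N0: "\<forall>n\<ge>N0. 0 \<le> t n \<and> exp (- lam0 * t n) * (norm (y n))\<^sup>2 \<le> 1" using small[of 1] by auto
  have bnd: "norm (v (n + N0)) \<le> sqrt (1 + c * past_source (\<lambda>_. 1) \<tau>)" for n
  proof (rule real_le_rsqrt)
    have n: "0 \<le> t (n + N0)" "exp (- lam0 * t (n + N0)) * (norm (y (n + N0)))\<^sup>2 \<le> 1" using N0 by auto
    show "(norm (v (n + N0)))\<^sup>2 \<le> 1 + c * past_source (\<lambda>_. 1) \<tau>"
      using energy[OF slowly_varying_const n(1)] n(2) unfolding diag_one power2_norm_eq_inner by linarith
  qed
  have tails: "\<exists>k N. \<forall>n\<ge>N. norm (tail k (v (n + N0))) \<le> \<eta>" if \<eta>: "0 < \<eta>" for \<eta>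
  proof -
    \<comment> \<open>Half of the square of \<open>\<eta>\<close> is spent on the source far out,
      which fixes \<open>k\<close>, the other half on the decayed initial energy, which fixes
      \<open>N\<close>.\<close>
    have e: "0 < \<eta>\<^sup>2 / 2" using \<eta> by simp
    then have "0 < \<eta>\<^sup>2 / 2 / c" using c by simp
    from metric_LIMSEQ_D[OF past_source_far_weight_tendsto[of \<tau>] this]
    obtain k where k: "dist (past_source (far_weight k) \<tau>) 0 < \<eta>\<^sup>2 / 2 / c" by auto
    then have "past_source (far_weight k) \<tau> < \<eta>\<^sup>2 / 2 / c" unfolding dist_real_def by linarith
    then have ck: "c * past_source (far_weight k) \<tau> \<le> \<eta>\<^sup>2 / 2" using c by (simp add: field_simps)
    obtain N where N: "\<forall>n\<ge>N. 0 \<le> t n \<and> exp (- lam0 * t n) * (norm (y n))\<^sup>2 \<le> \<eta>\<^sup>2 / 2" using small[OF e] by blast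
    have "norm (tail k (v (n + N0))) \<le> \<eta>" if "n \<ge> N" for n
    proof (rule power2_le_imp_le)
      have n: "0 \<le> t (n + N0)" "exp (- lam0 * t (n + N0)) * (norm (y (n + N0)))\<^sup>2 \<le> \<eta>\<^sup>2 / 2" using N that by auto
      have "(norm (tail k (v (n + N0))))\<^sup>2 \<le> inner (diag (far_weight k) (v (n + N0))) (v (n + N0))" by (rule tail_le_far_weight)
      also have "\<dots> \<le> exp (- lam0 * t (n + N0)) * (norm (y (n + N0)))\<^sup>2 + c * past_source (far_weight k) \<tau>"
        by (rule energy[OF slowly_varying_far_weight n(1)])
      also have "\<dots> \<le> \<eta>\<^sup>2" using n(2) ck by linarith
      finally show "(norm (tail k (v (n + N0))))\<^sup>2 \<le> \<eta>\<^sup>2" .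
    qed (use \<eta> in simp)
    then show ?thesis by blast
  qed
  obtain l r where r: "strict_mono (r :: nat \<Rightarrow> nat)" "(\<lambda>n. v (r n + N0)) \<longlonglongrightarrow> l"
    using uniform_tails_convergent_subsequence[of "\<lambda>n. v (n + N0)", OF bnd tails] by blast
  have "(\<lambda>n. v (r n + N0) + z \<tau> *\<^sub>R h \<tau>) \<longlonglongrightarrow> l + z \<tau> *\<^sub>R h \<tau>" by (intro tendsto_intros r(2))
  moreover have "strict_mono (\<lambda>n. r n + N0)" using r(1) by (simp add: strict_mono_def)
  ultimately show ?thesis
    by (intro exI[of _ "l + z \<tau> *\<^sub>R h \<tau>"] exI[of _ "\<lambda>n. r n + N0"]) (simp add: uflow_def v_def y_def)
qed

lemma exp_at_bot_0: "0 < c \<Longrightarrow> ((\<lambda>s::real. exp (c * s)) \<longlongrightarrow> 0) at_bot"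
  by (rule filterlim_compose[OF exp_at_bot])
    (intro filterlim_tendsto_pos_mult_at_bot[OF tendsto_const _ filterlim_ident])

text \<open>The argument \<open>m * exp (- rate * s)\<close> bounds the noise constant after a shift
  by \<open>s\<close>. Every part of the weighted radius then decays with a positive exponent:
  \<open>lam0\<close>, \<open>lam0 - lam1\<close>, half of this gap, or
  \<open>lam0 - lam1 - 2 * rate\<close>.\<close>

lemma rad_tempered:
  assumes m: "0 \<le> m"
  shows "((\<lambda>s. exp (lam0 * s) * rad (m * exp (- rate * s)) (\<tau> + s)) \<longlongrightarrow> 0) at_bot"
proof -
  obtain C where C: "C \<ge> 0" "\<And>s. s \<le> \<tau> \<Longrightarrow> (norm (h s))\<^sup>2 \<le> C * exp (- lam1 * s)" using h_growth[of \<tau>] by blast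
  define G where "G = past_source (\<lambda>_. 1) \<tau>"
  define e1 where "e1 = exp (- lam1 * \<tau>)"
  let ?U = "\<lambda>s. 2 * exp (lam0 * s) + 2 * C0 * G * e1 * (exp ((lam0 - lam1) * s) + m powr q * exp (((lam0 - lam1) / 2) * s))
    + 2 * m\<^sup>2 * C * e1 * exp ((lam0 - lam1 - 2 * rate) * s)"
  show ?thesis
  proof (rule Lim_null_comparison)
    show "\<forall>\<^sub>F s in at_bot. norm (exp (lam0 * s) * rad (m * exp (- rate * s)) (\<tau> + s)) \<le> ?U s"
      using eventually_le_at_bot[of 0]
    proof eventually_elim
      case (elim s)
      have pG: "past_source (\<lambda>_. 1) (\<tau> + s) \<le> G"
        unfolding G_def past_source_def[of _ "\<tau> + s"] using elim by (intro past_source_mono) auto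
      have pow: "(m * exp (- rate * s)) powr q = m powr q * exp (- ((lam0 - lam1) / 2) * s)"
        unfolding rate_pos(2)[symmetric] by (simp add: powr_mult exp_powr_real mult_ac)
      have e2: "exp (- lam1 * (\<tau> + s)) = e1 * exp (- lam1 * s)"
        unfolding e1_def exp_add[symmetric] by (simp add: algebra_simps)
      have "C0 * (1 + (m * exp (- rate * s)) powr q) * (exp (- lam1 * (\<tau> + s)) * past_source (\<lambda>_. 1) (\<tau> + s))
        \<le> C0 * (1 + m powr q * exp (- ((lam0 - lam1) / 2) * s)) * ((e1 * exp (- lam1 * s)) * G)"
        unfolding pow e2 using pG const_pos by (intro mult_left_mono mult_nonneg_nonneg) (auto simp: e1_def)
      moreover have "(m * exp (- rate * s))\<^sup>2 * (norm (h (\<tau> + s)))\<^sup>2 \<le> (m\<^sup>2 * exp (- 2 * rate * s)) * (C * (e1 * exp (- lam1 * s)))"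
      proof -
        have "(m * exp (- rate * s))\<^sup>2 = m\<^sup>2 * exp (- 2 * rate * s)"
          by (simp add: power_mult_distrib exp_double[symmetric] mult_ac)
        then show ?thesis using C(2)[of "\<tau> + s"] elim unfolding e2 by (simp add: mult_left_mono)
      qed
      ultimately have "rad (m * exp (- rate * s)) (\<tau> + s) \<le>
          2 * (1 + C0 * (1 + m powr q * exp (- ((lam0 - lam1) / 2) * s)) * ((e1 * exp (- lam1 * s)) * G))
          + 2 * ((m\<^sup>2 * exp (- 2 * rate * s)) * (C * (e1 * exp (- lam1 * s))))"
        unfolding rad_def by (intro add_mono mult_left_mono) auto
      then have "exp (lam0 * s) * rad (m * exp (- rate * s)) (\<tau> + s) \<le> exp (lam0 * s) *
          (2 * (1 + C0 * (1 + m powr q * exp (- ((lam0 - lam1) / 2) * s)) * ((e1 * exp (- lam1 * s)) * G))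
          + 2 * ((m\<^sup>2 * exp (- 2 * rate * s)) * (C * (e1 * exp (- lam1 * s)))))"
        by (intro mult_left_mono) auto
      also have "\<dots> = 2 * exp (lam0 * s) + 2 * C0 * G * e1 * (exp (lam0 * s) * exp (- lam1 * s)
            + m powr q * (exp (lam0 * s) * exp (- lam1 * s) * exp (- ((lam0 - lam1) / 2) * s)))
          + 2 * m\<^sup>2 * C * e1 * (exp (lam0 * s) * exp (- lam1 * s) * exp (- 2 * rate * s))"
        by (simp only: algebra_simps)
      also have "\<dots> = ?U s"
        unfolding exp_add[symmetric] by (simp add: algebra_simps add_divide_distrib diff_divide_distrib)
      finally show ?case using rad_nonneg by (simp add: abs_mult)
    qed
    have "(?U \<longlongrightarrow> 2 * 0 + 2 * C0 * G * e1 * (0 + m powr q * 0) + 2 * m\<^sup>2 * C * e1 * 0) at_bot"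
      using lam rate_pos(3) by (intro tendsto_intros exp_at_bot_0) auto
    then show "(?U \<longlongrightarrow> 0) at_bot" by simp
  qed
qed

text \<open>Measurability in the path follows by replacing it with its Bernstein polynomials, which
  depend on finitely many of its values.\<close>

definition bernstein_path :: "real \<Rightarrow> real \<Rightarrow> nat \<Rightarrow> (nat \<Rightarrow> real) \<Rightarrow> real \<Rightarrow> real" where
  "bernstein_path a b k c s = (\<Sum>j\<le>k. c j * Bernstein k j ((s - a) / (b - a)))"

lemma bernstein_path_continuous: "continuous_on S (bernstein_path a b k c)"
  unfolding bernstein_path_def[abs_def] Bernstein_def divide_inverse by (intro continuous_intros)

text \<open>Only the finitely many coefficients with index at most \<open>k\<close> enter, so
  convergence in the product topology implies uniform convergence of the polynomials on
  \<open>{a..b}\<close>.\<close>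

lemma flow_bernstein_continuous:
  assumes ab: "a < b"
  shows "continuous_on UNIV (\<lambda>p. flow (bernstein_path a b k (fst p)) a b (snd p))"
  unfolding continuous_on_eq_continuous_within
proof (intro ballI continuous_within_sequentiallyI)
  fix p :: "(nat \<Rightarrow> real) \<times> ell2" and u :: "nat \<Rightarrow> (nat \<Rightarrow> real) \<times> ell2"
  assume u: "u \<longlonglongrightarrow> p"
  have f: "(\<lambda>n. fst (u n)) \<longlonglongrightarrow> fst p" and sn: "(\<lambda>n. snd (u n)) \<longlonglongrightarrow> snd p"
    using u by (auto intro: tendsto_fst tendsto_snd)
  have c: "(\<lambda>n. fst (u n) j) \<longlonglongrightarrow> fst p j" for j
    using continuous_on_tendsto_compose[OF continuous_on_product_coordinates f, of j] by simp
  show "(\<lambda>n. flow (bernstein_path a b k (fst (u n))) a b (snd (u n))) \<longlonglongrightarrow> flow (bernstein_path a b k (fst p)) a b (snd p)"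
  proof (rule flow_tendsto[OF bernstein_path_continuous bernstein_path_continuous _ sn])
    show "a \<le> b" using ab by simp
    show "uniform_limit {a..b} (\<lambda>n. bernstein_path a b k (fst (u n))) (bernstein_path a b k (fst p)) sequentially"
    proof (rule uniform_limitI)
      fix e :: real assume e: "0 < e"
      have "(\<lambda>n. \<Sum>j\<le>k. \<bar>fst (u n) j - fst p j\<bar>) \<longlonglongrightarrow> (\<Sum>j\<le>k. \<bar>fst p j - fst p j\<bar>)" by (intro tendsto_intros c)
      then have "(\<lambda>n. \<Sum>j\<le>k. \<bar>fst (u n) j - fst p j\<bar>) \<longlonglongrightarrow> 0" by simp
      then have "\<forall>\<^sub>F n in sequentially. (\<Sum>j\<le>k. \<bar>fst (u n) j - fst p j\<bar>) < e" using e by (rule order_tendstoD)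
      then show "\<forall>\<^sub>F n in sequentially. \<forall>s\<in>{a..b}. dist (bernstein_path a b k (fst (u n)) s) (bernstein_path a b k (fst p) s) < e"
      proof eventually_elim
        case (elim n)
        show ?case
        proof
          fix s assume s: "s \<in> {a..b}"
          define y where "y = (s - a) / (b - a)"
          have y: "0 \<le> y" "y \<le> 1" using s ab by (auto simp: y_def)
          have B: "0 \<le> Bernstein k j y" "Bernstein k j y \<le> 1" if "j \<le> k" for j
          proof -
            show "0 \<le> Bernstein k j y" using y by (rule Bernstein_nonneg)
            have "Bernstein k j y \<le> (\<Sum>j\<le>k. Bernstein k j y)"
              using that Bernstein_nonneg[OF y] by (intro member_le_sum) auto
            then show "Bernstein k j y \<le> 1" by simp
          qed
          have "\<bar>bernstein_path a b k (fst (u n)) s - bernstein_path a b k (fst p) s\<bar> = \<bar>\<Sum>j\<le>k. (fst (u n) j - fst p j) * Bernstein k j y\<bar>"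
            unfolding bernstein_path_def y_def[symmetric] by (simp add: sum_subtractf algebra_simps)
          also have "\<dots> \<le> (\<Sum>j\<le>k. \<bar>(fst (u n) j - fst p j) * Bernstein k j y\<bar>)" by (rule sum_abs)
          also have "\<dots> \<le> (\<Sum>j\<le>k. \<bar>fst (u n) j - fst p j\<bar>)"
            using B by (intro sum_mono) (auto simp: abs_mult intro!: mult_right_le_one_le)
          finally show "dist (bernstein_path a b k (fst (u n)) s) (bernstein_path a b k (fst p) s) < e"
            using elim by (simp add: dist_real_def)
        qed
      qed
    qed
  qed
qed

lemma flow_measurable:
  assumes ab: "a \<le> b" and Z: "\<And>\<omega>. \<omega> \<in> space M \<Longrightarrow> continuous_on UNIV (Z \<omega>)"
    and Zm: "\<And>s. (\<lambda>\<omega>. Z \<omega> s) \<in> borel_measurable M" and X: "X \<in> borel_measurable M"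
  shows "(\<lambda>\<omega>. flow (Z \<omega>) a b (X \<omega>)) \<in> borel_measurable M"
proof (cases "a = b")
  case True
  then show ?thesis using X flow_refl[OF Z] by (simp cong: measurable_cong)
next
  case False
  then have ab': "a < b" using ab by simp
  \<comment> \<open>Samples at equidistant nodes. For \<open>k = 0\<close> the quotient is 0 by
    convention and the node is \<open>a\<close>, which does not affect the limit.\<close>
  define c where "c k \<omega> j = Z \<omega> (a + (b - a) * (real j / real k))" for k \<omega> j
  show ?thesis
  proof (rule borel_measurable_LIMSEQ_metric[where f = "\<lambda>k \<omega>. flow (bernstein_path a b k (c k \<omega>)) a b (X \<omega>)"])
    fix k
    have "c k \<in> borel_measurable M"
      by (rule measurable_coordinatewise_then_product) (simp add: c_def Zm)
    then show "(\<lambda>\<omega>. flow (bernstein_path a b k (c k \<omega>)) a b (X \<omega>)) \<in> borel_measurable M"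
      using X flow_bernstein_continuous[OF ab'] by (rule borel_measurable_continuous_Pair)
  next
    fix \<omega> assume w: "\<omega> \<in> space M"
    show "(\<lambda>k. flow (bernstein_path a b k (c k \<omega>)) a b (X \<omega>)) \<longlonglongrightarrow> flow (Z \<omega>) a b (X \<omega>)"
    proof (rule flow_tendsto[OF bernstein_path_continuous Z[OF w] _ tendsto_const ab])
      show "uniform_limit {a..b} (\<lambda>k. bernstein_path a b k (c k \<omega>)) (Z \<omega>) sequentially"
      proof (rule uniform_limitI)
        fix e :: real assume e: "0 < e"
        have "continuous_on {0..1} (\<lambda>x. Z \<omega> (a + (b - a) * x))"
          by (intro continuous_on_compose2[OF Z[OF w]] continuous_intros) auto
        from Bernstein_Weierstrass[OF this e] obtain N where
          N: "\<And>n x. N \<le> n \<Longrightarrow> x \<in> {0..1} \<Longrightarrow>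
            \<bar>Z \<omega> (a + (b - a) * x) - (\<Sum>k\<le>n. Z \<omega> (a + (b - a) * (real k / real n)) * Bernstein n k x)\<bar> < e" by blast
        have "dist (bernstein_path a b n (c n \<omega>) s) (Z \<omega> s) < e" if "N \<le> n" "s \<in> {a..b}" for n s
        proof -
          have "(s - a) / (b - a) \<in> {0..1}" using that ab' by auto
          from N[OF that(1) this] show ?thesis
            using ab' by (simp add: bernstein_path_def c_def dist_real_def abs_minus_commute)
        qed
        then show "\<forall>\<^sub>F k in sequentially. \<forall>s\<in>{a..b}. dist (bernstein_path a b k (c k \<omega>) s) (Z \<omega> s) < e"
          unfolding eventually_sequentially by blast
      qed
    qed
  qed
qed

lemma uflow_measurable:
  assumes "a \<le> b" "\<And>\<omega>. \<omega> \<in> space M \<Longrightarrow> continuous_on UNIV (Z \<omega>)"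
    "\<And>s. (\<lambda>\<omega>. Z \<omega> s) \<in> borel_measurable M" "X \<in> borel_measurable M"
  shows "(\<lambda>\<omega>. uflow (Z \<omega>) a b (X \<omega>)) \<in> borel_measurable M"
  unfolding uflow_def
  by (intro borel_measurable_add flow_measurable assms borel_measurable_diff borel_measurable_scaleR borel_measurable_const)

end

section \<open>Measurability on the Wiener space\<close>

lemma wiener_measure_space: "wiener_measure P \<Longrightarrow> space P = path_space"
  unfolding wiener_measure_def by (elim conjE)

lemma wiener_measure_sets:
  "wiener_measure P \<Longrightarrow> sets P = sigma_sets path_space {U. openin compact_open_topology U}"
  unfolding wiener_measure_def by (elim conjE)

text \<open>A singleton is compact, so the preimage of an open set under evaluation belongs to the
  family that generates the topology.\<close>

lemma wiener_eval_measurable: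
  assumes "wiener_measure P" shows "(\<lambda>\<omega>. \<omega> t) \<in> borel_measurable P"
proof (rule borel_measurableI)
  fix U :: "real set" assume U: "open U"
  note sp = wiener_measure_space[OF assms] and st = wiener_measure_sets[OF assms]
  have "openin compact_open_topology {\<omega> \<in> path_space. \<omega> ` {t} \<subseteq> U}"
    unfolding compact_open_topology_def
    by (rule topology_generated_by_Basis, rule CollectI, rule exI[of _ "{t}"], rule exI[of _ U]) (simp add: U)
  moreover have "(\<lambda>\<omega>. \<omega> t) -` U \<inter> space P = {\<omega> \<in> path_space. \<omega> ` {t} \<subseteq> U}" by (auto simp: sp)
  ultimately show "(\<lambda>\<omega>. \<omega> t) -` U \<inter> space P \<in> sets P" by (auto simp: st)
qed

text \<open>Joint measurability is needed to integrate over time in \<open>ou\<close>. A continuous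
  path is the limit of its values at grid points to the left of the argument, and on each of the
  countably many grid cells only an evaluation at a fixed time occurs.\<close>

lemma wiener_eval_pair_measurable:
  assumes P: "wiener_measure P"
  shows "(\<lambda>p. fst p (snd p)) \<in> borel_measurable (P \<Otimes>\<^sub>M borel)"
proof (rule borel_measurable_LIMSEQ_real[where u = "\<lambda>n p. fst p (real_of_int \<lfloor>real (Suc n) * snd p\<rfloor> / real (Suc n))"])
  fix n
  have [measurable]: "(\<lambda>\<omega>. \<omega> t) \<in> borel_measurable P" for t by (rule wiener_eval_measurable[OF P])
  show "(\<lambda>p. fst p (real_of_int \<lfloor>real (Suc n) * snd p\<rfloor> / real (Suc n))) \<in> borel_measurable (P \<Otimes>\<^sub>M borel)"
  proof (rule measurable_compose_countable[where f = "\<lambda>i p. fst p (real_of_int i / real (Suc n))" and g = "\<lambda>p. \<lfloor>real (Suc n) * snd p\<rfloor>"])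
    show "(\<lambda>p. fst p (real_of_int i / real (Suc n))) \<in> borel_measurable (P \<Otimes>\<^sub>M borel)" for i
      by (rule measurable_compose[OF measurable_fst wiener_eval_measurable[OF P]])
    show "(\<lambda>p. \<lfloor>real (Suc n) * snd p\<rfloor>) \<in> P \<Otimes>\<^sub>M borel \<rightarrow>\<^sub>M count_space UNIV" by measurable
  qed
next
  fix p assume "p \<in> space (P \<Otimes>\<^sub>M (borel :: real measure))"
  then have "fst p \<in> path_space" by (auto simp: space_pair_measure wiener_measure_space[OF P])
  then have c: "continuous_on UNIV (fst p)" by (simp add: path_space_def)
  have "(\<lambda>n. real_of_int \<lfloor>real (Suc n) * snd p\<rfloor> / real (Suc n) - snd p) \<longlonglongrightarrow> 0"
  proof (rule Lim_null_comparison)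
    show "\<forall>\<^sub>F n in sequentially. norm (real_of_int \<lfloor>real (Suc n) * snd p\<rfloor> / real (Suc n) - snd p) \<le> 1 / real (Suc n)"
    proof (intro always_eventually allI)
      fix n
      have "\<bar>real_of_int \<lfloor>real (Suc n) * snd p\<rfloor> - real (Suc n) * snd p\<bar> \<le> 1" by linarith
      then have "\<bar>real_of_int \<lfloor>real (Suc n) * snd p\<rfloor> - real (Suc n) * snd p\<bar> / real (Suc n) \<le> 1 / real (Suc n)"
        by (intro divide_right_mono) auto
      also have "\<bar>real_of_int \<lfloor>real (Suc n) * snd p\<rfloor> - real (Suc n) * snd p\<bar> / real (Suc n)
          = \<bar>(real_of_int \<lfloor>real (Suc n) * snd p\<rfloor> - real (Suc n) * snd p) / real (Suc n)\<bar>"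
        by (simp only: abs_divide abs_of_nat)
      also have "(real_of_int \<lfloor>real (Suc n) * snd p\<rfloor> - real (Suc n) * snd p) / real (Suc n) =
          real_of_int \<lfloor>real (Suc n) * snd p\<rfloor> / real (Suc n) - snd p"
        by (simp only: diff_divide_distrib) simp
      finally show "norm (real_of_int \<lfloor>real (Suc n) * snd p\<rfloor> / real (Suc n) - snd p) \<le> 1 / real (Suc n)"
        by (simp only: real_norm_def)
    qed
    show "(\<lambda>n. 1 / real (Suc n)) \<longlonglongrightarrow> 0" using LIMSEQ_Suc[OF lim_const_over_n[of 1]] by simp
  qed
  then have "(\<lambda>n. real_of_int \<lfloor>real (Suc n) * snd p\<rfloor> / real (Suc n)) \<longlonglongrightarrow> snd p" by (simp only: LIM_zero_iff)
  then show "(\<lambda>n. fst p (real_of_int \<lfloor>real (Suc n) * snd p\<rfloor> / real (Suc n))) \<longlonglongrightarrow> fst p (snd p)"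
    by (rule continuous_on_tendsto_compose[OF c]) auto
qed

lemma ou_shift_measurable:
  assumes P: "wiener_measure P" shows "(\<lambda>\<omega>. ou (shift r \<omega>)) \<in> borel_measurable P"
proof -
  have 1: "(\<lambda>p. fst p (snd p + r)) \<in> borel_measurable (P \<Otimes>\<^sub>M lborel)"
  proof -
    have "(\<lambda>p. (fst p, snd p + r)) \<in> P \<Otimes>\<^sub>M lborel \<rightarrow>\<^sub>M P \<Otimes>\<^sub>M borel" by measurable
    from measurable_compose[OF this wiener_eval_pair_measurable[OF P]] show ?thesis by simp
  qed
  have 2: "(\<lambda>p. fst p r) \<in> borel_measurable (P \<Otimes>\<^sub>M (lborel :: real measure))"
    by (rule measurable_compose[OF measurable_fst wiener_eval_measurable[OF P]])
  have "(\<lambda>p. indicator {..0} (snd p) *\<^sub>R (exp (snd p) * (fst p (snd p + r) - fst p r))) \<in> borel_measurable (P \<Otimes>\<^sub>M lborel)"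
    using 1 2 by measurable
  then have "case_prod (\<lambda>\<omega> s. indicator {..0} s *\<^sub>R (exp s * (\<omega> (s + r) - \<omega> r))) \<in> borel_measurable (P \<Otimes>\<^sub>M (lborel :: real measure))"
    by (simp add: case_prod_beta')
  from lborel.borel_measurable_lebesgue_integral[OF this]
  show ?thesis unfolding ou_def shift_def set_lebesgue_integral_def by simp
qed

lemma shift_shift: "shift a (shift b \<omega>) = shift (a + b) \<omega>"
  by (auto simp: shift_def fun_eq_iff add_ac)

lemma shift_0: "\<omega> 0 = 0 \<Longrightarrow> shift 0 \<omega> = \<omega>"
  by (auto simp: shift_def)

text \<open>A countable dense subset of the unit ball, scaled by the random radius, replaces the
  ball, so that the infimum has the same index set for all paths. Continuity of
  \<open>\<Phi> \<omega>\<close> shows that its value is not changed.\<close>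

lemma infdist_image_cball_measurable:
  fixes \<Phi> :: "'w \<Rightarrow> ell2 \<Rightarrow> ell2"
  assumes R: "R \<in> borel_measurable M" "\<And>\<omega>. \<omega> \<in> space M \<Longrightarrow> 0 \<le> R \<omega>"
    and \<Phi>: "\<And>d. (\<lambda>\<omega>. \<Phi> \<omega> (R \<omega> *\<^sub>R d)) \<in> borel_measurable M"
    and cont: "\<And>\<omega>. \<omega> \<in> space M \<Longrightarrow> continuous_on UNIV (\<Phi> \<omega>)"
  shows "(\<lambda>\<omega>. infdist y (\<Phi> \<omega> ` cball 0 (R \<omega>))) \<in> borel_measurable M"
proof -
  obtain T :: "ell2 set" where T: "countable T" "T \<subseteq> cball 0 1" "cball 0 1 \<subseteq> closure T" by (rule separable)
  have Tne: "T \<noteq> {}" using T(3) by force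
  have "(\<lambda>\<omega>. INF d\<in>T. dist y (\<Phi> \<omega> (R \<omega> *\<^sub>R d))) \<in> borel_measurable M"
  proof (rule borel_measurable_cINF[OF T(1)])
    show "(\<lambda>\<omega>. dist y (\<Phi> \<omega> (R \<omega> *\<^sub>R d))) \<in> borel_measurable M" for d
      using \<Phi>[of d] by (intro borel_measurable_dist borel_measurable_const)
    show "bdd_below ((\<lambda>d. dist y (\<Phi> \<omega> (R \<omega> *\<^sub>R d))) ` T)" for \<omega> by (intro bdd_belowI2[of _ 0]) auto
  qed
  moreover have "(INF d\<in>T. dist y (\<Phi> \<omega> (R \<omega> *\<^sub>R d))) = infdist y (\<Phi> \<omega> ` cball 0 (R \<omega>))" if w: "\<omega> \<in> space M" for \<omega>
  proof (rule antisym)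
    have ne: "\<Phi> \<omega> ` cball 0 (R \<omega>) \<noteq> {}" using R(2)[OF w] by auto
    have bb: "bdd_below ((\<lambda>d. dist y (\<Phi> \<omega> (R \<omega> *\<^sub>R d))) ` T)" by (intro bdd_belowI2[of _ 0]) auto
    show "infdist y (\<Phi> \<omega> ` cball 0 (R \<omega>)) \<le> (INF d\<in>T. dist y (\<Phi> \<omega> (R \<omega> *\<^sub>R d)))"
    proof (rule cINF_greatest[OF Tne])
      fix d assume "d \<in> T"
      then have "norm d \<le> 1" using T(2) by auto
      then have "norm (R \<omega> *\<^sub>R d) \<le> R \<omega>" using R(2)[OF w] by (simp add: mult_left_le)
      then show "infdist y (\<Phi> \<omega> ` cball 0 (R \<omega>)) \<le> dist y (\<Phi> \<omega> (R \<omega> *\<^sub>R d))" by (intro infdist_le) auto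
    qed
    show "(INF d\<in>T. dist y (\<Phi> \<omega> (R \<omega> *\<^sub>R d))) \<le> infdist y (\<Phi> \<omega> ` cball 0 (R \<omega>))"
      unfolding infdist_notempty[OF ne]
    proof (rule cINF_greatest[OF ne])
      fix b assume "b \<in> \<Phi> \<omega> ` cball 0 (R \<omega>)"
      then obtain x where x: "norm x \<le> R \<omega>" "b = \<Phi> \<omega> x" by auto
      \<comment> \<open>For radius 0 the inverse is 0 by convention, and \<open>x = 0\<close> gives
        \<open>d = 0\<close>.\<close>
      define d where "d = inverse (R \<omega>) *\<^sub>R x"
      have d: "R \<omega> *\<^sub>R d = x" "d \<in> cball 0 1"
        using x R(2)[OF w] by (cases "R \<omega> = 0"; auto simp: d_def divide_simps)+
      from d(2) T(3) obtain u where u: "\<And>n. u n \<in> T" "u \<longlonglongrightarrow> d" using closure_sequential[of d T] by blast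
      have "(\<lambda>n. dist y (\<Phi> \<omega> (R \<omega> *\<^sub>R u n))) \<longlonglongrightarrow> dist y (\<Phi> \<omega> (R \<omega> *\<^sub>R d))"
        by (intro tendsto_dist tendsto_const continuous_on_tendsto_compose[OF cont[OF w]] tendsto_scaleR u(2)) auto
      moreover have "(INF d\<in>T. dist y (\<Phi> \<omega> (R \<omega> *\<^sub>R d))) \<le> dist y (\<Phi> \<omega> (R \<omega> *\<^sub>R u n))" for n
        by (rule cINF_lower[OF bb u(1)])
      ultimately show "(INF d\<in>T. dist y (\<Phi> \<omega> (R \<omega> *\<^sub>R d))) \<le> dist y b"
        unfolding d(1) x(2) by (intro LIMSEQ_le_const) auto
    qed
  qed
  ultimately show ?thesis by (simp cong: measurable_cong)
qed

lemma ennreal_tendsto_0I: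
  fixes f :: "'a \<Rightarrow> ennreal"
  assumes "\<And>e. 0 < e \<Longrightarrow> eventually (\<lambda>x. f x \<le> ennreal e) F"
  shows "(f \<longlongrightarrow> 0) F"
proof (rule order_tendstoI)
  fix a :: ennreal assume a: "0 < a"
  obtain e where e: "0 < e" "ennreal e < a"
  proof (cases a)
    case (real r)
    then show ?thesis using a that[of "r / 2"] by (simp add: ennreal_less_iff)
  next
    case top
    then show ?thesis using that[of 1] by (simp add: ennreal_less_top)
  qed
  show "eventually (\<lambda>x. f x < a) F" using assms[OF e(1)] by eventually_elim (use e(2) in auto)
qed simp

text \<open>By invariance \<open>\<A> \<tau> \<omega>\<close> is the image of its own past, hence
  contained in the image of the tempered set enclosing \<open>\<A>\<close>; since
  \<open>\<B>\<close> attracts that set, the semidistance vanishes. Closedness is asked at the one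
  fibre concerned, because the fibres of an attractor are compact almost surely only.\<close>

lemma pullback_attractor_subset:
  fixes \<A> \<B> :: "'x::metric_space family"
  assumes A: "pullback_attractor M \<D> \<phi> \<A>" and B: "pullback_attractor M \<D> \<phi> \<B>"
    and \<omega>: "\<omega> \<in> space M" "\<omega> 0 = 0" and inv: "\<And>t. shift t \<omega> \<in> space M" and cl: "closed (\<B> \<tau> \<omega>)"
  shows "\<A> \<tau> \<omega> \<subseteq> \<B> \<tau> \<omega>"
proof -
  obtain K where K: "K \<in> \<D>" "\<And>\<tau> \<omega>. \<omega> \<in> space M \<Longrightarrow> \<A> \<tau> \<omega> \<subseteq> K \<tau> \<omega>"
    using A unfolding pullback_attractor_def by blast
  have lim: "((\<lambda>t. semidist (\<phi> t (\<tau> - t) (shift (- t) \<omega>) ` K (\<tau> - t) (shift (- t) \<omega>)) (\<B> \<tau> \<omega>)) \<longlongrightarrow> 0) at_top"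
    using B K(1) \<omega>(1) unfolding pullback_attractor_def by blast
  have "eventually (\<lambda>t. semidist (\<A> \<tau> \<omega>) (\<B> \<tau> \<omega>) \<le>
      semidist (\<phi> t (\<tau> - t) (shift (- t) \<omega>) ` K (\<tau> - t) (shift (- t) \<omega>)) (\<B> \<tau> \<omega>)) at_top"
    using eventually_ge_at_top[of 0]
  proof eventually_elim
    case (elim t)
    have "\<phi> t (\<tau> - t) (shift (- t) \<omega>) ` \<A> (\<tau> - t) (shift (- t) \<omega>) = \<A> (\<tau> - t + t) (shift t (shift (- t) \<omega>))"
      using A elim inv unfolding pullback_attractor_def by blast
    then have "\<A> \<tau> \<omega> = \<phi> t (\<tau> - t) (shift (- t) \<omega>) ` \<A> (\<tau> - t) (shift (- t) \<omega>)"
      by (simp add: shift_shift shift_0 \<omega>)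
    also have "\<dots> \<subseteq> \<phi> t (\<tau> - t) (shift (- t) \<omega>) ` K (\<tau> - t) (shift (- t) \<omega>)"
      using K(2)[OF inv] by blast
    finally show ?case unfolding semidist_def by (rule SUP_subset_mono) simp
  qed
  then have le: "semidist (\<A> \<tau> \<omega>) (\<B> \<tau> \<omega>) \<le> 0"
    by (intro tendsto_lowerbound[OF lim]) auto
  have *: "ennreal (infdist a (\<B> \<tau> \<omega>)) \<le> 0" if "a \<in> \<A> \<tau> \<omega>" for a
    using that by (intro order_trans[OF SUP_upper le[unfolded semidist_def]])
  have "infdist a (\<B> \<tau> \<omega>) = 0" if "a \<in> \<A> \<tau> \<omega>" for a
    using *[OF that] infdist_nonneg[of a "\<B> \<tau> \<omega>"] by (auto simp: ennreal_eq_0_iff)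
  moreover have "\<B> \<tau> \<omega> \<noteq> {}" using B \<omega>(1) unfolding pullback_attractor_def nonauto_random_set_def by blast
  ultimately show ?thesis using in_closed_iff_infdist_zero[OF cl] by blast
qed

section \<open>The random attractor\<close>

locale random_lattice_equation = lattice_equation +
  fixes P :: "(real \<Rightarrow> real) measure" and \<Omega> :: "(real \<Rightarrow> real) set"
  assumes wiener: "wiener_measure P" and adm: "admissible_paths P \<Omega>"
begin

abbreviation M :: "(real \<Rightarrow> real) measure" where "M \<equiv> restrict_space P \<Omega>"
abbreviation \<phi> :: "real \<Rightarrow> real \<Rightarrow> (real \<Rightarrow> real) \<Rightarrow> ell2 \<Rightarrow> ell2" where "\<phi> \<equiv> nrds lam f g h h'"

section \<open>The noise path and its exponentially weighted supremum\<close>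

lemma space_M: "space M = \<Omega>"
proof -
  have "\<Omega> \<in> sets P" using adm by (simp add: admissible_paths_def)
  then have "\<Omega> \<subseteq> space P" by (rule sets.sets_into_space)
  then show ?thesis by (auto simp: space_restrict_space)
qed

lemma \<Omega>_zero: "\<omega> \<in> \<Omega> \<Longrightarrow> \<omega> 0 = 0"
proof -
  assume w: "\<omega> \<in> \<Omega>"
  have "\<Omega> \<in> sets P" using adm by (simp add: admissible_paths_def)
  then have "\<Omega> \<subseteq> space P" by (rule sets.sets_into_space)
  then have "\<omega> \<in> path_space" using w wiener_measure_space[OF wiener] by blast
  then show ?thesis by (simp add: path_space_def)
qed

lemma shift_in: "\<omega> \<in> \<Omega> \<Longrightarrow> shift t \<omega> \<in> \<Omega>"
  using adm unfolding admissible_paths_def by blast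

lemma ou_continuous: "\<omega> \<in> \<Omega> \<Longrightarrow> continuous_on UNIV (\<lambda>t. ou (shift t \<omega>))"
  using adm unfolding admissible_paths_def by blast

lemma ou_measurable: "(\<lambda>\<omega>. ou (shift r \<omega>)) \<in> borel_measurable M"
  by (rule measurable_restrict_space1[OF ou_shift_measurable[OF wiener]])

text \<open>Beyond some past time the growth is at most linear and
  \<open>- s * exp (rate * s)\<close> is at most \<open>1 / rate\<close>; continuity covers the
  remaining compact interval.\<close>

lemma ou_bounded:
  assumes w: "\<omega> \<in> \<Omega>"
  shows "\<exists>B. \<forall>s\<le>0. \<bar>ou (shift s \<omega>)\<bar> * exp (rate * s) \<le> B"
proof -
  have "((\<lambda>t. ou (shift t \<omega>) / t) \<longlongrightarrow> 0) at_bot" using adm w unfolding admissible_paths_def by blast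
  then have "eventually (\<lambda>t. dist (ou (shift t \<omega>) / t) 0 < 1) at_bot" by (rule tendstoD) simp
  then obtain T0 where T0: "\<forall>t\<le>T0. dist (ou (shift t \<omega>) / t) 0 < 1" unfolding eventually_at_bot_linorder by blast
  define T where "T = min T0 (- 1)"
  have "continuous_on {T..0} (\<lambda>t. ou (shift t \<omega>))" using ou_continuous[OF w] continuous_on_subset by blast
  then obtain B1 where B1: "B1 > 0" "\<And>s. s \<in> {T..0} \<Longrightarrow> \<bar>ou (shift s \<omega>)\<bar> \<le> B1"
    using continuous_Icc_norm_bound[of T 0 "\<lambda>t. ou (shift t \<omega>)"] by auto
  show ?thesis
  proof (intro exI[of _ "B1 + 1 / rate"] allI impI)
    fix s :: real assume s: "s \<le> 0"
    show "\<bar>ou (shift s \<omega>)\<bar> * exp (rate * s) \<le> B1 + 1 / rate"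
    proof (cases "T \<le> s")
      case True
      have "\<bar>ou (shift s \<omega>)\<bar> * exp (rate * s) \<le> B1 * 1"
        using B1 True s rate_pos by (intro mult_mono) (auto simp: mult_nonneg_nonpos)
      then show ?thesis using rate_pos by (simp add: add_increasing2)
    next
      case False
      then have s': "s \<le> T0" "s < 0" by (auto simp: T_def)
      have "\<bar>ou (shift s \<omega>)\<bar> / \<bar>s\<bar> < 1" using T0 s'(1) by (simp add: dist_real_def)
      then have "\<bar>ou (shift s \<omega>)\<bar> \<le> - s" using s'(2) by (simp add: field_simps)
      then have "\<bar>ou (shift s \<omega>)\<bar> * exp (rate * s) \<le> - s * exp (rate * s)" by (intro mult_right_mono) auto
      also have "\<dots> \<le> 1 / rate"
      proof -
        have "- (rate * s) \<le> exp (- (rate * s))" using exp_ge_add_one_self[of "- (rate * s)"] by linarith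
        then have "- (rate * s) * exp (rate * s) \<le> exp (- (rate * s)) * exp (rate * s)" by (intro mult_right_mono) auto
        then have "- (rate * s) * exp (rate * s) \<le> 1" by (simp add: exp_add[symmetric])
        then show ?thesis using rate_pos(1) by (simp add: field_simps)
      qed
      finally show ?thesis using B1 by simp
    qed
  qed
qed

definition past_rat :: "real set" where "past_rat = {r \<in> \<rat>. r \<le> 0}"

text \<open>Rational times make the supremum countable and so measurable, and by continuity of the
  noise the bound extends to all past times. The exponential weight makes it finite.\<close>

definition ou_sup :: "(real \<Rightarrow> real) \<Rightarrow> real" where
  "ou_sup \<omega> = (SUP r\<in>past_rat. \<bar>ou (shift r \<omega>)\<bar> * exp (rate * r))"

lemma past_rat: "countable past_rat" "0 \<in> past_rat"
  by (auto simp: past_rat_def intro: countable_subset[OF _ countable_rat])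

lemma ou_sup_bdd: "\<omega> \<in> \<Omega> \<Longrightarrow> bdd_above ((\<lambda>r. \<bar>ou (shift r \<omega>)\<bar> * exp (rate * r)) ` past_rat)"
  using ou_bounded[of \<omega>] by (force simp: past_rat_def bdd_above_def)

lemma ou_sup_measurable: "(\<lambda>\<omega>. ou_sup (shift a \<omega>)) \<in> borel_measurable M"
  unfolding ou_sup_def shift_shift
proof (rule borel_measurable_cSUP[OF past_rat(1)])
  show "(\<lambda>\<omega>. \<bar>ou (shift (r + a) \<omega>)\<bar> * exp (rate * r)) \<in> borel_measurable M" for r
    using ou_measurable by measurable
  show "bdd_above ((\<lambda>r. \<bar>ou (shift (r + a) \<omega>)\<bar> * exp (rate * r)) ` past_rat)" if "\<omega> \<in> space M" for \<omega>
    using ou_sup_bdd[OF shift_in[of \<omega> a]] that by (simp add: space_M shift_shift)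
qed

lemma ou_le_sup:
  assumes w: "\<omega> \<in> \<Omega>" and s: "s \<le> 0"
  shows "\<bar>ou (shift s \<omega>)\<bar> \<le> ou_sup \<omega> * exp (- rate * s)"
proof -
  let ?k = "\<lambda>s. \<bar>ou (shift s \<omega>)\<bar> * exp (rate * s)"
  have r: "?k r \<le> ou_sup \<omega>" if "r \<in> \<rat>" "r \<le> 0" for r
    unfolding ou_sup_def using that by (intro cSUP_upper ou_sup_bdd[OF w]) (auto simp: past_rat_def)
  have "?k s \<le> ou_sup \<omega>"
  proof (rule ccontr)
    assume bad: "\<not> ?k s \<le> ou_sup \<omega>"
    have "continuous_on UNIV ?k" by (intro continuous_intros ou_continuous[OF w])
    then have "open {s. ou_sup \<omega> < ?k s}" by (rule open_Collect_less[OF continuous_on_const])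
    moreover have "s \<in> {s. ou_sup \<omega> < ?k s}" using bad by simp
    ultimately obtain d where d: "0 < d" "ball s d \<subseteq> {s. ou_sup \<omega> < ?k s}" using open_contains_ball by blast
    obtain r' where r': "r' \<in> \<rat>" "s - d < r'" "r' < s" using Rats_dense_in_real[of "s - d" s] d(1) by auto
    then have "r' \<in> ball s d" by (simp add: dist_real_def)
    then show False using d(2) r[OF r'(1)] r'(3) s by auto
  qed
  then have "?k s * exp (- rate * s) \<le> ou_sup \<omega> * exp (- rate * s)" by (intro mult_right_mono) auto
  then show ?thesis by (simp add: mult.assoc exp_add[symmetric])
qed

lemma ou_sup_nonneg: "\<omega> \<in> \<Omega> \<Longrightarrow> 0 \<le> ou_sup \<omega>"
  using ou_le_sup[of \<omega> 0] by (auto intro: order_trans[OF abs_ge_zero])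

text \<open>A shift into the past multiplies the exponential weight by a known factor; this is what
  makes the random radius tempered.\<close>

lemma ou_sup_shift_le:
  assumes w: "\<omega> \<in> \<Omega>" and s: "s \<le> 0"
  shows "ou_sup (shift s \<omega>) \<le> ou_sup \<omega> * exp (- rate * s)"
  unfolding ou_sup_def[of "shift s \<omega>"]
proof (rule cSUP_least)
  show "past_rat \<noteq> {}" using past_rat by blast
  fix r assume r: "r \<in> past_rat"
  then have "\<bar>ou (shift (r + s) \<omega>)\<bar> \<le> ou_sup \<omega> * exp (- rate * (r + s))" using s by (intro ou_le_sup[OF w]) (auto simp: past_rat_def)
  then have "\<bar>ou (shift (r + s) \<omega>)\<bar> * exp (rate * r) \<le> ou_sup \<omega> * exp (- rate * (r + s)) * exp (rate * r)" by (intro mult_right_mono) auto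
  also have "\<dots> = ou_sup \<omega> * exp (- rate * s)" unfolding mult.assoc exp_add[symmetric] by (simp add: algebra_simps)
  finally show "\<bar>ou (shift r (shift s \<omega>))\<bar> * exp (rate * r) \<le> ou_sup \<omega> * exp (- rate * s)" by (simp add: shift_shift)
qed

section \<open>The cocycle over the joint shift and its absorbing set\<close>

definition zpath :: "real \<Rightarrow> (real \<Rightarrow> real) \<Rightarrow> real \<Rightarrow> real" where
  "zpath \<tau> \<omega> s = ou (shift (s - \<tau>) \<omega>)"

text \<open>In absolute time the noise is unchanged when time and path are shifted together, so the
  cocycle property reduces to composing solutions along one fixed path.\<close>

lemma zpath_shift: "zpath (\<tau> + t) (shift t \<omega>) = zpath \<tau> \<omega>"
  by (simp add: zpath_def shift_shift fun_eq_iff)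

lemma \<phi>_eq: "\<phi> t \<tau> \<omega> x = uflow (zpath \<tau> \<omega>) \<tau> (\<tau> + t) x"
  unfolding nrds_def sol_u_def sol_v_eq_flow uflow_def zpath_def shift_shift by (simp add: add_ac)

lemma zpath_continuous: "\<omega> \<in> \<Omega> \<Longrightarrow> continuous_on UNIV (zpath \<tau> \<omega>)"
  unfolding zpath_def[abs_def]
  by (rule continuous_on_compose2[OF ou_continuous]) (auto intro!: continuous_intros)

lemma zpath_tempered: "\<omega> \<in> \<Omega> \<Longrightarrow> tempered_path (ou_sup \<omega>) \<tau> (zpath \<tau> \<omega>)"
  unfolding tempered_path_def
proof (intro conjI allI impI)
  assume w: "\<omega> \<in> \<Omega>"
  show "\<bar>zpath \<tau> \<omega> s\<bar> \<le> ou_sup \<omega> * exp (rate * (\<tau> - s))" if "s \<le> \<tau>" for s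
    using ou_le_sup[OF w, of "s - \<tau>"] that by (simp add: zpath_def algebra_simps)
qed (auto intro: zpath_continuous ou_sup_nonneg)

text \<open>All pullback orbits that end in the fibre over \<open>\<tau>\<close> and
  \<open>\<omega>\<close> are driven by the same path, whatever their starting time; the
  deterministic pullback estimates apply for this reason.\<close>

lemma \<phi>_pull: "\<phi> t (\<tau> - t) (shift (- t) \<omega>) x = uflow (zpath \<tau> \<omega>) (\<tau> - t) \<tau> x"
  using zpath_shift[of \<tau> "- t" \<omega>] by (simp add: \<phi>_eq)

definition K :: "real \<Rightarrow> (real \<Rightarrow> real) \<Rightarrow> ell2 set" where
  "K \<tau> \<omega> = cball 0 (sqrt (rad (ou_sup \<omega>) \<tau>))"

lemma K_nonempty: "K \<tau> \<omega> \<noteq> {}"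
  using rad_nonneg[of "ou_sup \<omega>" \<tau>] by (simp add: K_def not_less)

lemma radius_measurable: "(\<lambda>\<omega>. sqrt (rad (ou_sup (shift a \<omega>)) \<tau>)) \<in> borel_measurable M"
  unfolding rad_def using ou_sup_measurable[of a] by measurable

lemma nonauto_random_set_K: "nonauto_random_set M K"
  unfolding nonauto_random_set_def
proof (intro conjI allI ballI)
  show "K \<tau> \<omega> \<noteq> {}" for \<tau> \<omega> by (rule K_nonempty)
  fix x :: ell2 and \<tau> :: real
  have m: "(\<lambda>\<omega>. sqrt (rad (ou_sup \<omega>) \<tau>)) \<in> borel_measurable M"
    by (rule measurable_cong[THEN iffD1, OF _ radius_measurable[of 0 \<tau>]])
      (simp add: space_M shift_0 \<Omega>_zero)
  have "(\<lambda>\<omega>. infdist x ((\<lambda>u. u) ` cball 0 (sqrt (rad (ou_sup \<omega>) \<tau>)))) \<in> borel_measurable M"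
    by (rule infdist_image_cball_measurable[where \<Phi> = "\<lambda>_ u. u", OF m])
      (auto intro: rad_nonneg continuous_on_id borel_measurable_scaleR m)
  then show "(\<lambda>\<omega>. infdist x (K \<tau> \<omega>)) \<in> borel_measurable M" by (simp add: K_def)
qed

lemma K_tempered: "K \<in> tempered_sets M lam0"
  unfolding tempered_sets_def
proof (intro CollectI conjI nonauto_random_set_K allI ballI)
  fix \<tau> \<omega> assume "\<omega> \<in> space M"
  then have w: "\<omega> \<in> \<Omega>" by (simp add: space_M)
  let ?b = "\<lambda>s. exp (lam0 * s) * rad (ou_sup \<omega> * exp (- rate * s)) (\<tau> + s)"
  have "((\<lambda>s. ennreal (?b s)) \<longlongrightarrow> ennreal 0) at_bot"
    by (intro tendsto_ennrealI rad_tempered ou_sup_nonneg[OF w])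
  then have lim: "((\<lambda>s. ennreal (?b s)) \<longlongrightarrow> 0) at_bot" by simp
  show "((\<lambda>s. ennreal (exp (lam0 * s)) * (set_norm (K (\<tau> + s) (shift s \<omega>)))\<^sup>2) \<longlongrightarrow> 0) at_bot"
  proof (rule tendsto_sandwich[OF _ _ tendsto_const lim])
    show "\<forall>\<^sub>F s in at_bot. ennreal (exp (lam0 * s)) * (set_norm (K (\<tau> + s) (shift s \<omega>)))\<^sup>2 \<le> ennreal (?b s)"
      using eventually_le_at_bot[of 0]
    proof eventually_elim
      case (elim s)
      define R where "R = rad (ou_sup (shift s \<omega>)) (\<tau> + s)"
      have R: "0 \<le> R" by (simp add: R_def rad_nonneg)
      have "set_norm (K (\<tau> + s) (shift s \<omega>)) \<le> ennreal (sqrt R)"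
        unfolding set_norm_def K_def R_def by (intro SUP_least ennreal_leI) simp
      then have "(set_norm (K (\<tau> + s) (shift s \<omega>)))\<^sup>2 \<le> (ennreal (sqrt R))\<^sup>2" by (rule power_mono) simp
      also have "\<dots> = ennreal R" using R by (simp add: ennreal_power)
      finally have "ennreal (exp (lam0 * s)) * (set_norm (K (\<tau> + s) (shift s \<omega>)))\<^sup>2 \<le> ennreal (exp (lam0 * s)) * ennreal R"
        by (rule mult_left_mono) simp
      also have "\<dots> = ennreal (exp (lam0 * s) * R)" using R by (simp add: ennreal_mult)
      also have "\<dots> \<le> ennreal (?b s)"
        unfolding R_def using ou_sup_shift_le[OF w elim] ou_sup_nonneg[OF shift_in[OF w]]
        by (intro ennreal_leI mult_left_mono rad_mono) auto
      finally show ?case .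
    qed
  qed simp
qed

lemma tempered_family_pull:
  assumes D: "D \<in> tempered_sets M lam0" and w: "\<omega> \<in> \<Omega>"
  shows "tempered_family (\<lambda>t. D (\<tau> - t) (shift (- t) \<omega>))"
  unfolding tempered_family_def
proof (intro allI impI)
  fix e :: real assume e: "0 < e"
  have "((\<lambda>s. ennreal (exp (lam0 * s)) * (set_norm (D (\<tau> + s) (shift s \<omega>)))\<^sup>2) \<longlongrightarrow> 0) at_bot"
    using D w unfolding tempered_sets_def by (simp add: space_M)
  then have "eventually (\<lambda>s. ennreal (exp (lam0 * s)) * (set_norm (D (\<tau> + s) (shift s \<omega>)))\<^sup>2 < ennreal e) at_bot"
    by (rule order_tendstoD) (use e in simp)
  then obtain S where S: "\<forall>s\<le>S. ennreal (exp (lam0 * s)) * (set_norm (D (\<tau> + s) (shift s \<omega>)))\<^sup>2 < ennreal e"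
    unfolding eventually_at_bot_linorder by blast
  have "exp (- lam0 * t) * (norm x)\<^sup>2 \<le> e" if t: "t \<ge> - S" and x: "x \<in> D (\<tau> - t) (shift (- t) \<omega>)" for t x
  proof -
    have "ennreal (norm x) \<le> set_norm (D (\<tau> + - t) (shift (- t) \<omega>))"
      unfolding set_norm_def using x by (intro SUP_upper) simp
    then have "(ennreal (norm x))\<^sup>2 \<le> (set_norm (D (\<tau> + - t) (shift (- t) \<omega>)))\<^sup>2" by (rule power_mono) simp
    then have "ennreal (exp (lam0 * - t)) * (ennreal (norm x))\<^sup>2 \<le> ennreal (exp (lam0 * - t)) * (set_norm (D (\<tau> + - t) (shift (- t) \<omega>)))\<^sup>2"
      by (rule mult_left_mono) simp
    also have "\<dots> < ennreal e" using S[rule_format, of "- t"] t by simp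
    finally have "ennreal (exp (lam0 * - t) * (norm x)\<^sup>2) < ennreal e" by (simp add: ennreal_power ennreal_mult)
    then show ?thesis using e by (simp add: ennreal_less_iff)
  qed
  then show "\<exists>T. \<forall>t\<ge>T. \<forall>x\<in>D (\<tau> - t) (shift (- t) \<omega>). exp (- lam0 * t) * (norm x)\<^sup>2 \<le> e" by blast
qed

definition pflow :: "real \<Rightarrow> real \<times> (real \<Rightarrow> real) \<Rightarrow> real \<times> (real \<Rightarrow> real)" where
  "pflow t p = (fst p + t, shift t (snd p))"

lemma K_absorbs_tempered:
  assumes D: "D \<in> tempered_sets M lam0" and p: "p \<in> UNIV \<times> \<Omega>"
  shows "\<exists>T\<ge>0. \<forall>t\<ge>T. \<forall>x\<in>(\<lambda>p. D (fst p) (snd p)) (pflow (- t) p).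
    (\<lambda>t p. \<phi> t (fst p) (snd p)) t (pflow (- t) p) x \<in> (\<lambda>p. K (fst p) (snd p)) p"
proof -
  obtain \<tau> \<omega> where p': "p = (\<tau>, \<omega>)" "\<omega> \<in> \<Omega>" using p by auto
  obtain T where T: "T \<ge> 0" "\<forall>t\<ge>T. \<forall>x\<in>D (\<tau> - t) (shift (- t) \<omega>). (norm (uflow (zpath \<tau> \<omega>) (\<tau> - t) \<tau> x))\<^sup>2 \<le> rad (ou_sup \<omega>) \<tau>"
    using uflow_absorbing[OF zpath_tempered[OF p'(2), of \<tau>] tempered_family_pull[OF D p'(2), of \<tau>]] by blast
  have "norm (uflow (zpath \<tau> \<omega>) (\<tau> - t) \<tau> x) \<le> sqrt (rad (ou_sup \<omega>) \<tau>)"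
    if "t \<ge> T" "x \<in> D (\<tau> - t) (shift (- t) \<omega>)" for t x
    using T(2) that by (intro real_le_rsqrt) blast
  then show ?thesis using T(1) by (intro exI[of _ T]) (simp add: p'(1) pflow_def \<phi>_pull K_def)
qed

text \<open>The base consists of all pairs of a time and an admissible path and carries neither
  topology nor measure; measurability of the attractor is a separate matter.\<close>

sublocale absorbed_cocycle "UNIV \<times> \<Omega>" pflow "\<lambda>t p. \<phi> t (fst p) (snd p)" "\<lambda>p. K (fst p) (snd p)"
proof
  fix p :: "real \<times> (real \<Rightarrow> real)" assume p: "p \<in> UNIV \<times> \<Omega>"
  then have w: "snd p \<in> \<Omega>" by auto
  show "pflow t p \<in> UNIV \<times> \<Omega>" for t using w by (auto simp: pflow_def shift_in)
  show "pflow 0 p = p" using \<Omega>_zero[OF w] by (simp add: pflow_def shift_0)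
  show "pflow s (pflow t p) = pflow (s + t) p" for s t by (simp add: pflow_def shift_shift add_ac)
  show "\<phi> (s + t) (fst p) (snd p) x = \<phi> t (fst (pflow s p)) (snd (pflow s p)) (\<phi> s (fst p) (snd p) x)"
    if "0 \<le> s" "0 \<le> t" for s t x
    using uflow_compose[OF zpath_continuous[OF w, of "fst p"], of "fst p" "fst p + s" "fst p + s + t" x] that
    by (simp add: pflow_def \<phi>_eq zpath_shift add.assoc)
  show "continuous_on UNIV (\<phi> t (fst p) (snd p))" if "0 \<le> t" for t
    unfolding \<phi>_eq[abs_def] using that by (intro uflow_continuous zpath_continuous[OF w]) auto
  show "K (fst p) (snd p) \<noteq> {}" "closed (K (fst p) (snd p))" by (rule K_nonempty, simp add: K_def)
  show "\<exists>T\<ge>0. \<forall>t\<ge>T. \<forall>x\<in>K (fst (pflow (- t) p)) (snd (pflow (- t) p)).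
      \<phi> t (fst (pflow (- t) p)) (snd (pflow (- t) p)) x \<in> K (fst p) (snd p)"
    using K_absorbs_tempered[OF K_tempered p] by simp
  show "\<exists>l r. strict_mono r \<and> (\<lambda>n. \<phi> (t (r n)) (fst (pflow (- t (r n)) p)) (snd (pflow (- t (r n)) p)) (x (r n))) \<longlonglongrightarrow> l"
    if t: "filterlim t at_top sequentially" and x: "\<And>n. x n \<in> K (fst (pflow (- t n) p)) (snd (pflow (- t n) p))"
    for t :: "nat \<Rightarrow> real" and x
  proof -
    have "\<exists>l r. strict_mono r \<and> (\<lambda>n. uflow (zpath (fst p) (snd p)) (fst p - t (r n)) (fst p) (x (r n))) \<longlonglongrightarrow> l"
    proof (rule uflow_asymptotically_compact[OF zpath_tempered[OF w] tempered_family_pull[OF K_tempered w, of "fst p"] t])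
      show "x n \<in> K (fst p - t n) (shift (- t n) (snd p))" for n using x[of n] by (simp add: pflow_def)
    qed
    then show ?thesis by (simp add: pflow_def \<phi>_pull)
  qed
qed

section \<open>The random attractor: measurability, attraction, uniqueness\<close>

definition rattractor :: "real \<Rightarrow> (real \<Rightarrow> real) \<Rightarrow> ell2 set" where
  "rattractor \<tau> \<omega> = attractor (\<tau>, \<omega>)"

lemma rattractor_subset: "\<omega> \<in> \<Omega> \<Longrightarrow> rattractor \<tau> \<omega> \<subseteq> K \<tau> \<omega>"
  using attractor_subset[of "(\<tau>, \<omega>)"] by (simp add: rattractor_def)

lemma rattractor_compact: "\<omega> \<in> \<Omega> \<Longrightarrow> compact (rattractor \<tau> \<omega>)"
  using attractor_compact[of "(\<tau>, \<omega>)"] by (simp add: rattractor_def)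

lemma nonauto_random_set_rattractor: "nonauto_random_set M rattractor"
  unfolding nonauto_random_set_def
proof (intro conjI allI ballI)
  show "rattractor \<tau> \<omega> \<noteq> {}" if "\<omega> \<in> space M" for \<tau> \<omega>
    using attractor_nonempty[of "(\<tau>, \<omega>)"] that by (simp add: rattractor_def space_M)
  fix y \<tau>
  let ?R = "\<lambda>n \<omega>. sqrt (rad (ou_sup (shift (- real n) \<omega>)) (\<tau> - real n))"
  show "(\<lambda>\<omega>. infdist y (rattractor \<tau> \<omega>)) \<in> borel_measurable M"
  proof (rule borel_measurable_LIMSEQ_real[where u = "\<lambda>n \<omega>. infdist y (uflow (zpath \<tau> \<omega>) (\<tau> - real n) \<tau> ` cball 0 (?R n \<omega>))"])
    fix n
    have zm: "(\<lambda>\<omega>. zpath \<tau> \<omega> s) \<in> borel_measurable M" for s unfolding zpath_def by (rule ou_measurable)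
    have zc: "continuous_on UNIV (zpath \<tau> \<omega>)" if "\<omega> \<in> space M" for \<omega> using zpath_continuous that by (simp add: space_M)
    show "(\<lambda>\<omega>. infdist y (uflow (zpath \<tau> \<omega>) (\<tau> - real n) \<tau> ` cball 0 (?R n \<omega>))) \<in> borel_measurable M"
    proof (rule infdist_image_cball_measurable[OF radius_measurable])
      show "(\<lambda>\<omega>. uflow (zpath \<tau> \<omega>) (\<tau> - real n) \<tau> (?R n \<omega> *\<^sub>R d)) \<in> borel_measurable M" for d
        by (intro uflow_measurable zc zm borel_measurable_scaleR radius_measurable borel_measurable_const) auto
      show "continuous_on UNIV (uflow (zpath \<tau> \<omega>) (\<tau> - real n) \<tau>)" if "\<omega> \<in> space M" for \<omega>
        by (rule uflow_continuous[OF zc[OF that]]) simp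
    qed (simp add: rad_nonneg)
  next
    fix \<omega> assume "\<omega> \<in> space M"
    then have "(\<tau>, \<omega>) \<in> UNIV \<times> \<Omega>" by (simp add: space_M)
    from infdist_attractor_lim[OF this, of y]
    show "(\<lambda>n. infdist y (uflow (zpath \<tau> \<omega>) (\<tau> - real n) \<tau> ` cball 0 (?R n \<omega>))) \<longlonglongrightarrow> infdist y (rattractor \<tau> \<omega>)"
      by (simp add: rattractor_def pflow_def \<phi>_pull K_def image_def)
  qed
qed

lemma rattractor_attracts:
  assumes D: "D \<in> tempered_sets M lam0" and w: "\<omega> \<in> \<Omega>"
  shows "((\<lambda>t. semidist (\<phi> t (\<tau> - t) (shift (- t) \<omega>) ` D (\<tau> - t) (shift (- t) \<omega>)) (rattractor \<tau> \<omega>)) \<longlongrightarrow> 0) at_top"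
proof (rule ennreal_tendsto_0I)
  fix e :: real assume e: "0 < e"
  have p: "(\<tau>, \<omega>) \<in> UNIV \<times> \<Omega>" using w by simp
  obtain T where T: "\<forall>t\<ge>T. \<forall>x\<in>D (\<tau> - t) (shift (- t) \<omega>). infdist (\<phi> t (\<tau> - t) (shift (- t) \<omega>) x) (rattractor \<tau> \<omega>) < e"
    using attractor_attracts[OF p e K_absorbs_tempered[OF D]] by (auto simp: pflow_def rattractor_def)
  show "eventually (\<lambda>t. semidist (\<phi> t (\<tau> - t) (shift (- t) \<omega>) ` D (\<tau> - t) (shift (- t) \<omega>)) (rattractor \<tau> \<omega>) \<le> ennreal e) at_top"
    using eventually_ge_at_top[of T]
  proof eventually_elim
    case (elim t)
    then show ?case
      using T unfolding semidist_def by (intro SUP_least ennreal_leI less_imp_le) blast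
  qed
qed

lemma rattractor_pullback: "pullback_attractor M (tempered_sets M lam0) \<phi> rattractor"
  unfolding pullback_attractor_def
proof (intro conjI allI impI ballI nonauto_random_set_rattractor)
  show "AE \<omega> in M. compact (rattractor \<tau> \<omega>)" for \<tau> using rattractor_compact by (intro AE_I2) (simp only: space_M)
  show "\<phi> t \<tau> \<omega> ` rattractor \<tau> \<omega> = rattractor (\<tau> + t) (shift t \<omega>)" if "0 \<le> t" "\<omega> \<in> space M" for t \<tau> \<omega>
    using attractor_invariant[of "(\<tau>, \<omega>)" t] that by (simp add: rattractor_def pflow_def space_M)
  show "((\<lambda>t. semidist (\<phi> t (\<tau> - t) (shift (- t) \<omega>) ` D (\<tau> - t) (shift (- t) \<omega>)) (rattractor \<tau> \<omega>)) \<longlongrightarrow> 0) at_top"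
    if "D \<in> tempered_sets M lam0" "\<omega> \<in> space M" for D \<tau> \<omega>
    using rattractor_attracts that by (simp only: space_M)
  show "\<exists>K\<in>tempered_sets M lam0. \<forall>\<tau>. \<forall>\<omega>\<in>space M. closed (K \<tau> \<omega>) \<and> rattractor \<tau> \<omega> \<subseteq> K \<tau> \<omega>"
    by (rule bexI[OF _ K_tempered]) (use rattractor_subset in \<open>auto simp: space_M K_def\<close>)
qed

lemma rattractor_tempered: "rattractor \<in> tempered_sets M lam0"
  unfolding tempered_sets_def
proof (intro CollectI conjI nonauto_random_set_rattractor allI ballI)
  fix \<tau> \<omega> assume w: "\<omega> \<in> space M"
  have lim: "((\<lambda>s. ennreal (exp (lam0 * s)) * (set_norm (K (\<tau> + s) (shift s \<omega>)))\<^sup>2) \<longlongrightarrow> 0) at_bot"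
    using K_tempered w unfolding tempered_sets_def by blast
  show "((\<lambda>s. ennreal (exp (lam0 * s)) * (set_norm (rattractor (\<tau> + s) (shift s \<omega>)))\<^sup>2) \<longlongrightarrow> 0) at_bot"
  proof (rule tendsto_sandwich[OF _ _ tendsto_const lim])
    have "set_norm (rattractor (\<tau> + s) (shift s \<omega>)) \<le> set_norm (K (\<tau> + s) (shift s \<omega>))" for s
      unfolding set_norm_def using rattractor_subset[OF shift_in] w by (intro SUP_subset_mono) (auto simp: space_M)
    then show "\<forall>\<^sub>F s in at_bot. ennreal (exp (lam0 * s)) * (set_norm (rattractor (\<tau> + s) (shift s \<omega>)))\<^sup>2
        \<le> ennreal (exp (lam0 * s)) * (set_norm (K (\<tau> + s) (shift s \<omega>)))\<^sup>2"
      by (intro always_eventually allI mult_left_mono power_mono) auto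
  qed simp
qed

text \<open>Both inclusions come from \<open>pullback_attractor_subset\<close>; compactness supplies
  the closedness of the target fibre in each of them.\<close>

lemma rattractor_unique:
  assumes A: "pullback_attractor M (tempered_sets M lam0) \<phi> \<A>" and w: "\<omega> \<in> \<Omega>" and c: "compact (\<A> \<tau> \<omega>)"
  shows "\<A> \<tau> \<omega> = rattractor \<tau> \<omega>"
proof
  show "\<A> \<tau> \<omega> \<subseteq> rattractor \<tau> \<omega>"
    using w shift_in[OF w] compact_imp_closed[OF rattractor_compact[OF w]]
    by (intro pullback_attractor_subset[OF A rattractor_pullback]) (auto simp: space_M \<Omega>_zero)
  show "rattractor \<tau> \<omega> \<subseteq> \<A> \<tau> \<omega>"
    using w shift_in[OF w] compact_imp_closed[OF c]
    by (intro pullback_attractor_subset[OF rattractor_pullback A]) (auto simp: space_M \<Omega>_zero)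
qed

end

text \<open>Compactness of the fibres is an almost sure condition, and comparing two attractors at a
  fibre takes closed fibres; this decides the two forms in which uniqueness is stated.\<close>

theorem theorem4p4:
  fixes P :: "(real \<Rightarrow> real) measure" and \<Omega> :: "(real \<Rightarrow> real) set"
    and lam lam0 lam1 q \<epsilon> \<beta> :: real
    and f :: "ell2 \<Rightarrow> ell2" and fi :: "int \<Rightarrow> real \<Rightarrow> real"
    and \<gamma> :: "real \<Rightarrow> real" and \<alpha>1 \<alpha>2 :: "int \<Rightarrow> real"
    and g :: "real \<Rightarrow> ell2 \<Rightarrow> ell2" and gi :: "int \<Rightarrow> real \<Rightarrow> real \<Rightarrow> real"
    and \<psi>1 \<psi>2 \<psi>3 \<psi>4 :: "real \<Rightarrow> int \<Rightarrow> real"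
    and h h' :: "real \<Rightarrow> ell2"
  defines "M \<equiv> restrict_space P \<Omega>"
    and "\<D> \<equiv> tempered_sets (restrict_space P \<Omega>) lam0"
    and "\<phi> \<equiv> nrds lam f g h h'"
  assumes P: "wiener_measure P" and \<Omega>: "admissible_paths P \<Omega>"
    and lambdas: "0 < lam1" "lam1 < lam0" "lam0 < lam"
    and F: "q > 2" "\<epsilon> > 0" "q - 1 - \<epsilon> > 0" "\<alpha>1 \<in> ellp 1" "\<alpha>2 \<in> ellp 1"
      "\<forall>u i. coord (f u) i = fi i (coord u i)"
      "\<forall>R\<ge>0. \<gamma> R \<ge> 0" "\<forall>r\<ge>0. bounded (\<gamma> ` {0..r})"
      "\<forall>R\<ge>0. \<forall>i a b. \<bar>a\<bar> \<le> R \<and> \<bar>b\<bar> \<le> R \<longrightarrow> \<bar>fi i a - fi i b\<bar> \<le> \<gamma> R * \<bar>a - b\<bar>"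
      "\<forall>i a. \<bar>fi i a\<bar> \<le> \<alpha>1 i * \<bar>a\<bar> powr (q - 1 - \<epsilon>) + \<alpha>2 i"
    and G1: "\<forall>t u i. coord (g t u) i = gi i t (coord u i)"
      "\<forall>i. continuous_on UNIV (\<lambda>(t, a). gi i t a)"
      "\<forall>i t a. gi i t differentiable at a"
      "\<beta> > 0"
      "\<forall>i t a. gi i t a * a \<le> - \<beta> * \<bar>a\<bar> powr q + \<psi>1 t i"
      "\<forall>i t a. deriv (gi i t) a \<le> \<psi>2 t i"
      "\<forall>i t a. \<bar>gi i t a\<bar> \<le> \<psi>3 t i * \<bar>a\<bar> powr (q - 1) + \<psi>4 t i"
      "\<psi>1 \<in> bochner_L_loc 1 1" "\<psi>2 \<in> bochner_L_loc \<infinity> \<infinity>" "\<psi>3 \<in> bochner_L_loc \<infinity> \<infinity>"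
      "\<psi>4 \<in> bochner_L_loc 2 2"
    and G2: "(\<integral>\<^sup>+s\<in>{..0}. ennreal (exp (lam1 * s) *
          (ellp_norm 1 (\<psi>1 s) + (ellp_norm 2 (\<psi>4 s))\<^sup>2)) \<partial>lebesgue) < \<infinity>"
      "\<psi>3 \<in> bochner_L \<infinity> \<infinity> {..0}"
    and H1: "\<forall>t. coord (h t) \<in> ellp (ennreal q)"
      "\<forall>t. (h has_vector_derivative h' t) (at t)"
      "(\<lambda>t. coord (h t)) \<in> bochner_L_loc 2 2"
      "(\<lambda>t. coord (h t)) \<in> bochner_L_loc (ennreal q) (ennreal q)"
      "(\<lambda>t. coord (h' t)) \<in> bochner_L_loc 2 2"
    and H2: "(\<integral>\<^sup>+s\<in>{..0}. ennreal (exp (lam1 * s) *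
          ((norm (h s))\<^sup>2 + ellp_norm (ennreal q) (coord (h s)) powr q + (norm (h' s))\<^sup>2))
          \<partial>lebesgue) < \<infinity>"
  shows "\<exists>\<A>. pullback_attractor M \<D> \<phi> \<A> \<and> \<A> \<in> \<D> \<and>
    (\<forall>\<A>'. pullback_attractor M \<D> \<phi> \<A>' \<longrightarrow>
      (\<forall>\<tau>. AE \<omega> in M. \<A>' \<tau> \<omega> = \<A> \<tau> \<omega>) \<and>
      (\<forall>\<tau>. \<forall>\<omega>\<in>\<Omega>. compact (\<A>' \<tau> \<omega>) \<and> compact (\<A> \<tau> \<omega>) \<longrightarrow> \<A>' \<tau> \<omega> = \<A> \<tau> \<omega>))"
proof -
  interpret random_lattice_equation lam lam0 lam1 q \<epsilon> \<beta> f fi \<gamma> \<alpha>1 \<alpha>2 g gi \<psi>1 \<psi>2 \<psi>3 \<psi>4 h h' P \<Omega>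
    by unfold_locales (rule lambdas F G1 G2 H1 H2 P \<Omega>)+
  have "(\<forall>\<tau>. AE \<omega> in M. \<A>' \<tau> \<omega> = rattractor \<tau> \<omega>) \<and>
      (\<forall>\<tau>. \<forall>\<omega>\<in>\<Omega>. compact (\<A>' \<tau> \<omega>) \<and> compact (rattractor \<tau> \<omega>) \<longrightarrow> \<A>' \<tau> \<omega> = rattractor \<tau> \<omega>)"
    if A: "pullback_attractor M \<D> \<phi> \<A>'" for \<A>'
  proof (intro conjI allI ballI impI)
    note A' = A[unfolded M_def \<D>_def \<phi>_def]
    fix \<tau>
    have "AE \<omega> in M. compact (\<A>' \<tau> \<omega>)" using A unfolding pullback_attractor_def by blast
    moreover have "AE \<omega> in M. \<omega> \<in> \<Omega>" by (rule AE_I2) (simp add: M_def space_M)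
    ultimately show "AE \<omega> in M. \<A>' \<tau> \<omega> = rattractor \<tau> \<omega>"
      by eventually_elim (rule rattractor_unique[OF A'])
    show "\<A>' \<tau> \<omega> = rattractor \<tau> \<omega>" if "\<omega> \<in> \<Omega>" "compact (\<A>' \<tau> \<omega>) \<and> compact (rattractor \<tau> \<omega>)" for \<omega>
      using that by (intro rattractor_unique[OF A']) auto
  qed
  moreover have "pullback_attractor M \<D> \<phi> rattractor" "rattractor \<in> \<D>"
    unfolding M_def \<D>_def \<phi>_def by (rule rattractor_pullback rattractor_tempered)+
  ultimately show ?thesis by blast
qed

end
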